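(* For any initial data $(u_0,\mu_0)\in\mathcal{D}$ the Hunter--Saxton equation $$u_t+uu_x=\tfrac14\Big(\int_{-\infty}^x d\mu(t,z)-\int_x^{\infty}d\mu(t,z)\Big),\qquad \mu_t+(u\mu)_x=0$$ has a unique global weak conservative solution $(u,\mu)$ (with $(u(t),\mu(t))\in\mathcal{D}$) in the sense defined below, with $(u(0,\cdot),\mu(0))=(u_0,\mu_0)$.
   Context: Fix $\psi^+,\psi^-\in C^\infty(\mathbb{R})$ with $\psi^++\psi^-\equiv1$, $0\le\psi^\pm\le1$, $\operatorname{supp}\psi^-\subset(-\infty,1)$, $\operatorname{supp}\psi^+\subset(-1,\infty)$. Let $E_1=\{\bar f+a\psi^+:\bar f\in H^1(\mathbb{R}),a\in\mathbb{R}\}$, $E_2=\{\bar f+a\psi^++b\psi^-:\bar f\in H^1(\mathbb{R}),a,b\in\mathbb{R}\}$, and let $E_1^0,E_2^0$ be defined in the same way with $\bar f\in L^2(\mathbb{R})$ instead of $H^1(\mathbb{R})$, with norms $\|\bar f+a\psi^+\|_{E_1^0}=(\|\bar f\|_{L^2}^2+a^2)^{1/2}$, $\|\bar f+a\psi^++b\psi^-\|_{E_2^0}=(\|\bar f\|_{L^2}^2+a^2+b^2)^{1/2}$. The set $\mathcal{D}$ consists of all pairs $(u,\mu)$ with $u\in E_2$, $\mu$ a positive finite Radon measure on $\mathbb{R}$, $x\mapsto\mu((-\infty,x))$ in $E_1^0$, and absolutely continuous part $d\mu_{\rm ac}=u_x^2dx$. A pair $(u,\mu)$ ($u:[0,\infty)\times\mathbb{R}\to\mathbb{R}$,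 $\mu(t)$ positive finite Radon measures) is a weak conservative solution with initial data $(u(0,\cdot),\mu(0))\in\mathcal{D}$ if: (i) $u(t,\cdot)\in E_2$ for each $t$; (ii) $\mu(t,(-\infty,\cdot))\in E_1^0$ and $d\mu_{\rm ac}(t)=u_x^2(t,\cdot)dx$ for each $t$; (iii) for all $\phi\in C_c^\infty([0,\infty)\times\mathbb{R})$, $\int_0^\infty\!\int_{\mathbb{R}}\big[u\phi_t+\tfrac12u^2\phi_x+\tfrac14\big(\int_{-\infty}^xd\mu(t)-\int_x^\infty d\mu(t)\big)\phi\big]dxdt=-\int_{\mathbb{R}}u\phi|_{t=0}dx$ and $\int_0^\infty\!\int_{\mathbb{R}}(\phi_t+u\phi_x)d\mu(t)dt=-\int_{\mathbb{R}}\phi|_{t=0}d\mu(0)$; (iv) for every $T>0$, $u$ is Hölder continuous on $[0,T]\times\mathbb{R}$ and $t\mapsto u(t,\cdot)$ is Lipschitz continuous from $[0,T]$ into $E_2^0$; (v) there is a Lebesgue null set $\mathcal{N}$ such that for $t\notin\mathcal{N}$ the measure $\mu(t)$ is absolutely continuous with density $u_x^2(t,\cdot)$; (vi) $t\mapsto\mu(t)$ is continuous with respect to weak convergence of measures. *)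

theory Defs
  imports "HOL-Analysis.Analysis"
begin

definition smooth1 :: "(real \<Rightarrow> real) \<Rightarrow> bool" where
  "smooth1 \<phi> \<longleftrightarrow> (\<forall>n x. ((deriv ^^ n) \<phi> has_real_derivative (deriv ^^ Suc n) \<phi> x) (at x))"

definition test1 :: "(real \<Rightarrow> real) \<Rightarrow> bool" where
  "test1 \<phi> \<longleftrightarrow> smooth1 \<phi> \<and> bounded {x. \<phi> x \<noteq> 0}"

definition pd :: "bool \<Rightarrow> (real \<times> real \<Rightarrow> real) \<Rightarrow> (real \<times> real \<Rightarrow> real)" where
  "pd b \<phi> = (if b then (\<lambda>(t,x). deriv (\<lambda>s. \<phi> (s,x)) t)
                  else (\<lambda>(t,x). deriv (\<lambda>y. \<phi> (t,y)) x))"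

definition smooth2 :: "(real \<times> real \<Rightarrow> real) \<Rightarrow> bool" where
  "smooth2 \<phi> \<longleftrightarrow> (\<forall>ds. continuous_on UNIV (fold pd ds \<phi>) \<and>
      (\<forall>t x. (\<lambda>s. fold pd ds \<phi> (s,x)) differentiable (at t) \<and>
             (\<lambda>y. fold pd ds \<phi> (t,y)) differentiable (at x)))"

text \<open>Test functions in C_c^infinity([0,infinity) x R): restrictions of
  compactly supported smooth functions on R^2 (only values with t >= 0 matter).\<close>
definition test2 :: "(real \<times> real \<Rightarrow> real) \<Rightarrow> bool" where
  "test2 \<phi> \<longleftrightarrow> smooth2 \<phi> \<and> bounded {p. \<phi> p \<noteq> 0}"

definition L2 :: "(real \<Rightarrow> real) \<Rightarrow> bool" where
  "L2 f \<longleftrightarrow> f \<in> borel_measurable borel \<and> integrable lborel (\<lambda>x. (f x)\<^sup>2)"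

definition L2_norm :: "(real \<Rightarrow> real) \<Rightarrow> real" where
  "L2_norm f = sqrt (\<integral>x. (f x)\<^sup>2 \<partial>lborel)"

definition weak_deriv :: "(real \<Rightarrow> real) \<Rightarrow> (real \<Rightarrow> real) \<Rightarrow> bool" where
  "weak_deriv f g \<longleftrightarrow>
     (\<forall>a b. set_integrable lborel {a..b} f \<and> set_integrable lborel {a..b} g) \<and>
     (\<forall>\<phi>. test1 \<phi> \<longrightarrow>
        (\<integral>x. f x * deriv \<phi> x \<partial>lborel) = - (\<integral>x. g x * \<phi> x \<partial>lborel))"

definition H1 :: "(real \<Rightarrow> real) \<Rightarrow> bool" where
  "H1 f \<longleftrightarrow> L2 f \<and> (\<exists>g. L2 g \<and> weak_deriv f g)"

definition psi_pair :: "(real \<Rightarrow> real) \<Rightarrow> (real \<Rightarrow> real) \<Rightarrow> bool" where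
  "psi_pair psp psm \<longleftrightarrow> smooth1 psp \<and> smooth1 psm \<and>
     (\<forall>x. psp x + psm x = 1) \<and>
     (\<forall>x. 0 \<le> psp x \<and> psp x \<le> 1 \<and> 0 \<le> psm x \<and> psm x \<le> 1) \<and>
     closure {x. psm x \<noteq> 0} \<subseteq> {..<1} \<and>
     closure {x. psp x \<noteq> 0} \<subseteq> {-1<..}"

text \<open>Elements are functions identified up to Lebesgue-a.e. equality.\<close>
definition in_E1 :: "(real \<Rightarrow> real) \<Rightarrow> (real \<Rightarrow> real) \<Rightarrow> bool" where
  "in_E1 psp v \<longleftrightarrow> (\<exists>f a. H1 f \<and> (AE x in lborel. v x = f x + a * psp x))"

definition in_E2 :: "(real \<Rightarrow> real) \<Rightarrow> (real \<Rightarrow> real) \<Rightarrow> (real \<Rightarrow> real) \<Rightarrow> bool" where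
  "in_E2 psp psm v \<longleftrightarrow>
     (\<exists>f a b. H1 f \<and> (AE x in lborel. v x = f x + a * psp x + b * psm x))"

definition in_E10 :: "(real \<Rightarrow> real) \<Rightarrow> (real \<Rightarrow> real) \<Rightarrow> bool" where
  "in_E10 psp v \<longleftrightarrow> (\<exists>f a. L2 f \<and> (AE x in lborel. v x = f x + a * psp x))"

definition in_E20 :: "(real \<Rightarrow> real) \<Rightarrow> (real \<Rightarrow> real) \<Rightarrow> (real \<Rightarrow> real) \<Rightarrow> bool" where
  "in_E20 psp psm v \<longleftrightarrow>
     (\<exists>f a b. L2 f \<and> (AE x in lborel. v x = f x + a * psp x + b * psm x))"

text \<open>Norm of E_2^0 (the decomposition is unique).\<close>
definition E20_norm :: "(real \<Rightarrow> real) \<Rightarrow> (real \<Rightarrow> real) \<Rightarrow> (real \<Rightarrow> real) \<Rightarrow> real" where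
  "E20_norm psp psm v = (THE r. \<exists>f a b. L2 f \<and>
      (AE x in lborel. v x = f x + a * psp x + b * psm x) \<and>
      r = sqrt ((L2_norm f)\<^sup>2 + a\<^sup>2 + b\<^sup>2))"

definition fin_borel_measure :: "real measure \<Rightarrow> bool" where
  "fin_borel_measure \<mu> \<longleftrightarrow> sets \<mu> = sets borel \<and> finite_measure \<mu>"

text \<open>The absolutely continuous part of mu (Lebesgue decomposition w.r.t. Lebesgue
  measure) has density h: mu restricted to the complement of some Lebesgue null
  set N equals h dx (the singular part being mu restricted to N).\<close>
definition ac_part_density :: "real measure \<Rightarrow> (real \<Rightarrow> real) \<Rightarrow> bool" where
  "ac_part_density \<mu> h \<longleftrightarrow> (\<exists>N \<in> null_sets lborel. \<forall>A \<in> sets borel.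
      emeasure \<mu> (A - N) = (\<integral>\<^sup>+ x \<in> A. ennreal (h x) \<partial>lborel))"

definition in_D :: "(real \<Rightarrow> real) \<Rightarrow> (real \<Rightarrow> real) \<Rightarrow> (real \<Rightarrow> real) \<Rightarrow> real measure \<Rightarrow> bool" where
  "in_D psp psm u \<mu> \<longleftrightarrow> in_E2 psp psm u \<and> fin_borel_measure \<mu> \<and>
     in_E10 psp (\<lambda>x. measure \<mu> {..<x}) \<and>
     (\<exists>ux. weak_deriv u ux \<and> ac_part_density \<mu> (\<lambda>x. (ux x)\<^sup>2))"

definition holder_on :: "(real \<times> real) set \<Rightarrow> (real \<times> real \<Rightarrow> real) \<Rightarrow> bool" where
  "holder_on S f \<longleftrightarrow> (\<exists>\<alpha> C. 0 < \<alpha> \<and> \<alpha> \<le> 1 \<and>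
      (\<forall>p\<in>S. \<forall>q\<in>S. \<bar>f p - f q\<bar> \<le> C * dist p q powr \<alpha>))"

definition HS_weak_conservative ::
  "(real \<Rightarrow> real) \<Rightarrow> (real \<Rightarrow> real) \<Rightarrow> (real \<Rightarrow> real \<Rightarrow> real) \<Rightarrow> (real \<Rightarrow> real measure) \<Rightarrow> bool" where
  "HS_weak_conservative psp psm u \<mu> \<longleftrightarrow>
    \<comment> \<open>(i), (ii): (u(t), mu(t)) in D for every t >= 0\<close>
    (\<forall>t\<ge>0. in_D psp psm (u t) (\<mu> t)) \<and>
    \<comment> \<open>(iii): weak formulation\<close>
    (\<forall>\<phi>. test2 \<phi> \<longrightarrow>
       (\<integral>t. indicator {0..} t *
          (\<integral>x. u t x * pd True \<phi> (t,x) + 1/2 * (u t x)\<^sup>2 * pd False \<phi> (t,x)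
               + 1/4 * (measure (\<mu> t) {..<x} - measure (\<mu> t) {x<..}) * \<phi> (t,x) \<partial>lborel) \<partial>lborel)
        = - (\<integral>x. u 0 x * \<phi> (0,x) \<partial>lborel)
     \<and> (\<integral>t. indicator {0..} t *
          (\<integral>x. pd True \<phi> (t,x) + u t x * pd False \<phi> (t,x) \<partial>(\<mu> t)) \<partial>lborel)
        = - (\<integral>x. \<phi> (0,x) \<partial>(\<mu> 0))) \<and>
    \<comment> \<open>(iv): Hoelder continuity and Lipschitz continuity into E_2^0\<close>
    (\<forall>T>0. holder_on ({0..T} \<times> UNIV) (\<lambda>(t,x). u t x) \<and>
       (\<exists>L. \<forall>s\<in>{0..T}. \<forall>t\<in>{0..T}. E20_norm psp psm (\<lambda>x. u t x - u s x) \<le> L * \<bar>t - s\<bar>)) \<and>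
    \<comment> \<open>(v): mu(t) = u_x(t)^2 dx for almost every t\<close>
    (\<exists>N \<in> null_sets lborel. \<forall>t\<ge>0. t \<notin> N \<longrightarrow>
       (\<exists>ux. weak_deriv (u t) ux \<and> \<mu> t = density lborel (\<lambda>x. ennreal ((ux x)\<^sup>2)))) \<and>
    \<comment> \<open>(vi): weak continuity of t |-> mu(t)\<close>
    (\<forall>f :: real \<Rightarrow> real. continuous_on UNIV f \<and> bounded (range f) \<longrightarrow>
       continuous_on {0..} (\<lambda>t. \<integral>x. f x \<partial>(\<mu> t)))"

end

theory Submission
  imports Defs
begin

text \<open>
  Existence: in Lagrangian variables, with \<open>\<xi>\<close> chosen so that \<open>d\<xi>\<close> corresponds to \<open>dx + d\<mu>\<^sub>0\<close>, the equation becomes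
  the linear system \<open>y_t = U\<close>, \<open>U_t = (2 H - M) / 4\<close> with time-independent cumulative energy \<open>H\<close> and total energy
  \<open>M\<close>. It is solved explicitly, and the measures are recovered as images of the fixed density \<open>H_\<xi>\<close>. For each
  \<open>\<xi>\<close> the slope \<open>y_\<xi>\<close>, a quadratic polynomial in \<open>t\<close>, vanishes for at most one time, so by Fubini concentration of
  energy happens only for a null set of times.

  Uniqueness: let \<open>y (t, \<eta>)\<close> be the \<open>\<eta>\<close>-quantile of \<open>\<mu> (t)\<close>. The transport equation for \<open>\<mu>\<close> and the continuity
  of \<open>u\<close> force \<open>y_t = u (t, y)\<close>. Testing the equation for \<open>u\<close> with a one-sided approximate identity centred at
  \<open>y (t, \<eta>)\<close>, the quadratic term drops out in the limit because \<open>(u (x) - u (y))\<^sup>2 \<le> (x - y) \<mu> (y, x)\<close>, and the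
  source term tends to \<open>(2 \<eta> - M) / 4\<close> for almost every \<open>t\<close>, as \<open>\<mu> (t)\<close> then has no atoms. Hence all quantiles and
  the velocities along them are explicit functions of the initial data, and they determine \<open>\<mu>\<close> and \<open>u\<close>.
\<close>

section \<open>Smooth functions and test functions\<close>

text \<open>The equation \<open>y_t = u (t, y)\<close> alone does not select trajectories:
  \<open>u\<close> is only Hoelder continuous in x, so the initial value problem may have many
  solutions. Labelling a trajectory by the amount of energy to its left removes the ambiguity,
  because transport preserves this label. Quantiles exist only where there is energy. On an
  energy-free interval \<open>u\<close> is constant, so its values there are recovered as one-sided
  limits along quantiles; if the total energy is 0 there are no quantiles and \<open>u\<close> is
  treated directly. Conservation through focusing is algebraic:
  \<open>\<beta>\<^sup>2 = \<alpha> \<gamma>\<close> gives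
  \<open>\<gamma> y_\<xi> = (\<beta> + t \<gamma> / 2)\<^sup>2\<close>, so the slope
  \<open>y_\<xi>\<close> touches 0 in a double root instead of changing sign, while the density
  \<open>\<gamma>\<close> is untouched. The normalisation \<open>\<alpha> + \<gamma> = 1\<close>
  excludes labels with neither length nor energy, whose slope would vanish at all times. The kernel
  in the uniqueness proof is supported to the right of the quantile, so the error involves the
  energy of an interval that excludes the quantile itself. It tends to 0 even at times when an atom
  sits there.\<close>

lemma smooth1I:
  assumes "f 0 = \<phi>" "\<And>n x. (f n has_real_derivative f (Suc n) x) (at x)"
  shows "smooth1 \<phi>"
proof -
  have "(deriv ^^ n) \<phi> = f n" for n
  proof (induction n)
    case (Suc n)
    have "deriv (f n) x = f (Suc n) x" for x
      using assms(2) by (rule DERIV_imp_deriv)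
    with Suc show ?case by auto
  qed (simp add: assms)
  then show ?thesis unfolding smooth1_def using assms(2) by metis
qed

text \<open>An order-by-order form of smoothness with the derivative under an existential
  quantifier: sums, products and affine substitutions follow by induction on the order, whereas the
  iterates of \<open>deriv\<close> in \<open>smooth1\<close> would call for a Leibniz
  formula.\<close>

primrec Ck :: "nat \<Rightarrow> (real \<Rightarrow> real) \<Rightarrow> bool" where
  "Ck 0 f = True"
| "Ck (Suc k) f = (\<exists>f'. (\<forall>x. (f has_real_derivative f' x) (at x)) \<and> Ck k f')"

lemma smooth1_iff_Ck: "smooth1 f \<longleftrightarrow> (\<forall>k. Ck k f)"
proof
  assume s: "smooth1 f"
  have "Ck k ((deriv ^^ n) f)" for k n
  proof (induction k arbitrary: n)
    case (Suc k)
    show ?case using s Suc[of "Suc n"] unfolding smooth1_def Ck.simps by (intro exI[of _ "(deriv ^^ Suc n) f"]) simp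
  qed simp
  from this[of _ 0] show "\<forall>k. Ck k f" by simp
next
  assume C: "\<forall>k. Ck k f"
  have deriv_eq: "deriv g = g'" if "\<forall>x. (g has_real_derivative g' x) (at x)" for g g' :: "real \<Rightarrow> real"
    using that by (auto intro: DERIV_imp_deriv)
  have "\<forall>k. Ck k ((deriv ^^ n) f)" for n
  proof (induction n)
    case (Suc n)
    show ?case
    proof
      fix k from Suc have "Ck (Suc k) ((deriv ^^ n) f)" by blast
      then show "Ck k ((deriv ^^ Suc n) f)" using deriv_eq by auto
    qed
  qed (use C in simp)
  then have *: "Ck (Suc 0) ((deriv ^^ n) f)" for n by blast
  show "smooth1 f" unfolding smooth1_def
  proof (intro allI)
    fix n x from *[of n] obtain f' where "\<forall>x. ((deriv ^^ n) f has_real_derivative f' x) (at x)" by auto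
    then show "((deriv ^^ n) f has_real_derivative (deriv ^^ Suc n) f x) (at x)" using deriv_eq by auto
  qed
qed

lemma Ck_Suc_D: "Ck (Suc k) f \<Longrightarrow> Ck k f"
proof (induction k arbitrary: f)
  case (Suc k)
  then obtain f' where "\<forall>x. (f has_real_derivative f' x) (at x)" "Ck (Suc k) f'"
    by (metis Ck.simps(2))
  with Suc.IH show ?case unfolding Ck.simps(2)[of k f] by blast
qed simp

lemma Ck_add: "Ck k f \<Longrightarrow> Ck k g \<Longrightarrow> Ck k (\<lambda>x. f x + g x)"
proof (induction k arbitrary: f g)
  case (Suc k)
  then obtain f' g' where "\<forall>x. (f has_real_derivative f' x) (at x)" "\<forall>x. (g has_real_derivative g' x) (at x)"
     "Ck k f'" "Ck k g'" by auto
  with Suc.IH[of f' g'] show ?case by (auto intro!: exI[of _ "\<lambda>x. f' x + g' x"] derivative_eq_intros)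
qed simp

lemma Ck_mult: "Ck k f \<Longrightarrow> Ck k g \<Longrightarrow> Ck k (\<lambda>x. f x * g x)"
proof (induction k arbitrary: f g)
  case (Suc k)
  then obtain f' g' where fg: "\<forall>x. (f has_real_derivative f' x) (at x)" "\<forall>x. (g has_real_derivative g' x) (at x)"
     "Ck k f'" "Ck k g'" by auto
  have "Ck k f" "Ck k g" using Suc.prems Ck_Suc_D by blast+
  with fg Suc.IH have "Ck k (\<lambda>x. f' x * g x + f x * g' x)" by (intro Ck_add)
  with fg show ?case by (auto intro!: exI[of _ "\<lambda>x. f' x * g x + f x * g' x"] derivative_eq_intros)
qed simp

lemma Ck_const: "Ck k (\<lambda>x. c)"
  by (induction k arbitrary: c) (auto intro!: exI[of _ "\<lambda>x. 0"])

lemma Ck_affine: "Ck k f \<Longrightarrow> Ck k (\<lambda>x. f (m * x + c))"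
proof (induction k arbitrary: f)
  case (Suc k)
  then obtain f' where f: "\<forall>x. (f has_real_derivative f' x) (at x)" "Ck k f'" by auto
  then have "Ck k (\<lambda>x. f' (m * x + c) * m)" using Ck_mult[OF Suc.IH[of f'] Ck_const[of k m]] by simp
  moreover have "((\<lambda>x. f (m * x + c)) has_real_derivative f' (m * x + c) * m) (at x)" for x
    by (rule DERIV_chain2[where f = f, OF f(1)[rule_format]]) (auto intro!: derivative_eq_intros)
  ultimately show ?case by (auto intro!: exI[of _ "\<lambda>x. f' (m * x + c) * m"])
qed simp

lemma smooth1_const: "smooth1 (\<lambda>x. c)" by (simp add: smooth1_iff_Ck Ck_const)
lemma smooth1_add: "smooth1 f \<Longrightarrow> smooth1 g \<Longrightarrow> smooth1 (\<lambda>x. f x + g x)" by (simp add: smooth1_iff_Ck Ck_add)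
lemma smooth1_mult: "smooth1 f \<Longrightarrow> smooth1 g \<Longrightarrow> smooth1 (\<lambda>x. f x * g x)" by (simp add: smooth1_iff_Ck Ck_mult)
lemma smooth1_affine: "smooth1 f \<Longrightarrow> smooth1 (\<lambda>x. f (m * x + c))" by (simp add: smooth1_iff_Ck Ck_affine)

lemma smooth1_DERIV: "smooth1 f \<Longrightarrow> (f has_real_derivative deriv f x) (at x)"
  unfolding smooth1_def by (drule spec[of _ 0]) simp

lemma smooth1_deriv: "smooth1 f \<Longrightarrow> smooth1 (deriv f)"
proof -
  assume "smooth1 f"
  then have "((deriv ^^ n) (deriv f) has_real_derivative (deriv ^^ Suc n) (deriv f) x) (at x)" for n x
    unfolding smooth1_def by (drule_tac spec[of _ "Suc n"]) (simp del: funpow.simps add: funpow_Suc_right)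
  then show ?thesis unfolding smooth1_def by blast
qed

lemma smooth1_antideriv: 
  assumes "smooth1 f" "\<And>x. (F has_real_derivative f x) (at x)"
  shows "smooth1 F"
  unfolding smooth1_iff_Ck
proof
  fix k show "Ck k F" using assms unfolding smooth1_iff_Ck by (cases k) auto
qed

lemma smooth1_continuous: "smooth1 f \<Longrightarrow> continuous_on S f"
  by (rule DERIV_continuous_on, rule has_field_derivative_at_within, rule smooth1_DERIV)

definition flat_exp :: "real \<Rightarrow> real" where
  "flat_exp x = (if x > 0 then exp (- (1/x)) else 0)"

lemma poly_exp_tendsto_0: "((\<lambda>x::real. poly p x * exp (- x)) \<longlongrightarrow> 0) at_top"
proof (induction p)
  case (pCons a p)
  have aux: "((\<lambda>x::real. x ^ k * exp (- x)) \<longlongrightarrow> 0) at_top" for k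
    using tendsto_power_div_exp_0[of k] by (simp add: exp_minus field_simps)
  have "((\<lambda>x::real. poly p x * x * exp (- x)) \<longlongrightarrow> 0) at_top" for p :: "real poly"
  proof -
    have eq: "(\<lambda>x::real. poly p x * x * exp (- x)) = (\<lambda>x. \<Sum>i\<le>degree p. coeff p i * (x ^ Suc i * exp (- x)))"
      by (auto simp: poly_altdef sum_distrib_right sum_distrib_left algebra_simps)
    have "((\<lambda>x. \<Sum>i\<le>degree p. coeff p i * (x ^ Suc i * exp (- x))) \<longlongrightarrow> (\<Sum>i\<le>degree p. coeff p i * 0)) at_top"
      by (intro tendsto_sum tendsto_mult tendsto_const aux)
    then show ?thesis by (simp add: eq)
  qed
  from tendsto_add[OF tendsto_mult[OF tendsto_const[of a] aux[of 0]] this[of p]]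
  show ?case by (simp add: algebra_simps)
qed simp

text \<open>The functions p(1/x) exp(-1/x) for x > 0, extended by 0, form a class closed under
  differentiation, also at 0. The n-th derivative of \<open>flat_exp\<close> is the member belonging
  to the n-th iterate of the operator \<open>D\<close> on polynomials.\<close>

lemma smooth1_flat_exp: "smooth1 flat_exp"
proof -
  define g where "g p x = (if x > 0 then poly p (1/x) * exp (- (1/x)) else 0)" for p and x :: real
  \<comment> \<open>With s = 1/x, the derivative of p(s) exp(-s) in x is s^2 (p(s) - p'(s))
    exp(-s).\<close>
  define D where "D p = [:0,0,1:] * (p - pderiv p)" for p :: "real poly"
  have "(g p has_real_derivative g (D p) x) (at x)" for p x
  proof -
    consider "x > 0" | "x < 0" | "x = 0" by linarith
    then show ?thesis
    proof cases
      case 1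
      have "((\<lambda>x. poly p (1/x) * exp (- (1/x))) has_real_derivative
          poly (pderiv p) (1/x) * (- (1 / x\<^sup>2)) * exp (- (1/x)) + poly p (1/x) * (exp (- (1/x)) * (1/x\<^sup>2))) (at x)"
        using 1 by (auto intro!: derivative_eq_intros DERIV_chain2[OF poly_DERIV] simp: power2_eq_square field_simps)
      also have "poly (pderiv p) (1/x) * (- (1 / x\<^sup>2)) * exp (- (1/x)) + poly p (1/x) * (exp (- (1/x)) * (1/x\<^sup>2)) = g (D p) x"
        using 1 by (simp add: g_def D_def power2_eq_square field_simps)
      finally show ?thesis
        by (rule has_field_derivative_transform_within_open[of _ _ _ "{0<..}"]) (use 1 in \<open>auto simp: g_def\<close>)
    next
      case 2
      have "((\<lambda>x. 0) has_real_derivative g (D p) x) (at x)" using 2 by (simp add: g_def)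
      then show ?thesis
        by (rule has_field_derivative_transform_within_open[of _ _ _ "{..<0}"]) (use 2 in \<open>auto simp: g_def\<close>)
    next
      case 3
      \<comment> \<open>At 0 the right difference quotient is s p(s) exp(-s) with s = 1/y, again a
        polynomial times a decaying exponential; the left one is 0.\<close>
      have "((\<lambda>y. poly (pCons 0 p) (inverse y) * exp (- inverse y)) \<longlongrightarrow> 0) (at_right 0)"
        by (rule filterlim_compose[OF poly_exp_tendsto_0 filterlim_inverse_at_top_right])
      then have r: "((\<lambda>y. g p y / y) \<longlongrightarrow> 0) (at_right 0)"
        by (rule Lim_transform_eventually) (auto simp: g_def eventually_at_filter field_simps)
      have l: "((\<lambda>y. g p y / y) \<longlongrightarrow> 0) (at_left 0)"
        by (rule tendsto_eventually) (auto simp: g_def eventually_at_filter)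
      have "((\<lambda>y. g p y / y) \<longlongrightarrow> 0) (at 0)" using l r by (simp add: filterlim_split_at)
      then show ?thesis using 3 by (simp add: has_field_derivative_iff g_def)
    qed
  qed
  then show ?thesis
    by (intro smooth1I[of "\<lambda>n. g ((D ^^ n) [:1:])"]) (auto simp: g_def flat_exp_def fun_eq_iff)
qed

text \<open>The scale n sits inside the arguments so that all bumps stay between 0 and 1, vanish off
  the same open interval and converge pointwise to its indicator. Dominated convergence then turns
  identities for test functions into identities for intervals.\<close>

definition bump :: "nat \<Rightarrow> real \<Rightarrow> real \<Rightarrow> real \<Rightarrow> real" where
  "bump n a b x = flat_exp (real (Suc n) * (x - a)) * flat_exp (real (Suc n) * (b - x))"

lemma smooth1_bump: "smooth1 (bump n a b)"
proof -
  have "smooth1 (\<lambda>x. flat_exp (real (Suc n) * x + (- (real (Suc n) * a))) * flat_exp ((- real (Suc n)) * x + real (Suc n) * b))"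
    by (intro smooth1_mult smooth1_affine smooth1_flat_exp)
  then show ?thesis by (simp add: bump_def[abs_def] algebra_simps)
qed

lemma flat_exp_bounds: "0 \<le> flat_exp x" "flat_exp x \<le> 1" by (auto simp: flat_exp_def)

lemma bump_nonneg: "0 \<le> bump n a b x" by (simp add: bump_def flat_exp_bounds)
lemma bump_le_1: "bump n a b x \<le> 1" by (simp add: bump_def flat_exp_bounds mult_le_one)
lemma bump_eq_0: "x \<notin> {a<..<b} \<Longrightarrow> bump n a b x = 0"
  by (auto simp: bump_def flat_exp_def mult_le_0_iff zero_less_mult_iff)
lemma bump_pos: "x \<in> {a<..<b} \<Longrightarrow> bump n a b x > 0"
  by (auto simp: bump_def flat_exp_def zero_less_mult_iff)

lemma bump_tendsto: "(\<lambda>n. bump n a b x) \<longlonglongrightarrow> indicator {a<..<b} x"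
proof (cases "x \<in> {a<..<b}")
  case True
  have *: "(\<lambda>n. flat_exp (real (Suc n) * d)) \<longlonglongrightarrow> 1" if "d > 0" for d
  proof -
    have "(\<lambda>n. exp (- (inverse (real (Suc n)) * (1/d)))) \<longlonglongrightarrow> exp (- (0 * (1/d)))"
      by (intro tendsto_intros LIMSEQ_inverse_real_of_nat)
    moreover have "flat_exp (real (Suc n) * d) = exp (- (inverse (real (Suc n)) * (1/d)))" for n
      using that by (simp add: flat_exp_def field_simps add_pos_nonneg)
    ultimately show ?thesis by simp
  qed
  have "(\<lambda>n. bump n a b x) \<longlonglongrightarrow> 1 * 1"
    unfolding bump_def using True by (intro tendsto_mult *) auto
  with True show ?thesis by simp
qed (simp add: bump_eq_0)

lemma test1_bump: "test1 (bump n a b)"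
proof -
  have "{x. bump n a b x \<noteq> 0} \<subseteq> {a..b}" 
  proof
    fix x assume "x \<in> {x. bump n a b x \<noteq> 0}"
    then have "x \<in> {a<..<b}" using bump_eq_0[of x a b n] by blast
    then show "x \<in> {a..b}" by simp
  qed
  then show ?thesis unfolding test1_def using smooth1_bump by (blast intro: bounded_subset[OF bounded_closed_interval])
qed

section \<open>Absolutely continuous functions and weak derivatives\<close>

lemma sigma_sets_Ico: "sets borel = sigma_sets UNIV (insert {} {{a..<b} | a b::real. a < b})"
proof -
  have "insert {} {{a..<b} | a b::real. a < b} = range (\<lambda>(a,b). {a..<b::real})"
  proof (intro equalityI subsetI)
    fix X :: "real set" assume "X \<in> insert {} {{a..<b} | a b::real. a < b}"
    then obtain a b where "X = {a..<b}" using atLeastLessThan_empty[of "0::real" 0] by blast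
    then have "X = (case (a, b) of (a, b) \<Rightarrow> {a..<b})" by simp
    then show "X \<in> range (\<lambda>(a,b). {a..<b::real})" by (rule range_eqI)
  next
    fix X :: "real set" assume "X \<in> range (\<lambda>(a,b). {a..<b::real})"
    then obtain a b where "X = {a..<b}" by auto
    then show "X \<in> insert {} {{a..<b} | a b::real. a < b}" by (cases "a < b") auto
  qed
  then show ?thesis using borel_eq_atLeastLessThan by (metis sets_measure_of top_greatest Pow_UNIV)
qed

text \<open>Half-open intervals suit the changes of variables below: preimages of such intervals
  under the monotone maps \<open>y\<close> and \<open>y0\<close> are again half-open, with endpoints
  given by a Galois connection and no correction for plateaus.\<close>

lemma measure_eqI_Ico:
  fixes M N :: "real measure"
  assumes "sets M = sets borel" "sets N = sets borel"
    and eq: "\<And>a b. a < b \<Longrightarrow> emeasure M {a..<b} = emeasure N {a..<b}"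
    and fin: "\<And>a b. a < b \<Longrightarrow> emeasure M {a..<b} \<noteq> \<infinity>"
  shows "M = N"
proof (rule measure_eqI_generator_eq)
  let ?E = "insert {} {{a..<b} | a b::real. a < b}"
  have "{a..<b} \<inter> {c..<d} \<in> ?E" for a b c d :: real
  proof -
    have "{a..<b} \<inter> {c..<d} = {max a c..<min b d}" by auto
    moreover have "{max a c..<min b d} \<in> ?E"
    proof (cases "max a c < min b d")
      case True
      then show ?thesis by (intro insertI2 CollectI exI conjI) (rule refl)
    next
      case False
      then have "{max a c..<min b d} = {}" by simp
      then show ?thesis by (rule ssubst) (rule insertI1)
    qed
    ultimately show ?thesis by (rule ssubst)
  qed
  note inter = this
  show "Int_stable ?E"
  proof (rule Int_stableI)
    fix X Y assume X: "X \<in> ?E" and Y: "Y \<in> ?E"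
    show "X \<inter> Y \<in> ?E"
    proof (cases "X = {} \<or> Y = {}")
      case True
      then have "X \<inter> Y = {}" by blast
      then show ?thesis by (rule ssubst) (rule insertI1)
    next
      case False
      with X obtain a b where "X = {a..<b}" by blast
      moreover from False Y obtain c d where "Y = {c..<d}" by blast
      ultimately show ?thesis by (simp only: inter)
    qed
  qed
  show "?E \<subseteq> Pow UNIV" by simp
  show "emeasure M X = emeasure N X" if "X \<in> ?E" for X
  proof (cases "X = {}")
    case False
    with that obtain a b where "X = {a..<b}" "a < b" by blast
    then show ?thesis using eq by simp
  qed simp
  show "sets M = sigma_sets UNIV ?E" "sets N = sigma_sets UNIV ?E" using assms(1,2) sigma_sets_Ico by simp_all
  define A where "A n = {- real (Suc n)..<real (Suc n)}" for n
  have "A n \<in> ?E" for n unfolding A_def by (intro insertI2 CollectI exI conjI) (rule refl, simp)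
  then show "range A \<subseteq> ?E" by blast
  have "x \<in> (\<Union>i. A i)" for x
  proof -
    obtain n where "\<bar>x\<bar> < real n" using reals_Archimedean2 by blast
    then show ?thesis by (auto simp: A_def intro!: exI[of _ n])
  qed
  then show "(\<Union>i. A i) = UNIV" by blast
  show "emeasure M (A i) \<noteq> \<infinity>" for i unfolding A_def by (rule fin) simp
qed

text \<open>Local absolute continuity of F with density f, encoded by the fundamental theorem of
  calculus over compact intervals instead of by derivatives almost everywhere. F is determined
  exactly up to a constant, f only up to null sets.\<close>

definition antideriv :: "(real \<Rightarrow> real) \<Rightarrow> (real \<Rightarrow> real) \<Rightarrow> bool" where
  "antideriv F f \<longleftrightarrow> (\<forall>a b. a \<le> b \<longrightarrow> set_integrable lborel {a..b} f \<and> (LBINT x:{a..b}. f x) = F b - F a)"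

lemma antideriv_integrable: "antideriv F f \<Longrightarrow> set_integrable lborel {a..b} f"
  unfolding antideriv_def by (cases "a \<le> b") auto

lemma antideriv_eq: "antideriv F f \<Longrightarrow> a \<le> b \<Longrightarrow> (LBINT x:{a..b}. f x) = F b - F a"
  unfolding antideriv_def by blast

lemma lborel_AE_neq: "AE x in lborel. x \<noteq> (c::real)"
  by (rule AE_I[of _ _ "{c}"]) auto

lemma locally_integrable_measurable:
  fixes f :: "real \<Rightarrow> real"
  assumes "\<And>a b. set_integrable lborel {a..b} f" shows "f \<in> borel_measurable borel"
proof -
  have 1: "(\<lambda>x. indicator {-real n..real n} x *\<^sub>R f x) \<in> borel_measurable borel" for n
    using assms[of "- real n" "real n"] unfolding set_integrable_def by (auto dest: borel_measurable_integrable)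
  have 2: "(\<lambda>n. indicator {-real n..real n} x *\<^sub>R f x) \<longlonglongrightarrow> f x" for x
  proof (rule tendsto_eventually)
    obtain N where "\<bar>x\<bar> < real N" using reals_Archimedean2 by blast
    then show "\<forall>\<^sub>F n in sequentially. indicat_real {- real n..real n} x *\<^sub>R f x = f x"
      by (auto simp: eventually_sequentially indicator_def intro!: exI[of _ N])
  qed
  show ?thesis by (rule borel_measurable_LIMSEQ_real[OF 2 1])
qed

lemma antideriv_measurable: "antideriv F f \<Longrightarrow> f \<in> borel_measurable borel"
  using antideriv_integrable locally_integrable_measurable by blast

lemma antideriv_Ico:
  assumes "antideriv F f" "a \<le> b" shows "(LBINT x:{a..<b}. f x) = F b - F a"
proof -
  have [measurable]: "f \<in> borel_measurable borel" using assms by (rule_tac antideriv_measurable)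
  have "(LBINT x:{a..<b}. f x) = (LBINT x:{a..b}. f x)"
    unfolding set_lebesgue_integral_def
  proof (rule integral_cong_AE)
    show "AE x in lborel. indicat_real {a..<b} x *\<^sub>R f x = indicat_real {a..b} x *\<^sub>R f x"
      using lborel_AE_neq[of b] by eventually_elim (auto simp: indicator_def)
  qed measurable
  then show ?thesis using antideriv_eq[OF assms] by simp
qed

lemma antideriv_DERIV:
  assumes "\<And>x. (F has_real_derivative f x) (at x)" "continuous_on UNIV f"
  shows "antideriv F f"
  unfolding antideriv_def
proof (intro allI impI)
  fix a b :: real assume ab: "a \<le> b"
  have 1: "(F has_vector_derivative f x) (at x within {a..b})" for x
    using assms(1)[of x] has_real_derivative_iff_has_vector_derivative has_vector_derivative_at_within by blast
  have 2: "continuous_on {a..b} f" using assms(2) continuous_on_subset by blast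
  show "set_integrable lborel {a..b} f \<and> (LBINT x:{a..b}. f x) = F b - F a"
    using has_bochner_integral_FTC_Icc[OF ab 1 2] unfolding set_integrable_def set_lebesgue_integral_def
    by (auto simp: has_bochner_integral_iff)
qed

lemma antideriv_add: "antideriv F f \<Longrightarrow> antideriv G g \<Longrightarrow> antideriv (\<lambda>x. F x + G x) (\<lambda>x. f x + g x)"
  unfolding antideriv_def by (auto simp: set_integral_add(1) set_integral_add(2))

lemma antideriv_cmult: "antideriv F f \<Longrightarrow> antideriv (\<lambda>x. c * F x) (\<lambda>x. c * f x)"
  unfolding antideriv_def by (auto simp: right_diff_distrib[symmetric] simp del: right_diff_distrib)

lemma antideriv_const: "antideriv (\<lambda>x. c) (\<lambda>x. 0)"
  by (rule antideriv_DERIV) auto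

lemma antideriv_diff: "antideriv F f \<Longrightarrow> antideriv G g \<Longrightarrow> antideriv (\<lambda>x. F x - G x) (\<lambda>x. f x - g x)"
  using antideriv_add[of F f "\<lambda>x. -1 * G x" "\<lambda>x. -1 * g x"] antideriv_cmult[of G g "-1"] by simp

lemma antideriv_continuous:
  assumes "antideriv F f" shows "continuous_on UNIV F"
proof -
  have "isCont F x" for x
  proof -
    have si: "set_integrable lborel {x-1..x+1} f" using assms by (rule antideriv_integrable)
    have "continuous_on {x-1..x+1} (\<lambda>y. F (x-1) + integral {x-1..y} f)"
      by (intro continuous_intros indefinite_integral_continuous_1 set_borel_integral_eq_integral(1)[OF si])
    also have "?this \<longleftrightarrow> continuous_on {x-1..x+1} F"
    proof (rule continuous_on_cong[OF refl])
      fix y assume "y \<in> {x-1..x+1}"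
      then show "F (x-1) + integral {x-1..y} f = F y"
        using antideriv_eq[OF assms, of "x-1" y] set_borel_integral_eq_integral(2)[OF antideriv_integrable[OF assms, of "x-1" y]] by simp
    qed
    finally show ?thesis by (rule continuous_on_interior) (simp add: interior_atLeastAtMost_real)
  qed
  then show ?thesis by (simp add: continuous_at_imp_continuous_on)
qed

lemma set_integrable_mult_cont:
  fixes f g :: "real \<Rightarrow> real"
  assumes "set_integrable lborel {a..b} f" "continuous_on UNIV g"
  shows "set_integrable lborel {a..b} (\<lambda>x. f x * g x)"
proof -
  have "bounded (g ` {a..b})"
    by (intro compact_imp_bounded compact_continuous_image continuous_on_subset[OF assms(2)]) auto
  then obtain K where K: "\<And>x. x \<in> {a..b} \<Longrightarrow> \<bar>g x\<bar> \<le> K" by (force simp: bounded_iff)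
  have [measurable]: "(\<lambda>x. indicator {a..b} x *\<^sub>R f x) \<in> borel_measurable borel" "g \<in> borel_measurable borel"
    using assms unfolding set_integrable_def
    by (auto dest: borel_measurable_integrable intro: borel_measurable_continuous_onI)
  have "integrable lborel (\<lambda>x. (indicator {a..b} x *\<^sub>R f x) * g x)"
  proof (rule Bochner_Integration.integrable_bound[OF integrable_mult_left[OF assms(1)[unfolded set_integrable_def], of K]])
    show "AE x in lborel. norm ((indicat_real {a..b} x *\<^sub>R f x) * g x) \<le> norm ((indicat_real {a..b} x *\<^sub>R f x) * K)"
    proof (rule AE_I2)
      fix x show "norm ((indicat_real {a..b} x *\<^sub>R f x) * g x) \<le> norm ((indicat_real {a..b} x *\<^sub>R f x) * K)"
      proof (cases "x \<in> {a..b}")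
        case True then show ?thesis using K[OF True] by (auto simp: abs_mult intro!: mult_left_mono)
      qed simp
    qed
  qed measurable
  then show ?thesis unfolding set_integrable_def by (simp add: algebra_simps)
qed

lemma integrable_prod:
  fixes f g :: "real \<Rightarrow> real"
  assumes "integrable lborel f" "integrable lborel g"
  shows "integrable (lborel \<Otimes>\<^sub>M lborel) (\<lambda>(x,y). f x * g y)"
proof (rule lborel_pair.Fubini_integrable)
  have [measurable]: "f \<in> borel_measurable borel" "g \<in> borel_measurable borel" using assms by (auto dest: borel_measurable_integrable)
  show "(\<lambda>(x, y). f x * g y) \<in> borel_measurable (lborel \<Otimes>\<^sub>M lborel)" by measurable
qed (use assms in \<open>auto simp: abs_mult\<close>)

text \<open>Integration by parts through Fubini: f(x) g(y) is integrated over the square on {a..b},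
  which is split into the triangles y \<le> x and x \<le> y. They overlap in the diagonal, a null
  set, and each triangle yields one of the two product terms.\<close>

lemma antideriv_mult:
  assumes F: "antideriv F f" and G: "antideriv G g"
  shows "antideriv (\<lambda>x. F x * G x) (\<lambda>x. f x * G x + F x * g x)"
  unfolding antideriv_def
proof (intro allI impI)
  fix a b :: real assume ab: "a \<le> b"
  note cF = antideriv_continuous[OF F] and cG = antideriv_continuous[OF G]
  note sf = antideriv_integrable[OF F, of a b] and sg = antideriv_integrable[OF G, of a b]
  have i1: "set_integrable lborel {a..b} (\<lambda>x. f x * G x)" by (rule set_integrable_mult_cont[OF sf cG])
  have i2: "set_integrable lborel {a..b} (\<lambda>x. F x * g x)" using set_integrable_mult_cont[OF sg cF] by (simp add: mult.commute)
  have "set_integrable lborel {a..b} (\<lambda>x. f x * G x + F x * g x)" using i1 i2 by (rule set_integral_add)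
  define f1 where "f1 x = indicator {a..b} x *\<^sub>R f x" for x
  define g1 where "g1 x = indicator {a..b} x *\<^sub>R g x" for x
  have int: "integrable lborel f1" "integrable lborel g1" using sf sg unfolding set_integrable_def f1_def g1_def by auto
  have [measurable]: "f1 \<in> borel_measurable borel" "g1 \<in> borel_measurable borel" using int by (auto dest: borel_measurable_integrable)
  have Fx: "(\<integral>y. f1 y * (if y \<le> x then 1 else 0) \<partial>lborel) = F x - F a" if "x \<in> {a..b}" for x
  proof -
    have "(\<integral>y. f1 y * (if y \<le> x then 1 else 0) \<partial>lborel) = (LBINT y:{a..x}. f y)"
      unfolding set_lebesgue_integral_def f1_def using that by (intro Bochner_Integration.integral_cong) (auto simp: indicator_def)
    then show ?thesis using antideriv_eq[OF F, of a x] that by simp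
  qed
  have Gx: "(\<integral>y. g1 y * (if y \<le> x then 1 else 0) \<partial>lborel) = G x - G a" if "x \<in> {a..b}" for x
  proof -
    have "(\<integral>y. g1 y * (if y \<le> x then 1 else 0) \<partial>lborel) = (LBINT y:{a..x}. g y)"
      unfolding set_lebesgue_integral_def g1_def using that by (intro Bochner_Integration.integral_cong) (auto simp: indicator_def)
    then show ?thesis using antideriv_eq[OF G, of a x] that by simp
  qed
  have P1: "integrable (lborel \<Otimes>\<^sub>M lborel) (\<lambda>(x,y). f1 x * g1 y * (if y \<le> x then 1 else 0))"
    by (rule Bochner_Integration.integrable_bound[OF integrable_prod[OF int]]) (auto simp: split_beta)
  have P2: "integrable (lborel \<Otimes>\<^sub>M lborel) (\<lambda>(x,y). f1 x * g1 y * (if x \<le> y then 1 else 0))"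
    by (rule Bochner_Integration.integrable_bound[OF integrable_prod[OF int]]) (auto simp: split_beta)
  let ?A = "\<integral>x. \<integral>y. f1 x * g1 y * (if y \<le> x then 1 else 0) \<partial>lborel \<partial>lborel"
  let ?B = "\<integral>x. \<integral>y. f1 x * g1 y * (if x \<le> y then 1 else 0) \<partial>lborel \<partial>lborel"
  have A: "?A = (\<integral>x. f1 x * (G x - G a) \<partial>lborel)"
    by (rule Bochner_Integration.integral_cong[OF refl]) (use Gx in \<open>auto simp: mult.assoc f1_def indicator_def\<close>)
  have "?B = (\<integral>y. \<integral>x. f1 x * g1 y * (if x \<le> y then 1 else 0) \<partial>lborel \<partial>lborel)"
    using lborel_pair.Fubini_integral[OF P2] by simp
  also have "\<dots> = (\<integral>y. g1 y * (\<integral>x. f1 x * (if x \<le> y then 1 else 0) \<partial>lborel) \<partial>lborel)"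
    by (subst integral_mult_right_zero[symmetric], intro Bochner_Integration.integral_cong) auto
  also have "\<dots> = (\<integral>y. g1 y * (F y - F a) \<partial>lborel)"
    by (rule Bochner_Integration.integral_cong[OF refl]) (use Fx in \<open>auto simp: g1_def indicator_def\<close>)
  finally have B: "?B = (\<integral>y. g1 y * (F y - F a) \<partial>lborel)" .
  have "?A + ?B = (\<integral>p. (case p of (x,y) \<Rightarrow> f1 x * g1 y * (if y \<le> x then 1 else 0)) + (case p of (x,y) \<Rightarrow> f1 x * g1 y * (if x \<le> y then 1 else 0)) \<partial>(lborel \<Otimes>\<^sub>M lborel))"
    using lborel_pair.integral_fst'[OF P1] lborel_pair.integral_fst'[OF P2] P1 P2 by (simp add: Bochner_Integration.integral_add)
  also have "\<dots> = (\<integral>p. (case p of (x,y) \<Rightarrow> f1 x * g1 y * (if y \<le> x then 1 else 0) + f1 x * g1 y * (if x \<le> y then 1 else 0)) \<partial>(lborel \<Otimes>\<^sub>M lborel))"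
    by (intro Bochner_Integration.integral_cong) auto
  also have "\<dots> = (\<integral>x. \<integral>y. f1 x * g1 y * (if y \<le> x then 1 else 0) + f1 x * g1 y * (if x \<le> y then 1 else 0) \<partial>lborel \<partial>lborel)"
  proof (subst lborel_pair.integral_fst'[symmetric])
    show "integrable (lborel \<Otimes>\<^sub>M lborel) (\<lambda>(x,y). f1 x * g1 y * (if y \<le> x then 1 else 0) + f1 x * g1 y * (if x \<le> y then 1 else 0))"
      using Bochner_Integration.integrable_add[OF P1 P2] unfolding split_beta .
  qed simp
  also have "\<dots> = (\<integral>x. \<integral>y. f1 x * g1 y \<partial>lborel \<partial>lborel)"
  proof (rule Bochner_Integration.integral_cong[OF refl], rule integral_cong_AE)
    fix x show "AE y in lborel. f1 x * g1 y * (if y \<le> x then 1 else 0) + f1 x * g1 y * (if x \<le> y then 1 else 0) = f1 x * g1 y"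
      using lborel_AE_neq[of x] by eventually_elim auto
  qed measurable
  also have "\<dots> = (\<integral>x. f1 x \<partial>lborel) * (\<integral>x. g1 x \<partial>lborel)" by simp
  also have "\<dots> = (F b - F a) * (G b - G a)"
    using antideriv_eq[OF F ab] antideriv_eq[OF G ab] unfolding set_lebesgue_integral_def f1_def g1_def by simp
  finally have AB: "(\<integral>x. f1 x * (G x - G a) \<partial>lborel) + (\<integral>y. g1 y * (F y - F a) \<partial>lborel) = (F b - F a) * (G b - G a)"
    unfolding A B .
  have If: "(\<integral>x. f1 x \<partial>lborel) = F b - F a" and Ig: "(\<integral>x. g1 x \<partial>lborel) = G b - G a"
    using antideriv_eq[OF F ab] antideriv_eq[OF G ab] unfolding set_lebesgue_integral_def f1_def g1_def by simp_all
  have j: "integrable lborel (\<lambda>x. f1 x * G x)" "integrable lborel (\<lambda>x. g1 x * F x)"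
    using i1 i2 unfolding set_integrable_def f1_def g1_def by (auto simp: mult_ac)
  have "(\<integral>x. f1 x * (G x - G a) \<partial>lborel) = (\<integral>x. f1 x * G x \<partial>lborel) - (F b - F a) * G a"
    using If j int by (simp add: right_diff_distrib)
  moreover have "(\<integral>x. g1 x * (F x - F a) \<partial>lborel) = (\<integral>x. g1 x * F x \<partial>lborel) - (G b - G a) * F a"
    using Ig j int by (simp add: right_diff_distrib)
  moreover have "(LBINT x:{a..b}. f x * G x + F x * g x) = (\<integral>x. f1 x * G x \<partial>lborel) + (\<integral>x. g1 x * F x \<partial>lborel)"
    unfolding set_integral_add(2)[OF i1 i2] by (simp add: set_lebesgue_integral_def f1_def g1_def mult_ac)
  ultimately have "(LBINT x:{a..b}. f x * G x + F x * g x) = F b * G b - F a * G a"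
    using AB by (simp add: algebra_simps)
  with \<open>set_integrable lborel {a..b} (\<lambda>x. f x * G x + F x * g x)\<close>
  show "set_integrable lborel {a..b} (\<lambda>x. f x * G x + F x * g x) \<and>
    (LBINT x:{a..b}. f x * G x + F x * g x) = F b * G b - F a * G a" by blast
qed

text \<open>A s^2 - 2 B s t + C t^2 is the integral of pointwise nonnegative quadratic forms, hence
  nonnegative, which bounds its discriminant. The hypothesis is a pointwise bound on
  \<open>\<beta>\<close> squared because this is the form in which slope, velocity and energy are
  related later.\<close>

lemma Cauchy_Schwarz_weighted:
  fixes \<alpha> \<beta> \<gamma> :: "'a \<Rightarrow> real"
  assumes "integrable M \<alpha>" "integrable M \<beta>" "integrable M \<gamma>"
    and "AE x in M. 0 \<le> \<alpha> x \<and> 0 \<le> \<gamma> x \<and> (\<beta> x)\<^sup>2 \<le> \<alpha> x * \<gamma> x"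
  shows "(\<integral>x. \<beta> x \<partial>M)\<^sup>2 \<le> (\<integral>x. \<alpha> x \<partial>M) * (\<integral>x. \<gamma> x \<partial>M)"
proof -
  define A B C where "A = (\<integral>x. \<alpha> x \<partial>M)" "B = (\<integral>x. \<beta> x \<partial>M)" "C = (\<integral>x. \<gamma> x \<partial>M)"
  have nn: "0 \<le> A * s\<^sup>2 - 2 * B * s * t + C * t\<^sup>2" for s t
  proof -
    have "0 \<le> (\<integral>x. \<alpha> x * s\<^sup>2 - 2 * \<beta> x * s * t + \<gamma> x * t\<^sup>2 \<partial>M)"
    proof (rule integral_nonneg_AE)
      show "AE x in M. 0 \<le> \<alpha> x * s\<^sup>2 - 2 * \<beta> x * s * t + \<gamma> x * t\<^sup>2"
        using assms(4)
      proof eventually_elim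
        case (elim x)
        let ?a = "sqrt (\<alpha> x)" and ?c = "sqrt (\<gamma> x)"
        have b: "\<bar>\<beta> x\<bar> \<le> ?a * ?c" using real_sqrt_le_mono[OF conjunct2[OF conjunct2[OF elim]]] by (simp add: real_sqrt_mult)
        have "\<beta> x * (s * t) \<le> ?a * ?c * \<bar>s * t\<bar>"
          using mult_right_mono[OF b, of "\<bar>s * t\<bar>"] abs_ge_self[of "\<beta> x * (s * t)"] by (simp add: abs_mult)
        moreover have "0 \<le> (?a * \<bar>s\<bar> - ?c * \<bar>t\<bar>)\<^sup>2" by simp
        then have "0 \<le> \<alpha> x * s\<^sup>2 - 2 * (?a * ?c * \<bar>s * t\<bar>) + \<gamma> x * t\<^sup>2"
          using elim by (simp add: power2_diff power_mult_distrib abs_mult algebra_simps)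
        ultimately show ?case by (simp add: algebra_simps)
      qed
    qed
    also have "\<dots> = A * s\<^sup>2 - 2 * B * s * t + C * t\<^sup>2"
      unfolding A_B_C_def using assms by simp
    finally show ?thesis .
  qed
  have AC: "0 \<le> A" "0 \<le> C" using nn[of 1 0] nn[of 0 1] by auto
  \<comment> \<open>The vectors (s, t) are (B, 1) if A and C vanish, (C, B) if only A vanishes, and
    (B, A) otherwise. In the last two cases the form equals C (A C - B^2) and A (A C - B^2).\<close>
  have "B\<^sup>2 \<le> A * C"
  proof (cases "A = 0 \<and> C = 0")
    case True
    then show ?thesis using nn[of B 1] by (simp add: power2_eq_square)
  next
    case False
    show ?thesis
    proof (cases "A = 0")
      case True
      with False AC have "C > 0" by auto
      have "0 \<le> C * (A * C - B\<^sup>2)" using nn[of C B] by (simp add: power2_eq_square algebra_simps)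
      with \<open>C > 0\<close> show ?thesis by (simp add: zero_le_mult_iff)
    next
      case False
      with AC have "A > 0" by auto
      have "0 \<le> A * (A * C - B\<^sup>2)" using nn[of B A] by (simp add: power2_eq_square algebra_simps)
      with \<open>A > 0\<close> show ?thesis by (simp add: zero_le_mult_iff)
    qed
  qed
  then show ?thesis by (simp add: A_B_C_def)
qed

text \<open>With \<open>\<alpha>\<close> the slope of the position and \<open>\<gamma>\<close> the
  energy density, increments of the velocity are controlled by displacement times energy. This makes
  the Eulerian velocity well defined and Hoelder continuous.\<close>

lemma antideriv_Cauchy_Schwarz:
  assumes "antideriv U \<beta>" "antideriv A \<alpha>" "antideriv H \<gamma>" "a \<le> b"
    and "\<And>x. 0 \<le> \<alpha> x" "\<And>x. 0 \<le> \<gamma> x" "\<And>x. (\<beta> x)\<^sup>2 \<le> \<alpha> x * \<gamma> x"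
  shows "(U b - U a)\<^sup>2 \<le> (A b - A a) * (H b - H a)"
proof -
  have i: "integrable lborel (\<lambda>x. indicator {a..b} x *\<^sub>R \<alpha> x)" "integrable lborel (\<lambda>x. indicator {a..b} x *\<^sub>R \<beta> x)" "integrable lborel (\<lambda>x. indicator {a..b} x *\<^sub>R \<gamma> x)"
    using assms(1-3)[THEN antideriv_integrable] unfolding set_integrable_def by blast+
  have "AE x in lborel. 0 \<le> indicator {a..b} x *\<^sub>R \<alpha> x \<and> 0 \<le> indicator {a..b} x *\<^sub>R \<gamma> x \<and> (indicator {a..b} x *\<^sub>R \<beta> x)\<^sup>2 \<le> (indicator {a..b} x *\<^sub>R \<alpha> x) * (indicator {a..b} x *\<^sub>R \<gamma> x)"
    using assms(5-) by (auto simp: indicator_def)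
  from Cauchy_Schwarz_weighted[OF i this] show ?thesis
    using antideriv_eq[OF assms(1,4)] antideriv_eq[OF assms(2,4)] antideriv_eq[OF assms(3,4)]
    unfolding set_lebesgue_integral_def by simp
qed

lemma set_integrable_cont: "continuous_on UNIV (f :: real \<Rightarrow> real) \<Longrightarrow> set_integrable lborel {a..b} f"
  unfolding set_integrable_def by (rule borel_integrable_compact) (auto intro: continuous_on_subset)

lemma integral_eq_LBINT_support:
  fixes f :: "real \<Rightarrow> real"
  assumes "\<And>x. x \<notin> {a..b} \<Longrightarrow> f x = 0"
  shows "(\<integral>x. f x \<partial>lborel) = (LBINT x:{a..b}. f x)"
  unfolding set_lebesgue_integral_def using assms by (intro Bochner_Integration.integral_cong) (auto simp: indicator_def)

lemma test1_smooth: "test1 \<phi> \<Longrightarrow> smooth1 \<phi>" by (simp add: test1_def)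

lemma test1_support:
  assumes "test1 \<phi>" obtains R where "R > 0" "\<And>x. \<bar>x\<bar> \<ge> R \<Longrightarrow> \<phi> x = 0" "\<And>x. \<bar>x\<bar> \<ge> R \<Longrightarrow> deriv \<phi> x = 0"
proof -
  from assms obtain R0 where R0: "\<And>x. \<phi> x \<noteq> 0 \<Longrightarrow> \<bar>x\<bar> \<le> R0"
    unfolding test1_def bounded_iff by auto
  define R where "R = max R0 0 + 1"
  have z: "\<phi> x = 0" if "\<bar>x\<bar> > R0" for x using R0[of x] that by force
  have "deriv \<phi> x = 0" if "\<bar>x\<bar> \<ge> R" for x
  proof (rule DERIV_imp_deriv)
    have "((\<lambda>x. 0) has_real_derivative 0) (at x)" by simp
    then show "(\<phi> has_real_derivative 0) (at x)"
      by (rule has_field_derivative_transform_within_open[of _ _ _ "- {-R0..R0}"]) (use that z in \<open>auto simp: R_def\<close>)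
  qed
  then show thesis using that[of R] z by (auto simp: R_def)
qed

lemma test1_deriv_test1:
  assumes "test1 \<phi>" shows "test1 (deriv \<phi>)"
proof -
  from test1_support[OF assms] obtain R where "\<And>x. \<bar>x\<bar> \<ge> R \<Longrightarrow> deriv \<phi> x = 0" by metis
  then have "{x. deriv \<phi> x \<noteq> 0} \<subseteq> {-R..R}" by force
  then show ?thesis using assms bounded_closed_interval smooth1_deriv unfolding test1_def by (blast intro: bounded_subset)
qed

lemma test1_bounded: assumes "test1 \<phi>" obtains K where "K > 0" "\<And>x. \<bar>\<phi> x\<bar> \<le> K"
proof -
  from test1_support[OF assms] obtain R where R: "R > 0" "\<And>x. \<bar>x\<bar> \<ge> R \<Longrightarrow> \<phi> x = 0" by metis
  have "bounded (\<phi> ` {-R..R})"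
    by (intro compact_imp_bounded compact_continuous_image smooth1_continuous test1_smooth assms) auto
  then obtain K where K: "\<And>x. x \<in> {-R..R} \<Longrightarrow> \<bar>\<phi> x\<bar> \<le> K" by (force simp: bounded_iff)
  have "\<bar>\<phi> x\<bar> \<le> max K 0 + 1" for x using K[of x] R(2)[of x] by (cases "\<bar>x\<bar> \<ge> R") (auto simp: abs_le_iff not_le abs_less_iff max_def)
  then show thesis using that[of "max K 0 + 1"] by auto
qed

lemma antideriv_smooth1: "smooth1 \<phi> \<Longrightarrow> antideriv \<phi> (deriv \<phi>)"
  by (intro antideriv_DERIV smooth1_DERIV smooth1_continuous smooth1_deriv)

lemma antideriv_imp_weak_deriv:
  assumes "antideriv F f" shows "weak_deriv F f"
  unfolding weak_deriv_def
proof (intro conjI allI impI)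
  show "set_integrable lborel {a..b} F" for a b
    using antideriv_continuous[OF assms] by (rule set_integrable_cont)
  show "set_integrable lborel {a..b} f" for a b by (rule antideriv_integrable[OF assms])
  fix \<phi> assume t: "test1 \<phi>"
  note sm = test1_smooth[OF t]
  from test1_support[OF t] obtain R where R: "R > 0" "\<And>x. \<bar>x\<bar> \<ge> R \<Longrightarrow> \<phi> x = 0" "\<And>x. \<bar>x\<bar> \<ge> R \<Longrightarrow> deriv \<phi> x = 0" by metis
  have "(LBINT x:{-R..R}. f x * \<phi> x + F x * deriv \<phi> x) = F R * \<phi> R - F (-R) * \<phi> (-R)"
    by (rule antideriv_eq[OF antideriv_mult[OF assms antideriv_smooth1[OF sm]]]) (use R in simp)
  also have "\<dots> = 0" using R by simp
  finally have "(LBINT x:{-R..R}. f x * \<phi> x + F x * deriv \<phi> x) = 0" .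
  moreover have "set_integrable lborel {-R..R} (\<lambda>x. f x * \<phi> x)"
    by (rule set_integrable_mult_cont[OF antideriv_integrable[OF assms] smooth1_continuous[OF sm]])
  moreover have "set_integrable lborel {-R..R} (\<lambda>x. F x * deriv \<phi> x)"
    by (intro set_integrable_cont continuous_intros antideriv_continuous[OF assms] smooth1_continuous smooth1_deriv sm)
  ultimately have "(LBINT x:{-R..R}. f x * \<phi> x) + (LBINT x:{-R..R}. F x * deriv \<phi> x) = 0" by simp
  moreover have "(\<integral>x. f x * \<phi> x \<partial>lborel) = (LBINT x:{-R..R}. f x * \<phi> x)" 
    by (rule integral_eq_LBINT_support) (use R in \<open>auto simp: abs_le_iff\<close>)
  moreover have "(\<integral>x. F x * deriv \<phi> x \<partial>lborel) = (LBINT x:{-R..R}. F x * deriv \<phi> x)"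
    by (rule integral_eq_LBINT_support) (use R in \<open>auto simp: abs_le_iff\<close>)
  ultimately show "(\<integral>x. F x * deriv \<phi> x \<partial>lborel) = - (\<integral>x. f x * \<phi> x \<partial>lborel)" by simp
qed

lemma test1_antiderivative:
  assumes t: "test1 f" and z: "(\<integral>x. f x \<partial>lborel) = 0"
  obtains \<phi> where "test1 \<phi>" "deriv \<phi> = f"
proof -
  from test1_support[OF t] obtain R where R: "R > 0" "\<And>x. \<bar>x\<bar> \<ge> R \<Longrightarrow> f x = 0" by metis
  have c: "continuous_on UNIV f" by (rule smooth1_continuous[OF test1_smooth[OF t]])
  have "\<exists>F. \<forall>x::real. -\<infinity> < ereal x \<longrightarrow> ereal x < \<infinity> \<longrightarrow> (F has_vector_derivative f x) (at x)"
    by (rule einterval_antiderivative) (use c continuous_on_eq_continuous_at open_UNIV in auto)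
  then obtain F where F: "\<And>x. (F has_real_derivative f x) (at x)"
    by (auto simp: has_real_derivative_iff_has_vector_derivative)
  have aF: "antideriv F f" by (rule antideriv_DERIV[OF F c])
  define \<phi> where "\<phi> x = F x - F (-R)" for x
  have D: "(\<phi> has_real_derivative f x) (at x)" for x
    unfolding \<phi>_def using F[of x] by (auto intro!: derivative_eq_intros)
  have z0: "(LBINT x:{c..d}. f x) = 0" if "\<And>x. x \<in> {c..d} \<Longrightarrow> \<bar>x\<bar> \<ge> R" for c d
    unfolding set_lebesgue_integral_def using that R(2) by (subst integral_eq_zero_AE) (auto simp: indicator_def)
  have FR: "F R = F (-R)"
  proof -
    have "(LBINT x:{-R..R}. f x) = 0"
    proof -
      have "f x = 0" if "x \<notin> {-R..R}" for x using R(2)[of x] that by auto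
      then show ?thesis using integral_eq_LBINT_support[of "-R" R f] z by simp
    qed
    then show ?thesis using antideriv_eq[OF aF, of "-R" R] R by simp
  qed
  have "\<phi> x = 0" if "\<bar>x\<bar> \<ge> R" for x
  proof (cases "x \<ge> 0")
    case True
    then have "F x = F R" using antideriv_eq[OF aF, of R x] z0[of R x] that R by auto
    then show ?thesis using FR by (simp add: \<phi>_def)
  next
    case False
    then have "F x = F (-R)" using antideriv_eq[OF aF, of x "-R"] z0[of x "-R"] that R by auto
    then show ?thesis by (simp add: \<phi>_def)
  qed
  then have "{x. \<phi> x \<noteq> 0} \<subseteq> {-R..R}" by force
  then have "test1 \<phi>" unfolding test1_def using smooth1_antideriv[OF test1_smooth[OF t] D] by (blast intro: bounded_subset[OF bounded_closed_interval])
  moreover have "deriv \<phi> = f" using D by (auto intro: DERIV_imp_deriv)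
  ultimately show thesis by (rule that)
qed

lemma test1_integrable: "test1 f \<Longrightarrow> integrable lborel f"
proof -
  assume t: "test1 f"
  from test1_support[OF t] obtain R where R: "R > 0" "\<And>x. \<bar>x\<bar> \<ge> R \<Longrightarrow> f x = 0" by metis
  have "integrable lborel (\<lambda>x. indicator {-R..R} x *\<^sub>R f x)"
    using set_integrable_cont[OF smooth1_continuous[OF test1_smooth[OF t]]] unfolding set_integrable_def .
  also have "(\<lambda>x. indicator {-R..R} x *\<^sub>R f x) = f"
    using R by (force simp: indicator_def)
  finally show ?thesis .
qed

lemma test1_lin: 
  assumes "test1 f" "test1 g" shows "test1 (\<lambda>x. c * f x + d * g x)"
proof -
  have "{x. c * f x + d * g x \<noteq> 0} \<subseteq> {x. f x \<noteq> 0} \<union> {x. g x \<noteq> 0}" by auto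
  then show ?thesis using assms unfolding test1_def
    by (auto intro!: smooth1_add smooth1_mult smooth1_const intro: bounded_subset[of "{x. f x \<noteq> 0} \<union> {x. g x \<noteq> 0}"])
qed

lemma bump_integral_tendsto:
  assumes R: "set_integrable lborel {A..B} R"
  shows "(\<lambda>n. \<integral>x. R x * bump n A B x \<partial>lborel) \<longlonglongrightarrow> (LBINT x:{A..B}. R x)"
proof -
  define R1 where "R1 x = indicator {A..B} x *\<^sub>R R x" for x
  have i: "integrable lborel R1" using R unfolding set_integrable_def R1_def .
  have [measurable]: "R1 \<in> borel_measurable borel" using i by (auto dest: borel_measurable_integrable)
  have [measurable]: "bump n A B \<in> borel_measurable borel" for n
    by (intro borel_measurable_continuous_onI smooth1_continuous smooth1_bump)
  have "(\<lambda>n. \<integral>x. R1 x * bump n A B x \<partial>lborel) \<longlonglongrightarrow> (\<integral>x. R1 x * indicator {A<..<B} x \<partial>lborel)"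
  proof (rule integral_dominated_convergence[where w = "\<lambda>x. \<bar>R1 x\<bar>"])
    show "AE x in lborel. (\<lambda>n. R1 x * bump n A B x) \<longlonglongrightarrow> R1 x * indicator {A<..<B} x"
      by (intro AE_I2 tendsto_mult tendsto_const bump_tendsto)
    show "AE x in lborel. norm (R1 x * bump n A B x) \<le> \<bar>R1 x\<bar>" for n
      using bump_nonneg[of n A B] bump_le_1[of n A B] by (auto simp: abs_mult mult_left_le)
  qed (use i in auto)
  also have "(\<lambda>n. \<integral>x. R1 x * bump n A B x \<partial>lborel) = (\<lambda>n. \<integral>x. R x * bump n A B x \<partial>lborel)"
  proof (intro ext Bochner_Integration.integral_cong)
    fix n x show "R1 x * bump n A B x = R x * bump n A B x"
      using bump_eq_0[of x A B n] by (cases "x \<in> {A..B}") (auto simp: R1_def)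
  qed simp
  also have "(\<integral>x. R1 x * indicator {A<..<B} x \<partial>lborel) = (\<integral>x. R1 x \<partial>lborel)"
  proof (rule integral_cong_AE)
    show "AE x in lborel. R1 x * indicator {A<..<B} x = R1 x"
      using lborel_AE_neq[of A] lborel_AE_neq[of B] by eventually_elim (auto simp: R1_def indicator_def)
  qed auto
  also have "(\<integral>x. R1 x \<partial>lborel) = (LBINT x:{A..B}. R x)" by (simp add: set_lebesgue_integral_def R1_def)
  finally show ?thesis .
qed

lemma enn2real_inj: "x \<noteq> \<infinity> \<Longrightarrow> y \<noteq> \<infinity> \<Longrightarrow> enn2real x = enn2real y \<Longrightarrow> x = y"
  by (cases x; cases y) auto

text \<open>A test function minus a suitable multiple of a fixed bump has mean 0 and is therefore
  the derivative of a test function. So R and the constant \<open>\<kappa>\<close> agree against all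
  test functions, then over all intervals by letting bumps tend to indicators, and then almost
  everywhere.\<close>

lemma du_Bois_Reymond:
  assumes R: "\<And>a b. set_integrable lborel {a..b} R"
    and zero: "\<And>\<phi>. test1 \<phi> \<Longrightarrow> (\<integral>x. R x * deriv \<phi> x \<partial>lborel) = 0"
  obtains \<kappa> where "AE x in lborel. R x = \<kappa>"
proof -
  define w0 where "w0 = bump 0 0 1"
  have tw0: "test1 w0" unfolding w0_def by (rule test1_bump)
  define c0 where "c0 = (\<integral>x. w0 x \<partial>lborel)"
  have "c0 \<noteq> 0"
  proof
    assume "c0 = 0"
    then have "AE x in lborel. w0 x = 0" unfolding c0_def
      using integral_nonneg_eq_0_iff_AE[OF test1_integrable[OF tw0]] bump_nonneg by (auto simp: w0_def)
    then have "AE x in lborel. x \<notin> {0<..<1::real}"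
      by eventually_elim (use bump_pos[of _ 0 1 0] in \<open>force simp: w0_def\<close>)
    then have "emeasure lborel {0<..<1::real} = 0" by (subst (asm) AE_iff_measurable[of "{0<..<1}"]) auto
    then show False by simp
  qed
  define \<kappa> where "\<kappa> = (\<integral>x. R x * w0 x \<partial>lborel) / c0"
  have Rt: "integrable lborel (\<lambda>x. R x * \<psi> x)" if "test1 \<psi>" for \<psi>
  proof -
    from test1_support[OF that] obtain r where r: "\<And>x. \<bar>x\<bar> \<ge> r \<Longrightarrow> \<psi> x = 0" by metis
    have "set_integrable lborel {-r..r} (\<lambda>x. R x * \<psi> x)"
      by (intro set_integrable_mult_cont R smooth1_continuous test1_smooth that)
    also have "?this \<longleftrightarrow> ?thesis" unfolding set_integrable_def
      using r by (intro arg_cong[of _ _ "integrable lborel"]) (force simp: indicator_def)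
    finally show ?thesis .
  qed
  have key: "(\<integral>x. R x * \<psi> x \<partial>lborel) = \<kappa> * (\<integral>x. \<psi> x \<partial>lborel)" if t: "test1 \<psi>" for \<psi>
  proof -
    define m where "m = (\<integral>x. \<psi> x \<partial>lborel) / c0"
    have t2: "test1 (\<lambda>x. 1 * \<psi> x + (-m) * w0 x)" by (rule test1_lin[OF t tw0])
    have "(\<integral>x. 1 * \<psi> x + (-m) * w0 x \<partial>lborel) = 0"
      using test1_integrable[OF t] test1_integrable[OF tw0] \<open>c0 \<noteq> 0\<close> by (simp add: m_def c0_def)
    from test1_antiderivative[OF t2 this] obtain \<phi> where p: "test1 \<phi>" "deriv \<phi> = (\<lambda>x. 1 * \<psi> x + (-m) * w0 x)" by blast
    have "0 = (\<integral>x. R x * \<psi> x - m * (R x * w0 x) \<partial>lborel)" using zero[OF p(1)] by (simp add: p(2) algebra_simps)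
    also have "\<dots> = (\<integral>x. R x * \<psi> x \<partial>lborel) - m * (\<integral>x. R x * w0 x \<partial>lborel)" using Rt[OF t] Rt[OF tw0] by simp
    finally show ?thesis using \<open>c0 \<noteq> 0\<close> by (simp add: \<kappa>_def m_def)
  qed
  have int0: "(LBINT x:{A..B}. R x) = \<kappa> * (B - A)" if "A \<le> B" for A B
  proof (rule LIMSEQ_unique)
    show "(\<lambda>n. \<integral>x. R x * bump n A B x \<partial>lborel) \<longlonglongrightarrow> (LBINT x:{A..B}. R x)" by (rule bump_integral_tendsto[OF R])
    have "(\<lambda>n. \<integral>x. 1 * bump n A B x \<partial>lborel) \<longlonglongrightarrow> (LBINT x:{A..B}. 1)"
      by (rule bump_integral_tendsto) (intro set_integrable_cont continuous_intros)
    also have "(LBINT x:{A..B}. 1) = B - A" using that by (simp add: set_lebesgue_integral_def)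
    finally have "(\<lambda>n. \<kappa> * (\<integral>x. bump n A B x \<partial>lborel)) \<longlonglongrightarrow> \<kappa> * (B - A)" by (intro tendsto_intros) simp
    then show "(\<lambda>n. \<integral>x. R x * bump n A B x \<partial>lborel) \<longlonglongrightarrow> \<kappa> * (B - A)" using key[OF test1_bump] by simp
  qed
  define g where "g x = R x - \<kappa>" for x
  have [measurable]: "R \<in> borel_measurable borel" using R by (rule locally_integrable_measurable)
  have gi: "set_integrable lborel {a..b} g" for a b unfolding g_def
    by (intro set_integral_diff R set_integrable_cont continuous_intros)
  have g0: "(LBINT x:{a..b}. g x) = 0" if "a \<le> b" for a b
  proof -
    have "(LBINT x:{a..b}. g x) = (LBINT x:{a..b}. R x) - (LBINT x:{a..b}. \<kappa>)" unfolding g_def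
      by (intro set_integral_diff R set_integrable_cont continuous_intros)
    then show ?thesis using int0[OF that] that by (simp add: set_lebesgue_integral_def algebra_simps)
  qed
  have [measurable]: "g \<in> borel_measurable borel" unfolding g_def by measurable
  have g00: "(LBINT x:{a..<b}. g x) = 0" if "a \<le> b" for a b
    using antideriv_Ico[of "\<lambda>x. 0" g a b] gi g0 that unfolding antideriv_def by simp
  \<comment> \<open>\<open>ennreal\<close> maps negative reals to 0, so these are the measures with
    densities the positive and the negative part of g. They agree on intervals since g has integral
    0 there.\<close>
  let ?P = "density lborel (\<lambda>x. ennreal (g x))" and ?N = "density lborel (\<lambda>x. ennreal (- g x))"
  have fin: "emeasure ?P {a..<b} \<noteq> \<infinity> \<and> emeasure ?N {a..<b} \<noteq> \<infinity> \<and> emeasure ?P {a..<b} = emeasure ?N {a..<b}" if "a < b" for a b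
  proof -
    have i: "integrable lborel (\<lambda>x. indicator {a..<b} x *\<^sub>R g x)"
    proof -
      have "{a..<b} \<subseteq> {a..b}" by auto
      then have "set_integrable lborel {a..<b} g" by (rule_tac set_integrable_subset[OF gi[of a b]]) auto
      then show ?thesis unfolding set_integrable_def .
    qed
    have e1: "emeasure ?P {a..<b} = (\<integral>\<^sup>+x. ennreal (indicator {a..<b} x *\<^sub>R g x) \<partial>lborel)"
      by (subst emeasure_density) (auto intro!: nn_integral_cong simp: indicator_def)
    have e2: "emeasure ?N {a..<b} = (\<integral>\<^sup>+x. ennreal (- (indicator {a..<b} x *\<^sub>R g x)) \<partial>lborel)"
      by (subst emeasure_density) (auto intro!: nn_integral_cong simp: indicator_def)
    have f: "(\<integral>\<^sup>+x. ennreal (indicator {a..<b} x *\<^sub>R g x) \<partial>lborel) \<noteq> \<infinity>" "(\<integral>\<^sup>+x. ennreal (- (indicator {a..<b} x *\<^sub>R g x)) \<partial>lborel) \<noteq> \<infinity>"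
      using i unfolding real_integrable_def by auto
    have "enn2real (emeasure ?P {a..<b}) = enn2real (emeasure ?N {a..<b})"
      using real_lebesgue_integral_def[OF i] g00[of a b] that unfolding set_lebesgue_integral_def e1 e2 by simp
    then have "emeasure ?P {a..<b} = emeasure ?N {a..<b}" by (rule enn2real_inj[rotated 2]) (use f e1 e2 in simp_all)
    with f show ?thesis unfolding e1 e2 by simp
  qed
  have PN: "?P = ?N" by (rule measure_eqI_Ico) (use fin in auto)
  have "AE x in lborel. ennreal (g x) = ennreal (- g x)"
    by (rule sigma_finite_measure.density_unique[OF lborel.sigma_finite_measure_axioms _ _ PN]) auto
  then have "AE x in lborel. R x = \<kappa>"
  proof eventually_elim
    case (elim x)
    then have "g x = 0" by (cases "g x \<ge> 0") (auto simp: ennreal_neg ennreal_eq_0_iff)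
    then show ?case by (simp add: g_def)
  qed
  then show thesis by (rule that)
qed

text \<open>The primitive G of f has weak derivative f by integration by parts; the weak derivative
  of F - G is then 0, and F - G is constant almost everywhere by du Bois-Reymond.\<close>

lemma weak_deriv_imp_antideriv:
  assumes w: "weak_deriv F f"
  obtains F0 where "antideriv F0 f" "AE x in lborel. F x = F0 x"
proof -
  have iF: "set_integrable lborel {a..b} F" and jf: "set_integrable lborel {a..b} f" for a b using w unfolding weak_deriv_def by auto
  define G where "G x = (if 0 \<le> x then (LBINT y:{0..x}. f y) else - (LBINT y:{x..0}. f y))" for x
  have aG: "antideriv G f"
  proof -
    have split: "(LBINT y:{a..c}. f y) = (LBINT y:{a..b}. f y) + (LBINT y:{b..c}. f y)" if "a \<le> b" "b \<le> c" for a b c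
    proof -
      have [measurable]: "f \<in> borel_measurable borel" using jf by (rule locally_integrable_measurable)
      have "(LBINT y:{a..c}. f y) = (\<integral>y. indicator {a..b} y *\<^sub>R f y + indicator {b..c} y *\<^sub>R f y \<partial>lborel)"
        unfolding set_lebesgue_integral_def
      proof (rule integral_cong_AE)
        show "AE x in lborel. indicat_real {a..c} x *\<^sub>R f x = indicator {a..b} x *\<^sub>R f x + indicator {b..c} x *\<^sub>R f x"
          using lborel_AE_neq[of b] by eventually_elim (use that in \<open>auto simp: indicator_def\<close>)
      qed measurable
      then show ?thesis using jf[of a b] jf[of b c] unfolding set_lebesgue_integral_def set_integrable_def by simp
    qed
    have "(LBINT x:{a..b}. f x) = G b - G a" if "a \<le> b" for a b
      using split[of a 0 b] split[of 0 a b] split[of a b 0] that by (auto simp: G_def)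
    then show ?thesis unfolding antideriv_def using jf by blast
  qed
  define R where "R x = F x - G x" for x
  have Ri: "set_integrable lborel {a..b} R" for a b unfolding R_def
    by (intro set_integral_diff iF set_integrable_cont antideriv_continuous[OF aG])
  have "(\<integral>x. R x * deriv \<phi> x \<partial>lborel) = 0" if t: "test1 \<phi>" for \<phi>
  proof -
    from test1_support[OF t] obtain r where r: "\<And>x. \<bar>x\<bar> \<ge> r \<Longrightarrow> deriv \<phi> x = 0" by metis
    have "integrable lborel (\<lambda>x. H x * deriv \<phi> x)" if "\<And>a b. set_integrable lborel {a..b} H" for H
    proof -
      have "set_integrable lborel {-r..r} (\<lambda>x. H x * deriv \<phi> x)"
        by (intro set_integrable_mult_cont that smooth1_continuous smooth1_deriv test1_smooth t)
      then show ?thesis unfolding set_integrable_def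
        by (rule back_subst[of "integrable lborel"]) (use r in \<open>force simp: indicator_def\<close>)
    qed
    note i = this
    have "(\<integral>x. R x * deriv \<phi> x \<partial>lborel) = (\<integral>x. F x * deriv \<phi> x \<partial>lborel) - (\<integral>x. G x * deriv \<phi> x \<partial>lborel)"
      unfolding R_def left_diff_distrib
      by (intro Bochner_Integration.integral_diff i iF set_integrable_cont antideriv_continuous[OF aG])
    then show ?thesis using w antideriv_imp_weak_deriv[OF aG] t unfolding weak_deriv_def by simp
  qed
  from du_Bois_Reymond[OF Ri this] obtain \<kappa> where k: "AE x in lborel. R x = \<kappa>" by blast
  show thesis
  proof
    show "antideriv (\<lambda>x. G x + \<kappa>) f" using antideriv_add[OF aG antideriv_const[of \<kappa>]] by simp
    show "AE x in lborel. F x = G x + \<kappa>" using k by eventually_elim (simp add: R_def)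
  qed
qed

lemma AE_eq_continuous_imp_eq:
  fixes f g :: "real \<Rightarrow> real"
  assumes "continuous_on UNIV f" "continuous_on UNIV g" "AE x in lborel. f x = g x"
  shows "f = g"
proof (rule ccontr)
  assume "f \<noteq> g"
  define S where "S = {x. f x \<noteq> g x}"
  have "open S" unfolding S_def by (rule open_Collect_neq[OF assms(1,2)])
  moreover have "S \<noteq> {}" using \<open>f \<noteq> g\<close> by (auto simp: S_def)
  ultimately have "\<not> negligible S" by (rule open_not_negligible)
  moreover have "S \<in> null_sets lborel"
    using assms(3) \<open>open S\<close> by (auto simp: S_def AE_iff_null_sets)
  then have "negligible S" by (simp add: negligible_iff_null_sets null_sets_completionI)
  ultimately show False by blast
qed

lemma weak_deriv_continuous_imp_antideriv:
  assumes "weak_deriv F f" "continuous_on UNIV F" shows "antideriv F f"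
  using weak_deriv_imp_antideriv[OF assms(1)] AE_eq_continuous_imp_eq[OF assms(2)] antideriv_continuous by metis

section \<open>Changing from Lagrangian to Eulerian variables\<close>

lemma set_integrable_Ico: "antideriv F f \<Longrightarrow> set_integrable lborel {a..<b} f"
proof -
  assume "antideriv F f"
  moreover have "{a..<b} \<subseteq> {a..b}" by auto
  ultimately show ?thesis by (rule_tac set_integrable_subset[OF antideriv_integrable]) auto
qed

lemma antideriv_mono:
  assumes "antideriv F f" "\<And>x. 0 \<le> f x" "a \<le> b" shows "F a \<le> F b"
proof -
  have "0 \<le> (LBINT x:{a..b}. f x)" unfolding set_lebesgue_integral_def using assms(2) by simp
  then show ?thesis using antideriv_eq[OF assms(1,3)] by simp
qed

lemma emeasure_density_antideriv:
  assumes "antideriv F f" "\<And>x. 0 \<le> f x" "a \<le> b"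
  shows "emeasure (density lborel (\<lambda>x. ennreal (f x))) {a..<b} = ennreal (F b - F a)"
proof -
  have [measurable]: "f \<in> borel_measurable borel" using assms(1) by (rule antideriv_measurable)
  have "emeasure (density lborel (\<lambda>x. ennreal (f x))) {a..<b} = (\<integral>\<^sup>+x. ennreal (indicator {a..<b} x *\<^sub>R f x) \<partial>lborel)"
    by (subst emeasure_density) (auto intro!: nn_integral_cong simp: indicator_def)
  also have "\<dots> = ennreal (LBINT x:{a..<b}. f x)" unfolding set_lebesgue_integral_def
    by (rule nn_integral_eq_integral) (use set_integrable_Ico[OF assms(1)] assms(2) in \<open>auto simp: set_integrable_def\<close>)
  finally show ?thesis using antideriv_Ico[OF assms(1,3)] by simp
qed

lemma antideriv_of_integrable:
  assumes "integrable lborel f" shows "antideriv (\<lambda>x. \<integral>z. indicator {..<x} z * f z \<partial>lborel) f"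
  unfolding antideriv_def
proof (intro allI impI)
  fix a b :: real assume ab: "a \<le> b"
  have [measurable]: "f \<in> borel_measurable borel" using assms by (auto dest: borel_measurable_integrable)
  have i: "integrable lborel (\<lambda>z. indicator A z * f z)" if "A \<in> sets borel" for A
    using integrable_mult_indicator[OF _ assms, of A] that by simp
  have "(\<integral>z. indicator {..<b} z * f z \<partial>lborel) - (\<integral>z. indicator {..<a} z * f z \<partial>lborel) = (\<integral>z. indicator {..<b} z * f z - indicator {..<a} z * f z \<partial>lborel)"
    by (rule Bochner_Integration.integral_diff[symmetric]) (auto intro: i)
  also have "\<dots> = (LBINT x:{a..b}. f x)" unfolding set_lebesgue_integral_def
  proof (rule integral_cong_AE)
    show "AE z in lborel. indicator {..<b} z * f z - indicator {..<a} z * f z = indicator {a..b} z *\<^sub>R f z"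
      using lborel_AE_neq[of b] by eventually_elim (use ab in \<open>auto simp: indicator_def\<close>)
  qed measurable
  finally show "set_integrable lborel {a..b} f \<and> (LBINT x:{a..b}. f x) = (\<integral>z. indicator {..<b} z * f z \<partial>lborel) - (\<integral>z. indicator {..<a} z * f z \<partial>lborel)"
    using i[of "{a..b}"] unfolding set_integrable_def by simp
qed

text \<open>Here \<open>\<alpha> = y_\<xi>\<close>, \<open>\<beta> = U_\<xi>\<close>, and \<open>\<gamma>\<close> is the energy density with respect to \<open>\<xi>\<close>; the relation
  \<open>\<beta>\<^sup>2 = \<alpha> \<gamma>\<close> encodes that the absolutely continuous part of the energy is \<open>u_x\<^sup>2 dx\<close>.\<close>
locale chart =
  fixes \<alpha> \<beta> \<gamma> y U :: "real \<Rightarrow> real" and K :: real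
  assumes \<alpha>_nonneg: "\<And>x. 0 \<le> \<alpha> x" and \<gamma>_nonneg: "\<And>x. 0 \<le> \<gamma> x"
    and sq: "\<And>x. (\<beta> x)\<^sup>2 = \<alpha> x * \<gamma> x"
    and y_ad: "antideriv y \<alpha>" and U_ad: "antideriv U \<beta>" and \<gamma>_int: "integrable lborel \<gamma>"
    and near: "\<And>x. \<bar>y x - x\<bar> \<le> K"
begin

text \<open>The leftmost label of x. With this choice \<open>\<xi> < inv x\<close> holds exactly
  when \<open>y \<xi> < x\<close>, so the energy of {..<x} is \<open>H (inv x)\<close> even if x is
  an atom.\<close>

definition inv :: "real \<Rightarrow> real" where "inv x = Inf {\<xi>. x \<le> y \<xi>}"

definition mu :: "real measure" where "mu = distr (density lborel (\<lambda>\<xi>. ennreal (\<gamma> \<xi>))) borel y"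

definition H :: "real \<Rightarrow> real" where "H x = (\<integral>z. indicator {..<x} z * \<gamma> z \<partial>lborel)"

text \<open>The Eulerian slope of the velocity by the chain rule. Where \<open>\<alpha>\<close>
  vanishes the division returns 0, which affects only the null set \<open>N0\<close>.\<close>

definition v :: "real \<Rightarrow> real" where "v x = \<beta> (inv x) / \<alpha> (inv x)"

definition u :: "real \<Rightarrow> real" where "u x = U (inv x)"

text \<open>The images of the intervals on which \<open>y\<close> is constant; there are countably many.\<close>
definition D :: "real set" where "D = {x. \<exists>\<xi>. y \<xi> = x \<and> inv x \<noteq> \<xi>}"

lemma y_mono: "a \<le> b \<Longrightarrow> y a \<le> y b"
  using antideriv_mono[OF y_ad \<alpha>_nonneg] .

lemma y_cont: "continuous_on S y"
  using antideriv_continuous[OF y_ad] continuous_on_subset by blast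

text \<open>The set of labels with \<open>x \<le> y \<xi>\<close> is closed because \<open>y\<close>
  is continuous, and it is nonempty and bounded below because \<open>y\<close> stays within K of the
  identity. So its infimum is attained, and monotonicity gives the equivalence.\<close>

lemma galois: "inv x \<le> \<xi> \<longleftrightarrow> x \<le> y \<xi>"
proof -
  let ?S = "{\<xi>. x \<le> y \<xi>}"
  have cl: "closed ?S" by (intro closed_Collect_le continuous_intros y_cont)
  have ne: "x + K \<in> ?S" using near[of "x + K"] by auto
  have bb: "bdd_below ?S"
  proof (rule bdd_belowI)
    fix \<xi> assume "\<xi> \<in> ?S" then show "x - K \<le> \<xi>" using near[of \<xi>] by auto
  qed
  have "inv x \<in> ?S" unfolding inv_def using closed_contains_Inf[OF _ bb cl] ne by blast
  then show ?thesis using y_mono[of "inv x" \<xi>] cInf_lower[OF _ bb, of \<xi>] unfolding inv_def[symmetric] by auto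
qed

lemma y_inv: "y (inv x) = x"
proof -
  have "\<exists>\<xi>\<ge>x - K. \<xi> \<le> x + K \<and> y \<xi> = x"
    by (rule IVT') (use near[of "x - K"] near[of "x + K"] y_cont in \<open>auto\<close>)
  then obtain \<xi> where "y \<xi> = x" by blast
  then show ?thesis using galois[of x \<xi>] galois[of x "inv x"] y_mono[of "inv x" \<xi>] by simp
qed

lemma inv_less: "\<xi> < inv x \<longleftrightarrow> y \<xi> < x" using galois[of x \<xi>] by linarith

lemma inv_mono: "a \<le> b \<Longrightarrow> inv a \<le> inv b"
  using galois[of a "inv b"] y_inv[of b] by simp

lemma measurables [measurable]:
  "y \<in> borel_measurable borel" "\<alpha> \<in> borel_measurable borel" "\<beta> \<in> borel_measurable borel" "\<gamma> \<in> borel_measurable borel"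
  "U \<in> borel_measurable borel" "inv \<in> borel_measurable borel"
proof -
  show "y \<in> borel_measurable borel" by (rule borel_measurable_continuous_onI[OF y_cont])
  show "\<alpha> \<in> borel_measurable borel" by (rule antideriv_measurable[OF y_ad])
  show "\<beta> \<in> borel_measurable borel" by (rule antideriv_measurable[OF U_ad])
  show "\<gamma> \<in> borel_measurable borel" using borel_measurable_integrable[OF \<gamma>_int] by simp
  show "U \<in> borel_measurable borel" by (rule borel_measurable_continuous_onI[OF antideriv_continuous[OF U_ad]])
  show "inv \<in> borel_measurable borel" by (rule borel_measurable_mono) (rule monoI, rule inv_mono)
qed

lemma v_measurable [measurable]: "v \<in> borel_measurable borel"
  unfolding v_def[abs_def] by measurable

text \<open>The area formula for the monotone map \<open>y\<close>. All substitutions between x and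
  \<open>\<xi>\<close> are read off from this one identity of measures.\<close>

lemma distr_lborel: "distr (density lborel (\<lambda>\<xi>. ennreal (\<alpha> \<xi>))) borel y = lborel"
proof (rule measure_eqI_Ico)
  fix a b :: real assume "a < b"
  have "y -` {a..<b} = {inv a..<inv b}" using galois inv_less by auto
  then have "emeasure (distr (density lborel (\<lambda>\<xi>. ennreal (\<alpha> \<xi>))) borel y) {a..<b} = emeasure (density lborel (\<lambda>\<xi>. ennreal (\<alpha> \<xi>))) {inv a..<inv b}"
    by (subst emeasure_distr) auto
  also have "\<dots> = ennreal (y (inv b) - y (inv a))"
    by (rule emeasure_density_antideriv[OF y_ad \<alpha>_nonneg]) (use inv_mono \<open>a < b\<close> in simp)
  finally have *: "emeasure (distr (density lborel (\<lambda>\<xi>. ennreal (\<alpha> \<xi>))) borel y) {a..<b} = ennreal (b - a)" by (simp add: y_inv)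
  show "emeasure (distr (density lborel (\<lambda>\<xi>. ennreal (\<alpha> \<xi>))) borel y) {a..<b} = emeasure lborel {a..<b}"
    using * \<open>a < b\<close> by simp
  show "emeasure (distr (density lborel (\<lambda>\<xi>. ennreal (\<alpha> \<xi>))) borel y) {a..<b} \<noteq> \<infinity>" using * by simp
qed auto

lemma nn_change:
  assumes [measurable]: "g \<in> borel_measurable borel"
  shows "(\<integral>\<^sup>+x. g x \<partial>lborel) = (\<integral>\<^sup>+\<xi>. ennreal (\<alpha> \<xi>) * g (y \<xi>) \<partial>lborel)"
proof -
  have "(\<integral>\<^sup>+x. g x \<partial>lborel) = (\<integral>\<^sup>+x. g x \<partial>distr (density lborel (\<lambda>\<xi>. ennreal (\<alpha> \<xi>))) borel y)"
    by (simp only: distr_lborel)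
  also have "\<dots> = (\<integral>\<^sup>+\<xi>. g (y \<xi>) \<partial>density lborel (\<lambda>\<xi>. ennreal (\<alpha> \<xi>)))"
    by (rule nn_integral_distr) measurable
  also have "\<dots> = (\<integral>\<^sup>+\<xi>. ennreal (\<alpha> \<xi>) * g (y \<xi>) \<partial>lborel)"
    by (rule nn_integral_density) measurable
  finally show ?thesis .
qed

lemma integral_change:
  fixes g :: "real \<Rightarrow> real"
  assumes [measurable]: "g \<in> borel_measurable borel"
  shows "(\<integral>x. g x \<partial>lborel) = (\<integral>\<xi>. \<alpha> \<xi> * g (y \<xi>) \<partial>lborel)"
proof -
  have "(\<integral>x. g x \<partial>lborel) = (\<integral>x. g x \<partial>distr (density lborel (\<lambda>\<xi>. ennreal (\<alpha> \<xi>))) borel y)"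
    by (simp only: distr_lborel)
  also have "\<dots> = (\<integral>\<xi>. g (y \<xi>) \<partial>density lborel (\<lambda>\<xi>. ennreal (\<alpha> \<xi>)))"
    by (rule integral_distr) measurable
  also have "\<dots> = (\<integral>\<xi>. \<alpha> \<xi> *\<^sub>R g (y \<xi>) \<partial>lborel)"
    by (rule integral_density) (use \<alpha>_nonneg in simp_all)
  finally show ?thesis by simp
qed

lemma integrable_change:
  fixes g :: "real \<Rightarrow> real"
  assumes [measurable]: "g \<in> borel_measurable borel"
  shows "integrable lborel g \<longleftrightarrow> integrable lborel (\<lambda>\<xi>. \<alpha> \<xi> * g (y \<xi>))"
proof -
  have "integrable lborel g \<longleftrightarrow> integrable (distr (density lborel (\<lambda>\<xi>. ennreal (\<alpha> \<xi>))) borel y) g"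
    by (simp only: distr_lborel)
  also have "\<dots> \<longleftrightarrow> integrable (density lborel (\<lambda>\<xi>. ennreal (\<alpha> \<xi>))) (\<lambda>\<xi>. g (y \<xi>))"
    by (rule integrable_distr_eq) measurable
  also have "\<dots> \<longleftrightarrow> integrable lborel (\<lambda>\<xi>. \<alpha> \<xi> *\<^sub>R g (y \<xi>))"
    by (rule integrable_density) (use \<alpha>_nonneg in simp_all)
  finally show ?thesis by simp
qed

text \<open>A null set in x pulls back to a null set of the measure \<open>\<alpha>\<close> d\<xi>,
  not of d\<xi>. The exceptional labels with \<open>\<alpha> \<xi> = 0\<close> are harmless wherever
  the integrand carries the factor \<open>\<alpha>\<close>.\<close>

lemma AE_change: "AE x in lborel. P x \<Longrightarrow> AE \<xi> in lborel. \<alpha> \<xi> = 0 \<or> P (y \<xi>)"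
proof -
  assume "AE x in lborel. P x"
  then have "AE x in distr (density lborel (\<lambda>\<xi>. ennreal (\<alpha> \<xi>))) borel y. P x" by (subst distr_lborel)
  then have "AE \<xi> in density lborel (\<lambda>\<xi>. ennreal (\<alpha> \<xi>)). P (y \<xi>)" by (rule AE_distrD[rotated]) auto
  then have "AE \<xi> in lborel. 0 < ennreal (\<alpha> \<xi>) \<longrightarrow> P (y \<xi>)" by (subst (asm) AE_density) auto
  then show ?thesis by eventually_elim (use \<alpha>_nonneg in \<open>force simp: less_le\<close>)
qed

lemma sets_mu [simp, measurable_cong]: "sets mu = sets borel" by (simp add: mu_def)
lemma space_mu [simp]: "space mu = UNIV" by (simp add: mu_def)

lemma integral_mu:
  fixes g :: "real \<Rightarrow> real"
  assumes [measurable]: "g \<in> borel_measurable borel"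
  shows "(\<integral>x. g x \<partial>mu) = (\<integral>\<xi>. \<gamma> \<xi> * g (y \<xi>) \<partial>lborel)"
proof -
  have "(\<integral>x. g x \<partial>mu) = (\<integral>\<xi>. g (y \<xi>) \<partial>density lborel (\<lambda>\<xi>. ennreal (\<gamma> \<xi>)))"
    unfolding mu_def by (rule integral_distr) measurable
  also have "\<dots> = (\<integral>\<xi>. \<gamma> \<xi> *\<^sub>R g (y \<xi>) \<partial>lborel)"
    by (rule integral_density) (use \<gamma>_nonneg in simp_all)
  finally show ?thesis by simp
qed

lemma emeasure_mu: "A \<in> sets borel \<Longrightarrow> emeasure mu A = (\<integral>\<^sup>+\<xi>. ennreal (\<gamma> \<xi>) * indicator A (y \<xi>) \<partial>lborel)"
proof -
  assume [measurable]: "A \<in> sets borel"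
  have "emeasure mu A = (\<integral>\<^sup>+x. indicator A x \<partial>mu)" by simp
  also have "\<dots> = (\<integral>\<^sup>+\<xi>. ennreal (\<gamma> \<xi>) * indicator A (y \<xi>) \<partial>lborel)"
    unfolding mu_def by (subst nn_integral_distr) (simp_all add: nn_integral_density)
  finally show ?thesis .
qed

lemma measure_mu: "A \<in> sets borel \<Longrightarrow> measure mu A = (\<integral>\<xi>. \<gamma> \<xi> * indicator A (y \<xi>) \<partial>lborel)"
  using integral_mu[of "indicator A"] by simp

lemma finite_mu: "finite_measure mu"
proof (rule finite_measureI)
  have "emeasure mu (space mu) = ennreal (\<integral>\<xi>. \<gamma> \<xi> \<partial>lborel)"
    by (subst emeasure_mu) (auto intro!: nn_integral_eq_integral \<gamma>_int \<gamma>_nonneg)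
  then show "emeasure mu (space mu) \<noteq> \<infinity>" by simp
qed

text \<open>Over a point of \<open>D\<close> the map \<open>y\<close> is constant on a nondegenerate
  interval starting at the leftmost label, and this interval contains a rational label with the same
  image.\<close>

lemma D_countable: "countable D"
proof (rule countable_subset)
  show "D \<subseteq> y ` \<rat>"
  proof
    fix x assume "x \<in> D"
    then obtain \<xi> where x: "y \<xi> = x" "inv x \<noteq> \<xi>" by (auto simp: D_def)
    then have "inv x < \<xi>" using galois[of x \<xi>] by simp
    from Rats_dense_in_real[OF this] obtain q where q: "q \<in> \<rat>" "inv x < q" "q < \<xi>" by blast
    then have "y q = x" using y_mono[of "inv x" q] y_mono[of q \<xi>] x y_inv[of x] by simp
    then show "x \<in> y ` \<rat>" using q by blast
  qed
qed (simp add: countable_rat)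

lemma D_null: "D \<in> null_sets lborel" using D_countable by (rule countable_imp_null_set_lborel)

lemma AE_not_D: "AE x in lborel. x \<notin> D" by (rule AE_not_in[OF D_null])

lemma inv_y: "y \<xi> \<notin> D \<Longrightarrow> inv (y \<xi>) = \<xi>" by (auto simp: D_def)

lemma \<beta>_0: "\<alpha> \<xi> = 0 \<Longrightarrow> \<beta> \<xi> = 0" using sq[of \<xi>] by simp

text \<open>The null set on which the singular part of \<open>mu\<close> lives: points whose
  leftmost label has slope 0, together with the images of plateaus.\<close>

definition N0 :: "real set" where "N0 = {x. \<alpha> (inv x) = 0} \<union> D"

lemma N0_null: "N0 \<in> null_sets lborel"
proof -
  have [measurable]: "D \<in> sets borel" using D_null by auto
  have "AE \<xi> in lborel. \<alpha> \<xi> = 0 \<or> y \<xi> \<notin> N0"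
    using AE_change[OF AE_not_D] by eventually_elim (auto simp: N0_def inv_y)
  then have *: "AE \<xi> in lborel. ennreal (\<alpha> \<xi>) * indicator N0 (y \<xi>) = 0"
    by eventually_elim auto
  have [measurable]: "N0 \<in> sets borel" unfolding N0_def by measurable
  have "emeasure lborel N0 = (\<integral>\<^sup>+\<xi>. ennreal (\<alpha> \<xi>) * indicator N0 (y \<xi>) \<partial>lborel)"
    using nn_change[of "indicator N0"] by simp
  also have "\<dots> = 0" using nn_integral_cong_AE[OF *] by simp
  finally show ?thesis by (simp add: null_sets_def)
qed

text \<open>In labels the integrand is \<open>\<alpha>\<close> v^2 = \<open>\<beta>\<close> squared
  over \<open>\<alpha>\<close>, which is \<open>\<gamma>\<close> by the relation \<open>sq\<close>
  as long as \<open>\<alpha>\<close> is nonzero. Labels with \<open>\<alpha>\<close> = 0 are sent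
  into \<open>N0\<close>, so the measure on the left is \<open>mu\<close> without what sits on
  \<open>N0\<close>.\<close>

lemma v_sq: 
  assumes [measurable]: "A \<in> sets borel"
  shows "(\<integral>\<^sup>+x\<in>A. ennreal ((v x)\<^sup>2) \<partial>lborel) = emeasure mu (A - N0)"
proof -
  have [measurable]: "N0 \<in> sets borel" using N0_null by auto
  have "(\<integral>\<^sup>+x\<in>A. ennreal ((v x)\<^sup>2) \<partial>lborel) = (\<integral>\<^sup>+\<xi>. ennreal (\<alpha> \<xi>) * (ennreal ((v (y \<xi>))\<^sup>2) * indicator A (y \<xi>)) \<partial>lborel)"
    by (subst nn_change) auto
  also have "\<dots> = (\<integral>\<^sup>+\<xi>. ennreal (\<gamma> \<xi>) * indicator (A - N0) (y \<xi>) \<partial>lborel)"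
  proof (rule nn_integral_cong_AE)
    show "AE \<xi> in lborel. ennreal (\<alpha> \<xi>) * (ennreal ((v (y \<xi>))\<^sup>2) * indicator A (y \<xi>)) = ennreal (\<gamma> \<xi>) * indicator (A - N0) (y \<xi>)"
      using AE_change[OF AE_not_D]
    proof eventually_elim
      case (elim \<xi>)
      show ?case
      proof (cases "\<alpha> \<xi> = 0")
        case True
        then have "y \<xi> \<in> N0" by (auto simp: N0_def D_def)
        with True show ?thesis by simp
      next
        case False
        with elim have nD: "y \<xi> \<notin> D" by simp
        with False have nN: "y \<xi> \<notin> N0" by (simp add: N0_def inv_y)
        have "\<alpha> \<xi> * (v (y \<xi>))\<^sup>2 = \<gamma> \<xi>"
          using False sq[of \<xi>] nD by (simp add: v_def inv_y power_divide) (simp add: power2_eq_square)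
        then have "ennreal (\<alpha> \<xi>) * ennreal ((v (y \<xi>))\<^sup>2) = ennreal (\<gamma> \<xi>)" by (simp add: ennreal_mult[symmetric] \<alpha>_nonneg)
        then show ?thesis using nN by (simp add: mult.assoc[symmetric] indicator_def)
      qed
    qed
  qed
  also have "\<dots> = emeasure mu (A - N0)" by (subst emeasure_mu) auto
  finally show ?thesis .
qed

lemma mu_ac: "ac_part_density mu (\<lambda>x. (v x)\<^sup>2)"
  unfolding ac_part_density_def by (intro bexI[OF _ N0_null] ballI v_sq[symmetric])

lemma H_ad: "antideriv H \<gamma>" unfolding H_def[abs_def] by (rule antideriv_of_integrable[OF \<gamma>_int])

text \<open>By Cauchy-Schwarz the squared increment of \<open>U\<close> is at most the increment of
  \<open>y\<close> times that of \<open>H\<close>, so \<open>U\<close> is constant on plateaus of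
  \<open>y\<close>. Hence the velocity at a position does not depend on the label chosen for
  it.\<close>

lemma U_y: assumes "y a = y b" shows "U a = U b"
proof -
  have *: "U a = U b" if "y a = y b" "a \<le> b" for a b
  proof -
    have "(U b - U a)\<^sup>2 \<le> (y b - y a) * (H b - H a)"
      by (rule antideriv_Cauchy_Schwarz[OF U_ad y_ad H_ad]) (use that \<alpha>_nonneg \<gamma>_nonneg sq in auto)
    then show ?thesis using that by simp
  qed
  show ?thesis
  proof (cases "a \<le> b")
    case True then show ?thesis by (rule *[OF assms])
  next
    case False then have "U b = U a" by (intro *[OF assms[symmetric]]) simp
    then show ?thesis by (rule sym)
  qed
qed

lemma u_y: "u (y \<xi>) = U \<xi>"
  unfolding u_def by (rule U_y) (rule y_inv)

lemma v_y: "AE \<xi> in lborel. \<alpha> \<xi> * v (y \<xi>) = \<beta> \<xi>"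
  using AE_change[OF AE_not_D] 
proof eventually_elim
  case (elim \<xi>)
  show ?case
  proof (cases "\<alpha> \<xi> = 0")
    case True then show ?thesis using \<beta>_0[OF True] by simp
  next
    case False
    with elim have "inv (y \<xi>) = \<xi>" by (intro inv_y) simp
    with False show ?thesis by (simp add: v_def)
  qed
qed

lemma u_ad: "antideriv u v"
proof -
  have main: "integrable lborel (\<lambda>x. indicator {a..<b} x * v x) \<and> (\<integral>x. indicator {a..<b} x * v x \<partial>lborel) = u b - u a" if "a \<le> b" for a b
  proof -
    have e: "AE \<xi> in lborel. \<alpha> \<xi> * (indicator {a..<b} (y \<xi>) * v (y \<xi>)) = indicator {inv a..<inv b} \<xi> *\<^sub>R \<beta> \<xi>"
      using v_y by eventually_elim (auto simp: indicator_def galois inv_less)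
    have i: "integrable lborel (\<lambda>\<xi>. indicator {inv a..<inv b} \<xi> *\<^sub>R \<beta> \<xi>)"
      using set_integrable_Ico[OF U_ad] unfolding set_integrable_def .
    have "integrable lborel (\<lambda>x. indicator {a..<b} x * v x)"
      by (subst integrable_change, measurable, subst integrable_cong_AE[OF _ _ e]) (use i in auto)
    moreover have "(\<integral>x. indicator {a..<b} x * v x \<partial>lborel) = (LBINT \<xi>:{inv a..<inv b}. \<beta> \<xi>)"
      unfolding set_lebesgue_integral_def by (subst integral_change, measurable, rule integral_cong_AE[OF _ _ e]) auto
    moreover have "(LBINT \<xi>:{inv a..<inv b}. \<beta> \<xi>) = U (inv b) - U (inv a)"
      by (rule antideriv_Ico[OF U_ad inv_mono[OF that]])
    ultimately show ?thesis by (simp add: u_def)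
  qed
  have e: "AE x in lborel. indicator {a..<b} x * v x = indicator {a..b} x *\<^sub>R v x" for a b
    using lborel_AE_neq[of b] by eventually_elim (auto simp: indicator_def)
  show ?thesis unfolding antideriv_def
  proof (intro allI impI)
    fix a b :: real assume ab: "a \<le> b"
    have "integrable lborel (\<lambda>x. indicator {a..<b} x * v x) = set_integrable lborel {a..b} v"
      unfolding set_integrable_def by (rule integrable_cong_AE[OF _ _ e]) auto
    moreover have "(\<integral>x. indicator {a..<b} x * v x \<partial>lborel) = (LBINT x:{a..b}. v x)"
      unfolding set_lebesgue_integral_def by (rule integral_cong_AE[OF _ _ e]) auto
    ultimately show "set_integrable lborel {a..b} v \<and> (LBINT x:{a..b}. v x) = u b - u a" using main[OF ab] by simp
  qed
qed

lemma mu_lessThan: "measure mu {..<x} = H (inv x)"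
proof -
  have "measure mu {..<x} = (\<integral>\<xi>. \<gamma> \<xi> * indicator {..<x} (y \<xi>) \<partial>lborel)" by (rule measure_mu) simp
  also have "\<dots> = H (inv x)" unfolding H_def
    by (rule Bochner_Integration.integral_cong) (auto simp: indicator_def inv_less)
  finally show ?thesis .
qed

text \<open>The plateau over a point of \<open>D\<close> may carry energy. This energy is then an
  atom at x, which belongs to neither of the two open half-lines, and the formula would be off by
  its mass.\<close>

lemma mu_greaterThan: 
  assumes "x \<notin> D" shows "measure mu {x<..} = (\<integral>\<xi>. \<gamma> \<xi> \<partial>lborel) - H (inv x)"
proof -
  have i: "integrable lborel (\<lambda>z. indicator A z * \<gamma> z)" if "A \<in> sets borel" for A
    using integrable_mult_indicator[OF _ \<gamma>_int, of A] that by simp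
  have "measure mu {x<..} = (\<integral>\<xi>. \<gamma> \<xi> - indicator {..<inv x} \<xi> * \<gamma> \<xi> \<partial>lborel)"
  proof (subst measure_mu, simp, rule integral_cong_AE)
    have "x < y \<xi> \<longleftrightarrow> \<not> \<xi> < inv x" if "\<xi> \<noteq> inv x" for \<xi>
    proof -
      have "y \<xi> \<noteq> x" using that inv_y[of \<xi>] assms by auto
      then show ?thesis using inv_less[of \<xi> x] by linarith
    qed
    then show "AE \<xi> in lborel. \<gamma> \<xi> * indicator {x<..} (y \<xi>) = \<gamma> \<xi> - indicator {..<inv x} \<xi> * \<gamma> \<xi>"
      using lborel_AE_neq[of "inv x"] by (elim eventually_mono) (auto simp: indicator_def)
  qed auto
  also have "\<dots> = (\<integral>\<xi>. \<gamma> \<xi> \<partial>lborel) - H (inv x)" unfolding H_def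
    by (rule Bochner_Integration.integral_diff) (auto intro: \<gamma>_int i)
  finally show ?thesis .
qed

lemma mu_Ico: assumes "a \<le> b" shows "measure mu {a..<b} = H (inv b) - H (inv a)"
proof -
  interpret finite_measure mu by (rule finite_mu)
  have "{a..<b} = {..<b} - {..<a}" by auto
  then show ?thesis using finite_measure_Diff[of "{..<b}" "{..<a}"] assms by (simp add: mu_lessThan)
qed

lemma u_holder: assumes "a \<le> b" shows "(u b - u a)\<^sup>2 \<le> (b - a) * measure mu {a..<b}"
proof -
  have "(U (inv b) - U (inv a))\<^sup>2 \<le> (y (inv b) - y (inv a)) * (H (inv b) - H (inv a))"
    by (rule antideriv_Cauchy_Schwarz[OF U_ad y_ad H_ad]) (use assms inv_mono \<alpha>_nonneg \<gamma>_nonneg sq in auto)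
  then show ?thesis by (simp add: y_inv u_def mu_Ico[OF assms])
qed

text \<open>If the slope vanishes for almost no label, d\<xi> is absolutely continuous with respect
  to \<open>\<alpha>\<close> d\<xi>, so the preimage of \<open>N0\<close> is null and
  \<open>mu\<close> has no singular part.\<close>

lemma mu_eq_density: 
  assumes "AE \<xi> in lborel. \<alpha> \<xi> \<noteq> 0"
  shows "mu = density lborel (\<lambda>x. ennreal ((v x)\<^sup>2))"
proof (rule measure_eqI)
  fix A assume "A \<in> sets mu"
  then have [measurable]: "A \<in> sets borel" by simp
  have [measurable]: "N0 \<in> sets borel" using N0_null by auto
  have "emeasure mu A = emeasure mu (A - N0)"
  proof (subst (1 2) emeasure_mu)
    show "(\<integral>\<^sup>+\<xi>. ennreal (\<gamma> \<xi>) * indicator A (y \<xi>) \<partial>lborel) = (\<integral>\<^sup>+\<xi>. ennreal (\<gamma> \<xi>) * indicator (A - N0) (y \<xi>) \<partial>lborel)"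
    proof (rule nn_integral_cong_AE)
      show "AE \<xi> in lborel. ennreal (\<gamma> \<xi>) * indicator A (y \<xi>) = ennreal (\<gamma> \<xi>) * indicator (A - N0) (y \<xi>)"
        using assms AE_change[OF AE_not_in[OF N0_null]] by eventually_elim (simp add: indicator_def)
    qed
  qed measurable
  then show "emeasure mu A = emeasure (density lborel (\<lambda>x. ennreal ((v x)\<^sup>2))) A"
    using v_sq[of A] by (simp add: emeasure_density)
qed simp

end

section \<open>Square-integrable functions and the asymptotic parts spanned by \<open>psp\<close>
  and \<open>psm\<close>\<close>

lemma L2_add: "L2 f \<Longrightarrow> L2 g \<Longrightarrow> L2 (\<lambda>x. f x + g x)"
  unfolding L2_def
proof safe
  assume [measurable]: "f \<in> borel_measurable borel" "g \<in> borel_measurable borel"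
    and i: "integrable lborel (\<lambda>x. (f x)\<^sup>2)" "integrable lborel (\<lambda>x. (g x)\<^sup>2)"
  show "integrable lborel (\<lambda>x. (f x + g x)\<^sup>2)"
  proof (rule Bochner_Integration.integrable_bound)
    show "integrable lborel (\<lambda>x. 2 * (f x)\<^sup>2 + 2 * (g x)\<^sup>2)" using i by simp
    show "AE x in lborel. norm ((f x + g x)\<^sup>2) \<le> norm (2 * (f x)\<^sup>2 + 2 * (g x)\<^sup>2)"
    proof (rule AE_I2)
      fix x have "0 \<le> (f x - g x)\<^sup>2" by simp
      then have "(f x + g x)\<^sup>2 \<le> 2 * (f x)\<^sup>2 + 2 * (g x)\<^sup>2" by (simp add: power2_sum power2_diff)
      then show "norm ((f x + g x)\<^sup>2) \<le> norm (2 * (f x)\<^sup>2 + 2 * (g x)\<^sup>2)" by simp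
    qed
  qed measurable
qed simp

lemma L2_cmult: "L2 f \<Longrightarrow> L2 (\<lambda>x. c * f x)"
  unfolding L2_def by (auto simp: power_mult_distrib)

lemma L2_diff: "L2 f \<Longrightarrow> L2 g \<Longrightarrow> L2 (\<lambda>x. f x - g x)"
  using L2_add[of f "\<lambda>x. -1 * g x"] L2_cmult[of g "-1"] by simp

lemma L2_bounded_support:
  assumes [measurable]: "f \<in> borel_measurable borel" and "\<And>x. \<bar>f x\<bar> \<le> c" "\<And>x. \<bar>x\<bar> > R \<Longrightarrow> f x = 0"
  shows "L2 f"
  unfolding L2_def
proof safe
  show "integrable lborel (\<lambda>x. (f x)\<^sup>2)"
  proof (rule Bochner_Integration.integrable_bound)
    show "integrable lborel (\<lambda>x. indicator {-R..R} x * c\<^sup>2)"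
      by (intro integrable_mult_left integrable_real_indicator) (auto simp: emeasure_lborel_Icc_eq)
    show "AE x in lborel. norm ((f x)\<^sup>2) \<le> norm (indicator {-R..R} x * c\<^sup>2)"
    proof (rule AE_I2)
      fix x
      have "\<bar>f x\<bar> \<le> \<bar>c\<bar>" using assms(2)[of x] by linarith
      then have f: "(f x)\<^sup>2 \<le> c\<^sup>2" by (simp only: abs_le_square_iff)
      show "norm ((f x)\<^sup>2) \<le> norm (indicator {-R..R} x * c\<^sup>2)"
      proof (cases "\<bar>x\<bar> \<le> R")
        case True
        then have "x \<in> {-R..R}" by auto
        then show ?thesis using f by simp
      next
        case False
        then show ?thesis using assms(3)[of x] by simp
      qed
    qed
  qed measurable
qed simp

lemma L2_AE_bound:
  assumes "L2 g" "f \<in> borel_measurable borel" "\<And>x. \<bar>f x\<bar> \<le> \<bar>g x\<bar>" shows "L2 f"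
proof -
  have [measurable]: "f \<in> borel_measurable borel" by (rule assms(2))
  have "integrable lborel (\<lambda>x. (g x)\<^sup>2)" using assms(1) unfolding L2_def by blast
  then have "integrable lborel (\<lambda>x. (f x)\<^sup>2)"
  proof (rule Bochner_Integration.integrable_bound)
    show "AE x in lborel. norm ((f x)\<^sup>2) \<le> norm ((g x)\<^sup>2)"
      using assms(3) by (intro AE_I2) (simp add: abs_le_square_iff[symmetric])
  qed measurable
  then show ?thesis unfolding L2_def using assms(2) by blast
qed

lemma ennreal_eq_top_of_nat_le: "(\<And>n. ennreal (real n) \<le> x) \<Longrightarrow> x = \<infinity>"
proof (cases x)
  case (real r)
  assume le: "\<And>n. ennreal (real n) \<le> x"
  obtain n where "r < real n" using reals_Archimedean2 by blast
  moreover have "real n \<le> r" using le[of n] real by simp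
  ultimately show ?thesis by simp
qed simp

locale psi =
  fixes psp psm :: "real \<Rightarrow> real"
  assumes psi_pair: "psi_pair psp psm"
begin

lemma psm_eq: "psm x = 1 - psp x" using psi_pair unfolding psi_pair_def by (metis add_diff_cancel_left')

lemma psp_bounds: "0 \<le> psp x" "psp x \<le> 1" using psi_pair unfolding psi_pair_def by auto

lemma psp_smooth: "smooth1 psp" and psm_smooth: "smooth1 psm" using psi_pair unfolding psi_pair_def by auto

lemma psp_right: "1 \<le> x \<Longrightarrow> psp x = 1"
proof -
  assume "1 \<le> x"
  then have "x \<notin> closure {x. psm x \<noteq> 0}" using psi_pair unfolding psi_pair_def by force
  then have "psm x = 0" using closure_subset[of "{x. psm x \<noteq> 0}"] by auto
  then show ?thesis by (simp add: psm_eq)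
qed

lemma psp_left: "x \<le> -1 \<Longrightarrow> psp x = 0"
proof -
  assume "x \<le> -1"
  then have "x \<notin> closure {x. psp x \<noteq> 0}" using psi_pair unfolding psi_pair_def by force
  then show "psp x = 0" using closure_subset[of "{x. psp x \<noteq> 0}"] by auto
qed

lemma psp_measurable [measurable]: "psp \<in> borel_measurable borel"
  by (intro borel_measurable_continuous_onI smooth1_continuous psp_smooth)

lemma psm_measurable [measurable]: "psm \<in> borel_measurable borel"
  by (intro borel_measurable_continuous_onI smooth1_continuous psm_smooth)

lemma psp_deriv_L2: "L2 (deriv psp)"
proof -
  have c: "continuous_on UNIV (deriv psp)" by (intro smooth1_continuous smooth1_deriv psp_smooth)
  have z: "deriv psp x = 0" if "\<bar>x\<bar> > 1" for x
  proof (cases "x > 0")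
    case True
    have "((\<lambda>x. 1) has_real_derivative 0) (at x)" by simp
    then have "(psp has_real_derivative 0) (at x)"
      by (rule has_field_derivative_transform_within_open[of _ _ _ "{1<..}"]) (use that True psp_right in auto)
    then show ?thesis by (rule DERIV_imp_deriv)
  next
    case False
    have "((\<lambda>x. 0) has_real_derivative 0) (at x)" by simp
    then have "(psp has_real_derivative 0) (at x)"
      by (rule has_field_derivative_transform_within_open[of _ _ _ "{..<-1}"]) (use that False psp_left in auto)
    then show ?thesis by (rule DERIV_imp_deriv)
  qed
  have "bounded (deriv psp ` {-1..1})"
    by (intro compact_imp_bounded compact_continuous_image continuous_on_subset[OF c]) auto
  then obtain k where k: "\<And>x. x \<in> {-1..1} \<Longrightarrow> \<bar>deriv psp x\<bar> \<le> k" by (force simp: bounded_iff)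
  have b: "\<bar>deriv psp x\<bar> \<le> max k 0" for x
  proof (cases "\<bar>x\<bar> > 1")
    case True then show ?thesis using z by simp
  next
    case False
    then have "x \<in> {-1..1}" by auto
    then show ?thesis using k[of x] by simp
  qed
  show ?thesis by (rule L2_bounded_support[of _ "max k 0" 1, OF borel_measurable_continuous_onI[OF c] b z])
qed

lemma psm_deriv: "deriv psm x = - deriv psp x"
proof (rule DERIV_imp_deriv)
  have "psm = (\<lambda>x. 1 - psp x)" by (auto simp: psm_eq)
  then show "(psm has_real_derivative - deriv psp x) (at x)"
    using smooth1_DERIV[OF psp_smooth, of x] by (auto intro!: derivative_eq_intros)
qed

lemma L2_const_half_line:
  assumes f: "L2 f" and ae: "AE x in lborel. x \<in> S \<longrightarrow> f x = (c::real)"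
    and S: "S \<in> sets borel" "emeasure lborel S = \<infinity>"
  shows "c = 0"
proof (rule ccontr)
  assume "c \<noteq> 0"
  have [measurable]: "f \<in> borel_measurable borel" and i: "integrable lborel (\<lambda>x. (f x)\<^sup>2)" using f unfolding L2_def by auto
  have "integrable lborel (\<lambda>x. indicator S x *\<^sub>R (f x)\<^sup>2)" by (rule integrable_mult_indicator) (use S i in auto)
  also have "?this \<longleftrightarrow> integrable lborel (\<lambda>x. indicator S x * c\<^sup>2)"
    by (rule integrable_cong_AE) (use S ae in \<open>auto elim!: eventually_mono simp: indicator_def\<close>)
  finally have "integrable lborel (\<lambda>x. indicator S x :: real)" using \<open>c \<noteq> 0\<close> by simp
  then have "emeasure lborel S < \<infinity>" using S by (simp add: integrable_indicator_iff)
  then show False using S by simp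
qed

lemma emeasure_half_lines: "emeasure lborel {1::real..} = \<infinity>" "emeasure lborel {..-1::real} = \<infinity>"
proof -
  have "ennreal (real n) \<le> emeasure lborel {1::real..} \<and> ennreal (real n) \<le> emeasure lborel {..-1::real}" for n
  proof
    have "emeasure lborel {1..1 + real n} \<le> emeasure lborel {1::real..}" by (rule emeasure_mono) auto
    then show "ennreal (real n) \<le> emeasure lborel {1::real..}" by simp
    have "emeasure lborel {-1 - real n..-1} \<le> emeasure lborel {..-1::real}" by (rule emeasure_mono) auto
    then show "ennreal (real n) \<le> emeasure lborel {..-1::real}" by simp
  qed
  then show "emeasure lborel {1::real..} = \<infinity>" "emeasure lborel {..-1::real} = \<infinity>"
    using ennreal_eq_top_of_nat_le by blast+
qed

text \<open>On {1..} the combination a psp + b psm equals a and on {..-1} it equals b. A constant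
  that agrees with a square-integrable function on a half-line must be 0.\<close>

lemma decomp_unique:
  assumes "L2 f" "L2 g" "AE x in lborel. f x + a * psp x + b * psm x = g x + c * psp x + d * psm x"
  shows "a = c" "b = d"
proof -
  have L: "L2 (\<lambda>x. g x - f x)" using assms by (intro L2_diff)
  have "AE x in lborel. x \<in> {1..} \<longrightarrow> g x - f x = a - c"
    using assms(3) by eventually_elim (auto simp: psm_eq psp_right)
  from L2_const_half_line[OF L this] show "a = c" using emeasure_half_lines by simp
  have "AE x in lborel. x \<in> {..-1} \<longrightarrow> g x - f x = b - d"
    using assms(3) by eventually_elim (auto simp: psm_eq psp_left)
  from L2_const_half_line[OF L this] show "b = d" using emeasure_half_lines by simp
qed

text \<open>\<open>E20_norm\<close> is a definite description; uniqueness of the decomposition makes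
  any one decomposition evaluate it.\<close>

lemma E20_norm_eq:
  assumes L: "L2 f" and ae: "AE x in lborel. w x = f x + a * psp x + b * psm x"
  shows "E20_norm psp psm w = sqrt ((L2_norm f)\<^sup>2 + a\<^sup>2 + b\<^sup>2)"
  unfolding E20_norm_def
proof (rule the_equality)
  show "\<exists>f' a' b'. L2 f' \<and> (AE x in lborel. w x = f' x + a' * psp x + b' * psm x) \<and> sqrt ((L2_norm f)\<^sup>2 + a\<^sup>2 + b\<^sup>2) = sqrt ((L2_norm f')\<^sup>2 + a'\<^sup>2 + b'\<^sup>2)"
    using assms by blast
  fix r assume "\<exists>f' a' b'. L2 f' \<and> (AE x in lborel. w x = f' x + a' * psp x + b' * psm x) \<and> r = sqrt ((L2_norm f')\<^sup>2 + a'\<^sup>2 + b'\<^sup>2)"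
  then obtain g c d where g: "L2 g" "AE x in lborel. w x = g x + c * psp x + d * psm x" "r = sqrt ((L2_norm g)\<^sup>2 + c\<^sup>2 + d\<^sup>2)" by blast
  have e: "AE x in lborel. f x + a * psp x + b * psm x = g x + c * psp x + d * psm x"
    using ae g(2) by eventually_elim simp
  note ac = decomp_unique[OF L g(1) e]
  have [measurable]: "f \<in> borel_measurable borel" "g \<in> borel_measurable borel" using L g(1) unfolding L2_def by auto
  have "L2_norm f = L2_norm g" unfolding L2_norm_def
    by (intro arg_cong[of _ _ sqrt] integral_cong_AE) (use e ac in \<open>auto elim!: eventually_mono\<close>)
  with ac show "r = sqrt ((L2_norm f)\<^sup>2 + a\<^sup>2 + b\<^sup>2)" by (simp add: g(3))
qed

end

section \<open>Test functions of time and space\<close>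

lemma pd_True: "pd True \<phi> (t,x) = deriv (\<lambda>s. \<phi> (s,x)) t" and pd_False: "pd False \<phi> (t,x) = deriv (\<lambda>y. \<phi> (t,y)) x"
  by (auto simp: pd_def)

lemma smooth2_props:
  assumes "smooth2 \<phi>"
  shows "continuous_on UNIV \<phi>" "continuous_on UNIV (pd b \<phi>)"
    and "((\<lambda>s. \<phi> (s,x)) has_real_derivative pd True \<phi> (t,x)) (at t)"
    and "((\<lambda>y. \<phi> (t,y)) has_real_derivative pd False \<phi> (t,x)) (at x)"
proof -
  have n: "continuous_on UNIV (fold pd ds \<phi>) \<and>
      (\<forall>t x. (\<lambda>s. fold pd ds \<phi> (s,x)) differentiable (at t) \<and>
             (\<lambda>y. fold pd ds \<phi> (t,y)) differentiable (at x))" for ds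
    using assms unfolding smooth2_def by blast
  show "continuous_on UNIV \<phi>" using n[of "[]"] by simp
  show "continuous_on UNIV (pd b \<phi>)" using n[of "[b]"] by simp
  have d: "(\<lambda>s. \<phi> (s,x)) differentiable (at t)" "(\<lambda>y. \<phi> (t,y)) differentiable (at x)" using n[of "[]"] by auto
  show "((\<lambda>s. \<phi> (s,x)) has_real_derivative pd True \<phi> (t,x)) (at t)"
    unfolding pd_True using d(1) by (simp add: DERIV_deriv_iff_real_differentiable)
  show "((\<lambda>y. \<phi> (t,y)) has_real_derivative pd False \<phi> (t,x)) (at x)"
    unfolding pd_False using d(2) by (simp add: DERIV_deriv_iff_real_differentiable)
qed

text \<open>\<open>smooth2\<close> provides partial derivatives only. Joint differentiability, which
  the chain rule along a curve needs, comes from the continuity of the x-derivative.\<close>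

lemma smooth2_chain:
  assumes s: "smooth2 \<phi>" and Y: "(Y has_real_derivative Y') (at t)"
  shows "((\<lambda>s. \<phi> (s, Y s)) has_real_derivative pd True \<phi> (t, Y t) + pd False \<phi> (t, Y t) * Y') (at t)"
proof -
  have "((\<lambda>(x, y). \<phi> (x,y)) has_derivative (\<lambda>(tx, ty). (pd True \<phi> (t, Y t) * tx) + blinfun_apply (blinfun_scaleR_left (pd False \<phi> (t, Y t))) ty)) (at (t, Y t) within UNIV \<times> UNIV)"
  proof (rule has_derivative_partialsI)
    show "((\<lambda>x. \<phi> (x, Y t)) has_derivative (*) (pd True \<phi> (t, Y t))) (at t within UNIV)"
      using smooth2_props(3)[OF s] unfolding has_field_derivative_def by simp
    show "((\<lambda>y. \<phi> (x, y)) has_derivative blinfun_apply (blinfun_scaleR_left (pd False \<phi> (x, y)))) (at y within UNIV)" for x y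
      using smooth2_props(4)[OF s, where t = x and x = y] unfolding has_field_derivative_def by (simp add: mult_commute_abs)
    have "continuous (at (t, Y t)) (\<lambda>p. blinfun_scaleR_left (pd False \<phi> p))"
      using smooth2_props(2)[OF s, of False] by (intro continuous_intros) (simp add: continuous_on_eq_continuous_at)
    then show "continuous (at (t, Y t) within UNIV \<times> UNIV) (\<lambda>(x, y). blinfun_scaleR_left (pd False \<phi> (x, y)))"
      by (simp add: case_prod_unfold)
  qed auto
  then have "(\<phi> has_derivative (\<lambda>p. pd True \<phi> (t, Y t) * fst p + pd False \<phi> (t, Y t) * snd p)) (at (t, Y t))"
    by (simp add: case_prod_unfold mult.commute[of "snd _"])
  moreover have "((\<lambda>s. (s, Y s)) has_derivative (\<lambda>h. (h, Y' * h))) (at t)"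
    using Y unfolding has_field_derivative_def by (intro has_derivative_Pair has_derivative_ident)
  ultimately have "((\<lambda>s. \<phi> (s, Y s)) has_derivative (\<lambda>h. pd True \<phi> (t, Y t) * h + pd False \<phi> (t, Y t) * (Y' * h))) (at t)"
    by (rule_tac has_derivative_compose[of "\<lambda>s. (s, Y s)" _ t UNIV \<phi>, THEN has_derivative_eq_rhs]) auto
  then show ?thesis unfolding has_field_derivative_def by (rule has_derivative_eq_rhs) (simp add: fun_eq_iff algebra_simps)
qed

lemma test2_support:
  assumes "test2 \<phi>"
  obtains R where "R > 0" "\<And>t x. \<bar>t\<bar> \<ge> R \<or> \<bar>x\<bar> \<ge> R \<Longrightarrow> \<phi> (t,x) = 0 \<and> pd True \<phi> (t,x) = 0 \<and> pd False \<phi> (t,x) = 0"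
proof -
  from assms obtain R0 where R0: "\<And>p. \<phi> p \<noteq> 0 \<Longrightarrow> norm p \<le> R0"
    unfolding test2_def bounded_iff by auto
  define R where "R = max R0 0 + 1"
  have z: "\<phi> (t,x) = 0" if "\<bar>t\<bar> > R0 \<or> \<bar>x\<bar> > R0" for t x
    using R0[of "(t,x)"] norm_fst_le[of t x] norm_snd_le[of x t] that by force
  have s: "smooth2 \<phi>" using assms by (simp add: test2_def)
  have zt: "pd True \<phi> (t,x) = 0" if "\<bar>t\<bar> \<ge> R \<or> \<bar>x\<bar> \<ge> R" for t x
  proof (cases "\<bar>t\<bar> \<ge> R")
    case True
    have "((\<lambda>s. 0) has_real_derivative 0) (at t)" by simp
    then have "((\<lambda>s. \<phi> (s,x)) has_real_derivative 0) (at t)"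
      by (rule has_field_derivative_transform_within_open[of _ _ _ "- {-R0..R0}"]) (use True z R_def in \<open>force+\<close>)
    then show ?thesis unfolding pd_True by (rule DERIV_imp_deriv)
  next
    case False
    then have "\<bar>x\<bar> > R0" using that unfolding R_def by linarith
    then have "(\<lambda>s. \<phi> (s,x)) = (\<lambda>s. 0)" using z by auto
    then show ?thesis unfolding pd_True by simp
  qed
  have zx: "pd False \<phi> (t,x) = 0" if "\<bar>t\<bar> \<ge> R \<or> \<bar>x\<bar> \<ge> R" for t x
  proof (cases "\<bar>x\<bar> \<ge> R")
    case True
    have "((\<lambda>s. 0) has_real_derivative 0) (at x)" by simp
    then have "((\<lambda>s. \<phi> (t,s)) has_real_derivative 0) (at x)"
      by (rule has_field_derivative_transform_within_open[of _ _ _ "- {-R0..R0}"]) (use True z R_def in \<open>force+\<close>)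
    then show ?thesis unfolding pd_False by (rule DERIV_imp_deriv)
  next
    case False
    then have "\<bar>t\<bar> > R0" using that unfolding R_def by linarith
    then have "(\<lambda>s. \<phi> (t,s)) = (\<lambda>s. 0)" using z by auto
    then show ?thesis unfolding pd_False by simp
  qed
  show thesis
  proof (rule that[of R])
    show "R > 0" by (simp add: R_def)
    show "\<phi> (t,x) = 0 \<and> pd True \<phi> (t,x) = 0 \<and> pd False \<phi> (t,x) = 0" if "\<bar>t\<bar> \<ge> R \<or> \<bar>x\<bar> \<ge> R" for t x
    proof -
      have "\<bar>t\<bar> > R0 \<or> \<bar>x\<bar> > R0" using that unfolding R_def by linarith
      then show ?thesis using z zt[OF that] zx[OF that] by simp
    qed
  qed
qed

lemma compact_support_bounded:
  fixes f :: "real \<times> real \<Rightarrow> real"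
  assumes "continuous_on UNIV f" "\<And>t x. \<bar>t\<bar> \<ge> R \<or> \<bar>x\<bar> \<ge> R \<Longrightarrow> f (t,x) = 0"
  obtains K where "K \<ge> 0" "\<And>p. \<bar>f p\<bar> \<le> K"
proof -
  have "bounded (f ` ({-R..R} \<times> {-R..R}))"
    by (intro compact_imp_bounded compact_continuous_image continuous_on_subset[OF assms(1)] compact_Times) auto
  then obtain k where k: "\<And>p. p \<in> {-R..R} \<times> {-R..R} \<Longrightarrow> \<bar>f p\<bar> \<le> k" by (force simp: bounded_iff)
  have "\<bar>f p\<bar> \<le> max k 0" for p
  proof (cases "p \<in> {-R..R} \<times> {-R..R}")
    case True then show ?thesis using k[OF True] by simp
  next
    case False
    then have "\<bar>fst p\<bar> \<ge> R \<or> \<bar>snd p\<bar> \<ge> R" by (cases p) auto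
    then have "f (fst p, snd p) = 0" by (rule assms(2))
    then show ?thesis by simp
  qed
  then show thesis using that[of "max k 0"] by auto
qed

section \<open>The conservative flow in Lagrangian variables\<close>

text \<open>Since dx is the image of \<open>\<alpha>\<close> d\<xi>, a square-integrable majorant in
  the label variable costs only the factor c in the norm, and labels with \<open>\<alpha>\<close> =
  0 need no bound at all.\<close>

lemma (in chart) L2_change:
  assumes F: "L2 F" and c: "\<And>\<xi>. \<alpha> \<xi> \<le> c" and [measurable]: "f \<in> borel_measurable borel"
    and b: "AE \<xi> in lborel. \<alpha> \<xi> = 0 \<or> \<bar>f (y \<xi>)\<bar> \<le> \<bar>F \<xi>\<bar>"
  shows "L2 f" "(\<integral>x. (f x)\<^sup>2 \<partial>lborel) \<le> c * (\<integral>\<xi>. (F \<xi>)\<^sup>2 \<partial>lborel)"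
proof -
  have [measurable]: "F \<in> borel_measurable borel" and Fi: "integrable lborel (\<lambda>\<xi>. (F \<xi>)\<^sup>2)" using F unfolding L2_def by auto
  have bd: "AE \<xi> in lborel. \<alpha> \<xi> * (f (y \<xi>))\<^sup>2 \<le> c * (F \<xi>)\<^sup>2"
    using b
  proof eventually_elim
    case (elim \<xi>)
    show ?case
    proof (cases "\<alpha> \<xi> = 0")
      case True
      have "0 \<le> c" using c[of 0] \<alpha>_nonneg[of 0] by linarith
      then show ?thesis using True by simp
    next
      case False
      then have "(f (y \<xi>))\<^sup>2 \<le> (F \<xi>)\<^sup>2" using elim by (simp add: abs_le_square_iff)
      moreover have "0 \<le> c" using c[of 0] \<alpha>_nonneg[of 0] by linarith
      ultimately show ?thesis using c \<alpha>_nonneg by (intro mult_mono) auto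
    qed
  qed
  have i: "integrable lborel (\<lambda>\<xi>. \<alpha> \<xi> * (f (y \<xi>))\<^sup>2)"
  proof (rule Bochner_Integration.integrable_bound[where f = "\<lambda>\<xi>. c * (F \<xi>)\<^sup>2"])
    show "AE \<xi> in lborel. norm (\<alpha> \<xi> * (f (y \<xi>))\<^sup>2) \<le> norm (c * (F \<xi>)\<^sup>2)"
      using bd
    proof eventually_elim
      case (elim \<xi>)
      have "0 \<le> \<alpha> \<xi> * (f (y \<xi>))\<^sup>2" using \<alpha>_nonneg[of \<xi>] by simp
      with elim show ?case unfolding real_norm_def by linarith
    qed
  qed (use Fi in auto)
  show "L2 f" unfolding L2_def using i by (subst integrable_change) auto
  have "(\<integral>x. (f x)\<^sup>2 \<partial>lborel) = (\<integral>\<xi>. \<alpha> \<xi> * (f (y \<xi>))\<^sup>2 \<partial>lborel)" by (rule integral_change) measurable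
  also have "\<dots> \<le> (\<integral>\<xi>. c * (F \<xi>)\<^sup>2 \<partial>lborel)" by (rule integral_mono_AE[OF i _ bd]) (use Fi in simp)
  finally show "(\<integral>x. (f x)\<^sup>2 \<partial>lborel) \<le> c * (\<integral>\<xi>. (F \<xi>)\<^sup>2 \<partial>lborel)" by simp
qed

lemma (in chart) u_measurable [measurable]: "u \<in> borel_measurable borel"
  unfolding u_def[abs_def] by measurable

lemma (in chart) v_L2: "L2 v"
proof -
  have "(\<integral>\<^sup>+x. ennreal ((v x)\<^sup>2) \<partial>lborel) = (\<integral>\<^sup>+x\<in>UNIV. ennreal ((v x)\<^sup>2) \<partial>lborel)" by simp
  also have "\<dots> = emeasure mu (UNIV - N0)" by (rule v_sq) simp
  also have "\<dots> < \<infinity>" using finite_measure.emeasure_finite[OF finite_mu] by (simp add: less_top)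
  finally have "integrable lborel (\<lambda>x. (v x)\<^sup>2)" by (simp add: integrable_iff_bounded)
  then show ?thesis unfolding L2_def by simp
qed

text \<open>The normalisation \<open>unit\<close> bounds \<open>\<alpha>\<close>,
  \<open>\<gamma>\<close> and \<open>\<beta>\<close> by 1. The last two assumptions fix the
  behaviour at both ends of the line; a step function of the label replaces \<open>psp\<close>
  there, because labels and positions stay at bounded distance.\<close>

locale lagrangian = psi psp psm for psp psm +
  fixes \<alpha> \<beta> \<gamma> y0 U0 :: "real \<Rightarrow> real" and K C a0 b0 :: real
  assumes ch: "chart \<alpha> \<beta> \<gamma> y0 U0 K"
    and unit: "\<And>\<xi>. \<alpha> \<xi> + \<gamma> \<xi> = 1"
    and U0_bound: "\<And>\<xi>. \<bar>U0 \<xi>\<bar> \<le> C"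
    and U0_L2: "L2 (\<lambda>\<xi>. U0 \<xi> - (if 0 \<le> \<xi> then a0 else b0))"
    and H_L2: "L2 (\<lambda>\<xi>. chart.H \<gamma> \<xi> - (if 0 \<le> \<xi> then (\<integral>\<xi>. \<gamma> \<xi> \<partial>lborel) else 0))"
begin

interpretation c0: chart \<alpha> \<beta> \<gamma> y0 U0 K by (rule ch)

abbreviation Hf :: "real \<Rightarrow> real" where "Hf \<equiv> chart.H \<gamma>"

definition M :: real where "M = (\<integral>\<xi>. \<gamma> \<xi> \<partial>lborel)"

text \<open>In Lagrangian variables the equation reads \<open>Y_t = V\<close>, \<open>V_t = (2 H - M) / 4\<close> with \<open>\<gamma>\<close> (and so \<open>H\<close>) fixed;
  \<open>A\<close> and \<open>B\<close> are the \<open>\<xi>\<close>-derivatives of the explicit solution \<open>Y\<close>, \<open>V\<close>.\<close>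
definition A :: "real \<Rightarrow> real \<Rightarrow> real" where "A t \<xi> = \<alpha> \<xi> + t * \<beta> \<xi> + t\<^sup>2 / 4 * \<gamma> \<xi>"
definition B :: "real \<Rightarrow> real \<Rightarrow> real" where "B t \<xi> = \<beta> \<xi> + t / 2 * \<gamma> \<xi>"
definition Y :: "real \<Rightarrow> real \<Rightarrow> real" where "Y t \<xi> = y0 \<xi> + t * U0 \<xi> + t\<^sup>2 / 8 * (2 * Hf \<xi> - M)"
definition V :: "real \<Rightarrow> real \<Rightarrow> real" where "V t \<xi> = U0 \<xi> + t / 4 * (2 * Hf \<xi> - M)"
definition Kt :: "real \<Rightarrow> real" where "Kt t = K + \<bar>t\<bar> * C + t\<^sup>2 / 8 * M"

abbreviation iv :: "real \<Rightarrow> real \<Rightarrow> real" where "iv t \<equiv> chart.inv (Y t)"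
abbreviation us :: "real \<Rightarrow> real \<Rightarrow> real" where "us t \<equiv> chart.u (Y t) (V t)"
abbreviation vs :: "real \<Rightarrow> real \<Rightarrow> real" where "vs t \<equiv> chart.v (A t) (B t) (Y t)"
abbreviation mus :: "real \<Rightarrow> real measure" where "mus t \<equiv> chart.mu \<gamma> (Y t)"

lemma \<alpha>_le: "\<alpha> \<xi> \<le> 1" and \<gamma>_le: "\<gamma> \<xi> \<le> 1" and \<beta>_le: "\<bar>\<beta> \<xi>\<bar> \<le> 1"
proof -
  show a: "\<alpha> \<xi> \<le> 1" and g: "\<gamma> \<xi> \<le> 1" using unit[of \<xi>] c0.\<alpha>_nonneg[of \<xi>] c0.\<gamma>_nonneg[of \<xi>] by linarith+
  have "(\<beta> \<xi>)\<^sup>2 \<le> 1" using a g c0.\<alpha>_nonneg[of \<xi>] c0.\<gamma>_nonneg[of \<xi>] by (simp add: c0.sq mult_le_one)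
  then show "\<bar>\<beta> \<xi>\<bar> \<le> 1" by (simp add: abs_square_le_1)
qed

lemma Hf_bounds: "0 \<le> Hf \<xi>" "Hf \<xi> \<le> M"
proof -
  show "0 \<le> Hf \<xi>" unfolding c0.H_def by (rule integral_nonneg_AE) (use c0.\<gamma>_nonneg in \<open>auto simp: indicator_def\<close>)
  show "Hf \<xi> \<le> M" unfolding c0.H_def M_def
  proof (rule integral_mono)
    show "integrable lborel (\<lambda>z. indicator {..<\<xi>} z * \<gamma> z)" using integrable_mult_indicator[OF _ c0.\<gamma>_int, of "{..<\<xi>}"] by simp
    show "indicator {..<\<xi>} z * \<gamma> z \<le> \<gamma> z" for z using c0.\<gamma>_nonneg[of z] by (simp add: indicator_def)
  qed (rule c0.\<gamma>_int)
qed

lemma HM: "\<bar>2 * Hf \<xi> - M\<bar> \<le> M" using Hf_bounds[of \<xi>] by linarith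

lemma M_nonneg: "0 \<le> M" using Hf_bounds[of 0] by linarith

lemma C_nonneg: "0 \<le> C" using U0_bound[of 0] by linarith

text \<open>Expanding the square of \<open>\<beta> \<xi> + t / 2 * \<gamma> \<xi>\<close> and using
  the relation at time 0 gives \<open>\<gamma> \<xi>\<close> times the polynomial
  \<open>A t \<xi>\<close>. So the flow preserves the structure of a chart, and the nonnegativity of
  the slope follows.\<close>

lemma B_sq: "(B t \<xi>)\<^sup>2 = A t \<xi> * \<gamma> \<xi>"
  using c0.sq[of \<xi>] unfolding A_def B_def by (simp add: power2_eq_square algebra_simps)

lemma A_nonneg: "0 \<le> A t \<xi>"
proof (cases "\<gamma> \<xi> = 0")
  case True
  then show ?thesis using c0.sq[of \<xi>] c0.\<alpha>_nonneg[of \<xi>] by (simp add: A_def)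
next
  case False
  then have "\<gamma> \<xi> > 0" using c0.\<gamma>_nonneg[of \<xi>] by simp
  moreover have "0 \<le> A t \<xi> * \<gamma> \<xi>" using B_sq[of t \<xi>] by (metis zero_le_power2)
  ultimately show ?thesis by (simp add: zero_le_mult_iff)
qed

text \<open>If \<open>\<gamma> \<xi> = 0\<close> then \<open>\<beta> \<xi> = 0\<close> and
  \<open>\<alpha> \<xi> = 1\<close>, so the slope is 1 at all times. Otherwise a zero of the slope
  is a zero of \<open>B t \<xi>\<close>, which is affine in t with leading coefficient
  \<open>\<gamma> \<xi> / 2\<close>.\<close>

lemma A_eq_0: "A t \<xi> = 0 \<Longrightarrow> t = - 2 * \<beta> \<xi> / \<gamma> \<xi>"
proof -
  assume z: "A t \<xi> = 0"
  have "\<gamma> \<xi> \<noteq> 0"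
  proof
    assume g: "\<gamma> \<xi> = 0"
    then show False using z c0.sq[of \<xi>] unit[of \<xi>] by (simp add: A_def)
  qed
  moreover have "B t \<xi> = 0" using B_sq[of t \<xi>] z by simp
  ultimately show ?thesis by (simp add: B_def field_simps)
qed

lemma A_le: "0 \<le> t \<Longrightarrow> t \<le> T \<Longrightarrow> A t \<xi> \<le> (1 + T)\<^sup>2"
proof -
  assume t: "0 \<le> t" "t \<le> T"
  have "t * \<beta> \<xi> \<le> T * 1" using t \<beta>_le[of \<xi>] by (intro order_trans[OF mult_left_mono[of "\<beta> \<xi>" 1 t]]) auto
  moreover have "t\<^sup>2 / 4 \<le> T\<^sup>2" using t power_mono[of t T 2] zero_le_power2[of t] by linarith
  then have "t\<^sup>2 / 4 * \<gamma> \<xi> \<le> T\<^sup>2 * 1"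
    using \<gamma>_le[of \<xi>] c0.\<gamma>_nonneg[of \<xi>] by (intro mult_mono) auto
  ultimately show ?thesis using \<alpha>_le[of \<xi>] t by (simp add: A_def power2_sum)
qed

lemma Y_diff: "0 \<le> s \<Longrightarrow> 0 \<le> t \<Longrightarrow> s \<le> T \<Longrightarrow> t \<le> T \<Longrightarrow> \<bar>Y t \<xi> - Y s \<xi>\<bar> \<le> (C + T * M) * \<bar>t - s\<bar>"
proof -
  assume st: "0 \<le> s" "0 \<le> t" "s \<le> T" "t \<le> T"
  have "Y t \<xi> - Y s \<xi> = (t - s) * U0 \<xi> + (t - s) * (t + s) / 8 * (2 * Hf \<xi> - M)"
    unfolding Y_def by (simp add: power2_eq_square field_simps)
  also have "\<bar>\<dots>\<bar> \<le> \<bar>t - s\<bar> * C + \<bar>t - s\<bar> * T * M"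
  proof (rule order_trans[OF abs_triangle_ineq], rule add_mono)
    show "\<bar>(t - s) * U0 \<xi>\<bar> \<le> \<bar>t - s\<bar> * C" using U0_bound[of \<xi>] by (auto simp: abs_mult intro: mult_left_mono)
    have "\<bar>t + s\<bar> = t + s" using st by simp
    then have "\<bar>t + s\<bar> / 8 \<le> T" using st by simp
    then have "\<bar>t - s\<bar> * (\<bar>t + s\<bar> / 8) * \<bar>2 * Hf \<xi> - M\<bar> \<le> \<bar>t - s\<bar> * T * M"
      using HM[of \<xi>] st M_nonneg by (intro mult_mono mult_left_mono) auto
    then show "\<bar>(t - s) * (t + s) / 8 * (2 * Hf \<xi> - M)\<bar> \<le> \<bar>t - s\<bar> * T * M"
      by (simp add: abs_mult)
  qed
  finally show ?thesis by (simp add: algebra_simps)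
qed

lemma V_bound: "\<bar>V t \<xi>\<bar> \<le> C + \<bar>t\<bar> / 4 * M"
proof -
  have "\<bar>t / 4 * (2 * Hf \<xi> - M)\<bar> \<le> \<bar>t\<bar> / 4 * M"
    unfolding abs_mult using HM[of \<xi>] by (intro mult_mono) auto
  then show ?thesis using U0_bound[of \<xi>] unfolding V_def by linarith
qed

lemma near_t: "\<bar>Y t \<xi> - \<xi>\<bar> \<le> Kt t"
proof -
  have "\<bar>t\<^sup>2 / 8 * (2 * Hf \<xi> - M)\<bar> \<le> t\<^sup>2 / 8 * M"
    unfolding abs_mult using HM[of \<xi>] by (intro mult_mono) auto
  moreover have "\<bar>t * U0 \<xi>\<bar> \<le> \<bar>t\<bar> * C" unfolding abs_mult using U0_bound[of \<xi>] by (intro mult_left_mono) auto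
  ultimately show ?thesis using c0.near[of \<xi>] unfolding Y_def Kt_def by linarith
qed

lemma Kt_mono: "0 \<le> t \<Longrightarrow> t \<le> T \<Longrightarrow> Kt t \<le> Kt T"
  unfolding Kt_def using C_nonneg M_nonneg
  by (intro add_mono mult_right_mono divide_right_mono power_mono) auto

lemma H_antideriv: "antideriv (\<lambda>\<xi>. 2 * Hf \<xi> - M) (\<lambda>\<xi>. 2 * \<gamma> \<xi>)"
  using antideriv_diff[OF antideriv_cmult[OF c0.H_ad, of 2] antideriv_const[of M]] by simp

lemma chart_t: "chart (A t) (B t) \<gamma> (Y t) (V t) (Kt t)"
proof
  show "0 \<le> A t x" for x by (rule A_nonneg)
  show "0 \<le> \<gamma> x" for x by (rule c0.\<gamma>_nonneg)
  show "(B t x)\<^sup>2 = A t x * \<gamma> x" for x by (rule B_sq)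
  have "antideriv (\<lambda>\<xi>. y0 \<xi> + t * U0 \<xi> + t\<^sup>2 / 8 * (2 * Hf \<xi> - M)) (\<lambda>\<xi>. \<alpha> \<xi> + t * \<beta> \<xi> + t\<^sup>2 / 8 * (2 * \<gamma> \<xi>))"
    by (intro antideriv_add antideriv_cmult c0.y_ad c0.U_ad H_antideriv)
  then show "antideriv (Y t) (A t)" unfolding Y_def[abs_def] A_def[abs_def] by (simp add: mult.assoc[symmetric])
  have "antideriv (\<lambda>\<xi>. U0 \<xi> + t / 4 * (2 * Hf \<xi> - M)) (\<lambda>\<xi>. \<beta> \<xi> + t / 4 * (2 * \<gamma> \<xi>))"
    by (intro antideriv_add antideriv_cmult c0.U_ad H_antideriv)
  then show "antideriv (V t) (B t)" unfolding V_def[abs_def] B_def[abs_def] by (simp add: mult.assoc[symmetric])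
  show "integrable lborel \<gamma>" by (rule c0.\<gamma>_int)
  show "\<bar>Y t x - x\<bar> \<le> Kt t" for x by (rule near_t)
qed

sublocale T: chart "A t" "B t" \<gamma> "Y t" "V t" "Kt t" for t by (rule chart_t)

text \<open>The error of replacing \<open>psp\<close> at the position by a unit step in the label.
  It is bounded with bounded support, hence negligible for membership in L2.\<close>

definition kk :: "real \<Rightarrow> real \<Rightarrow> real" where "kk t \<xi> = (if 0 \<le> \<xi> then 1 else 0) - psp (Y t \<xi>)"

lemma kk_bound: "\<bar>kk t \<xi>\<bar> \<le> 1" using psp_bounds[of "Y t \<xi>"] by (auto simp: kk_def)

lemma kk_support: "\<bar>\<xi>\<bar> > Kt t + 1 \<Longrightarrow> kk t \<xi> = 0"
proof -
  assume *: "\<bar>\<xi>\<bar> > Kt t + 1"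
  have "Kt t \<ge> 0" using near_t[of t 0] by linarith
  show ?thesis
  proof (cases "0 \<le> \<xi>")
    case True
    then have "Y t \<xi> \<ge> 1" using near_t[of t \<xi>] * by linarith
    then show ?thesis using True psp_right by (simp add: kk_def)
  next
    case False
    then have "Y t \<xi> \<le> -1" using near_t[of t \<xi>] * by linarith
    then show ?thesis using False psp_left by (simp add: kk_def)
  qed
qed

lemma kk_L2: "L2 (kk t)"
proof (rule L2_bounded_support[of _ 1 "Kt t + 1"])
  show "kk t \<in> borel_measurable borel" unfolding kk_def[abs_def] by measurable
qed (rule kk_bound kk_support, assumption?)+

text \<open>The asymptotic values of the velocity at the right and the left end. There
  \<open>2 * Hf \<xi> - M\<close> approaches M and -M, so they drift apart linearly with rates M / 4
  and -M / 4.\<close>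

definition cp :: "real \<Rightarrow> real" where "cp t = a0 + t / 4 * M"
definition cm :: "real \<Rightarrow> real" where "cm t = b0 - t / 4 * M"

lemma H0_L2: "L2 (\<lambda>\<xi>. Hf \<xi> - (if 0 \<le> \<xi> then M else 0))" using H_L2 unfolding M_def .

lemma u_decomp_L2: assumes "0 \<le> t" shows "L2 (\<lambda>x. us t x - cp t * psp x - cm t * psm x)"
proof (rule T.L2_change(1))
  let ?F = "\<lambda>\<xi>. (U0 \<xi> - (if 0 \<le> \<xi> then a0 else b0)) + (t / 2 * (Hf \<xi> - (if 0 \<le> \<xi> then M else 0)) + (cp t - cm t) * kk t \<xi>)"
  show "L2 ?F" by (intro L2_add L2_cmult U0_L2 H0_L2 kk_L2)
  show "A t \<xi> \<le> (1 + t)\<^sup>2" for \<xi> using A_le[OF assms order_refl] .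
  show "(\<lambda>x. us t x - cp t * psp x - cm t * psm x) \<in> borel_measurable borel" by measurable
  have "us t (Y t \<xi>) - cp t * psp (Y t \<xi>) - cm t * psm (Y t \<xi>) = ?F \<xi>" for \<xi>
    unfolding T.u_y psm_eq V_def cp_def cm_def kk_def by (simp add: field_simps)
  then show "AE \<xi> in lborel. A t \<xi> = 0 \<or> \<bar>us t (Y t \<xi>) - cp t * psp (Y t \<xi>) - cm t * psm (Y t \<xi>)\<bar> \<le> \<bar>?F \<xi>\<bar>"
    by simp
qed

lemma u_E2: assumes "0 \<le> t" shows "in_E2 psp psm (us t)"
  unfolding in_E2_def
proof (intro exI conjI)
  let ?f = "\<lambda>x. us t x - cp t * psp x - cm t * psm x"
  show "AE x in lborel. us t x = ?f x + cp t * psp x + cm t * psm x" by simp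
  have "antideriv ?f (\<lambda>x. vs t x - cp t * deriv psp x - cm t * deriv psm x)"
    by (intro antideriv_diff antideriv_cmult T.u_ad antideriv_smooth1 psp_smooth psm_smooth)
  moreover have "L2 (\<lambda>x. vs t x - cp t * deriv psp x - cm t * deriv psm x)"
  proof -
    have "L2 (\<lambda>x. (vs t x - cp t * deriv psp x) + cm t * deriv psp x)"
      by (intro L2_add L2_diff L2_cmult T.v_L2 psp_deriv_L2)
    then show ?thesis by (simp add: psm_deriv)
  qed
  ultimately show "H1 ?f" unfolding H1_def using u_decomp_L2[OF assms] antideriv_imp_weak_deriv by blast
qed

text \<open>A square-integrable majorant of the deviation of \<open>Hf\<close> from \<open>M\<close>
  times \<open>psp\<close> at the position, valid for all times in {0..T} at once. This uniformity
  makes the Lipschitz constant independent of the two times compared.\<close>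

definition FT :: "real \<Rightarrow> real \<Rightarrow> real" where
  "FT T \<xi> = \<bar>Hf \<xi> - (if 0 \<le> \<xi> then M else 0)\<bar> + M * indicator {- (Kt T + 1)..Kt T + 1} \<xi>"

lemma FT_L2: "L2 (FT T)"
proof -
  have "L2 (\<lambda>\<xi>. \<bar>Hf \<xi> - (if 0 \<le> \<xi> then M else 0)\<bar>)" using H0_L2 unfolding L2_def by auto
  moreover have "L2 (\<lambda>\<xi>. indicator {- (Kt T + 1)..Kt T + 1} \<xi>)"
    by (rule L2_bounded_support[of _ 1 "Kt T + 1"]) (auto simp: indicator_def)
  ultimately show ?thesis unfolding FT_def[abs_def] by (intro L2_add L2_cmult)
qed

lemma H_decomp:
  assumes "0 \<le> t" "t \<le> T"
  shows "L2 (\<lambda>x. Hf (iv t x) - M * psp x)"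
    "(\<integral>x. (Hf (iv t x) - M * psp x)\<^sup>2 \<partial>lborel) \<le> (1 + T)\<^sup>2 * (\<integral>\<xi>. (FT T \<xi>)\<^sup>2 \<partial>lborel)"
proof -
  have [measurable]: "Hf \<in> borel_measurable borel" by (rule borel_measurable_continuous_onI[OF antideriv_continuous[OF c0.H_ad]])
  have *: "AE \<xi> in lborel. A t \<xi> = 0 \<or> \<bar>Hf (iv t (Y t \<xi>)) - M * psp (Y t \<xi>)\<bar> \<le> \<bar>FT T \<xi>\<bar>"
    using T.AE_change[OF T.AE_not_D, of t t]
  proof eventually_elim
    case (elim \<xi>)
    have "\<bar>Hf \<xi> - M * psp (Y t \<xi>)\<bar> \<le> FT T \<xi>"
    proof -
      have "Hf \<xi> - M * psp (Y t \<xi>) = (Hf \<xi> - (if 0 \<le> \<xi> then M else 0)) + M * kk t \<xi>" by (simp add: kk_def algebra_simps)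
      moreover have "\<bar>M * kk t \<xi>\<bar> \<le> M * indicator {- (Kt T + 1)..Kt T + 1} \<xi>"
      proof (cases "\<bar>\<xi>\<bar> > Kt T + 1")
        case True
        then show ?thesis using kk_support[of t \<xi>] Kt_mono[OF assms] M_nonneg by simp
      next
        case False
        then have "\<xi> \<in> {- (Kt T + 1)..Kt T + 1}" by auto
        then show ?thesis using kk_bound[of t \<xi>] M_nonneg by (simp add: abs_mult mult_left_le)
      qed
      ultimately show ?thesis unfolding FT_def by linarith
    qed
    then show ?case using elim T.inv_y[of t \<xi>] by auto
  qed
  have m: "(\<lambda>x. Hf (iv t x) - M * psp x) \<in> borel_measurable borel" by measurable
  show "L2 (\<lambda>x. Hf (iv t x) - M * psp x)" "(\<integral>x. (Hf (iv t x) - M * psp x)\<^sup>2 \<partial>lborel) \<le> (1 + T)\<^sup>2 * (\<integral>\<xi>. (FT T \<xi>)\<^sup>2 \<partial>lborel)"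
    by (rule T.L2_change[OF FT_L2 A_le[OF assms] m *])+
qed

lemma in_D_t: assumes "0 \<le> t" shows "in_D psp psm (us t) (mus t)"
  unfolding in_D_def
proof (intro conjI)
  show "in_E2 psp psm (us t)" by (rule u_E2[OF assms])
  show "fin_borel_measure (mus t)" unfolding fin_borel_measure_def using T.finite_mu by simp
  show "in_E10 psp (\<lambda>x. measure (mus t) {..<x})"
    unfolding in_E10_def T.mu_lessThan
    by (intro exI[of _ "\<lambda>x. Hf (iv t x) - M * psp x"] exI[of _ M] conjI H_decomp(1)[OF assms order_refl]) simp
  show "\<exists>ux. weak_deriv (us t) ux \<and> ac_part_density (mus t) (\<lambda>x. (ux x)\<^sup>2)"
    using antideriv_imp_weak_deriv[OF T.u_ad] T.mu_ac by blast
qed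

end

section \<open>The weak equations for the flow in Lagrangian variables\<close>

lemma integrable_iff_support:
  fixes f :: "real \<Rightarrow> real"
  assumes "\<And>x. x \<notin> {a..b} \<Longrightarrow> f x = 0"
  shows "set_integrable lborel {a..b} f \<longleftrightarrow> integrable lborel f"
proof -
  have "(\<lambda>x. indicator {a..b} x *\<^sub>R f x) = f"
  proof
    fix x show "indicator {a..b} x *\<^sub>R f x = f x" using assms[of x] by (cases "x \<in> {a..b}") auto
  qed
  then show ?thesis unfolding set_integrable_def by simp
qed

lemma integrable_bounded_support:
  fixes f :: "real \<Rightarrow> real"
  assumes [measurable]: "f \<in> borel_measurable borel" and "\<And>x. \<bar>f x\<bar> \<le> c" "\<And>x. x \<notin> {a..b} \<Longrightarrow> f x = 0"
  shows "integrable lborel f"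
proof (rule Bochner_Integration.integrable_bound)
  show "integrable lborel (\<lambda>x. indicator {a..b} x * c)"
    by (intro integrable_mult_left integrable_real_indicator) (auto simp: emeasure_lborel_Icc_eq)
  show "AE x in lborel. norm (f x) \<le> norm (indicator {a..b} x * c)"
  proof (rule AE_I2)
    fix x show "norm (f x) \<le> norm (indicator {a..b} x * c)"
      using assms(2)[of x] assms(3)[of x] by (cases "x \<in> {a..b}") auto
  qed
qed measurable

lemma integral_half_line:
  fixes h :: "real \<Rightarrow> real"
  assumes d: "\<And>t. (h has_real_derivative h' t) (at t)" and c: "continuous_on UNIV h'" and R: "R > 0"
    and z: "\<And>t. t \<ge> R \<Longrightarrow> h t = 0" "\<And>t. t \<ge> R \<Longrightarrow> h' t = 0"
  shows "(\<integral>t. indicator {0..} t * h' t \<partial>lborel) = - h 0"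
proof -
  have "(\<integral>t. indicator {0..} t * h' t \<partial>lborel) = (LBINT t:{0..R}. h' t)"
    unfolding set_lebesgue_integral_def
  proof (rule Bochner_Integration.integral_cong[OF refl])
    fix t show "indicator {0..} t * h' t = indicator {0..R} t *\<^sub>R h' t"
      using z(2)[of t] by (cases "t \<ge> R") (auto simp: indicator_def)
  qed
  also have "\<dots> = h R - h 0" by (rule antideriv_eq[OF antideriv_DERIV[OF d c]]) (use R in simp)
  finally show ?thesis using z(1)[of R] by simp
qed

context lagrangian begin

lemma Y_measurable2 [measurable]: "(\<lambda>(t,\<xi>). Y t \<xi>) \<in> borel_measurable (borel \<Otimes>\<^sub>M borel)"
  and V_measurable2 [measurable]: "(\<lambda>(t,\<xi>). V t \<xi>) \<in> borel_measurable (borel \<Otimes>\<^sub>M borel)"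
  and A_measurable2 [measurable]: "(\<lambda>(t,\<xi>). A t \<xi>) \<in> borel_measurable (borel \<Otimes>\<^sub>M borel)"
  and B_measurable2 [measurable]: "(\<lambda>(t,\<xi>). B t \<xi>) \<in> borel_measurable (borel \<Otimes>\<^sub>M borel)"
  and Hf_measurable [measurable]: "Hf \<in> borel_measurable borel"
proof -
  interpret c0: chart \<alpha> \<beta> \<gamma> y0 U0 K by (rule ch)
  show [measurable]: "Hf \<in> borel_measurable borel"
    by (rule borel_measurable_continuous_onI[OF antideriv_continuous[OF c0.H_ad]])
  show "(\<lambda>(t,\<xi>). Y t \<xi>) \<in> borel_measurable (borel \<Otimes>\<^sub>M borel)" unfolding Y_def by measurable
  show "(\<lambda>(t,\<xi>). V t \<xi>) \<in> borel_measurable (borel \<Otimes>\<^sub>M borel)" unfolding V_def by measurable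
  show "(\<lambda>(t,\<xi>). A t \<xi>) \<in> borel_measurable (borel \<Otimes>\<^sub>M borel)" unfolding A_def by measurable
  show "(\<lambda>(t,\<xi>). B t \<xi>) \<in> borel_measurable (borel \<Otimes>\<^sub>M borel)" unfolding B_def by measurable
qed

lemma Y_DERIV: "((\<lambda>t. Y t \<xi>) has_real_derivative V t \<xi>) (at t)"
  unfolding Y_def V_def by (auto intro!: derivative_eq_intros)

lemma V_DERIV: "((\<lambda>t. V t \<xi>) has_real_derivative (2 * Hf \<xi> - M) / 4) (at t)"
  unfolding V_def by (auto intro!: derivative_eq_intros)

lemma A_DERIV: "((\<lambda>t. A t \<xi>) has_real_derivative B t \<xi>) (at t)"
  unfolding A_def B_def by (auto intro!: derivative_eq_intros)

lemma cont_t: "continuous_on UNIV (\<lambda>t. Y t \<xi>)" "continuous_on UNIV (\<lambda>t. V t \<xi>)" "continuous_on UNIV (\<lambda>t. A t \<xi>)" "continuous_on UNIV (\<lambda>t. B t \<xi>)"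
  unfolding Y_def V_def A_def B_def by (intro continuous_intros; simp)+

lemma cont_comp: "continuous_on UNIV f \<Longrightarrow> continuous_on UNIV (\<lambda>t. f (t, Y t \<xi>))" for f :: "real \<times> real \<Rightarrow> real"
proof -
  assume c: "continuous_on UNIV f"
  have "continuous_on UNIV (\<lambda>t. (t, Y t \<xi>))" by (intro continuous_intros cont_t)
  from continuous_on_compose2[OF c this] show ?thesis by simp
qed

lemma us_bound: "\<bar>us t x\<bar> \<le> C + \<bar>t\<bar> / 4 * M" unfolding T.u_def by (rule V_bound)

text \<open>In labels the inner integrand is \<open>\<gamma> \<xi>\<close> times the time derivative
  of the test function along the trajectory of \<open>\<xi>\<close>, and \<open>\<gamma>\<close>
  does not depend on time. Fubini and the fundamental theorem leave the value at time 0.\<close>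

lemma measure_weak:
  assumes t2: "test2 \<phi>"
  shows "(\<integral>t. indicator {0..} t * (\<integral>x. pd True \<phi> (t,x) + us t x * pd False \<phi> (t,x) \<partial>mus t) \<partial>lborel) = - (\<integral>x. \<phi> (0,x) \<partial>mus 0)"
proof -
  have s: "smooth2 \<phi>" using t2 by (simp add: test2_def)
  obtain R where R: "R > 0" and z: "\<And>t x. \<bar>t\<bar> \<ge> R \<or> \<bar>x\<bar> \<ge> R \<Longrightarrow> \<phi> (t,x) = 0 \<and> pd True \<phi> (t,x) = 0 \<and> pd False \<phi> (t,x) = 0"
    using test2_support[OF t2] by blast
  obtain k1 where k1: "k1 \<ge> 0" "\<And>p. \<bar>pd True \<phi> p\<bar> \<le> k1"
    by (rule compact_support_bounded[OF smooth2_props(2)[OF s, of True], of R]) (use z in auto)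
  obtain k2 where k2: "k2 \<ge> 0" "\<And>p. \<bar>pd False \<phi> p\<bar> \<le> k2"
    by (rule compact_support_bounded[OF smooth2_props(2)[OF s, of False], of R]) (use z in auto)
  have [measurable]: "\<phi> \<in> borel_measurable borel" "pd b \<phi> \<in> borel_measurable borel" for b
    using smooth2_props(1,2)[OF s] by (auto intro: borel_measurable_continuous_onI)
  define h' where "h' t \<xi> = pd True \<phi> (t, Y t \<xi>) + pd False \<phi> (t, Y t \<xi>) * V t \<xi>" for t \<xi>
  have [measurable]: "(\<lambda>(t,\<xi>). h' t \<xi>) \<in> borel_measurable (borel \<Otimes>\<^sub>M borel)" unfolding h'_def by measurable
  have h'b: "\<bar>h' t \<xi>\<bar> \<le> (k1 + k2 * (C + R / 4 * M)) * indicator {0..R} t" if "0 \<le> t" for t \<xi>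
  proof (cases "t \<ge> R")
    case True
    then show ?thesis using z[of t] R k1 k2 C_nonneg M_nonneg by (simp add: h'_def)
  next
    case False
    have "\<bar>V t \<xi>\<bar> \<le> C + R / 4 * M"
      using V_bound[of t \<xi>] mult_right_mono[of "\<bar>t\<bar> / 4" "R / 4" M] False that M_nonneg by simp
    then have "\<bar>pd False \<phi> (t, Y t \<xi>) * V t \<xi>\<bar> \<le> k2 * (C + R / 4 * M)"
      unfolding abs_mult using k2 by (intro mult_mono) auto
    then have "\<bar>h' t \<xi>\<bar> \<le> k1 + k2 * (C + R / 4 * M)"
      using k1(2)[of "(t, Y t \<xi>)"] unfolding h'_def by linarith
    then show ?thesis using False that by simp
  qed
  have int: "integrable (lborel \<Otimes>\<^sub>M lborel) (\<lambda>(t,\<xi>). indicator {0..} t * (\<gamma> \<xi> * h' t \<xi>))"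
  proof (rule Bochner_Integration.integrable_bound[OF integrable_prod[of "\<lambda>t. (k1 + k2 * (C + R / 4 * M)) * indicator {0..R} t" \<gamma>]])
    show "integrable lborel (\<lambda>t. (k1 + k2 * (C + R / 4 * M)) * indicator {0..R} t)"
      by (intro integrable_mult_right integrable_real_indicator) (auto simp: emeasure_lborel_Icc_eq)
    show "integrable lborel \<gamma>" by (rule T.\<gamma>_int)
    show "AE p in lborel \<Otimes>\<^sub>M lborel. norm (case p of (t,\<xi>) \<Rightarrow> indicator {0..} t * (\<gamma> \<xi> * h' t \<xi>)) \<le> norm (case p of (t,\<xi>) \<Rightarrow> (k1 + k2 * (C + R / 4 * M)) * indicator {0..R} t * \<gamma> \<xi>)"
    proof (rule AE_I2, clarify)
      fix t \<xi>
      show "norm (indicator {0..} t * (\<gamma> \<xi> * h' t \<xi>)) \<le> norm ((k1 + k2 * (C + R / 4 * M)) * indicator {0..R} t * \<gamma> \<xi>)"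
      proof (cases "0 \<le> t")
        case True
        have "\<bar>\<gamma> \<xi>\<bar> * \<bar>h' t \<xi>\<bar> \<le> \<bar>\<gamma> \<xi>\<bar> * \<bar>(k1 + k2 * (C + R / 4 * M)) * indicator {0..R} t\<bar>"
          using h'b[OF True, of \<xi>] by (intro mult_left_mono) auto
        then show ?thesis using True by (simp add: abs_mult mult_ac)
      qed simp
    qed
  qed measurable
  have "(\<integral>t. indicator {0..} t * (\<integral>x. pd True \<phi> (t,x) + us t x * pd False \<phi> (t,x) \<partial>mus t) \<partial>lborel)
      = (\<integral>t. \<integral>\<xi>. indicator {0..} t * (\<gamma> \<xi> * h' t \<xi>) \<partial>lborel \<partial>lborel)"
  proof (rule Bochner_Integration.integral_cong[OF refl])
    fix t
    have "(\<integral>x. pd True \<phi> (t,x) + us t x * pd False \<phi> (t,x) \<partial>mus t) = (\<integral>\<xi>. \<gamma> \<xi> * (pd True \<phi> (t,Y t \<xi>) + us t (Y t \<xi>) * pd False \<phi> (t,Y t \<xi>)) \<partial>lborel)"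
      by (rule T.integral_mu) measurable
    also have "\<dots> = (\<integral>\<xi>. \<gamma> \<xi> * h' t \<xi> \<partial>lborel)" by (simp add: T.u_y h'_def mult.commute)
    finally show "indicator {0..} t * (\<integral>x. pd True \<phi> (t,x) + us t x * pd False \<phi> (t,x) \<partial>mus t) = (\<integral>\<xi>. indicator {0..} t * (\<gamma> \<xi> * h' t \<xi>) \<partial>lborel)" by simp
  qed
  also have "\<dots> = (\<integral>\<xi>. \<integral>t. indicator {0..} t * (\<gamma> \<xi> * h' t \<xi>) \<partial>lborel \<partial>lborel)"
    by (rule lborel_pair.Fubini_integral[OF int, symmetric])
  also have "\<dots> = (\<integral>\<xi>. - (\<gamma> \<xi> * \<phi> (0, Y 0 \<xi>)) \<partial>lborel)"
  proof (rule Bochner_Integration.integral_cong[OF refl])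
    fix \<xi>
    have "(\<integral>t. indicator {0..} t * h' t \<xi> \<partial>lborel) = - \<phi> (0, Y 0 \<xi>)"
    proof (rule integral_half_line[of "\<lambda>t. \<phi> (t, Y t \<xi>)" _ R])
      show "((\<lambda>t. \<phi> (t, Y t \<xi>)) has_real_derivative h' t \<xi>) (at t)" for t
        unfolding h'_def by (rule smooth2_chain[OF s Y_DERIV])
      show "continuous_on UNIV (\<lambda>t. h' t \<xi>)" unfolding h'_def
        by (intro continuous_intros cont_comp smooth2_props(2)[OF s] cont_t)
    qed (use R z in \<open>auto simp: h'_def\<close>)
    then have "\<gamma> \<xi> * (\<integral>t. indicator {0..} t * h' t \<xi> \<partial>lborel) = - (\<gamma> \<xi> * \<phi> (0, Y 0 \<xi>))" by simp
    then show "(\<integral>t. indicator {0..} t * (\<gamma> \<xi> * h' t \<xi>) \<partial>lborel) = - (\<gamma> \<xi> * \<phi> (0, Y 0 \<xi>))"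
      by (subst (asm) integral_mult_right_zero[symmetric]) (simp add: mult.left_commute)
  qed
  also have "\<dots> = - (\<integral>\<xi>. \<gamma> \<xi> * \<phi> (0, Y 0 \<xi>) \<partial>lborel)" by simp
  also have "(\<integral>\<xi>. \<gamma> \<xi> * \<phi> (0, Y 0 \<xi>) \<partial>lborel) = (\<integral>x. \<phi> (0,x) \<partial>mus 0)"
    by (rule T.integral_mu[symmetric]) measurable
  finally show ?thesis .
qed

text \<open>The factor 1/2 in front of u^2 prevents a direct chain rule along trajectories. Adding
  the x-derivative of (1/2) u^2 \<open>\<phi>\<close>, whose integral is 0, turns the integrand into
  a full time derivative: the right-hand side is that of A V \<open>\<phi>\<close>(t, Y).\<close>

lemma inner_u_weak:
  assumes s: "smooth2 \<phi>" and R: "R > 0" and z: "\<And>t x. \<bar>t\<bar> \<ge> R \<or> \<bar>x\<bar> \<ge> R \<Longrightarrow> \<phi> (t,x) = 0 \<and> pd True \<phi> (t,x) = 0 \<and> pd False \<phi> (t,x) = 0"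
  shows "(\<integral>x. us t x * pd True \<phi> (t,x) + 1/2 * (us t x)\<^sup>2 * pd False \<phi> (t,x) + 1/4 * (measure (mus t) {..<x} - measure (mus t) {x<..}) * \<phi> (t,x) \<partial>lborel)
    = (\<integral>\<xi>. A t \<xi> * (V t \<xi> * pd True \<phi> (t, Y t \<xi>) + (V t \<xi>)\<^sup>2 * pd False \<phi> (t, Y t \<xi>) + 1/4 * (2 * Hf \<xi> - M) * \<phi> (t, Y t \<xi>)) + B t \<xi> * V t \<xi> * \<phi> (t, Y t \<xi>) \<partial>lborel)" (is "?L = ?R")
proof -
  obtain k1 where k1: "k1 \<ge> 0" "\<And>p. \<bar>pd True \<phi> p\<bar> \<le> k1"
    by (rule compact_support_bounded[OF smooth2_props(2)[OF s, of True], of R]) (use z in auto)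
  obtain k2 where k2: "k2 \<ge> 0" "\<And>p. \<bar>pd False \<phi> p\<bar> \<le> k2"
    by (rule compact_support_bounded[OF smooth2_props(2)[OF s, of False], of R]) (use z in auto)
  obtain k0 where k0: "k0 \<ge> 0" "\<And>p. \<bar>\<phi> p\<bar> \<le> k0"
    by (rule compact_support_bounded[OF smooth2_props(1)[OF s], of R]) (use z in auto)
  have [measurable]: "\<phi> \<in> borel_measurable borel" "pd b \<phi> \<in> borel_measurable borel" for b
    using smooth2_props(1,2)[OF s] by (auto intro: borel_measurable_continuous_onI)
  define P where "P x = us t x * pd True \<phi> (t,x) + 1/2 * (us t x)\<^sup>2 * pd False \<phi> (t,x) + 1/4 * (2 * Hf (iv t x) - M) * \<phi> (t,x)" for x
  \<comment> \<open>The x-derivative of (1/2) u^2 \<open>\<phi>\<close>; its integral vanishes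
    because \<open>\<phi>\<close> has compact support.\<close>
  define Z where "Z x = us t x * vs t x * \<phi> (t,x) + 1/2 * (us t x)\<^sup>2 * pd False \<phi> (t,x)" for x
  have [measurable]: "P \<in> borel_measurable borel" "Z \<in> borel_measurable borel" unfolding P_def[abs_def] Z_def[abs_def] by measurable
  define c where "c = C + \<bar>t\<bar> / 4 * M"
  have c0: "c \<ge> 0" using C_nonneg M_nonneg by (simp add: c_def)
  have Pi: "integrable lborel P"
  proof (rule integrable_bounded_support[of _ "c * k1 + 1/2 * c\<^sup>2 * k2 + 1/4 * M * k0" "-R" R])
    fix x
    have "\<bar>us t x * pd True \<phi> (t,x)\<bar> \<le> c * k1" unfolding abs_mult using us_bound[of t x] k1 c0 by (intro mult_mono) (auto simp: c_def)
    moreover have "\<bar>1/2 * (us t x)\<^sup>2 * pd False \<phi> (t,x)\<bar> \<le> 1/2 * c\<^sup>2 * k2"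
      unfolding abs_mult using us_bound[of t x] k2 c0 by (intro mult_mono) (auto simp: c_def abs_le_square_iff[symmetric])
    moreover have "\<bar>1/4 * (2 * Hf (iv t x) - M) * \<phi> (t,x)\<bar> \<le> 1/4 * M * k0"
      unfolding abs_mult using HM k0 M_nonneg by (intro mult_mono) auto
    ultimately show "\<bar>P x\<bar> \<le> c * k1 + 1/2 * c\<^sup>2 * k2 + 1/4 * M * k0" unfolding P_def by linarith
    show "P x = 0" if "x \<notin> {-R..R}"
    proof -
      have "\<bar>x\<bar> \<ge> R" using that by auto
      then show ?thesis using z by (simp add: P_def)
    qed
  qed measurable
  have Z0: "Z x = 0" if "x \<notin> {-R..R}" for x
  proof -
    have "\<bar>x\<bar> \<ge> R" using that by auto
    then show ?thesis using z by (simp add: Z_def)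
  qed
  have aphi: "antideriv (\<lambda>x. \<phi> (t,x)) (\<lambda>x. pd False \<phi> (t,x))"
    by (rule antideriv_DERIV[OF smooth2_props(4)[OF s]])
      (rule continuous_on_compose2[OF smooth2_props(2)[OF s]], auto intro!: continuous_intros)
  have "antideriv (\<lambda>x. (us t x * us t x) * \<phi> (t,x)) (\<lambda>x. (vs t x * us t x + us t x * vs t x) * \<phi> (t,x) + (us t x * us t x) * pd False \<phi> (t,x))"
    by (intro antideriv_mult T.u_ad aphi)
  from antideriv_cmult[OF this, of "1/2"]
  have aZ: "antideriv (\<lambda>x. 1/2 * ((us t x * us t x) * \<phi> (t,x))) Z"
    unfolding Z_def[abs_def] by (simp add: power2_eq_square algebra_simps)
  have Zi: "integrable lborel Z" using antideriv_integrable[OF aZ, of "-R" R] integrable_iff_support[OF Z0] by simp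
  have "(\<integral>x. Z x \<partial>lborel) = 0"
    using integral_eq_LBINT_support[OF Z0] antideriv_eq[OF aZ, of "-R" R] z R by simp
  then have "(\<integral>x. P x \<partial>lborel) = (\<integral>x. P x + Z x \<partial>lborel)" using Pi Zi by simp
  also have "\<dots> = (\<integral>\<xi>. A t \<xi> * (P (Y t \<xi>) + Z (Y t \<xi>)) \<partial>lborel)" by (rule T.integral_change) measurable
  also have "\<dots> = ?R"
  proof (rule integral_cong_AE)
    show "AE \<xi> in lborel. A t \<xi> * (P (Y t \<xi>) + Z (Y t \<xi>)) = A t \<xi> * (V t \<xi> * pd True \<phi> (t, Y t \<xi>) + (V t \<xi>)\<^sup>2 * pd False \<phi> (t, Y t \<xi>) + 1/4 * (2 * Hf \<xi> - M) * \<phi> (t, Y t \<xi>)) + B t \<xi> * V t \<xi> * \<phi> (t, Y t \<xi>)"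
      using T.AE_change[OF T.AE_not_D, of t t] T.v_y[of t]
    proof eventually_elim
      case (elim \<xi>)
      have "A t \<xi> * Hf (iv t (Y t \<xi>)) = A t \<xi> * Hf \<xi>" using elim(1) T.inv_y[of t \<xi>] by auto
      moreover have "A t \<xi> * (P (Y t \<xi>) + Z (Y t \<xi>)) = A t \<xi> * (V t \<xi> * pd True \<phi> (t, Y t \<xi>) + (V t \<xi>)\<^sup>2 * pd False \<phi> (t, Y t \<xi>)) + 1/4 * (2 * (A t \<xi> * Hf (iv t (Y t \<xi>))) - A t \<xi> * M) * \<phi> (t, Y t \<xi>) + (A t \<xi> * vs t (Y t \<xi>)) * V t \<xi> * \<phi> (t, Y t \<xi>)"
        unfolding P_def Z_def T.u_y by (simp add: power2_eq_square algebra_simps)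
      ultimately show ?case by (simp only: elim(2)) (simp add: algebra_simps)
    qed
  qed measurable
  finally have PR: "(\<integral>x. P x \<partial>lborel) = ?R" .
  have "?L = (\<integral>x. P x \<partial>lborel)"
  proof (rule integral_cong_AE)
    have e: "us t x * pd True \<phi> (t,x) + 1/2 * (us t x)\<^sup>2 * pd False \<phi> (t,x) + 1/4 * (measure (mus t) {..<x} - measure (mus t) {x<..}) * \<phi> (t,x) = P x" if "x \<notin> chart.D (Y t)" for x
      unfolding P_def T.mu_lessThan T.mu_greaterThan[OF that] M_def[symmetric] by simp
    show "AE x in lborel. us t x * pd True \<phi> (t,x) + 1/2 * (us t x)\<^sup>2 * pd False \<phi> (t,x) + 1/4 * (measure (mus t) {..<x} - measure (mus t) {x<..}) * \<phi> (t,x) = P x"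
      using T.AE_not_D[of t] by eventually_elim (rule e)
    have "(\<lambda>x. measure (mus t) {x<..}) \<in> borel_measurable borel"
    proof -
      interpret finite_measure "mus t" by (rule T.finite_mu)
      have "mono (\<lambda>x. - measure (mus t) {x<..})"
        by (rule monoI) (auto intro!: finite_measure_mono)
      then have "(\<lambda>x. - (- measure (mus t) {x<..})) \<in> borel_measurable borel" by (intro borel_measurable_uminus borel_measurable_mono)
      then show ?thesis by simp
    qed
    then show "(\<lambda>x. us t x * pd True \<phi> (t,x) + 1/2 * (us t x)\<^sup>2 * pd False \<phi> (t,x) + 1/4 * (measure (mus t) {..<x} - measure (mus t) {x<..}) * \<phi> (t,x)) \<in> borel_measurable lborel"
      unfolding T.mu_lessThan by measurable
  qed measurable
  with PR show ?thesis by simp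
qed

text \<open>The weight A converts dx into d\<xi>, and A V \<open>\<phi>\<close>(t, Y) is
  differentiable in t for each label because A, V and Y are polynomials in t. Bounds on a box of
  times and labels justify exchanging the integrals.\<close>

lemma u_weak:
  assumes t2: "test2 \<phi>"
  shows "(\<integral>t. indicator {0..} t * (\<integral>x. us t x * pd True \<phi> (t,x) + 1/2 * (us t x)\<^sup>2 * pd False \<phi> (t,x) + 1/4 * (measure (mus t) {..<x} - measure (mus t) {x<..}) * \<phi> (t,x) \<partial>lborel) \<partial>lborel)
    = - (\<integral>x. us 0 x * \<phi> (0,x) \<partial>lborel)"
proof -
  have s: "smooth2 \<phi>" using t2 by (simp add: test2_def)
  obtain R where R: "R > 0" and z: "\<And>t x. \<bar>t\<bar> \<ge> R \<or> \<bar>x\<bar> \<ge> R \<Longrightarrow> \<phi> (t,x) = 0 \<and> pd True \<phi> (t,x) = 0 \<and> pd False \<phi> (t,x) = 0"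
    using test2_support[OF t2] by blast
  obtain k1 where k1: "k1 \<ge> 0" "\<And>p. \<bar>pd True \<phi> p\<bar> \<le> k1"
    by (rule compact_support_bounded[OF smooth2_props(2)[OF s, of True], of R]) (use z in auto)
  obtain k2 where k2: "k2 \<ge> 0" "\<And>p. \<bar>pd False \<phi> p\<bar> \<le> k2"
    by (rule compact_support_bounded[OF smooth2_props(2)[OF s, of False], of R]) (use z in auto)
  obtain k0 where k0: "k0 \<ge> 0" "\<And>p. \<bar>\<phi> p\<bar> \<le> k0"
    by (rule compact_support_bounded[OF smooth2_props(1)[OF s], of R]) (use z in auto)
  have [measurable]: "\<phi> \<in> borel_measurable borel" "pd b \<phi> \<in> borel_measurable borel" for b
    using smooth2_props(1,2)[OF s] by (auto intro: borel_measurable_continuous_onI)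
  define h' where "h' t \<xi> = A t \<xi> * (V t \<xi> * pd True \<phi> (t, Y t \<xi>) + (V t \<xi>)\<^sup>2 * pd False \<phi> (t, Y t \<xi>) + 1/4 * (2 * Hf \<xi> - M) * \<phi> (t, Y t \<xi>)) + B t \<xi> * V t \<xi> * \<phi> (t, Y t \<xi>)" for t \<xi>
  have hm[measurable]: "(\<lambda>(t,\<xi>). h' t \<xi>) \<in> borel_measurable (borel \<Otimes>\<^sub>M borel)" unfolding h'_def by measurable
  define c where "c = C + R / 4 * M"
  define Q where "Q = (1 + R)\<^sup>2 * (c * k1 + c\<^sup>2 * k2 + 1/4 * M * k0) + (1 + R) * c * k0"
  have c0: "c \<ge> 0" using C_nonneg M_nonneg R by (simp add: c_def)
  \<comment> \<open>Up to time R a trajectory stays within \<open>Kt R\<close> of its label, so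
    labels beyond R' never meet the support of the test function.\<close>
  define R' where "R' = R + Kt R"
  have h'b: "\<bar>h' t \<xi>\<bar> \<le> Q" and h'z: "t \<notin> {0..R} \<or> \<xi> \<notin> {-R'..R'} \<Longrightarrow> h' t \<xi> = 0" if "0 \<le> t" for t \<xi>
  proof -
    show zero: "h' t \<xi> = 0" if "t \<notin> {0..R} \<or> \<xi> \<notin> {-R'..R'}"
    proof (cases "t \<ge> R")
      case True
      then have "R \<le> \<bar>t\<bar>" by simp
      then show ?thesis using z[of t "Y t \<xi>"] by (simp add: h'_def)
    next
      case False
      then have "\<bar>\<xi>\<bar> \<ge> R + Kt R" using that \<open>0 \<le> t\<close> by (auto simp: R'_def)
      then have "\<bar>Y t \<xi>\<bar> \<ge> R" using near_t[of t \<xi>] Kt_mono[of t R] False \<open>0 \<le> t\<close> by linarith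
      then show ?thesis using z by (simp add: h'_def)
    qed
    have Q0: "0 \<le> Q" unfolding Q_def using c0 k0 k1 k2 M_nonneg R by auto
    show "\<bar>h' t \<xi>\<bar> \<le> Q"
    proof (cases "t \<ge> R")
      case True
      then have "R \<le> \<bar>t\<bar>" by simp
      then show ?thesis using z[of t "Y t \<xi>"] Q0 by (simp add: h'_def)
    next
      case False
      have V: "\<bar>V t \<xi>\<bar> \<le> c"
        using V_bound[of t \<xi>] mult_right_mono[of "\<bar>t\<bar> / 4" "R / 4" M] False that M_nonneg by (simp add: c_def)
      have A: "\<bar>A t \<xi>\<bar> \<le> (1 + R)\<^sup>2" using A_le[of t R \<xi>] A_nonneg[of t \<xi>] that False by simp
      have "\<bar>t / 2 * \<gamma> \<xi>\<bar> \<le> R * 1" unfolding abs_mult using \<gamma>_le[of \<xi>] T.\<gamma>_nonneg[of \<xi>] that False by (intro mult_mono) auto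
      then have B: "\<bar>B t \<xi>\<bar> \<le> 1 + R" using \<beta>_le[of \<xi>] unfolding B_def by linarith
      have 1: "\<bar>V t \<xi> * pd True \<phi> (t, Y t \<xi>)\<bar> \<le> c * k1" unfolding abs_mult using V k1 c0 by (intro mult_mono) auto
      have 2: "\<bar>(V t \<xi>)\<^sup>2 * pd False \<phi> (t, Y t \<xi>)\<bar> \<le> c\<^sup>2 * k2" unfolding abs_mult using V k2 c0 by (intro mult_mono) (auto simp: abs_le_square_iff[symmetric])
      have 3: "\<bar>1/4 * (2 * Hf \<xi> - M) * \<phi> (t, Y t \<xi>)\<bar> \<le> 1/4 * M * k0" unfolding abs_mult using HM k0 M_nonneg by (intro mult_mono) auto
      have 4: "\<bar>B t \<xi> * V t \<xi> * \<phi> (t, Y t \<xi>)\<bar> \<le> (1 + R) * c * k0" unfolding abs_mult using B V k0 c0 R by (intro mult_mono) auto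
      have "\<bar>V t \<xi> * pd True \<phi> (t, Y t \<xi>) + (V t \<xi>)\<^sup>2 * pd False \<phi> (t, Y t \<xi>) + 1/4 * (2 * Hf \<xi> - M) * \<phi> (t, Y t \<xi>)\<bar> \<le> c * k1 + c\<^sup>2 * k2 + 1/4 * M * k0"
        using 1 2 3 by linarith
      then have "\<bar>A t \<xi> * (V t \<xi> * pd True \<phi> (t, Y t \<xi>) + (V t \<xi>)\<^sup>2 * pd False \<phi> (t, Y t \<xi>) + 1/4 * (2 * Hf \<xi> - M) * \<phi> (t, Y t \<xi>))\<bar> \<le> (1 + R)\<^sup>2 * (c * k1 + c\<^sup>2 * k2 + 1/4 * M * k0)"
        unfolding abs_mult using A by (intro mult_mono) auto
      with 4 show ?thesis unfolding h'_def Q_def by linarith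
    qed
  qed
  have int: "integrable (lborel \<Otimes>\<^sub>M lborel) (\<lambda>(t,\<xi>). indicator {0..} t * h' t \<xi>)"
  proof (rule Bochner_Integration.integrable_bound[OF integrable_prod[of "\<lambda>t. Q * indicator {0..R} t" "indicator {-R'..R'}"]])
    show "integrable lborel (\<lambda>t. Q * indicator {0..R} t)" "integrable lborel (indicator {-R'..R'} :: real \<Rightarrow> real)"
      by (intro integrable_mult_right integrable_real_indicator; simp add: emeasure_lborel_Icc_eq)+
    show "AE p in lborel \<Otimes>\<^sub>M lborel. norm (case p of (t,\<xi>) \<Rightarrow> indicator {0..} t * h' t \<xi>) \<le> norm (case p of (t,\<xi>) \<Rightarrow> Q * indicator {0..R} t * indicator {-R'..R'} \<xi>)"
    proof (rule AE_I2, clarify)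
      fix t \<xi>
      show "norm (indicator {0..} t * h' t \<xi>) \<le> norm (Q * indicator {0..R} t * indicator {-R'..R'} \<xi>)"
      proof (cases "0 \<le> t")
        case True
        show ?thesis
        proof (cases "t \<notin> {0..R} \<or> \<xi> \<notin> {-R'..R'}")
          case z: True then show ?thesis using h'z[OF True z] by simp
        next
          case False then show ?thesis using h'b[OF True, of \<xi>] by simp
        qed
      qed simp
    qed
  qed measurable
  have "(\<integral>t. indicator {0..} t * (\<integral>x. us t x * pd True \<phi> (t,x) + 1/2 * (us t x)\<^sup>2 * pd False \<phi> (t,x) + 1/4 * (measure (mus t) {..<x} - measure (mus t) {x<..}) * \<phi> (t,x) \<partial>lborel) \<partial>lborel)
      = (\<integral>t. \<integral>\<xi>. indicator {0..} t * h' t \<xi> \<partial>lborel \<partial>lborel)"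
  proof (rule Bochner_Integration.integral_cong[OF refl])
    fix t
    have "(\<integral>x. us t x * pd True \<phi> (t,x) + 1/2 * (us t x)\<^sup>2 * pd False \<phi> (t,x) + 1/4 * (measure (mus t) {..<x} - measure (mus t) {x<..}) * \<phi> (t,x) \<partial>lborel) = (\<integral>\<xi>. h' t \<xi> \<partial>lborel)"
      unfolding h'_def by (rule inner_u_weak[OF s R]) (rule z)
    then show "indicator {0..} t * (\<integral>x. us t x * pd True \<phi> (t,x) + 1/2 * (us t x)\<^sup>2 * pd False \<phi> (t,x) + 1/4 * (measure (mus t) {..<x} - measure (mus t) {x<..}) * \<phi> (t,x) \<partial>lborel) = (\<integral>\<xi>. indicator {0..} t * h' t \<xi> \<partial>lborel)"
      by (simp only: integral_mult_right_zero)
  qed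
  also have "\<dots> = (\<integral>\<xi>. \<integral>t. indicator {0..} t * h' t \<xi> \<partial>lborel \<partial>lborel)"
    by (rule lborel_pair.Fubini_integral[OF int, symmetric])
  also have "\<dots> = (\<integral>\<xi>. - (A 0 \<xi> * (us 0 (Y 0 \<xi>) * \<phi> (0, Y 0 \<xi>))) \<partial>lborel)"
  proof (rule Bochner_Integration.integral_cong[OF refl])
    fix \<xi>
    have "(\<integral>t. indicator {0..} t * h' t \<xi> \<partial>lborel) = - (A 0 \<xi> * V 0 \<xi> * \<phi> (0, Y 0 \<xi>))"
    proof (rule integral_half_line[of "\<lambda>t. A t \<xi> * V t \<xi> * \<phi> (t, Y t \<xi>)" _ R])
      show "((\<lambda>t. A t \<xi> * V t \<xi> * \<phi> (t, Y t \<xi>)) has_real_derivative h' t \<xi>) (at t)" for t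
        unfolding h'_def by (rule derivative_eq_intros A_DERIV V_DERIV smooth2_chain[OF s Y_DERIV] refl)+
          (simp add: power2_eq_square field_simps)
      show "continuous_on UNIV (\<lambda>t. h' t \<xi>)" unfolding h'_def
        by (intro continuous_intros cont_comp smooth2_props(1,2)[OF s] cont_t)
    qed (use R z in \<open>auto simp: h'_def\<close>)
    then show "(\<integral>t. indicator {0..} t * h' t \<xi> \<partial>lborel) = - (A 0 \<xi> * (us 0 (Y 0 \<xi>) * \<phi> (0, Y 0 \<xi>)))" by (simp add: T.u_y mult.assoc)
  qed
  also have "\<dots> = - (\<integral>\<xi>. A 0 \<xi> * (us 0 (Y 0 \<xi>) * \<phi> (0, Y 0 \<xi>)) \<partial>lborel)" by simp
  also have "(\<integral>\<xi>. A 0 \<xi> * (us 0 (Y 0 \<xi>) * \<phi> (0, Y 0 \<xi>)) \<partial>lborel) = (\<integral>x. us 0 x * \<phi> (0,x) \<partial>lborel)"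
    by (rule T.integral_change[symmetric]) measurable
  finally show ?thesis .
qed

end

section \<open>Continuity in time of the Lagrangian solution\<close>

lemma measure_ball_integral:
  fixes M :: "real measure"
  assumes fin: "finite_measure M" and sets: "sets M = sets borel" and r: "0 \<le> r"
  shows "(\<integral>\<^sup>+x. emeasure M {x - r..x + r} \<partial>lborel) = ennreal (2 * r) * emeasure M (space M)"
proof -
  interpret finite_measure M by (rule fin)
  interpret pair_sigma_finite lborel M
    by (simp add: pair_sigma_finite_def sigma_finite_measure_axioms lborel.sigma_finite_measure_axioms)
  note [measurable_cong] = sets
  have "(\<integral>\<^sup>+x. emeasure M {x - r..x + r} \<partial>lborel) = (\<integral>\<^sup>+x. \<integral>\<^sup>+z. indicator {(x,z). x - r \<le> z \<and> z \<le> x + r} (x,z) \<partial>M \<partial>lborel)"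
  proof (rule nn_integral_cong)
    fix x :: real
    have "emeasure M {x - r..x + r} = (\<integral>\<^sup>+z. indicator {x - r..x + r} z \<partial>M)" by (simp add: sets)
    also have "\<dots> = (\<integral>\<^sup>+z. indicator {(x,z). x - r \<le> z \<and> z \<le> x + r} (x,z) \<partial>M)"
      by (rule nn_integral_cong) (auto simp: indicator_def)
    finally show "emeasure M {x - r..x + r} = (\<integral>\<^sup>+z. indicator {(x,z). x - r \<le> z \<and> z \<le> x + r} (x,z) \<partial>M)" .
  qed
  also have "\<dots> = (\<integral>\<^sup>+z. \<integral>\<^sup>+x. indicator {(x,z). x - r \<le> z \<and> z \<le> x + r} (x,z) \<partial>lborel \<partial>M)"
    by (rule Fubini'[symmetric]) measurable
  also have "\<dots> = (\<integral>\<^sup>+z. ennreal (2 * r) \<partial>M)"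
  proof (rule nn_integral_cong)
    fix z
    have "(\<integral>\<^sup>+x. indicator {(x,z). x - r \<le> z \<and> z \<le> x + r} (x,z) \<partial>lborel) = (\<integral>\<^sup>+x. indicator {z - r..z + r} x \<partial>lborel)"
      by (rule nn_integral_cong) (auto simp: indicator_def)
    then show "(\<integral>\<^sup>+x. indicator {(x,z). x - r \<le> z \<and> z \<le> x + r} (x,z) \<partial>lborel) = ennreal (2 * r)" using r by simp
  qed
  finally show ?thesis by simp
qed

context lagrangian begin

lemma mass_t: "measure (mus t) UNIV = M"
  using T.measure_mu[of UNIV t] by (simp add: M_def)

lemma us_sq_le: "(us t x - us t x')\<^sup>2 \<le> \<bar>x - x'\<bar> * measure (mus t) {min x x'..max x x'}"
proof -
  interpret finite_measure "mus t" by (rule T.finite_mu)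
  have *: "(us t x - us t x')\<^sup>2 \<le> (x - x') * measure (mus t) {x'..x}" if "x' \<le> x" for x x'
  proof -
    have "measure (mus t) {x'..<x} \<le> measure (mus t) {x'..x}" by (rule finite_measure_mono) auto
    then show ?thesis using T.u_holder[OF that, of t] that mult_left_mono[of _ _ "x - x'"] by (meson diff_ge_0_iff_ge order_trans)
  qed
  show ?thesis
  proof (cases "x' \<le> x")
    case True then show ?thesis using *[OF True] by simp
  next
    case False
    then have "x \<le> x'" by simp
    from *[OF this] show ?thesis using False by (simp add: power2_commute min_def max_def)
  qed
qed

lemma us_holder: "\<bar>us t x - us t x'\<bar> \<le> sqrt (M * \<bar>x - x'\<bar>)"
proof -
  interpret finite_measure "mus t" by (rule T.finite_mu)
  have "measure (mus t) {min x x'..max x x'} \<le> M"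
    using finite_measure_mono[of "{min x x'..max x x'}" UNIV] by (simp add: mass_t)
  then have "(us t x - us t x')\<^sup>2 \<le> M * \<bar>x - x'\<bar>"
    using us_sq_le[of t x x'] mult_left_mono[of _ M "\<bar>x - x'\<bar>"] by (fastforce simp: mult.commute)
  then show ?thesis by (metis real_sqrt_abs real_sqrt_le_mono)
qed

text \<open>The velocity at (t, x) is compared with the velocity at time s on the same trajectory.
  Along it the change is explicit; what remains is a spatial increment at time s over the distance
  travelled.\<close>

lemma us_time: 
  assumes "0 \<le> s" "0 \<le> t" "s \<le> T" "t \<le> T"
  shows "us t x - us s x = (t - s) / 4 * (2 * Hf (iv t x) - M) + (us s (Y s (iv t x)) - us s x)"
    "\<bar>Y s (iv t x) - x\<bar> \<le> (C + T * M) * \<bar>t - s\<bar>"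
proof -
  have "us t x - us s (Y s (iv t x)) = (t - s) / 4 * (2 * Hf (iv t x) - M)"
    unfolding T.u_y T.u_def[of t x] by (simp add: V_def field_simps)
  then show "us t x - us s x = (t - s) / 4 * (2 * Hf (iv t x) - M) + (us s (Y s (iv t x)) - us s x)" by simp
  show "\<bar>Y s (iv t x) - x\<bar> \<le> (C + T * M) * \<bar>t - s\<bar>"
    using Y_diff[OF assms(2,1,4,3), of "iv t x"] by (simp add: T.y_inv abs_minus_commute)
qed

lemma holder_t: assumes T: "0 < T" shows "holder_on ({0..T} \<times> UNIV) (\<lambda>(t,x). us t x)"
  unfolding holder_on_def
\<comment> \<open>The first summand bounds the acceleration along a trajectory, at most M / 4. The
  second applies the spatial modulus with exponent 1/2 to a displacement of at most C + T M + 1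
  times the distance of the two points.\<close>
proof (rule exI[of _ "1/2"], rule exI[of _ "M / 4 * sqrt T + sqrt (M * (C + T * M + 1))"], intro conjI ballI)
  fix p q :: "real \<times> real" assume "p \<in> {0..T} \<times> UNIV" "q \<in> {0..T} \<times> UNIV"
  then obtain t x s x' where p: "p = (t,x)" and q: "q = (s,x')" and st: "0 \<le> s" "0 \<le> t" "s \<le> T" "t \<le> T" by auto
  define d where "d = dist p q"
  have d0: "0 \<le> d" by (simp add: d_def)
  have dt: "\<bar>t - s\<bar> \<le> d" and dx: "\<bar>x - x'\<bar> \<le> d"
    using dist_fst_le[of p q] dist_snd_le[of p q] by (auto simp: p q d_def dist_real_def)
  have L0: "0 \<le> C + T * M" using C_nonneg M_nonneg T by simp
  define z where "z = Y s (iv t x)"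
  have "\<bar>z - x'\<bar> \<le> (C + T * M) * \<bar>t - s\<bar> + \<bar>x - x'\<bar>" using us_time(2)[OF st, of x] by (simp add: z_def)
  also have "\<dots> \<le> (C + T * M) * d + d" using L0 dt dx by (intro add_mono mult_left_mono) auto
  finally have zx: "\<bar>z - x'\<bar> \<le> (C + T * M + 1) * d" by (simp add: algebra_simps)
  have e: "us t x - us s x' = (t - s) / 4 * (2 * Hf (iv t x) - M) + (us s z - us s x')"
    using us_time(1)[OF st, of x] by (simp add: z_def)
  have 1: "\<bar>(t - s) / 4 * (2 * Hf (iv t x) - M)\<bar> \<le> M / 4 * sqrt T * sqrt d"
  proof -
    have "\<bar>t - s\<bar> \<le> sqrt T * sqrt d"
    proof -
      have "\<bar>t - s\<bar> = sqrt (\<bar>t - s\<bar> * \<bar>t - s\<bar>)" by simp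
      also have "\<dots> \<le> sqrt (T * d)" by (intro real_sqrt_le_mono mult_mono) (use st dt T in auto)
      finally show ?thesis by (simp add: real_sqrt_mult)
    qed
    then have "\<bar>t - s\<bar> / 4 * \<bar>2 * Hf (iv t x) - M\<bar> \<le> (sqrt T * sqrt d) / 4 * M"
      using HM[of "iv t x"] T d0 by (intro mult_mono) auto
    then show ?thesis by (simp add: abs_mult mult_ac)
  qed
  have "\<bar>us s z - us s x'\<bar> \<le> sqrt (M * \<bar>z - x'\<bar>)" by (rule us_holder)
  also have "\<dots> \<le> sqrt (M * ((C + T * M + 1) * d))" using zx M_nonneg by (intro real_sqrt_le_mono mult_left_mono) auto
  also have "\<dots> = sqrt (M * (C + T * M + 1)) * sqrt d" by (simp add: real_sqrt_mult mult.assoc)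
  finally have 2: "\<bar>us s z - us s x'\<bar> \<le> sqrt (M * (C + T * M + 1)) * sqrt d" .
  have "\<bar>us t x - us s x'\<bar> \<le> (M / 4 * sqrt T + sqrt (M * (C + T * M + 1))) * sqrt d"
    using 1 2 unfolding e distrib_right by linarith
  then show "\<bar>(case p of (t, x) \<Rightarrow> us t x) - (case q of (t, x) \<Rightarrow> us t x)\<bar> \<le> (M / 4 * sqrt T + sqrt (M * (C + T * M + 1))) * dist p q powr (1/2)"
    using d0 by (simp add: p q powr_half_sqrt d_def)
qed auto

text \<open>Pointwise, a displacement of size r changes the velocity only by order sqrt r, too weak
  for a Lipschitz estimate. But the squared change is at most r times the energy within distance r
  of x, and integrating that energy over x gains another factor 2 r by Fubini.\<close>

lemma us_shift_L2:
  assumes st: "0 \<le> s" "0 \<le> t" "s \<le> T" "t \<le> T"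
  defines "w \<equiv> \<lambda>x. us s (Y s (iv t x)) - us s x"
  shows "L2 w" "(\<integral>x. (w x)\<^sup>2 \<partial>lborel) \<le> 2 * M * ((C + T * M) * \<bar>t - s\<bar>)\<^sup>2"
proof -
  interpret finite_measure "mus s" by (rule T.finite_mu)
  define r where "r = (C + T * M) * \<bar>t - s\<bar>"
  have r0: "0 \<le> r" using C_nonneg M_nonneg st by (simp add: r_def)
  have [measurable]: "w \<in> borel_measurable borel" unfolding w_def by measurable
  have le: "(w x)\<^sup>2 \<le> r * measure (mus s) {x - r..x + r}" for x
  proof -
    have z: "\<bar>Y s (iv t x) - x\<bar> \<le> r" using us_time(2)[OF st] by (simp add: r_def)
    have "(w x)\<^sup>2 \<le> \<bar>Y s (iv t x) - x\<bar> * measure (mus s) {min (Y s (iv t x)) x..max (Y s (iv t x)) x}"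
      unfolding w_def by (rule us_sq_le)
    also have "\<dots> \<le> r * measure (mus s) {x - r..x + r}"
    proof (rule mult_mono[OF z])
      show "measure (mus s) {min (Y s (iv t x)) x..max (Y s (iv t x)) x} \<le> measure (mus s) {x - r..x + r}"
        by (rule finite_measure_mono) (use z in \<open>auto simp: abs_le_iff\<close>)
    qed (use r0 in auto)
    finally show ?thesis .
  qed
  have "(\<integral>\<^sup>+x. ennreal ((w x)\<^sup>2) \<partial>lborel) \<le> (\<integral>\<^sup>+x. ennreal r * emeasure (mus s) {x - r..x + r} \<partial>lborel)"
  proof (rule nn_integral_mono)
    fix x show "ennreal ((w x)\<^sup>2) \<le> ennreal r * emeasure (mus s) {x - r..x + r}"
      using ennreal_leI[OF le[of x]] r0 by (simp add: emeasure_eq_measure ennreal_mult)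
  qed
  also have "\<dots> = ennreal r * (\<integral>\<^sup>+x. emeasure (mus s) {x - r..x + r} \<partial>lborel)"
  proof (rule nn_integral_cmult)
    have "(\<lambda>x. emeasure (mus s) {x - r..x + r}) = (\<lambda>x. ennreal (measure (mus s) ({..x + r} - {..<x - r})))"
    proof
      fix x have "{x - r..x + r} = {..x + r} - {..<x - r}" by auto
      then show "emeasure (mus s) {x - r..x + r} = ennreal (measure (mus s) ({..x + r} - {..<x - r}))"
        by (simp add: emeasure_eq_measure)
    qed
    also have "\<dots> = (\<lambda>x. ennreal (measure (mus s) {..x + r} - measure (mus s) {..<x - r}))"
      using r0 by (intro ext arg_cong[of _ _ ennreal] finite_measure_Diff) auto
    also have "\<dots> \<in> borel_measurable lborel"
    proof -
      have "mono (\<lambda>x. measure (mus s) {..x + r})" "mono (\<lambda>x. measure (mus s) {..<x - r})"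
        by (auto intro!: monoI finite_measure_mono)
      from this[THEN borel_measurable_mono] show ?thesis by measurable
    qed
    finally show "(\<lambda>x. emeasure (mus s) {x - r..x + r}) \<in> borel_measurable lborel" .
  qed
  also have "\<dots> = ennreal r * (ennreal (2 * r) * ennreal M)"
    unfolding measure_ball_integral[OF T.finite_mu T.sets_mu r0, of s] by (simp add: emeasure_eq_measure mass_t)
  also have "\<dots> = ennreal (2 * M * r\<^sup>2)" using r0 M_nonneg by (simp add: ennreal_mult[symmetric] power2_eq_square mult_ac)
  finally have nn: "(\<integral>\<^sup>+x. ennreal ((w x)\<^sup>2) \<partial>lborel) \<le> ennreal (2 * M * r\<^sup>2)" .
  also have "\<dots> < \<infinity>" by simp
  finally have i: "integrable lborel (\<lambda>x. (w x)\<^sup>2)" by (simp add: integrable_iff_bounded)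
  then show "L2 w" unfolding L2_def by simp
  have "ennreal (\<integral>x. (w x)\<^sup>2 \<partial>lborel) \<le> ennreal (2 * M * r\<^sup>2)"
    using nn nn_integral_eq_integral[OF i] by simp
  then show "(\<integral>x. (w x)\<^sup>2 \<partial>lborel) \<le> 2 * M * ((C + T * M) * \<bar>t - s\<bar>)\<^sup>2"
    using M_nonneg by (subst (asm) ennreal_le_iff) (auto simp: r_def)
qed

lemma lipschitz_t:
  assumes T: "0 < T"
  shows "\<exists>L. \<forall>s\<in>{0..T}. \<forall>t\<in>{0..T}. E20_norm psp psm (\<lambda>x. us t x - us s x) \<le> L * \<bar>t - s\<bar>"
proof -
  define Q where "Q = (1 + T)\<^sup>2 * (\<integral>\<xi>. (FT T \<xi>)\<^sup>2 \<partial>lborel)"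
  have Q0: "0 \<le> Q" unfolding Q_def by simp
  \<comment> \<open>The three summands come from \<open>f1\<close>, from \<open>f2\<close> and from
    the two coefficients of \<open>psp\<close> and \<open>psm\<close>; the first two are doubled by
    the estimate of a squared sum.\<close>
  define L2c where "L2c = Q / 2 + 4 * M * (C + T * M)\<^sup>2 + M\<^sup>2 / 8"
  have Lc0: "0 \<le> L2c" unfolding L2c_def using Q0 M_nonneg by simp
  show ?thesis
  proof (intro exI[of _ "sqrt L2c"] ballI)
    fix s t assume "s \<in> {0..T}" "t \<in> {0..T}"
    then have st: "0 \<le> s" "0 \<le> t" "s \<le> T" "t \<le> T" by auto
    \<comment> \<open>The splitting uses 2 H - M = 2 (H - M psp) + M psp - M psm. The first part is
      square integrable and the other two change only the asymptotic values.\<close>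
    define f1 where "f1 x = (t - s) / 2 * (Hf (iv t x) - M * psp x)" for x
    define f2 where "f2 x = us s (Y s (iv t x)) - us s x" for x
    have f1L: "L2 f1" unfolding f1_def[abs_def] by (rule L2_cmult[OF H_decomp(1)[OF st(2,4)]])
    have f2L: "L2 f2" unfolding f2_def[abs_def] by (rule us_shift_L2(1)[OF st])
    have L: "L2 (\<lambda>x. f1 x + f2 x)" by (rule L2_add[OF f1L f2L])
    have "us t x - us s x = (f1 x + f2 x) + ((t - s) * M / 4) * psp x + (- ((t - s) * M / 4)) * psm x" for x
      unfolding us_time(1)[OF st] f1_def f2_def psm_eq by (simp add: field_simps)
    then have E: "E20_norm psp psm (\<lambda>x. us t x - us s x) = sqrt ((L2_norm (\<lambda>x. f1 x + f2 x))\<^sup>2 + ((t - s) * M / 4)\<^sup>2 + (- ((t - s) * M / 4))\<^sup>2)"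
      by (intro E20_norm_eq[OF L]) simp
    have "(L2_norm (\<lambda>x. f1 x + f2 x))\<^sup>2 = (\<integral>x. (f1 x + f2 x)\<^sup>2 \<partial>lborel)" unfolding L2_norm_def by simp
    also have "\<dots> \<le> (\<integral>x. 2 * (f1 x)\<^sup>2 + 2 * (f2 x)\<^sup>2 \<partial>lborel)"
    proof (rule integral_mono)
      show "integrable lborel (\<lambda>x. (f1 x + f2 x)\<^sup>2)" "integrable lborel (\<lambda>x. 2 * (f1 x)\<^sup>2 + 2 * (f2 x)\<^sup>2)"
        using L f1L f2L unfolding L2_def by auto
      fix x have "0 \<le> (f1 x - f2 x)\<^sup>2" by simp
      then show "(f1 x + f2 x)\<^sup>2 \<le> 2 * (f1 x)\<^sup>2 + 2 * (f2 x)\<^sup>2" by (simp add: power2_sum power2_diff)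
    qed
    also have "\<dots> = 2 * (\<integral>x. (f1 x)\<^sup>2 \<partial>lborel) + 2 * (\<integral>x. (f2 x)\<^sup>2 \<partial>lborel)"
      using f1L f2L unfolding L2_def by simp
    also have "(\<integral>x. (f1 x)\<^sup>2 \<partial>lborel) = ((t - s) / 2)\<^sup>2 * (\<integral>x. (Hf (iv t x) - M * psp x)\<^sup>2 \<partial>lborel)"
      unfolding f1_def by (simp only: power_mult_distrib integral_mult_right_zero)
    also have "2 * (((t - s) / 2)\<^sup>2 * (\<integral>x. (Hf (iv t x) - M * psp x)\<^sup>2 \<partial>lborel)) + 2 * (\<integral>x. (f2 x)\<^sup>2 \<partial>lborel)
        \<le> 2 * (((t - s) / 2)\<^sup>2 * Q) + 2 * (2 * M * ((C + T * M) * \<bar>t - s\<bar>)\<^sup>2)"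
      using H_decomp(2)[OF st(2,4)] us_shift_L2(2)[OF st] unfolding Q_def f2_def
      by (intro add_mono mult_left_mono) auto
    also have "\<dots> = (Q / 2 + 4 * M * (C + T * M)\<^sup>2) * (t - s)\<^sup>2"
      unfolding power_mult_distrib power2_abs power_divide by (simp add: field_simps)
    finally have "(L2_norm (\<lambda>x. f1 x + f2 x))\<^sup>2 \<le> (Q / 2 + 4 * M * (C + T * M)\<^sup>2) * (t - s)\<^sup>2" .
    then have "(L2_norm (\<lambda>x. f1 x + f2 x))\<^sup>2 + ((t - s) * M / 4)\<^sup>2 + (- ((t - s) * M / 4))\<^sup>2 \<le> L2c * (t - s)\<^sup>2"
    proof -
      assume le: "(L2_norm (\<lambda>x. f1 x + f2 x))\<^sup>2 \<le> (Q / 2 + 4 * M * (C + T * M)\<^sup>2) * (t - s)\<^sup>2"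
      have e: "((t - s) * M / 4)\<^sup>2 = (t - s)\<^sup>2 * M\<^sup>2 / 16" unfolding power_mult_distrib power_divide by simp
      have "L2c * (t - s)\<^sup>2 = (Q / 2 + 4 * M * (C + T * M)\<^sup>2) * (t - s)\<^sup>2 + 2 * ((t - s)\<^sup>2 * M\<^sup>2 / 16)"
        unfolding L2c_def distrib_right by simp
      then show ?thesis using le unfolding power2_minus e by linarith
    qed
    then have "E20_norm psp psm (\<lambda>x. us t x - us s x) \<le> sqrt (L2c * (t - s)\<^sup>2)" unfolding E by (rule real_sqrt_le_mono)
    then show "E20_norm psp psm (\<lambda>x. us t x - us s x) \<le> sqrt L2c * \<bar>t - s\<bar>" by (simp add: real_sqrt_mult)
  qed
qed

lemma ac_a_e_t:
  "\<exists>N \<in> null_sets lborel. \<forall>t\<ge>0. t \<notin> N \<longrightarrow> (\<exists>ux. weak_deriv (us t) ux \<and> mus t = density lborel (\<lambda>x. ennreal ((ux x)\<^sup>2)))"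
proof -
  have "AE \<xi> in lborel. AE t in lborel. A t \<xi> \<noteq> 0"
  proof (rule AE_I2)
    fix \<xi> show "AE t in lborel. A t \<xi> \<noteq> 0"
      using lborel_AE_neq[of "- 2 * \<beta> \<xi> / \<gamma> \<xi>"] by eventually_elim (use A_eq_0 in blast)
  qed
  then have "AE t in lborel. AE \<xi> in lborel. A t \<xi> \<noteq> 0"
  proof (subst lborel_pair.AE_commute)
    have [measurable]: "(\<lambda>p. A (fst p) (snd p)) \<in> borel_measurable (lborel \<Otimes>\<^sub>M lborel)"
      using A_measurable2 by (simp add: case_prod_beta')
    show "{p \<in> space (lborel \<Otimes>\<^sub>M lborel). A (fst p) (snd p) \<noteq> 0} \<in> sets (lborel \<Otimes>\<^sub>M lborel)" by measurable
  qed
  then obtain N where N: "{t. \<not> (AE \<xi> in lborel. A t \<xi> \<noteq> 0)} \<subseteq> N" "N \<in> null_sets lborel"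
    by (auto elim!: AE_E simp: null_sets_def)
  have "weak_deriv (us t) (vs t) \<and> mus t = density lborel (\<lambda>x. ennreal ((vs t x)\<^sup>2))" if "t \<notin> N" for t
  proof
    show "weak_deriv (us t) (vs t)" by (rule antideriv_imp_weak_deriv[OF T.u_ad])
    show "mus t = density lborel (\<lambda>x. ennreal ((vs t x)\<^sup>2))" by (rule T.mu_eq_density) (use that N(1) in blast)
  qed
  then show ?thesis using N(2) by blast
qed

lemma weak_cont_t:
  fixes f :: "real \<Rightarrow> real"
  assumes c: "continuous_on UNIV f" and b: "bounded (range f)"
  shows "continuous_on {0..} (\<lambda>t. \<integral>x. f x \<partial>(mus t))"
proof -
  have [measurable]: "f \<in> borel_measurable borel" by (rule borel_measurable_continuous_onI[OF c])
  from b obtain k where k: "\<And>x. \<bar>f x\<bar> \<le> k" by (auto simp: bounded_iff)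
  have e: "(\<integral>x. f x \<partial>(mus t)) = (\<integral>\<xi>. \<gamma> \<xi> * f (Y t \<xi>) \<partial>lborel)" for t by (rule T.integral_mu) measurable
  show ?thesis unfolding e continuous_on_sequentially comp_def
  proof (intro allI ballI impI)
    fix X :: "nat \<Rightarrow> real" and a assume "(\<forall>n. X n \<in> {0..}) \<and> X \<longlonglongrightarrow> a"
    then have X: "X \<longlonglongrightarrow> a" by blast
    show "(\<lambda>n. \<integral>\<xi>. \<gamma> \<xi> * f (Y (X n) \<xi>) \<partial>lborel) \<longlonglongrightarrow> (\<integral>\<xi>. \<gamma> \<xi> * f (Y a \<xi>) \<partial>lborel)"
    proof (rule integral_dominated_convergence[where w = "\<lambda>\<xi>. \<gamma> \<xi> * k"])
      show "integrable lborel (\<lambda>\<xi>. \<gamma> \<xi> * k)" using T.\<gamma>_int by simp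
      show "AE \<xi> in lborel. (\<lambda>n. \<gamma> \<xi> * f (Y (X n) \<xi>)) \<longlonglongrightarrow> \<gamma> \<xi> * f (Y a \<xi>)"
      proof (rule AE_I2, intro tendsto_mult tendsto_const)
        fix \<xi>
        have "isCont f (Y a \<xi>)" using c by (simp add: continuous_on_eq_continuous_at)
        moreover have "isCont (\<lambda>t. Y t \<xi>) a" using cont_t(1) by (simp add: continuous_on_eq_continuous_at)
        then have "(\<lambda>n. Y (X n) \<xi>) \<longlonglongrightarrow> Y a \<xi>" using X by (rule isCont_tendsto_compose)
        ultimately show "(\<lambda>n. f (Y (X n) \<xi>)) \<longlonglongrightarrow> f (Y a \<xi>)" by (rule isCont_tendsto_compose)
      qed
      show "AE \<xi> in lborel. norm (\<gamma> \<xi> * f (Y (X n) \<xi>)) \<le> \<gamma> \<xi> * k" for n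
        using k T.\<gamma>_nonneg by (auto simp: abs_mult intro!: mult_left_mono)
    qed measurable
  qed
qed

theorem solution: "HS_weak_conservative psp psm us mus"
  unfolding HS_weak_conservative_def
  by (intro conjI allI impI in_D_t u_weak measure_weak holder_t lipschitz_t ac_a_e_t; (elim conjE)?; (intro weak_cont_t)?; assumption)

end

section \<open>Lagrangian variables for given initial data\<close>

lemma nn_integral_sum_measure:
  assumes sets: "sets L = sets P" "sets L = sets Q"
    and em: "\<And>A. A \<in> sets L \<Longrightarrow> emeasure L A = emeasure P A + emeasure Q A"
    and h: "h \<in> borel_measurable L"
  shows "(\<integral>\<^sup>+x. h x \<partial>L) = (\<integral>\<^sup>+x. h x \<partial>P) + (\<integral>\<^sup>+x. h x \<partial>Q)"
  using h
proof (induction h rule: borel_measurable_induct)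
  have sp: "space P = space L" "space Q = space L" using sets[THEN sets_eq_imp_space_eq] by auto
  have m: "\<And>g. g \<in> borel_measurable L \<Longrightarrow> g \<in> borel_measurable P" "\<And>g. g \<in> borel_measurable L \<Longrightarrow> g \<in> borel_measurable Q"
    using sets by (auto cong: measurable_cong_sets)
  {
    case (cong f g)
    have "integral\<^sup>N X f = integral\<^sup>N X g" if "space X = space L" for X
      by (rule nn_integral_cong) (use cong(3) that in simp)
    then show ?case using cong(4) sp by simp
  next
    case (set A)
    then show ?case using sets by (simp add: em)
  next
    case (mult u c)
    have "u \<in> borel_measurable P" "u \<in> borel_measurable Q" using m mult by blast+
    with mult show ?case by (simp add: nn_integral_cmult distrib_left)
  next
    case (add u v)
    have "u \<in> borel_measurable P" "u \<in> borel_measurable Q" "v \<in> borel_measurable P" "v \<in> borel_measurable Q"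
      using m add by blast+
    with add show ?case by (simp add: nn_integral_add ac_simps)
  next
    case (seq U)
    have e: "(\<integral>\<^sup>+x. (SUP i. U i x) \<partial>X) = (SUP i. \<integral>\<^sup>+x. U i x \<partial>X)" if "\<And>i. U i \<in> borel_measurable X" for X
      by (rule nn_integral_monotone_convergence_SUP[OF seq(3)]) (rule that)
    have i: "incseq (\<lambda>i. \<integral>\<^sup>+x. U i x \<partial>X)" for X
      using seq(3) by (auto simp: incseq_def le_fun_def intro!: nn_integral_mono)
    have "(\<integral>\<^sup>+x. (SUP i. U i x) \<partial>L) = (SUP i. (\<integral>\<^sup>+x. U i x \<partial>P) + (\<integral>\<^sup>+x. U i x \<partial>Q))"
      using e[OF seq(1)] seq.IH by simp
    also have "\<dots> = (SUP i. \<integral>\<^sup>+x. U i x \<partial>P) + (SUP i. \<integral>\<^sup>+x. U i x \<partial>Q)"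
      by (rule ennreal_SUP_add[OF i i])
    also have "\<dots> = (\<integral>\<^sup>+x. (SUP i. U i x) \<partial>P) + (\<integral>\<^sup>+x. (SUP i. U i x) \<partial>Q)"
      using e[OF m(1)[OF seq(1)]] e[OF m(2)[OF seq(1)]] by simp
    finally show ?case by (simp add: image_comp SUP_apply[abs_def])
  }
qed

text \<open>Here \<open>w\<close> is the absolutely continuous representative of the initial
  velocity with slope \<open>f\<close>, and \<open>N\<close> is a Lebesgue null set outside which
  the initial energy is f^2 dx.\<close>

locale init_data =
  fixes \<mu>0 :: "real measure" and f w :: "real \<Rightarrow> real" and N :: "real set"
  assumes fin: "finite_measure \<mu>0" and sets_mu0 [measurable_cong, simp]: "sets \<mu>0 = sets borel"
    and N_null: "N \<in> null_sets lborel"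
    and ac: "\<And>A. A \<in> sets borel \<Longrightarrow> emeasure \<mu>0 (A - N) = (\<integral>\<^sup>+ x \<in> A. ennreal ((f x)\<^sup>2) \<partial>lborel)"
    and w_ad: "antideriv w f"
begin

sublocale m0: finite_measure \<mu>0 by (rule fin)

definition m where "m = measure \<mu>0 UNIV"
definition F where "F x = measure \<mu>0 {..<x}"
text \<open>\<open>y0\<close> is the generalized inverse of \<open>x + \<mu>0 {..<x}\<close>, so that \<open>\<alpha> + \<gamma> = 1\<close>; off the null set \<open>N\<close>
  carrying the singular part, its slope is \<open>1 / (1 + f\<^sup>2)\<close>.\<close>
definition G where "G x = x + F x"
definition y0 where "y0 \<xi> = Sup {x. G x \<le> \<xi>}"
definition a where "a x = (if x \<in> N then 0 else 1 / (1 + (f x)\<^sup>2))"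
definition \<alpha> where "\<alpha> \<xi> = a (y0 \<xi>)"
definition \<beta> where "\<beta> \<xi> = f (y0 \<xi>) * a (y0 \<xi>)"
definition \<gamma> where "\<gamma> \<xi> = 1 - a (y0 \<xi>)"

lemma space_mu0 [simp]: "space \<mu>0 = UNIV" using sets_eq_imp_space_eq[OF sets_mu0] by simp

lemma f_meas [measurable]: "f \<in> borel_measurable borel" by (rule antideriv_measurable[OF w_ad])
lemma w_meas [measurable]: "w \<in> borel_measurable borel" by (rule borel_measurable_continuous_onI[OF antideriv_continuous[OF w_ad]])
lemma N_meas [measurable]: "N \<in> sets borel" using N_null by auto
lemma a_meas [measurable]: "a \<in> borel_measurable borel" unfolding a_def[abs_def] by measurable

lemma one_plus_sq_pos: "0 < 1 + (f x)\<^sup>2" using zero_le_power2[of "f x"] by linarith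

lemma a_bounds: "0 \<le> a x" "a x \<le> 1" using one_plus_sq_pos[of x] by (auto simp: a_def)

lemma F_mono: "x \<le> y \<Longrightarrow> F x \<le> F y" unfolding F_def by (rule m0.finite_measure_mono) auto
lemma F_bounds: "0 \<le> F x" "F x \<le> m" unfolding F_def m_def by (auto intro: m0.finite_measure_mono)

text \<open>\<open>F\<close> measures open half-lines and is therefore left continuous, so the
  supremum defining \<open>y0\<close> belongs to its set. The bounds 0 \<le> F \<le> m make the set
  nonempty and bounded above.\<close>

lemma G_galois: "x \<le> y0 \<xi> \<longleftrightarrow> G x \<le> \<xi>"
proof -
  let ?S = "{x. G x \<le> \<xi>}"
  have ne: "\<xi> - m \<in> ?S" using F_bounds[of "\<xi> - m"] by (simp add: G_def)
  have bb: "bdd_above ?S"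
  proof (rule bdd_aboveI)
    fix x assume "x \<in> ?S" then show "x \<le> \<xi>" using F_bounds[of x] by (simp add: G_def)
  qed
  have Gm: "G x \<le> G y" if "x \<le> y" for x y using F_mono[OF that] that by (simp add: G_def)
  define s where "s = Sup ?S"
  have 1: "G (s - inverse (real (Suc n))) \<le> \<xi>" for n
  proof -
    have "s - inverse (real (Suc n)) < Sup ?S" by (simp add: s_def)
    then obtain x where "x \<in> ?S" "s - inverse (real (Suc n)) < x" using less_cSupE[of _ ?S] ne by blast
    then show ?thesis using Gm[of "s - inverse (real (Suc n))" x] by simp
  qed
  have "(\<lambda>n. measure \<mu>0 {..<s - inverse (real (Suc n))}) \<longlonglongrightarrow> measure \<mu>0 (\<Union>n. {..<s - inverse (real (Suc n))})"
  proof (rule m0.finite_Lim_measure_incseq)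
    show "incseq (\<lambda>n. {..<s - inverse (real (Suc n))})"
    proof (rule incseq_SucI)
      fix n have "inverse (real (Suc (Suc n))) \<le> inverse (real (Suc n))" by (rule le_imp_inverse_le) auto
      then show "{..<s - inverse (real (Suc n))} \<subseteq> {..<s - inverse (real (Suc (Suc n)))}" by auto
    qed
  qed auto
  also have "(\<Union>n. {..<s - inverse (real (Suc n))}) = {..<s}"
  proof (intro equalityI subsetI)
    fix x assume "x \<in> {..<s}"
    then have "0 < s - x" by simp
    from reals_Archimedean[OF this] obtain n where "inverse (real (Suc n)) < s - x" by blast
    then have "x \<in> {..<s - inverse (real (Suc n))}" by simp
    then show "x \<in> (\<Union>n. {..<s - inverse (real (Suc n))})" by blast
  next
    fix x assume "x \<in> (\<Union>n. {..<s - inverse (real (Suc n))})"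
    then obtain n where "x < s - inverse (real (Suc n))" by blast
    moreover have "0 < inverse (real (Suc n))" by simp
    ultimately have "x < s" by linarith
    then show "x \<in> {..<s}" by simp
  qed
  finally have "(\<lambda>n. (s - inverse (real (Suc n))) + F (s - inverse (real (Suc n)))) \<longlonglongrightarrow> (s - 0) + F s"
    unfolding F_def by (intro tendsto_add tendsto_diff tendsto_const LIMSEQ_inverse_real_of_nat)
  then have "G s \<le> \<xi>" using 1 unfolding G_def by (rule_tac LIMSEQ_le_const2) auto
  then have S: "s \<in> ?S" by simp
  show ?thesis unfolding y0_def s_def[symmetric]
  proof
    assume "x \<le> s" then show "G x \<le> \<xi>" using Gm[of x s] S by simp
  next
    assume "G x \<le> \<xi>" then show "x \<le> s" unfolding s_def by (intro cSup_upper[OF _ bb]) simp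
  qed
qed

lemma y0_near: "y0 \<xi> \<le> \<xi>" "\<xi> - m \<le> y0 \<xi>"
proof -
  show "y0 \<xi> \<le> \<xi>" using G_galois[of "y0 \<xi>" \<xi>] F_bounds[of "y0 \<xi>"] by (simp add: G_def)
  show "\<xi> - m \<le> y0 \<xi>" using G_galois[of "\<xi> - m" \<xi>] F_bounds[of "\<xi> - m"] by (simp add: G_def)
qed

lemma y0_mono: "\<xi> \<le> \<eta> \<Longrightarrow> y0 \<xi> \<le> y0 \<eta>"
  using G_galois[of "y0 \<xi>" \<xi>] G_galois[of "y0 \<xi>" \<eta>] by simp

lemma y0_meas [measurable]: "y0 \<in> borel_measurable borel"
  by (rule borel_measurable_mono) (rule monoI, rule y0_mono)

lemma abg_meas [measurable]: "\<alpha> \<in> borel_measurable borel" "\<beta> \<in> borel_measurable borel" "\<gamma> \<in> borel_measurable borel"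
  unfolding \<alpha>_def[abs_def] \<beta>_def[abs_def] \<gamma>_def[abs_def] by measurable

definition \<Lambda> :: "real measure" where "\<Lambda> = measure_of UNIV (sets borel) (\<lambda>A. emeasure lborel A + emeasure \<mu>0 A)"

lemma sets_\<Lambda>: "sets \<Lambda> = sets borel"
  unfolding \<Lambda>_def by (subst sets_measure_of) (auto simp: sets.sigma_sets_eq[of borel, simplified])

lemma emeasure_\<Lambda>: "A \<in> sets borel \<Longrightarrow> emeasure \<Lambda> A = emeasure lborel A + emeasure \<mu>0 A"
  unfolding \<Lambda>_def
proof (rule emeasure_measure_of_sigma)
  show "sigma_algebra UNIV (sets borel)" using sets.sigma_algebra_axioms[of borel] by simp
  show "positive (sets borel) (\<lambda>A. emeasure lborel A + emeasure \<mu>0 A)" by (simp add: positive_def)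
  show "countably_additive (sets borel) (\<lambda>A. emeasure lborel A + emeasure \<mu>0 A)"
    by (rule countably_additiveI) (auto simp: suminf_add[symmetric] suminf_emeasure)
qed

text \<open>The label parametrises the measure dx + d\<mu>0: a jump of \<open>G\<close> at an atom
  becomes an interval of labels on which \<open>y0\<close> is constant, with length equal to the
  mass of the atom.\<close>

lemma distr_y0: "distr lborel borel y0 = \<Lambda>"
proof (rule measure_eqI_Ico)
  fix x z :: real assume xz: "x < z"
  have "y0 -` {x..<z} = {G x..<G z}"
  proof (intro equalityI subsetI)
    fix \<xi> assume "\<xi> \<in> y0 -` {x..<z}"
    then have "x \<le> y0 \<xi>" "\<not> z \<le> y0 \<xi>" by auto
    then show "\<xi> \<in> {G x..<G z}" unfolding G_galois by auto
  next
    fix \<xi> assume "\<xi> \<in> {G x..<G z}"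
    then have "x \<le> y0 \<xi>" "\<not> z \<le> y0 \<xi>" unfolding G_galois by auto
    then show "\<xi> \<in> y0 -` {x..<z}" by auto
  qed
  moreover have "G x \<le> G z" using F_mono[of x z] xz by (simp add: G_def)
  ultimately have 1: "emeasure (distr lborel borel y0) {x..<z} = ennreal (G z - G x)"
    by (subst emeasure_distr) auto
  have "F z - F x = measure \<mu>0 {x..<z}"
  proof -
    have "{x..<z} = {..<z} - {..<x}" by auto
    then show ?thesis unfolding F_def using m0.finite_measure_Diff[of "{..<z}" "{..<x}"] xz by simp
  qed
  then have "G z - G x = z - x + measure \<mu>0 {x..<z}" by (simp add: G_def)
  then have 2: "emeasure \<Lambda> {x..<z} = ennreal (G z - G x)"
    using xz by (simp add: emeasure_\<Lambda> m0.emeasure_eq_measure ennreal_plus[symmetric] del: ennreal_plus)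
  show "emeasure (distr lborel borel y0) {x..<z} = emeasure \<Lambda> {x..<z}" using 1 2 by simp
  show "emeasure (distr lborel borel y0) {x..<z} \<noteq> \<infinity>" using 1 by simp
qed (auto simp: sets_\<Lambda>)

lemma nn_y0:
  assumes [measurable]: "h \<in> borel_measurable borel"
  shows "(\<integral>\<^sup>+\<xi>. h (y0 \<xi>) \<partial>lborel) = (\<integral>\<^sup>+x. h x \<partial>lborel) + (\<integral>\<^sup>+x. h x \<partial>\<mu>0)"
proof -
  have "(\<integral>\<^sup>+\<xi>. h (y0 \<xi>) \<partial>lborel) = (\<integral>\<^sup>+x. h x \<partial>distr lborel borel y0)"
    by (rule nn_integral_distr[symmetric]) measurable
  also have "\<dots> = (\<integral>\<^sup>+x. h x \<partial>\<Lambda>)" by (simp only: distr_y0)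
  also have "\<dots> = (\<integral>\<^sup>+x. h x \<partial>lborel) + (\<integral>\<^sup>+x. h x \<partial>\<mu>0)"
    by (rule nn_integral_sum_measure) (auto simp: sets_\<Lambda> emeasure_\<Lambda> measurable_cong_sets[OF sets_\<Lambda> refl])
  finally show ?thesis .
qed

lemma density_off_N: "density \<mu>0 (\<lambda>x. indicator (- N) x) = density lborel (\<lambda>x. ennreal ((f x)\<^sup>2))"
proof (rule measure_eqI)
  fix A assume "A \<in> sets (density \<mu>0 (\<lambda>x. indicator (- N) x))"
  then have [measurable]: "A \<in> sets borel" by simp
  have "emeasure (density \<mu>0 (\<lambda>x. indicator (- N) x)) A = (\<integral>\<^sup>+x. indicator (A - N) x \<partial>\<mu>0)"
  proof (subst emeasure_density)
    show "(\<integral>\<^sup>+x. indicator (- N) x * indicator A x \<partial>\<mu>0) = (\<integral>\<^sup>+x. indicator (A - N) x \<partial>\<mu>0)"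
      by (rule nn_integral_cong) (auto simp: indicator_def)
  qed auto
  also have "\<dots> = emeasure \<mu>0 (A - N)" by simp
  also have "\<dots> = (\<integral>\<^sup>+ x \<in> A. ennreal ((f x)\<^sup>2) \<partial>lborel)" by (rule ac) simp
  also have "\<dots> = emeasure (density lborel (\<lambda>x. ennreal ((f x)\<^sup>2))) A" by (subst emeasure_density) auto
  finally show "emeasure (density \<mu>0 (\<lambda>x. indicator (- N) x)) A = emeasure (density lborel (\<lambda>x. ennreal ((f x)\<^sup>2))) A" .
qed simp

lemma nn_off_N:
  assumes [measurable]: "h \<in> borel_measurable borel"
  shows "(\<integral>\<^sup>+x. indicator (- N) x * h x \<partial>\<mu>0) = (\<integral>\<^sup>+x. ennreal ((f x)\<^sup>2) * h x \<partial>lborel)"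
proof -
  have "(\<integral>\<^sup>+x. indicator (- N) x * h x \<partial>\<mu>0) = (\<integral>\<^sup>+x. h x \<partial>density \<mu>0 (\<lambda>x. indicator (- N) x))"
    by (rule nn_integral_density[symmetric]) measurable
  also have "\<dots> = (\<integral>\<^sup>+x. ennreal ((f x)\<^sup>2) * h x \<partial>lborel)"
    unfolding density_off_N by (rule nn_integral_density) measurable
  finally show ?thesis .
qed

lemma AE_not_N: "AE x in lborel. x \<notin> N" by (rule AE_not_in[OF N_null])

text \<open>Outside \<open>N\<close> the measure dx + d\<mu>0 is (1 + f^2) dx, and \<open>a\<close>
  is the reciprocal of that density; on \<open>N\<close> it is 0. So weighting with \<open>a\<close>
  removes exactly the energy.\<close>

lemma distr_\<alpha>: "distr (density lborel (\<lambda>\<xi>. ennreal (\<alpha> \<xi>))) borel y0 = lborel"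
proof (rule measure_eqI)
  fix A assume "A \<in> sets (distr (density lborel (\<lambda>\<xi>. ennreal (\<alpha> \<xi>))) borel y0)"
  then have [measurable]: "A \<in> sets borel" by simp
  let ?a = "\<lambda>x. 1 / (1 + (f x)\<^sup>2)"
  have "emeasure (distr (density lborel (\<lambda>\<xi>. ennreal (\<alpha> \<xi>))) borel y0) A = (\<integral>\<^sup>+x. indicator A x \<partial>distr (density lborel (\<lambda>\<xi>. ennreal (\<alpha> \<xi>))) borel y0)" by simp
  also have "\<dots> = (\<integral>\<^sup>+\<xi>. ennreal (a (y0 \<xi>)) * indicator A (y0 \<xi>) \<partial>lborel)"
    by (subst nn_integral_distr) (simp_all add: nn_integral_density \<alpha>_def)
  also have "\<dots> = (\<integral>\<^sup>+x. ennreal (a x) * indicator A x \<partial>lborel) + (\<integral>\<^sup>+x. ennreal (a x) * indicator A x \<partial>\<mu>0)"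
    by (rule nn_y0[of "\<lambda>x. ennreal (a x) * indicator A x"]) measurable
  also have "(\<integral>\<^sup>+x. ennreal (a x) * indicator A x \<partial>lborel) = (\<integral>\<^sup>+x. ennreal (?a x) * indicator A x \<partial>lborel)"
    by (rule nn_integral_cong_AE) (use AE_not_N in \<open>eventually_elim, simp add: a_def\<close>)
  also have "(\<integral>\<^sup>+x. ennreal (a x) * indicator A x \<partial>\<mu>0) = (\<integral>\<^sup>+x. indicator (- N) x * (ennreal (?a x) * indicator A x) \<partial>\<mu>0)"
    by (rule nn_integral_cong) (simp add: a_def)
  also have "\<dots> = (\<integral>\<^sup>+x. ennreal ((f x)\<^sup>2) * (ennreal (?a x) * indicator A x) \<partial>lborel)" by (rule nn_off_N) measurable
  also have "(\<integral>\<^sup>+x. ennreal (?a x) * indicator A x \<partial>lborel) + \<dots> = (\<integral>\<^sup>+x. ennreal (?a x) * indicator A x + ennreal ((f x)\<^sup>2) * (ennreal (?a x) * indicator A x) \<partial>lborel)"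
    by (rule nn_integral_add[symmetric]) measurable
  also have "\<dots> = (\<integral>\<^sup>+x. indicator A x \<partial>lborel)"
  proof (rule nn_integral_cong)
    fix x
    have "?a x + (f x)\<^sup>2 * ?a x = 1"
      using one_plus_sq_pos[of x] by (simp add: add_divide_distrib[symmetric])
    then have "ennreal (?a x) + ennreal ((f x)\<^sup>2) * ennreal (?a x) = 1"
      by (simp add: ennreal_mult[symmetric] ennreal_plus[symmetric] del: ennreal_plus)
    then show "ennreal (?a x) * indicator A x + ennreal ((f x)\<^sup>2) * (ennreal (?a x) * indicator A x) = indicator A x"
      by (cases "x \<in> A") auto
  qed
  finally show "emeasure (distr (density lborel (\<lambda>\<xi>. ennreal (\<alpha> \<xi>))) borel y0) A = emeasure lborel A" by simp
qed simp

text \<open>The complementary weight 1 - a keeps f^2 dx outside \<open>N\<close> and all of \<mu>0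
  on \<open>N\<close>. Together these recompose \<mu>0, including its singular part.\<close>

lemma distr_\<gamma>: "distr (density lborel (\<lambda>\<xi>. ennreal (\<gamma> \<xi>))) borel y0 = \<mu>0"
proof (rule measure_eqI)
  fix A assume "A \<in> sets (distr (density lborel (\<lambda>\<xi>. ennreal (\<gamma> \<xi>))) borel y0)"
  then have [measurable]: "A \<in> sets borel" by simp
  let ?g = "\<lambda>x. 1 - 1 / (1 + (f x)\<^sup>2)"
  have "emeasure (distr (density lborel (\<lambda>\<xi>. ennreal (\<gamma> \<xi>))) borel y0) A = (\<integral>\<^sup>+x. indicator A x \<partial>distr (density lborel (\<lambda>\<xi>. ennreal (\<gamma> \<xi>))) borel y0)" by simp
  also have "\<dots> = (\<integral>\<^sup>+\<xi>. ennreal (1 - a (y0 \<xi>)) * indicator A (y0 \<xi>) \<partial>lborel)"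
    by (subst nn_integral_distr) (simp_all add: nn_integral_density \<gamma>_def)
  also have "\<dots> = (\<integral>\<^sup>+x. ennreal (1 - a x) * indicator A x \<partial>lborel) + (\<integral>\<^sup>+x. ennreal (1 - a x) * indicator A x \<partial>\<mu>0)"
    by (rule nn_y0[of "\<lambda>x. ennreal (1 - a x) * indicator A x"]) measurable
  also have "(\<integral>\<^sup>+x. ennreal (1 - a x) * indicator A x \<partial>lborel) = (\<integral>\<^sup>+x. ennreal (?g x) * indicator A x \<partial>lborel)"
    by (rule nn_integral_cong_AE) (use AE_not_N in \<open>eventually_elim, simp add: a_def\<close>)
  also have "(\<integral>\<^sup>+x. ennreal (1 - a x) * indicator A x \<partial>\<mu>0) = (\<integral>\<^sup>+x. indicator (A \<inter> N) x + indicator (- N) x * (ennreal (?g x) * indicator A x) \<partial>\<mu>0)"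
    by (rule nn_integral_cong) (auto simp: a_def indicator_def)
  also have "\<dots> = (\<integral>\<^sup>+x. indicator (A \<inter> N) x \<partial>\<mu>0) + (\<integral>\<^sup>+x. indicator (- N) x * (ennreal (?g x) * indicator A x) \<partial>\<mu>0)"
    by (rule nn_integral_add) measurable
  also have "(\<integral>\<^sup>+x. indicator (- N) x * (ennreal (?g x) * indicator A x) \<partial>\<mu>0) = (\<integral>\<^sup>+x. ennreal ((f x)\<^sup>2) * (ennreal (?g x) * indicator A x) \<partial>lborel)" by (rule nn_off_N) measurable
  also have "(\<integral>\<^sup>+x. ennreal (?g x) * indicator A x \<partial>lborel) + ((\<integral>\<^sup>+x. indicator (A \<inter> N) x \<partial>\<mu>0) + (\<integral>\<^sup>+x. ennreal ((f x)\<^sup>2) * (ennreal (?g x) * indicator A x) \<partial>lborel))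
      = emeasure \<mu>0 (A \<inter> N) + ((\<integral>\<^sup>+x. ennreal (?g x) * indicator A x \<partial>lborel) + (\<integral>\<^sup>+x. ennreal ((f x)\<^sup>2) * (ennreal (?g x) * indicator A x) \<partial>lborel))" by (simp add: add_ac)
  also have "(\<integral>\<^sup>+x. ennreal (?g x) * indicator A x \<partial>lborel) + (\<integral>\<^sup>+x. ennreal ((f x)\<^sup>2) * (ennreal (?g x) * indicator A x) \<partial>lborel) = (\<integral>\<^sup>+x. ennreal (?g x) * indicator A x + ennreal ((f x)\<^sup>2) * (ennreal (?g x) * indicator A x) \<partial>lborel)"
    by (rule nn_integral_add[symmetric]) measurable
  also have "\<dots> = (\<integral>\<^sup>+x \<in> A. ennreal ((f x)\<^sup>2) \<partial>lborel)"
  proof (rule nn_integral_cong)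
    fix x
    have aux: "(1 - 1 / (1 + s)) + s * (1 - 1 / (1 + s)) = s" if "s \<ge> 0" for s :: real
    proof -
      have ne: "1 + s \<noteq> 0" using that by simp
      then have "1 - 1 / (1 + s) = s / (1 + s)" by (simp add: field_simps)
      then have "(1 - 1 / (1 + s)) + s * (1 - 1 / (1 + s)) = (s * (1 + s)) / (1 + s)"
        by (simp only: distrib_left add_divide_distrib) simp
      also have "\<dots> = s" using ne by simp
      finally show ?thesis .
    qed
    have "?g x + (f x)\<^sup>2 * ?g x = (f x)\<^sup>2" by (rule aux[OF zero_le_power2])
    moreover have g0: "0 \<le> ?g x" using one_plus_sq_pos[of x] by simp
    ultimately have e: "?g x + (f x)\<^sup>2 * ?g x = (f x)\<^sup>2" by simp
    have "ennreal (?g x) + ennreal ((f x)\<^sup>2) * ennreal (?g x) = ennreal ((f x)\<^sup>2)"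
      by (simp only: e ennreal_mult[symmetric, OF zero_le_power2 g0] ennreal_plus[symmetric, OF g0 mult_nonneg_nonneg[OF zero_le_power2 g0]])
    then show "ennreal (?g x) * indicator A x + ennreal ((f x)\<^sup>2) * (ennreal (?g x) * indicator A x) = ennreal ((f x)\<^sup>2) * indicator A x"
      by (cases "x \<in> A") auto
  qed
  also have "\<dots> = emeasure \<mu>0 (A - N)" by (rule ac[symmetric]) simp
  also have "emeasure \<mu>0 (A \<inter> N) + emeasure \<mu>0 (A - N) = emeasure \<mu>0 A"
    by (subst plus_emeasure) (auto intro!: arg_cong[of _ _ "emeasure \<mu>0"])
  finally show "emeasure (distr (density lborel (\<lambda>\<xi>. ennreal (\<gamma> \<xi>))) borel y0) A = emeasure \<mu>0 A" .
qed simp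

lemma integral_\<alpha>:
  fixes g :: "real \<Rightarrow> real"
  assumes [measurable]: "g \<in> borel_measurable borel"
  shows "(\<integral>x. g x \<partial>lborel) = (\<integral>\<xi>. \<alpha> \<xi> * g (y0 \<xi>) \<partial>lborel)"
    "integrable lborel g \<longleftrightarrow> integrable lborel (\<lambda>\<xi>. \<alpha> \<xi> * g (y0 \<xi>))"
proof -
  have "(\<integral>x. g x \<partial>lborel) = (\<integral>x. g x \<partial>distr (density lborel (\<lambda>\<xi>. ennreal (\<alpha> \<xi>))) borel y0)"
    by (simp only: distr_\<alpha>)
  also have "\<dots> = (\<integral>\<xi>. g (y0 \<xi>) \<partial>density lborel (\<lambda>\<xi>. ennreal (\<alpha> \<xi>)))"
    by (rule integral_distr) measurable
  also have "\<dots> = (\<integral>\<xi>. \<alpha> \<xi> *\<^sub>R g (y0 \<xi>) \<partial>lborel)"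
    by (rule integral_density) (use a_bounds in \<open>simp_all add: \<alpha>_def\<close>)
  finally show "(\<integral>x. g x \<partial>lborel) = (\<integral>\<xi>. \<alpha> \<xi> * g (y0 \<xi>) \<partial>lborel)" by simp
  have "integrable lborel g \<longleftrightarrow> integrable (distr (density lborel (\<lambda>\<xi>. ennreal (\<alpha> \<xi>))) borel y0) g"
    by (simp only: distr_\<alpha>)
  also have "\<dots> \<longleftrightarrow> integrable (density lborel (\<lambda>\<xi>. ennreal (\<alpha> \<xi>))) (\<lambda>\<xi>. g (y0 \<xi>))"
    by (rule integrable_distr_eq) measurable
  also have "\<dots> \<longleftrightarrow> integrable lborel (\<lambda>\<xi>. \<alpha> \<xi> *\<^sub>R g (y0 \<xi>))"
    by (rule integrable_density) (use a_bounds in \<open>simp_all add: \<alpha>_def\<close>)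
  finally show "integrable lborel g \<longleftrightarrow> integrable lborel (\<lambda>\<xi>. \<alpha> \<xi> * g (y0 \<xi>))" by simp
qed

lemma AE_\<alpha>: "AE x in lborel. P x \<Longrightarrow> AE \<xi> in lborel. \<alpha> \<xi> = 0 \<or> P (y0 \<xi>)"
proof -
  assume "AE x in lborel. P x"
  then have "AE x in distr (density lborel (\<lambda>\<xi>. ennreal (\<alpha> \<xi>))) borel y0. P x" by (subst distr_\<alpha>)
  then have "AE \<xi> in density lborel (\<lambda>\<xi>. ennreal (\<alpha> \<xi>)). P (y0 \<xi>)" by (rule AE_distrD[rotated]) auto
  then have "AE \<xi> in lborel. 0 < ennreal (\<alpha> \<xi>) \<longrightarrow> P (y0 \<xi>)" by (subst (asm) AE_density) auto
  then show ?thesis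
  proof eventually_elim
    case (elim \<xi>)
    then show ?case using a_bounds(1)[of "y0 \<xi>"] by (cases "\<alpha> \<xi> = 0") (auto simp: \<alpha>_def less_le)
  qed
qed

text \<open>\<open>y0\<close> is monotone, so the preimage of an interval of positions is an
  interval of labels up to labels sharing the position of an endpoint. Those labels have
  \<open>\<alpha>\<close> = 0 almost everywhere and do not contribute.\<close>

lemma antideriv_y0:
  assumes W: "antideriv W g"
  shows "antideriv (\<lambda>\<xi>. W (y0 \<xi>)) (\<lambda>\<xi>. \<alpha> \<xi> * g (y0 \<xi>))"
  unfolding antideriv_def
proof (intro allI impI)
  fix p q :: real assume pq: "p \<le> q"
  have [measurable]: "g \<in> borel_measurable borel" by (rule antideriv_measurable[OF W])
  have yy: "y0 p \<le> y0 q" by (rule y0_mono[OF pq])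
  let ?h = "\<lambda>x. indicator {y0 p..y0 q} x * g x"
  have i: "integrable lborel ?h" using antideriv_integrable[OF W, of "y0 p" "y0 q"] unfolding set_integrable_def by simp
  have I: "(\<integral>x. ?h x \<partial>lborel) = W (y0 q) - W (y0 p)"
    using antideriv_eq[OF W yy] unfolding set_lebesgue_integral_def by simp
  have hm: "?h \<in> borel_measurable borel" by measurable
  have e: "AE \<xi> in lborel. \<alpha> \<xi> * ?h (y0 \<xi>) = indicator {p..q} \<xi> *\<^sub>R (\<alpha> \<xi> * g (y0 \<xi>))"
    using AE_\<alpha>[OF lborel_AE_neq[of "y0 p"]] AE_\<alpha>[OF lborel_AE_neq[of "y0 q"]]
  proof eventually_elim
    case (elim \<xi>)
    show ?case
    proof (cases "\<alpha> \<xi> = 0")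
      case False
      then have ne: "y0 \<xi> \<noteq> y0 p" "y0 \<xi> \<noteq> y0 q" using elim by auto
      have "y0 \<xi> \<in> {y0 p..y0 q} \<longleftrightarrow> \<xi> \<in> {p..q}"
      proof
        assume "y0 \<xi> \<in> {y0 p..y0 q}"
        then have "y0 p < y0 \<xi>" "y0 \<xi> < y0 q" using ne by auto
        then show "\<xi> \<in> {p..q}" using y0_mono[of \<xi> p] y0_mono[of q \<xi>] by (auto simp: not_le[symmetric] intro: ccontr)
      qed (use y0_mono in auto)
      then show ?thesis by (simp add: indicator_def)
    qed simp
  qed
  have m: "(\<lambda>\<xi>. \<alpha> \<xi> * ?h (y0 \<xi>)) \<in> borel_measurable lborel" "(\<lambda>\<xi>. indicator {p..q} \<xi> *\<^sub>R (\<alpha> \<xi> * g (y0 \<xi>))) \<in> borel_measurable lborel"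
    by measurable
  show "set_integrable lborel {p..q} (\<lambda>\<xi>. \<alpha> \<xi> * g (y0 \<xi>)) \<and> (LBINT \<xi>:{p..q}. \<alpha> \<xi> * g (y0 \<xi>)) = W (y0 q) - W (y0 p)"
    using integral_\<alpha>(1)[OF hm] integral_\<alpha>(2)[OF hm] i I integrable_cong_AE[OF m e] integral_cong_AE[OF m e]
    unfolding set_integrable_def set_lebesgue_integral_def by simp
qed

lemma \<gamma>_integrable: "integrable lborel \<gamma>" and \<gamma>_total: "(\<integral>\<xi>. \<gamma> \<xi> \<partial>lborel) = m"
  and \<gamma>_set: "A \<in> sets borel \<Longrightarrow> (\<integral>\<xi>. indicator A (y0 \<xi>) * \<gamma> \<xi> \<partial>lborel) = measure \<mu>0 A"
proof -
  have g0: "0 \<le> \<gamma> \<xi>" for \<xi> using a_bounds by (simp add: \<gamma>_def)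
  have em: "(\<integral>\<^sup>+\<xi>. ennreal (\<gamma> \<xi>) * indicator A (y0 \<xi>) \<partial>lborel) = emeasure \<mu>0 A" if [measurable]: "A \<in> sets borel" for A
  proof -
    have "emeasure \<mu>0 A = (\<integral>\<^sup>+x. indicator A x \<partial>distr (density lborel (\<lambda>\<xi>. ennreal (\<gamma> \<xi>))) borel y0)"
      unfolding distr_\<gamma> by simp
    also have "\<dots> = (\<integral>\<^sup>+\<xi>. ennreal (\<gamma> \<xi>) * indicator A (y0 \<xi>) \<partial>lborel)"
      by (subst nn_integral_distr) (simp_all add: nn_integral_density)
    finally show ?thesis by simp
  qed
  have "(\<integral>\<^sup>+\<xi>. ennreal (\<gamma> \<xi>) \<partial>lborel) < \<infinity>" using em[of UNIV] by (simp add: m0.emeasure_eq_measure)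
  then show i: "integrable lborel \<gamma>" using g0 by (simp add: integrable_iff_bounded)
  show I: "(\<integral>\<xi>. indicator A (y0 \<xi>) * \<gamma> \<xi> \<partial>lborel) = measure \<mu>0 A" if [measurable]: "A \<in> sets borel" for A
  proof -
    have "ennreal (\<integral>\<xi>. indicator A (y0 \<xi>) * \<gamma> \<xi> \<partial>lborel) = (\<integral>\<^sup>+\<xi>. ennreal (indicator A (y0 \<xi>) * \<gamma> \<xi>) \<partial>lborel)"
    proof (rule nn_integral_eq_integral[symmetric])
      show "integrable lborel (\<lambda>\<xi>. indicator A (y0 \<xi>) * \<gamma> \<xi>)"
        by (rule Bochner_Integration.integrable_bound[OF i]) (auto simp: indicator_def)
    qed (use g0 in simp)
    also have "\<dots> = (\<integral>\<^sup>+\<xi>. ennreal (\<gamma> \<xi>) * indicator A (y0 \<xi>) \<partial>lborel)"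
      by (rule nn_integral_cong) (simp add: indicator_def)
    also have "\<dots> = ennreal (measure \<mu>0 A)" using em[of A] by (simp add: m0.emeasure_eq_measure)
    finally show ?thesis using g0 by (subst (asm) ennreal_inj) (auto intro: integral_nonneg_AE)
  qed
  from I[of UNIV] show "(\<integral>\<xi>. \<gamma> \<xi> \<partial>lborel) = m" by (simp add: m_def)
qed

lemma \<beta>_sq: "(\<beta> \<xi>)\<^sup>2 = \<alpha> \<xi> * \<gamma> \<xi>"
proof (cases "y0 \<xi> \<in> N")
  case False
  let ?q = "1 + (f (y0 \<xi>))\<^sup>2"
  have q: "?q > 0" by (rule one_plus_sq_pos)
  have "\<gamma> \<xi> = (f (y0 \<xi>))\<^sup>2 * (1 / ?q)" using False q by (simp add: \<gamma>_def a_def field_simps)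
  then show ?thesis using False by (simp add: \<alpha>_def \<beta>_def a_def power2_eq_square)
qed (simp add: \<alpha>_def \<beta>_def a_def)

lemma chart_init: "chart \<alpha> \<beta> \<gamma> y0 (\<lambda>\<xi>. w (y0 \<xi>)) m"
proof
  show "0 \<le> \<alpha> x" "0 \<le> \<gamma> x" "(\<beta> x)\<^sup>2 = \<alpha> x * \<gamma> x" for x
    using a_bounds \<beta>_sq by (auto simp: \<alpha>_def \<gamma>_def)
  have "antideriv (\<lambda>x. x) (\<lambda>x. 1)" by (rule antideriv_DERIV) auto
  from antideriv_y0[OF this] show "antideriv y0 \<alpha>" by simp
  from antideriv_y0[OF w_ad] show "antideriv (\<lambda>\<xi>. w (y0 \<xi>)) \<beta>" by (simp add: \<alpha>_def[abs_def] \<beta>_def[abs_def] mult.commute)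
  show "integrable lborel \<gamma>" by (rule \<gamma>_integrable)
  show "\<bar>y0 x - x\<bar> \<le> m" for x using y0_near[of x] F_bounds[of 0] by (simp add: abs_le_iff)
qed

lemma w_modulus: "(w x - w z)\<^sup>2 \<le> \<bar>x - z\<bar> * m"
proof -
  have "(\<integral>\<^sup>+x. ennreal ((f x)\<^sup>2) \<partial>lborel) = emeasure \<mu>0 (UNIV - N)" using ac[of UNIV] by simp
  also have "\<dots> \<le> ennreal m" unfolding m0.emeasure_eq_measure m_def by (intro ennreal_leI m0.finite_measure_mono) auto
  finally have le: "(\<integral>\<^sup>+x. ennreal ((f x)\<^sup>2) \<partial>lborel) \<le> ennreal m" .
  also have "\<dots> < \<infinity>" by simp
  finally have i: "integrable lborel (\<lambda>x. (f x)\<^sup>2)" by (simp add: integrable_iff_bounded)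
  have m0: "0 \<le> m" by (simp add: m_def)
  have le2: "(\<integral>x. (f x)\<^sup>2 \<partial>lborel) \<le> m" using le nn_integral_eq_integral[OF i] m0 by simp
  define q where "q x = (\<integral>z. indicator {..<x} z * (f z)\<^sup>2 \<partial>lborel)" for x
  have q: "antideriv q (\<lambda>x. (f x)\<^sup>2)" unfolding q_def[abs_def] by (rule antideriv_of_integrable[OF i])
  have q0: "0 \<le> q x" for x unfolding q_def by (rule integral_nonneg_AE) simp
  have q1: "q x \<le> m" for x
  proof -
    have "q x \<le> (\<integral>x. (f x)\<^sup>2 \<partial>lborel)" unfolding q_def
    proof (rule integral_mono)
      show "integrable lborel (\<lambda>z. indicator {..<x} z * (f z)\<^sup>2)" using integrable_mult_indicator[OF _ i, of "{..<x}"] by simp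
      show "indicator {..<x} z * (f z)\<^sup>2 \<le> (f z)\<^sup>2" for z by (simp add: indicator_def)
    qed (rule i)
    then show ?thesis using le2 by simp
  qed
  have idad: "antideriv (\<lambda>x. x) (\<lambda>x. 1)" by (rule antideriv_DERIV) auto
  have *: "(w z - w x)\<^sup>2 \<le> (z - x) * m" if "x \<le> z" for x z
  proof -
    have "(w z - w x)\<^sup>2 \<le> (z - x) * (q z - q x)"
      by (rule antideriv_Cauchy_Schwarz[OF w_ad idad q that]) auto
    also have "\<dots> \<le> (z - x) * m" using q0[of x] q1[of z] that by (intro mult_left_mono) auto
    finally show ?thesis .
  qed
  show ?thesis
  proof (cases "x \<le> z")
    case True then show ?thesis using *[OF True] by (simp add: power2_commute)
  next
    case False then show ?thesis using *[of z x] by simp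
  qed
qed

end

text \<open>The square of w(x) is averaged over the unit interval to the right of x, where w
  oscillates little, differs from e by at most c, and e is square integrable over the whole line.
  Splitting a square of a sum twice gives the factors 2 and 4 in \<open>Q\<close>.\<close>

lemma bounded_of_modulus:
  fixes w e :: "real \<Rightarrow> real"
  assumes mod: "\<And>x z. \<bar>x - z\<bar> \<le> 1 \<Longrightarrow> (w x - w z)\<^sup>2 \<le> m"
    and e: "L2 e" and b: "AE x in lborel. \<bar>w x - e x\<bar> \<le> c"
  obtains C where "\<And>x. \<bar>w x\<bar> \<le> C"
proof -
  define Q where "Q = 4 * (\<integral>z. (e z)\<^sup>2 \<partial>lborel) + 4 * c\<^sup>2 + 2 * m"
  have ei: "integrable lborel (\<lambda>z. (e z)\<^sup>2)" using e unfolding L2_def by blast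
  have "(w x)\<^sup>2 \<le> Q" for x
  proof -
    have i1: "integrable lborel (\<lambda>z. indicator {x..x+1} z * k)" for k :: real
      by (intro integrable_mult_left integrable_real_indicator) (auto simp: emeasure_lborel_Icc_eq)
    have i2: "integrable lborel (\<lambda>z. indicator {x..x+1} z * (4 * c\<^sup>2 + 2 * m) + 4 * (e z)\<^sup>2)"
      using i1 ei by simp
    have "(w x)\<^sup>2 = (\<integral>z. indicator {x..x+1} z * (w x)\<^sup>2 \<partial>lborel)" by simp
    also have "\<dots> \<le> (\<integral>z. indicator {x..x+1} z * (4 * c\<^sup>2 + 2 * m) + 4 * (e z)\<^sup>2 \<partial>lborel)"
    proof (rule integral_mono_AE[OF i1 i2])
      show "AE z in lborel. indicator {x..x+1} z * (w x)\<^sup>2 \<le> indicator {x..x+1} z * (4 * c\<^sup>2 + 2 * m) + 4 * (e z)\<^sup>2"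
        using b
      proof eventually_elim
        case (elim z)
        show ?case
        proof (cases "z \<in> {x..x+1}")
          case True
          have sq: "(p + q)\<^sup>2 \<le> 2 * p\<^sup>2 + 2 * q\<^sup>2" for p q :: real
          proof -
            have "0 \<le> (p - q)\<^sup>2" by simp
            then show ?thesis by (simp add: power2_sum power2_diff)
          qed
          have 1: "(w x - w z)\<^sup>2 \<le> m" using True by (intro mod) auto
          have "(w x)\<^sup>2 \<le> 2 * (w x - w z)\<^sup>2 + 2 * (w z)\<^sup>2" using sq[of "w x - w z" "w z"] by simp
          moreover have "(w z)\<^sup>2 \<le> 2 * (w z - e z)\<^sup>2 + 2 * (e z)\<^sup>2" using sq[of "w z - e z" "e z"] by simp
          moreover have "(w z - e z)\<^sup>2 \<le> c\<^sup>2" using elim by (simp add: abs_le_square_iff[symmetric])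
          ultimately show ?thesis using True 1 by simp
        qed simp
      qed
    qed
    also have "\<dots> = Q" using i1 ei by (simp add: Q_def)
    finally show ?thesis .
  qed
  then have "\<bar>w x\<bar> \<le> sqrt Q" for x using real_sqrt_le_mono[of "(w x)\<^sup>2" Q] by simp
  then show thesis by (rule that)
qed

section \<open>The initial data at infinity in Lagrangian variables\<close>

lemma L2_shift: assumes "L2 g" shows "L2 (\<lambda>x. g (x - c))"
proof -
  have [measurable]: "g \<in> borel_measurable borel" and i: "integrable lborel (\<lambda>x. (g x)\<^sup>2)" using assms unfolding L2_def by auto
  have "integrable lborel (\<lambda>x. (g (- c + 1 * x))\<^sup>2)" by (rule lborel_integrable_real_affine[OF i]) simp
  then show ?thesis unfolding L2_def by simp
qed

lemma L2_cong_AE: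
  assumes "L2 f" "AE x in lborel. f x = g x" "g \<in> borel_measurable borel" shows "L2 g"
proof -
  have [measurable]: "f \<in> borel_measurable borel" using assms(1) unfolding L2_def by blast
  note [measurable] = assms(3)
  have "integrable lborel (\<lambda>x. (f x)\<^sup>2) \<longleftrightarrow> integrable lborel (\<lambda>x. (g x)\<^sup>2)"
  proof (rule integrable_cong_AE)
    show "AE x in lborel. (f x)\<^sup>2 = (g x)\<^sup>2" using assms(2) by eventually_elim simp
  qed measurable
  then show ?thesis using assms unfolding L2_def by simp
qed

lemma emeasure_half_line: "emeasure lborel {x::real..} = \<infinity>"
proof (rule ennreal_eq_top_of_nat_le)
  fix n :: nat
  have "emeasure lborel {x..x + real n} \<le> emeasure lborel {x..}" by (rule emeasure_mono) auto
  then show "ennreal (real n) \<le> emeasure lborel {x..}" by simp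
qed

context psi begin

lemma psp_step_L2:
  assumes near: "\<And>\<xi>. \<bar>y \<xi> - \<xi>\<bar> \<le> K" and [measurable]: "y \<in> borel_measurable borel"
  shows "L2 (\<lambda>\<xi>. (if 0 \<le> \<xi> then 1 else 0) - psp (y \<xi>))"
proof (rule L2_bounded_support[of _ 1 "K + 1"])
  show "\<bar>(if 0 \<le> x then 1 else 0) - psp (y x)\<bar> \<le> 1" for x using psp_bounds[of "y x"] by auto
  fix x :: real assume x: "\<bar>x\<bar> > K + 1"
  have "K \<ge> 0" using near[of 0] by linarith
  show "(if 0 \<le> x then 1 else 0) - psp (y x) = 0"
  proof (cases "0 \<le> x")
    case True
    then have "y x \<ge> 1" using near[of x] x by linarith
    then show ?thesis using True psp_right by simp
  next
    case False
    then have "y x \<le> -1" using near[of x] x by linarith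
    then show ?thesis using False psp_left by simp
  qed
qed measurable

end

text \<open>The numbers \<open>ca\<close> and \<open>cb\<close> are the asymptotic values of the
  initial velocity; \<open>cm\<close> is the one of the cumulative energy and will turn out to be
  the total energy.\<close>

locale init_psi = init_data \<mu>0 f w N + psi psp psm
  for \<mu>0 f w N psp psm +
  fixes e g :: "real \<Rightarrow> real" and ca cb cm :: real
  assumes e_L2: "L2 e" and w_e: "AE x in lborel. w x = e x + ca * psp x + cb * psm x"
    and g_L2: "L2 g" and F_g: "AE x in lborel. measure \<mu>0 {..<x} = g x + cm * psp x"
begin

lemma w_bounded: obtains C where "\<And>x. \<bar>w x\<bar> \<le> C"
proof (rule bounded_of_modulus[of w m e "\<bar>ca\<bar> + \<bar>cb\<bar>"])
  have m0: "0 \<le> m" by (simp add: m_def)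
  show "(w x - w z)\<^sup>2 \<le> m" if "\<bar>x - z\<bar> \<le> 1" for x z
    using w_modulus[of x z] mult_right_mono[OF that m0] by simp
  show "AE x in lborel. \<bar>w x - e x\<bar> \<le> \<bar>ca\<bar> + \<bar>cb\<bar>"
    using w_e
  proof eventually_elim
    case (elim x)
    have "\<bar>ca * psp x\<bar> \<le> \<bar>ca\<bar>" "\<bar>cb * psm x\<bar> \<le> \<bar>cb\<bar>"
      using psp_bounds[of x] by (auto simp: abs_mult psm_eq mult_left_le)
    then show ?case using elim by linarith
  qed
qed (rule e_L2, rule that)

lemma F_meas [measurable]: "F \<in> borel_measurable borel"
  by (rule borel_measurable_mono) (rule monoI, rule F_mono)

lemma F_tendsto: "(\<lambda>n. F (real n)) \<longlonglongrightarrow> m"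
proof -
  have "(\<lambda>n. measure \<mu>0 {..<real n}) \<longlonglongrightarrow> measure \<mu>0 (\<Union>n. {..<real n})"
    by (rule m0.finite_Lim_measure_incseq) (auto simp: incseq_def)
  also have "(\<Union>n. {..<real n}) = UNIV" using reals_Archimedean2 by auto
  finally show ?thesis by (simp add: F_def m_def)
qed

text \<open>The cumulative energy tends to m at the right end. If \<open>cm\<close> differed from m,
  then g = F - cm would stay away from 0 on a half-line and could not be square integrable.\<close>

lemma cm_eq: "cm = m"
proof (rule ccontr)
  assume ne: "cm \<noteq> m"
  define d where "d = \<bar>m - cm\<bar> / 2"
  have d: "d > 0" using ne by (simp add: d_def)
  obtain n where n: "\<bar>F (real n) - m\<bar> < d"
    using LIMSEQ_D[OF F_tendsto d] by auto
  define X where "X = max 1 (real n)"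
  have far: "d \<le> \<bar>F x - cm\<bar>" if "X \<le> x" for x
  proof -
    have "F (real n) \<le> F x" using that by (intro F_mono) (simp add: X_def)
    then have "\<bar>F x - m\<bar> < d" using n F_bounds[of x] by linarith
    moreover have "\<bar>m - cm\<bar> \<le> \<bar>F x - m\<bar> + \<bar>F x - cm\<bar>" by linarith
    moreover have "\<bar>m - cm\<bar> = 2 * d" by (simp add: d_def)
    ultimately show ?thesis by linarith
  qed
  define h where "h x = indicator {X..} x * (F x - cm)" for x
  have "L2 h"
  proof (rule L2_cong_AE)
    have [measurable]: "g \<in> borel_measurable borel" using g_L2 unfolding L2_def by blast
    show "L2 (\<lambda>x. indicator {X..} x * g x)"
      by (rule L2_AE_bound[OF g_L2]) (auto simp: indicator_def)
    show "AE x in lborel. indicator {X..} x * g x = h x"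
      using F_g by eventually_elim (auto simp: h_def F_def[symmetric] psp_right X_def indicator_def)
    show "h \<in> borel_measurable borel" unfolding h_def[abs_def] by measurable
  qed
  then have "L2 (\<lambda>x. d * indicator {X..} x)"
  proof (rule L2_AE_bound)
    show "\<bar>d * indicator {X..} x\<bar> \<le> \<bar>h x\<bar>" for x using far[of x] d by (auto simp: h_def indicator_def)
  qed measurable
  then have "d = 0" by (rule L2_const_half_line[of _ "{X..}"]) (auto simp: emeasure_half_line)
  with d show False by simp
qed

lemma F_step_L2: "L2 (\<lambda>x. F x - (if 0 \<le> x then m else 0))"
proof (rule L2_cong_AE)
  show "L2 (\<lambda>x. g x - m * ((if 0 \<le> x then 1 else 0) - psp x))"
    by (intro L2_diff g_L2 L2_cmult psp_step_L2[of "\<lambda>x. x" 0]) auto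
  show "AE x in lborel. g x - m * ((if 0 \<le> x then 1 else 0) - psp x) = F x - (if 0 \<le> x then m else 0)"
    using F_g by eventually_elim (auto simp: F_def[symmetric] cm_eq algebra_simps)
qed measurable

text \<open>A label exceeds its position by at least 0 and at most m, which squeezes the cumulative
  energy in labels between F(\<xi> - m) and F(\<xi>). Square integrability is thus inherited from F
  and its translate.\<close>

lemma H_step_L2: "L2 (\<lambda>\<xi>. chart.H \<gamma> \<xi> - (if 0 \<le> \<xi> then m else 0))"
proof -
  interpret c: chart \<alpha> \<beta> \<gamma> y0 "\<lambda>\<xi>. w (y0 \<xi>)" m by (rule chart_init)
  let ?D = "\<lambda>x. F x - (if 0 \<le> x then m else 0)"
  have g0: "0 \<le> \<gamma> z" for z by (rule c.\<gamma>_nonneg)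
  have ind: "integrable lborel (\<lambda>z. indicator S z * \<gamma> z)" if [measurable]: "S \<in> sets borel" for S
    using integrable_mult_indicator[OF _ \<gamma>_integrable, of S] by simp
  have ind2: "integrable lborel (\<lambda>z. indicator S (y0 z) * \<gamma> z)" if [measurable]: "S \<in> sets borel" for S
    by (rule Bochner_Integration.integrable_bound[OF \<gamma>_integrable]) (auto simp: indicator_def)
  have m0: "0 \<le> m" by (simp add: m_def)
  have H0: "0 \<le> chart.H \<gamma> \<xi>" "chart.H \<gamma> \<xi> \<le> m" for \<xi>
  proof -
    show "0 \<le> chart.H \<gamma> \<xi>" unfolding c.H_def by (rule integral_nonneg_AE) (use g0 in \<open>auto simp: indicator_def\<close>)
    show "chart.H \<gamma> \<xi> \<le> m" unfolding c.H_def \<gamma>_total[symmetric]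
      by (rule integral_mono[OF ind \<gamma>_integrable]) (use g0 in \<open>auto simp: indicator_def\<close>)
  qed
  have up: "chart.H \<gamma> \<xi> \<le> F \<xi>" for \<xi>
  proof -
    have "chart.H \<gamma> \<xi> \<le> (\<integral>z. indicator {..<\<xi>} (y0 z) * \<gamma> z \<partial>lborel)" unfolding c.H_def
    proof (rule integral_mono[OF ind ind2])
      show "indicator {..<\<xi>} z * \<gamma> z \<le> indicator {..<\<xi>} (y0 z) * \<gamma> z" for z
        using g0[of z] y0_near(1)[of z] by (auto simp: indicator_def)
    qed auto
    also have "\<dots> = F \<xi>" unfolding F_def by (rule \<gamma>_set) simp
    finally show ?thesis .
  qed
  have low: "F (\<xi> - m) \<le> chart.H \<gamma> \<xi>" for \<xi>
  proof -
    have "F (\<xi> - m) = (\<integral>z. indicator {..<\<xi> - m} (y0 z) * \<gamma> z \<partial>lborel)" unfolding F_def by (rule \<gamma>_set[symmetric]) simp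
    also have "\<dots> \<le> chart.H \<gamma> \<xi>" unfolding c.H_def
    proof (rule integral_mono[OF ind2 ind])
      show "indicator {..<\<xi> - m} (y0 z) * \<gamma> z \<le> indicator {..<\<xi>} z * \<gamma> z" for z
        using g0[of z] y0_near(2)[of z] by (auto simp: indicator_def)
    qed auto
    finally show ?thesis .
  qed
  \<comment> \<open>The first summand dominates for \<xi> < 0, the second for \<xi> \<ge> m, and the
    third on the gap in between, where the two steps disagree.\<close>
  have "L2 (\<lambda>\<xi>. \<bar>?D \<xi>\<bar> + \<bar>?D (\<xi> - m)\<bar> + m * indicator {-m..m} \<xi>)"
  proof (intro L2_add L2_cmult)
    show "L2 (\<lambda>\<xi>. \<bar>?D \<xi>\<bar>)" using F_step_L2 unfolding L2_def by auto
    have "L2 (\<lambda>\<xi>. ?D (\<xi> - m))" by (rule L2_shift[OF F_step_L2])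
    then show "L2 (\<lambda>\<xi>. \<bar>?D (\<xi> - m)\<bar>)" unfolding L2_def by auto
    show "L2 (indicator {-m..m})" by (rule L2_bounded_support[of _ 1 m]) (auto simp: indicator_def)
  qed
  then show ?thesis
  proof (rule L2_AE_bound)
    have [measurable]: "chart.H \<gamma> \<in> borel_measurable borel"
      by (rule borel_measurable_continuous_onI[OF antideriv_continuous[OF c.H_ad]])
    show "(\<lambda>\<xi>. chart.H \<gamma> \<xi> - (if 0 \<le> \<xi> then m else 0)) \<in> borel_measurable borel" by measurable
    fix \<xi> :: real
    have "\<bar>chart.H \<gamma> \<xi> - (if 0 \<le> \<xi> then m else 0)\<bar> \<le> \<bar>?D \<xi>\<bar> + \<bar>?D (\<xi> - m)\<bar> + m * indicator {-m..m} \<xi>"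
    proof (cases "0 \<le> \<xi>")
      case False
      then have "\<bar>chart.H \<gamma> \<xi>\<bar> \<le> \<bar>F \<xi>\<bar>" using up[of \<xi>] H0[of \<xi>] by linarith
      moreover have "0 \<le> m * indicator {-m..m} \<xi>" using m0 by simp
      ultimately show ?thesis using False by simp
    next
      case True
      show ?thesis
      proof (cases "m \<le> \<xi>")
        case m: True
        then have "\<bar>chart.H \<gamma> \<xi> - m\<bar> \<le> \<bar>F (\<xi> - m) - m\<bar>" using low[of \<xi>] H0[of \<xi>] by linarith
        moreover have "0 \<le> m * indicator {-m..m} \<xi>" using m0 by simp
        ultimately show ?thesis using True m by simp
      next
        case False
        then have "m * indicator {-m..m} \<xi> = m" using True m0 by (simp add: indicator_def)
        moreover have "\<bar>chart.H \<gamma> \<xi> - (if 0 \<le> \<xi> then m else 0)\<bar> \<le> m" using True H0[of \<xi>] by (simp add: abs_le_iff)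
        ultimately show ?thesis using abs_ge_zero[of "?D \<xi>"] abs_ge_zero[of "?D (\<xi> - m)"] by linarith
      qed
    qed
    then show "\<bar>chart.H \<gamma> \<xi> - (if 0 \<le> \<xi> then m else 0)\<bar> \<le> \<bar>\<bar>?D \<xi>\<bar> + \<bar>?D (\<xi> - m)\<bar> + m * indicator {-m..m} \<xi>\<bar>" by linarith
  qed
qed

text \<open>Integrating over labels amounts to integrating over positions against dx + d\<mu>0.
  Square integrability in x handles the first part; for the second, \<mu>0 may be singular, and the
  boundedness of w together with the finiteness of \<mu>0 is used.\<close>

lemma U_step_L2: "L2 (\<lambda>\<xi>. w (y0 \<xi>) - (if 0 \<le> \<xi> then ca else cb))"
proof -
  obtain C where C: "\<And>x. \<bar>w x\<bar> \<le> C" by (rule w_bounded) blast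
  define E where "E x = w x - ca * psp x - cb * psm x" for x
  have Em[measurable]: "E \<in> borel_measurable borel" unfolding E_def[abs_def] by measurable
  have EL: "L2 E"
    by (rule L2_cong_AE[OF e_L2 _ Em]) (use w_e in \<open>eventually_elim, simp add: E_def\<close>)
  have Eb: "\<bar>E x\<bar> \<le> C + \<bar>ca\<bar> + \<bar>cb\<bar>" for x
  proof -
    have "\<bar>ca * psp x\<bar> \<le> \<bar>ca\<bar>" "\<bar>cb * psm x\<bar> \<le> \<bar>cb\<bar>"
      using psp_bounds[of x] by (auto simp: abs_mult psm_eq mult_left_le)
    then show ?thesis using C[of x] unfolding E_def by linarith
  qed
  have "L2 (\<lambda>\<xi>. E (y0 \<xi>))"
  proof -
    have "(\<integral>\<^sup>+\<xi>. ennreal ((E (y0 \<xi>))\<^sup>2) \<partial>lborel) = (\<integral>\<^sup>+x. ennreal ((E x)\<^sup>2) \<partial>lborel) + (\<integral>\<^sup>+x. ennreal ((E x)\<^sup>2) \<partial>\<mu>0)"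
      by (rule nn_y0[of "\<lambda>x. ennreal ((E x)\<^sup>2)"]) measurable
    also have "\<dots> < \<infinity>"
    proof -
      have "(\<integral>\<^sup>+x. ennreal ((E x)\<^sup>2) \<partial>lborel) < \<infinity>" using EL unfolding L2_def by (simp add: integrable_iff_bounded)
      moreover have "(\<integral>\<^sup>+x. ennreal ((E x)\<^sup>2) \<partial>\<mu>0) \<le> (\<integral>\<^sup>+x. ennreal ((C + \<bar>ca\<bar> + \<bar>cb\<bar>)\<^sup>2) \<partial>\<mu>0)"
      proof (rule nn_integral_mono, rule ennreal_leI)
        fix x
        have "\<bar>E x\<bar> \<le> \<bar>C + \<bar>ca\<bar> + \<bar>cb\<bar>\<bar>" using Eb[of x] by linarith
        then show "(E x)\<^sup>2 \<le> (C + \<bar>ca\<bar> + \<bar>cb\<bar>)\<^sup>2" by (simp only: abs_le_square_iff)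
      qed
      then have "(\<integral>\<^sup>+x. ennreal ((E x)\<^sup>2) \<partial>\<mu>0) < \<infinity>"
        by (rule le_less_trans) (simp add: m0.emeasure_eq_measure ennreal_mult[symmetric])
      ultimately show ?thesis by simp
    qed
    finally show ?thesis unfolding L2_def by (simp add: integrable_iff_bounded)
  qed
  note LE = this
  have Lp: "L2 (\<lambda>\<xi>. (if 0 \<le> \<xi> then 1 else 0) - psp (y0 \<xi>))"
    by (rule psp_step_L2[of _ m]) (use y0_near F_bounds[of 0] in \<open>auto simp: abs_le_iff algebra_simps intro: order_trans\<close>)
  have "L2 (\<lambda>\<xi>. E (y0 \<xi>) - (ca - cb) * ((if 0 \<le> \<xi> then 1 else 0) - psp (y0 \<xi>)))"
    by (rule L2_diff[OF LE L2_cmult[OF Lp]])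
  also have "(\<lambda>\<xi>. E (y0 \<xi>) - (ca - cb) * ((if 0 \<le> \<xi> then 1 else 0) - psp (y0 \<xi>))) = (\<lambda>\<xi>. w (y0 \<xi>) - (if 0 \<le> \<xi> then ca else cb))"
    by (auto simp: E_def psm_eq algebra_simps)
  finally show ?thesis .
qed

lemma existence:
  "\<exists>u \<mu>. HS_weak_conservative psp psm u \<mu> \<and> (\<forall>x. u 0 x = w x) \<and> \<mu> 0 = \<mu>0"
proof -
  obtain C where C: "\<And>x. \<bar>w x\<bar> \<le> C" by (rule w_bounded) blast
  interpret c: chart \<alpha> \<beta> \<gamma> y0 "\<lambda>\<xi>. w (y0 \<xi>)" m by (rule chart_init)
  interpret l: lagrangian psp psm \<alpha> \<beta> \<gamma> y0 "\<lambda>\<xi>. w (y0 \<xi>)" m C ca cb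
  proof (unfold_locales)
    show "\<alpha> \<xi> + \<gamma> \<xi> = 1" for \<xi> by (simp add: \<alpha>_def \<gamma>_def)
    show "\<bar>w (y0 \<xi>)\<bar> \<le> C" for \<xi> by (rule C)
    show "L2 (\<lambda>\<xi>. w (y0 \<xi>) - (if 0 \<le> \<xi> then ca else cb))" by (rule U_step_L2)
    show "L2 (\<lambda>\<xi>. chart.H \<gamma> \<xi> - (if 0 \<le> \<xi> then (\<integral>\<xi>. \<gamma> \<xi> \<partial>lborel) else 0))"
      unfolding \<gamma>_total by (rule H_step_L2)
  qed
  have Y0: "l.Y 0 = y0" by (rule ext) (simp add: l.Y_def)
  have V0: "l.V 0 = (\<lambda>\<xi>. w (y0 \<xi>))" by (rule ext) (simp add: l.V_def)
  have "l.us 0 x = w x" for x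
    unfolding Y0 V0 using c.u_y[of "c.inv x"] by (simp add: c.y_inv)
  moreover have "l.mus 0 = \<mu>0" unfolding Y0 c.mu_def by (rule distr_\<gamma>)
  ultimately show ?thesis using l.solution by blast
qed

end

lemma HS_existence:
  assumes psi: "psi_pair psp psm" and D: "in_D psp psm u0 \<mu>0"
  shows "\<exists>u \<mu>. HS_weak_conservative psp psm u \<mu> \<and> (AE x in lborel. u 0 x = u0 x) \<and> \<mu> 0 = \<mu>0"
proof -
  from D obtain f where wd: "weak_deriv u0 f" and ac: "ac_part_density \<mu>0 (\<lambda>x. (f x)\<^sup>2)" unfolding in_D_def by blast
  from ac obtain N where N: "N \<in> null_sets lborel" "\<And>A. A \<in> sets borel \<Longrightarrow> emeasure \<mu>0 (A - N) = (\<integral>\<^sup>+ x \<in> A. ennreal ((f x)\<^sup>2) \<partial>lborel)"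
    unfolding ac_part_density_def by blast
  obtain w where w: "antideriv w f" "AE x in lborel. u0 x = w x" by (rule weak_deriv_imp_antideriv[OF wd])
  from D obtain e ca cb where e: "L2 e" "AE x in lborel. u0 x = e x + ca * psp x + cb * psm x"
    unfolding in_D_def in_E2_def H1_def by blast
  from D obtain g cm where g: "L2 g" "AE x in lborel. measure \<mu>0 {..<x} = g x + cm * psp x"
    unfolding in_D_def in_E10_def by blast
  have fb: "finite_measure \<mu>0" "sets \<mu>0 = sets borel" using D unfolding in_D_def fin_borel_measure_def by auto
  have "AE x in lborel. w x = e x + ca * psp x + cb * psm x" using w(2) e(2) by eventually_elim simp
  note we = this
  interpret init_psi \<mu>0 f w N psp psm e g ca cb cm
    by (rule init_psi.intro[OF init_data.intro psi.intro init_psi_axioms.intro])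
      (fact fb N w(1) e(1) g we psi)+
  from existence obtain u \<mu> where u: "HS_weak_conservative psp psm u \<mu>" "\<forall>x. u 0 x = w x" "\<mu> 0 = \<mu>0" by blast
  have "AE x in lborel. u 0 x = u0 x" using w(2) by eventually_elim (simp add: u(2))
  with u show ?thesis by blast
qed

section \<open>Differentiation in time of weak solutions\<close>

lemma fold_pd_prod:
  assumes "smooth1 a" "smooth1 b"
  shows "\<exists>a1 b1. smooth1 a1 \<and> smooth1 b1 \<and> fold pd ds (\<lambda>(t,x). a t * b x) = (\<lambda>(t,x). a1 t * b1 x)"
  using assms
proof (induction ds arbitrary: a b)
  case Nil
  then show ?case by auto
next
  case (Cons d ds)
  have d: "deriv (\<lambda>s. a s * c) t = deriv a t * c" "deriv (\<lambda>s. c * b s) t = c * deriv b t" for c t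
    using smooth1_DERIV[OF Cons.prems(1), of t] smooth1_DERIV[OF Cons.prems(2), of t]
    by (auto intro!: DERIV_imp_deriv derivative_eq_intros)
  have "pd d (\<lambda>(t,x). a t * b x) = (if d then (\<lambda>(t,x). deriv a t * b x) else (\<lambda>(t,x). a t * deriv b x))"
    by (auto simp: pd_def d)
  then show ?case
    using Cons.IH[of "deriv a" b] Cons.IH[of a "deriv b"] Cons.prems smooth1_deriv by (cases d) simp_all
qed

lemma test2_prod:
  assumes a: "test1 a" and b: "test1 b"
  shows "test2 (\<lambda>(t,x). a t * b x)"
    "pd True (\<lambda>(t,x). a t * b x) (t,x) = deriv a t * b x"
    "pd False (\<lambda>(t,x). a t * b x) (t,x) = a t * deriv b x"
proof -
  note sa = test1_smooth[OF a] and sb = test1_smooth[OF b]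
  have "smooth2 (\<lambda>(t,x). a t * b x)" unfolding smooth2_def
  proof (intro allI conjI)
    fix ds t x
    obtain a1 b1 where ab: "smooth1 a1" "smooth1 b1" and e: "fold pd ds (\<lambda>(t,x). a t * b x) = (\<lambda>(t,x). a1 t * b1 x)"
      using fold_pd_prod[OF sa sb] by blast
    have c: "continuous_on UNIV a1" "continuous_on UNIV b1" using ab smooth1_continuous by auto
    show "continuous_on UNIV (fold pd ds (\<lambda>(t,x). a t * b x))" unfolding e case_prod_beta
      by (intro continuous_intros continuous_on_compose2[OF c(1)] continuous_on_compose2[OF c(2)]) auto
    show "(\<lambda>s. fold pd ds (\<lambda>(t,x). a t * b x) (s, x)) differentiable at t"
      "(\<lambda>y. fold pd ds (\<lambda>(t,x). a t * b x) (t, y)) differentiable at x"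
      unfolding e using smooth1_DERIV[OF ab(1), of t] smooth1_DERIV[OF ab(2), of x]
      by (auto simp: real_differentiable_def intro!: derivative_eq_intros exI)
  qed
  moreover have "bounded {p. (\<lambda>(t,x). a t * b x) p \<noteq> 0}"
  proof (rule bounded_subset)
    show "bounded ({t. a t \<noteq> 0} \<times> {x. b x \<noteq> 0})" using a b by (intro bounded_Times) (auto simp: test1_def)
    show "{p. (\<lambda>(t,x). a t * b x) p \<noteq> 0} \<subseteq> {t. a t \<noteq> 0} \<times> {x. b x \<noteq> 0}" by auto
  qed
  ultimately show "test2 (\<lambda>(t,x). a t * b x)" by (simp add: test2_def)
  show "pd True (\<lambda>(t,x). a t * b x) (t,x) = deriv a t * b x" unfolding pd_True prod.case
    using smooth1_DERIV[OF sa, of t] by (auto intro!: DERIV_imp_deriv derivative_eq_intros)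
  show "pd False (\<lambda>(t,x). a t * b x) (t,x) = a t * deriv b x" unfolding pd_False prod.case
    using smooth1_DERIV[OF sb, of x] by (auto intro!: DERIV_imp_deriv derivative_eq_intros)
qed

lemma lipschitz_of_deriv:
  fixes f :: "real \<Rightarrow> real"
  assumes "\<And>x. (f has_real_derivative f' x) (at x)" "\<And>x. \<bar>f' x\<bar> \<le> K"
  shows "\<bar>f x - f y\<bar> \<le> K * \<bar>x - y\<bar>"
  using field_differentiable_bound[of UNIV f f' K x y] assms by auto

lemma quadratic_bound:
  fixes f :: "real \<Rightarrow> real"
  assumes d: "\<And>x. (f has_real_derivative f' x) (at x)" "\<And>x. (f' has_real_derivative f'' x) (at x)" "\<And>x. \<bar>f'' x\<bar> \<le> K"
  shows "\<bar>f (x + h) - f x - h * f' x\<bar> \<le> K * h\<^sup>2"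
proof -
  have K0: "0 \<le> K" using d(3)[of 0] by linarith
  let ?S = "closed_segment x (x + h)"
  have "norm ((\<lambda>z. f z - z * f' x) (x + h) - (\<lambda>z. f z - z * f' x) x) \<le> (K * \<bar>h\<bar>) * norm ((x + h) - x)"
  proof (rule field_differentiable_bound[where S = ?S])
    show "((\<lambda>z. f z - z * f' x) has_field_derivative f' z - f' x) (at z within ?S)" for z
      by (rule has_field_derivative_at_within) (auto intro!: derivative_eq_intros d(1))
    show "norm (f' z - f' x) \<le> K * \<bar>h\<bar>" if "z \<in> ?S" for z
    proof -
      have "\<bar>z - x\<bar> \<le> \<bar>h\<bar>" using that by (auto simp: closed_segment_eq_real_ivl split: if_splits)
      then show ?thesis using lipschitz_of_deriv[OF d(2,3), of z x] mult_left_mono[OF _ K0, of "\<bar>z - x\<bar>" "\<bar>h\<bar>"] by simp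
    qed
  qed auto
  then show ?thesis by (simp add: power2_eq_square algebra_simps)
qed

lemma integrable_mult_bounded:
  fixes k g :: "'a \<Rightarrow> real"
  assumes k: "integrable M k" and [measurable]: "g \<in> borel_measurable M" and b: "\<And>x. \<bar>g x\<bar> \<le> c"
  shows "integrable M (\<lambda>x. k x * g x)"
proof -
  have [measurable]: "k \<in> borel_measurable M" using k by auto
  have c0: "0 \<le> c" using b[of undefined] by linarith
  have "integrable M (\<lambda>x. k x * c)" using k by simp
  then show ?thesis
  proof (rule Bochner_Integration.integrable_bound)
    show "AE x in M. norm (k x * g x) \<le> norm (k x * c)"
      using b c0 by (intro AE_I2) (auto simp: abs_mult intro!: mult_left_mono)
  qed measurable
qed

text \<open>A bounded second derivative makes the Taylor error uniformly quadratic, so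
  differentiation under the integral is a direct estimate. The measure is general because the result
  is applied both to Lebesgue measure and to the energy measures.\<close>

lemma deriv_convolution:
  fixes b :: "real \<Rightarrow> real"
  assumes k: "integrable M k" and sets: "sets M = sets borel"
    and d: "\<And>x. (b has_real_derivative b' x) (at x)" "\<And>x. (b' has_real_derivative b'' x) (at x)"
    and bd: "\<And>x. \<bar>b x\<bar> \<le> K0" "\<And>x. \<bar>b' x\<bar> \<le> K1" "\<And>x. \<bar>b'' x\<bar> \<le> K2"
  shows "((\<lambda>s. \<integral>x. k x * b (x - s) \<partial>M) has_real_derivative - (\<integral>x. k x * b' (x - s) \<partial>M)) (at s)"
  unfolding DERIV_def
proof -
  note [measurable_cong] = sets
  have cb: "continuous_on UNIV b" "continuous_on UNIV b'"
    by (rule DERIV_continuous_on, rule has_field_derivative_at_within, rule d)+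
  have [measurable]: "b \<in> borel_measurable borel" "b' \<in> borel_measurable borel"
    using cb by (auto intro: borel_measurable_continuous_onI)
  have i0: "integrable M (\<lambda>x. k x * b (x - s))" for s by (rule integrable_mult_bounded[OF k _ bd(1)]) measurable
  have i1: "integrable M (\<lambda>x. k x * b' (x - s))" for s by (rule integrable_mult_bounded[OF k _ bd(2)]) measurable
  define Q where "Q h = ((\<integral>x. k x * b (x - (s + h)) \<partial>M) - (\<integral>x. k x * b (x - s) \<partial>M)) / h" for h
  define D where "D = - (\<integral>x. k x * b' (x - s) \<partial>M)"
  define C where "C = K2 * (\<integral>x. \<bar>k x\<bar> \<partial>M)"
  have K2: "0 \<le> K2" using bd(3)[of 0] by linarith
  have est: "\<bar>Q h - D\<bar> \<le> C * \<bar>h\<bar>" if "h \<noteq> 0" for h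
  proof -
    have "Q h - D = (1 / h) * ((\<integral>x. k x * b (x - (s + h)) \<partial>M) - (\<integral>x. k x * b (x - s) \<partial>M) + h * (\<integral>x. k x * b' (x - s) \<partial>M))"
      using that by (simp add: Q_def D_def field_simps)
    also have "(\<integral>x. k x * b (x - (s + h)) \<partial>M) - (\<integral>x. k x * b (x - s) \<partial>M) + h * (\<integral>x. k x * b' (x - s) \<partial>M)
        = (\<integral>x. k x * (b (x - s + (- h)) - b (x - s) - (- h) * b' (x - s)) \<partial>M)"
    proof -
      have "(\<integral>x. k x * (b (x - s + (- h)) - b (x - s) - (- h) * b' (x - s)) \<partial>M) = (\<integral>x. (k x * b (x - (s + h)) - k x * b (x - s)) + h * (k x * b' (x - s)) \<partial>M)"
        by (rule Bochner_Integration.integral_cong) (auto simp: algebra_simps)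
      then show ?thesis using i0 i1 by simp
    qed
    finally have e: "\<bar>Q h - D\<bar> = \<bar>1 / h\<bar> * \<bar>\<integral>x. k x * (b (x - s + (- h)) - b (x - s) - (- h) * b' (x - s)) \<partial>M\<bar>"
      by (simp add: abs_mult)
    have "\<bar>\<integral>x. k x * (b (x - s + (- h)) - b (x - s) - (- h) * b' (x - s)) \<partial>M\<bar> \<le> (\<integral>x. \<bar>k x\<bar> * (K2 * h\<^sup>2) \<partial>M)"
    proof (rule order_trans[OF integral_abs_bound integral_mono])
      have q: "\<bar>b (x - s + (- h)) - b (x - s) - (- h) * b' (x - s)\<bar> \<le> K2 * h\<^sup>2" for x
        using quadratic_bound[OF d bd(3), of "x - s" "-h"] by simp
      show "integrable M (\<lambda>x. \<bar>k x * (b (x - s + (- h)) - b (x - s) - (- h) * b' (x - s))\<bar>)"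
        by (intro integrable_abs integrable_mult_bounded[OF k _ q]) measurable
      show "integrable M (\<lambda>x. \<bar>k x\<bar> * (K2 * h\<^sup>2))" using k by simp
      show "\<bar>k x * (b (x - s + (- h)) - b (x - s) - (- h) * b' (x - s))\<bar> \<le> \<bar>k x\<bar> * (K2 * h\<^sup>2)" for x
        unfolding abs_mult by (rule mult_left_mono[OF q]) simp
    qed
    also have "\<dots> = C * h\<^sup>2" by (simp add: C_def)
    finally have "\<bar>Q h - D\<bar> \<le> \<bar>1 / h\<bar> * (C * h\<^sup>2)" unfolding e by (rule mult_left_mono) simp
    also have "\<dots> = C * \<bar>h\<bar>" using that by (simp add: power2_eq_square abs_if)
    finally show ?thesis .
  qed
  have "((\<lambda>h. Q h - D) \<longlongrightarrow> 0) (at 0)"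
  proof (rule Lim_null_comparison)
    show "\<forall>\<^sub>F h in at 0. norm (Q h - D) \<le> C * \<bar>h\<bar>" using est by (auto simp: eventually_at_filter)
    have "((\<lambda>h. C * \<bar>h\<bar>) \<longlongrightarrow> C * \<bar>0\<bar>) (at (0::real))" by (intro tendsto_intros)
    then show "((\<lambda>h. C * \<bar>h\<bar>) \<longlongrightarrow> 0) (at (0::real))" by simp
  qed
  then have "(Q \<longlongrightarrow> D) (at 0)" by (rule LIM_zero_cancel)
  then show "(\<lambda>h. ((\<integral>x. k x * b (x - (s + h)) \<partial>M) - (\<integral>x. k x * b (x - s) \<partial>M)) / h) \<midarrow>0\<rightarrow> - (\<integral>x. k x * b' (x - s) \<partial>M)"
    unfolding Q_def D_def .
qed

lemma moving_frame_DERIV: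
  fixes f :: "real \<Rightarrow> real \<Rightarrow> real"
  assumes fx: "((\<lambda>t. f t (y t0)) has_real_derivative fx) (at t0 within {0..})"
    and fy: "\<And>t s. t \<ge> 0 \<Longrightarrow> ((\<lambda>s. f t s) has_real_derivative fy t s) (at s)"
    and cont: "continuous (at (t0, y t0) within {0..} \<times> UNIV) (\<lambda>(t,s). fy t s)"
    and y: "(y has_real_derivative y') (at t0 within {0..})"
  shows "((\<lambda>t. f t (y t)) has_real_derivative fx + fy t0 (y t0) * y') (at t0 within {0..})"
proof -
  have "((\<lambda>(t, s). f t s) has_derivative (\<lambda>(tx, ty). (fx * tx) + blinfun_apply (blinfun_scaleR_left (fy t0 (y t0))) ty)) (at (t0, y t0) within {0..} \<times> UNIV)"
  proof (rule has_derivative_partialsI)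
    show "((\<lambda>t. f t (y t0)) has_derivative (*) fx) (at t0 within {0..})"
      using fx unfolding has_field_derivative_def .
    show "((\<lambda>s. f t s) has_derivative blinfun_apply (blinfun_scaleR_left (fy t s))) (at s within UNIV)" if "t \<in> {0..}" for t s
      using fy[of t s] that unfolding has_field_derivative_def by (simp add: mult_commute_abs)
    have "continuous (at (t0, y t0) within {0..} \<times> UNIV) (\<lambda>p. blinfun_scaleR_left ((\<lambda>(t,s). fy t s) p))"
      using cont by (intro continuous_intros)
    then show "continuous (at (t0, y t0) within {0..} \<times> UNIV) (\<lambda>(t, s). blinfun_scaleR_left (fy t s))"
      by (simp add: case_prod_unfold)
  qed auto
  then have F: "((\<lambda>p. f (fst p) (snd p)) has_derivative (\<lambda>p. fx * fst p + fy t0 (y t0) * snd p)) (at (t0, y t0) within {0..} \<times> UNIV)"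
    by (simp add: case_prod_unfold mult.commute[of "snd _"])
  have P: "((\<lambda>s. (s, y s)) has_derivative (\<lambda>h. (h, y' * h))) (at t0 within {0..})"
    using y unfolding has_field_derivative_def by (intro has_derivative_Pair has_derivative_ident)
  have sub: "(\<lambda>s. (s, y s)) ` {0..} \<subseteq> {0..} \<times> UNIV" by auto
  have "((\<lambda>t. f (fst (t, y t)) (snd (t, y t))) has_derivative (\<lambda>h. fx * fst (h, y' * h) + fy t0 (y t0) * snd (h, y' * h))) (at t0 within {0..})"
    by (rule has_derivative_in_compose[OF P has_derivative_subset[OF F sub]])
  then have "((\<lambda>t. f t (y t)) has_derivative (\<lambda>h. fx * h + fy t0 (y t0) * (y' * h))) (at t0 within {0..})"
    by simp
  then show ?thesis unfolding has_field_derivative_def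
    by (rule has_derivative_eq_rhs) (simp add: fun_eq_iff algebra_simps)
qed

text \<open>The test functions of time do not vanish at 0, so the weak identity encodes both P' = Q
  and the initial value of P.\<close>

lemma time_derivative:
  fixes P Q :: "real \<Rightarrow> real"
  assumes cP: "continuous_on {0..} P" and cQ: "continuous_on {0..} Q"
    and weak: "\<And>a. test1 a \<Longrightarrow> (\<integral>t. indicator {0..} t * (deriv a t * P t + a t * Q t) \<partial>lborel) = - (a 0 * P 0)"
  shows "t \<ge> 0 \<Longrightarrow> (P has_real_derivative Q t) (at t within {0..})"
proof -
  define Qh where "Qh t = Q (max 0 t)" for t
  define Ph where "Ph t = P (max 0 t)" for t
  have cQh: "continuous_on UNIV Qh" unfolding Qh_def[abs_def]
    by (rule continuous_on_compose2[OF cQ]) (auto intro!: continuous_intros)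
  have cPh: "continuous_on UNIV Ph" unfolding Ph_def[abs_def]
    by (rule continuous_on_compose2[OF cP]) (auto intro!: continuous_intros)
  have "\<exists>F. \<forall>x::real. -\<infinity> < ereal x \<longrightarrow> ereal x < \<infinity> \<longrightarrow> (F has_vector_derivative Qh x) (at x)"
    by (rule einterval_antiderivative) (use cQh continuous_on_eq_continuous_at open_UNIV in auto)
  then obtain q0 where q0: "\<And>x. (q0 has_real_derivative Qh x) (at x)"
    by (auto simp: has_real_derivative_iff_has_vector_derivative)
  define q where "q t = q0 t - q0 0" for t
  have q: "(q has_real_derivative Qh t) (at t)" for t unfolding q_def using q0[of t] by (auto intro!: derivative_eq_intros)
  have cq: "continuous_on UNIV q" using q DERIV_isCont by (blast intro: continuous_at_imp_continuous_on)
  \<comment> \<open>Extended by 0 to negative times, the defect R still has weak derivative 0,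
    across time 0 as well. So it is constant, and the constant is read off at negative
    times.\<close>
  define R where "R t = indicator {0..} t * (Ph t - P 0 - q t)" for t
  have cR0: "continuous_on UNIV (\<lambda>t. Ph t - P 0 - q t)" by (intro continuous_intros cPh cq)
  have Ri: "set_integrable lborel {c..d} R" for c d
  proof -
    have "set_integrable lborel {max 0 c..d} (\<lambda>t. Ph t - P 0 - q t)" by (rule set_integrable_cont[OF cR0])
    also have "?this \<longleftrightarrow> set_integrable lborel {c..d} R" unfolding set_integrable_def
      by (intro arg_cong[of _ _ "integrable lborel"]) (auto simp: R_def indicator_def fun_eq_iff)
    finally show ?thesis .
  qed
  have "(\<integral>t. R t * deriv a t \<partial>lborel) = 0" if t: "test1 a" for a
  proof -
    obtain r where r: "r > 0" "\<And>x. \<bar>x\<bar> \<ge> r \<Longrightarrow> a x = 0" "\<And>x. \<bar>x\<bar> \<ge> r \<Longrightarrow> deriv a x = 0"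
      using test1_support[OF t] by blast
    note sa = test1_smooth[OF t]
    have ca: "continuous_on UNIV a" "continuous_on UNIV (deriv a)" using sa smooth1_continuous smooth1_deriv by auto
    have int: "integrable lborel (\<lambda>t. indicator {0..} t * g t)" if "continuous_on UNIV g" "\<And>x. \<bar>x\<bar> \<ge> r \<Longrightarrow> g x = 0" for g :: "real \<Rightarrow> real"
    proof -
      have "set_integrable lborel {0..r} g" by (rule set_integrable_cont[OF that(1)])
      also have "?this \<longleftrightarrow> ?thesis" unfolding set_integrable_def
      proof (intro arg_cong[of _ _ "integrable lborel"] ext)
        fix x show "indicator {0..r} x *\<^sub>R g x = indicator {0..} x * g x"
          using that(2)[of x] by (auto simp: indicator_def)
      qed
      finally show ?thesis .
    qed
    have I1: "integrable lborel (\<lambda>t. indicator {0..} t * (deriv a t * Ph t + a t * Qh t))"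
      by (rule int) (auto intro!: continuous_intros ca cPh cQh simp: r)
    have I2: "integrable lborel (\<lambda>t. indicator {0..} t * deriv a t)" by (rule int) (auto intro!: ca simp: r)
    have I3: "integrable lborel (\<lambda>t. indicator {0..} t * (Qh t * a t + q t * deriv a t))"
      by (rule int) (auto intro!: continuous_intros ca cQh cq simp: r)
    have 1: "(\<integral>t. indicator {0..} t * (deriv a t * Ph t + a t * Qh t) \<partial>lborel) = - (a 0 * P 0)"
    proof -
      have "(\<integral>t. indicator {0..} t * (deriv a t * Ph t + a t * Qh t) \<partial>lborel) = (\<integral>t. indicator {0..} t * (deriv a t * P t + a t * Q t) \<partial>lborel)"
        by (rule Bochner_Integration.integral_cong) (auto simp: Ph_def Qh_def indicator_def)
      then show ?thesis using weak[OF t] by simp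
    qed
    have 2: "(\<integral>t. indicator {0..} t * deriv a t \<partial>lborel) = - a 0"
      by (rule integral_half_line[OF smooth1_DERIV[OF sa] ca(2) r(1)]) (use r in auto)
    have 3: "(\<integral>t. indicator {0..} t * (Qh t * a t + q t * deriv a t) \<partial>lborel) = - (q 0 * a 0)"
    proof (rule integral_half_line[of "\<lambda>t. q t * a t" _ r])
      show "((\<lambda>t. q t * a t) has_real_derivative Qh t * a t + q t * deriv a t) (at t)" for t
        using q[of t] smooth1_DERIV[OF sa, of t] by (auto intro!: derivative_eq_intros)
      show "continuous_on UNIV (\<lambda>t. Qh t * a t + q t * deriv a t)" by (intro continuous_intros ca cQh cq)
    qed (use r in auto)
    have "(\<integral>t. R t * deriv a t \<partial>lborel) = (\<integral>t. indicator {0..} t * (deriv a t * Ph t + a t * Qh t) - P 0 * (indicator {0..} t * deriv a t) - indicator {0..} t * (Qh t * a t + q t * deriv a t) \<partial>lborel)"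
      by (rule Bochner_Integration.integral_cong) (auto simp: R_def algebra_simps)
    also have "\<dots> = - (a 0 * P 0) - P 0 * (- a 0) - (- (q 0 * a 0))"
      using I1 I2 I3 1 2 3 by simp
    also have "\<dots> = 0" by (simp add: q_def)
    finally show ?thesis .
  qed
  from du_Bois_Reymond[OF Ri this] obtain \<kappa> where \<kappa>: "AE t in lborel. R t = \<kappa>" by blast
  have "\<kappa> = 0"
  proof (rule ccontr)
    assume "\<kappa> \<noteq> 0"
    from \<kappa> have "AE t in lborel. t \<notin> {..<0::real}"
      by eventually_elim (use \<open>\<kappa> \<noteq> 0\<close> in \<open>auto simp: R_def\<close>)
    then have "emeasure lborel {..<0::real} = 0" by (subst (asm) AE_iff_measurable[of "{..<0}"]) auto
    moreover have "emeasure lborel {-1..<0::real} \<le> emeasure lborel {..<0::real}" by (rule emeasure_mono) auto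
    ultimately show False by simp
  qed
  \<comment> \<open>The defect with P and q frozen at their values at 0 for negative times: it
    agrees with R and is evidently continuous, so equality almost everywhere becomes equality
    everywhere.\<close>
  define Rh where "Rh t = Ph t - P 0 - q (max 0 t)" for t
  have "AE t in lborel. Rh t = 0"
    using \<kappa> by eventually_elim (use \<open>\<kappa> = 0\<close> in \<open>auto simp: Rh_def R_def Ph_def q_def indicator_def max_def split: if_splits\<close>)
  moreover have "continuous_on UNIV Rh" unfolding Rh_def[abs_def]
    by (intro continuous_intros cPh continuous_on_compose2[OF cq]) auto
  ultimately have "Rh = (\<lambda>t. 0)" by (intro AE_eq_continuous_imp_eq) auto
  then have Pq: "P t = P 0 + q t" if "t \<ge> 0" for t
  proof -
    have "Rh t = 0" using \<open>Rh = (\<lambda>t. 0)\<close> by simp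
    then show ?thesis using that by (simp add: Rh_def Ph_def)
  qed
  show "(P has_real_derivative Q t) (at t within {0..})" if t: "t \<ge> 0"
  proof -
    have "((\<lambda>t. P 0 + q t) has_real_derivative Q t) (at t within {0..})"
      using has_field_derivative_at_within[OF q[of t], of "{0..}"] t by (auto intro!: derivative_eq_intros simp: Qh_def)
    then show ?thesis by (rule has_field_derivative_transform_within[of _ _ _ _ 1]) (use t in \<open>simp_all add: Pq[symmetric]\<close>)
  qed
qed

lemma DERIV_integral:
  fixes P Q :: "real \<Rightarrow> real"
  assumes cQ: "continuous_on {0..} Q" and d: "\<And>t. t \<ge> 0 \<Longrightarrow> (P has_real_derivative Q t) (at t within {0..})" and t: "t \<ge> 0"
  shows "(LBINT s:{0..t}. Q s) = P t - P 0" "set_integrable lborel {0..t} Q"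
proof -
  have "(P has_vector_derivative Q s) (at s within {0..t})" if "0 \<le> s" for s
    using DERIV_subset[OF d[OF that], of "{0..t}"] by (auto simp: has_real_derivative_iff_has_vector_derivative)
  moreover have "continuous_on {0..t} Q" by (rule continuous_on_subset[OF cQ]) auto
  ultimately have "has_bochner_integral lborel (\<lambda>s. indicator {0..t} s *\<^sub>R Q s) (P t - P 0)"
    by (intro has_bochner_integral_FTC_Icc t) auto
  then show "(LBINT s:{0..t}. Q s) = P t - P 0" "set_integrable lborel {0..t} Q"
    unfolding set_lebesgue_integral_def set_integrable_def by (auto simp: has_bochner_integral_iff)
qed

lemma integral_DERIV:
  fixes P Q :: "real \<Rightarrow> real"
  assumes cQ: "continuous_on {0..} Q" and r: "\<And>t. t \<ge> 0 \<Longrightarrow> P t = P 0 + (LBINT s:{0..t}. Q s)" and t: "t \<ge> 0"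
  shows "(P has_real_derivative Q t) (at t within {0..})"
proof -
  define Qh where "Qh t = Q (max 0 t)" for t
  have cQh: "continuous_on UNIV Qh" unfolding Qh_def[abs_def]
    by (rule continuous_on_compose2[OF cQ]) (auto intro!: continuous_intros)
  have "\<exists>F. \<forall>x::real. -\<infinity> < ereal x \<longrightarrow> ereal x < \<infinity> \<longrightarrow> (F has_vector_derivative Qh x) (at x)"
    by (rule einterval_antiderivative) (use cQh continuous_on_eq_continuous_at open_UNIV in auto)
  then obtain q where q: "\<And>x. (q has_real_derivative Qh x) (at x)"
    by (auto simp: has_real_derivative_iff_has_vector_derivative)
  have "(q has_real_derivative Q s) (at s within {0..})" if "s \<ge> 0" for s
    using has_field_derivative_at_within[OF q[of s]] that by (simp add: Qh_def)
  note qq = this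
  have "P s = P 0 + (q s - q 0)" if "s \<ge> 0" for s
    using r[OF that] DERIV_integral(1)[OF cQ qq that] by simp
  note Pq = this
  have "((\<lambda>s. P 0 + (q s - q 0)) has_real_derivative Q t) (at t within {0..})"
    using qq[OF t] by (auto intro!: derivative_eq_intros)
  then show ?thesis by (rule has_field_derivative_transform_within[of _ _ _ _ 1]) (use t in \<open>simp_all add: Pq[symmetric]\<close>)
qed

section \<open>Estimates valid for every weak conservative solution\<close>

locale weak_solution = psi psp psm for psp psm +
  fixes u :: "real \<Rightarrow> real \<Rightarrow> real" and \<mu> :: "real \<Rightarrow> real measure"
  assumes HS: "HS_weak_conservative psp psm u \<mu>"
begin

lemma D: "t \<ge> 0 \<Longrightarrow> in_D psp psm (u t) (\<mu> t)"
  and weak_u: "test2 \<phi> \<Longrightarrow> (\<integral>t. indicator {0..} t *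
          (\<integral>x. u t x * pd True \<phi> (t,x) + 1/2 * (u t x)\<^sup>2 * pd False \<phi> (t,x)
               + 1/4 * (measure (\<mu> t) {..<x} - measure (\<mu> t) {x<..}) * \<phi> (t,x) \<partial>lborel) \<partial>lborel)
        = - (\<integral>x. u 0 x * \<phi> (0,x) \<partial>lborel)"
  and weak_mu: "test2 \<phi> \<Longrightarrow> (\<integral>t. indicator {0..} t *
          (\<integral>x. pd True \<phi> (t,x) + u t x * pd False \<phi> (t,x) \<partial>(\<mu> t)) \<partial>lborel)
        = - (\<integral>x. \<phi> (0,x) \<partial>(\<mu> 0))"
  and holder: "T > 0 \<Longrightarrow> holder_on ({0..T} \<times> UNIV) (\<lambda>(t,x). u t x)"
  and ac_ae: "\<exists>N \<in> null_sets lborel. \<forall>t\<ge>0. t \<notin> N \<longrightarrow>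
       (\<exists>ux. weak_deriv (u t) ux \<and> \<mu> t = density lborel (\<lambda>x. ennreal ((ux x)\<^sup>2)))"
  and mu_weak: "continuous_on UNIV (f :: real \<Rightarrow> real) \<Longrightarrow> bounded (range f) \<Longrightarrow> continuous_on {0..} (\<lambda>t. \<integral>x. f x \<partial>(\<mu> t))"
proof -
  note H = HS[unfolded HS_weak_conservative_def]
  note H1 = conjunct1[OF H] and H2 = conjunct1[OF conjunct2[OF H]] and H3 = conjunct1[OF conjunct2[OF conjunct2[OF H]]]
    and H4 = conjunct1[OF conjunct2[OF conjunct2[OF conjunct2[OF H]]]] and H5 = conjunct2[OF conjunct2[OF conjunct2[OF conjunct2[OF H]]]]
  show "in_D psp psm (u t) (\<mu> t)" if "t \<ge> 0" by (rule H1[rule_format, OF that])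
  show "(\<integral>t. indicator {0..} t *
          (\<integral>x. u t x * pd True \<phi> (t,x) + 1/2 * (u t x)\<^sup>2 * pd False \<phi> (t,x)
               + 1/4 * (measure (\<mu> t) {..<x} - measure (\<mu> t) {x<..}) * \<phi> (t,x) \<partial>lborel) \<partial>lborel)
        = - (\<integral>x. u 0 x * \<phi> (0,x) \<partial>lborel)"
    "(\<integral>t. indicator {0..} t *
          (\<integral>x. pd True \<phi> (t,x) + u t x * pd False \<phi> (t,x) \<partial>(\<mu> t)) \<partial>lborel)
        = - (\<integral>x. \<phi> (0,x) \<partial>(\<mu> 0))" if "test2 \<phi>"
    using H2[THEN spec, THEN mp, OF that] by (rule conjunct1, rule conjunct2)
  show "holder_on ({0..T} \<times> UNIV) (\<lambda>(t,x). u t x)" if "T > 0"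
    by (rule conjunct1[OF H3[THEN spec, THEN mp, OF that]])
  show "\<exists>N \<in> null_sets lborel. \<forall>t\<ge>0. t \<notin> N \<longrightarrow>
       (\<exists>ux. weak_deriv (u t) ux \<and> \<mu> t = density lborel (\<lambda>x. ennreal ((ux x)\<^sup>2)))" by (rule H4)
  show "continuous_on {0..} (\<lambda>t. \<integral>x. f x \<partial>(\<mu> t))" if "continuous_on UNIV f" "bounded (range f)" for f :: "real \<Rightarrow> real"
    by (rule H5[THEN spec, THEN mp, OF conjI[OF that]])
qed

lemma mfin: "t \<ge> 0 \<Longrightarrow> finite_measure (\<mu> t)" and msets: "t \<ge> 0 \<Longrightarrow> sets (\<mu> t) = sets borel"
  using D[of t] unfolding in_D_def fin_borel_measure_def by simp_all

lemma mspace: "t \<ge> 0 \<Longrightarrow> space (\<mu> t) = UNIV"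
  using sets_eq_imp_space_eq[OF msets] by simp

lemma m_integrable:
  assumes t: "t \<ge> 0" and g: "g \<in> borel_measurable borel" "\<And>x. \<bar>g x\<bar> \<le> (c::real)"
  shows "integrable (\<mu> t) g"
proof -
  interpret finite_measure "\<mu> t" by (rule mfin[OF t])
  show ?thesis by (rule integrable_const_bound[of _ c])
    (use g in \<open>simp_all add: measurable_cong_sets[OF msets[OF t] refl]\<close>)
qed

lemma m_integral_bound:
  assumes t: "t \<ge> 0" and g: "g \<in> borel_measurable borel" "\<And>x. \<bar>g x\<bar> \<le> (c::real)"
  shows "\<bar>\<integral>x. g x \<partial>\<mu> t\<bar> \<le> c * measure (\<mu> t) UNIV"
proof -
  interpret finite_measure "\<mu> t" by (rule mfin[OF t])
  have "\<bar>\<integral>x. g x \<partial>\<mu> t\<bar> \<le> (\<integral>x. \<bar>g x\<bar> \<partial>\<mu> t)" by (rule integral_abs_bound)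
  also have "\<dots> \<le> (\<integral>x. c \<partial>\<mu> t)"
    by (rule integral_mono) (use m_integrable[OF t g] g(2) in auto)
  finally show ?thesis by (simp add: mspace[OF t] mult.commute)
qed

text \<open>The Hoelder estimate on a time strip is global in x, so \<open>u\<close> converges
  uniformly on the line as time converges. Uniformity is what permits limits of integrals against
  measures that change at the same time.\<close>

lemma u_unif:
  assumes X: "X \<longlonglongrightarrow> t" "\<And>n. X n \<ge> 0" "t \<ge> 0"
  obtains c where "c \<longlonglongrightarrow> 0" "\<And>n x. \<bar>u (X n) x - u t x\<bar> \<le> c n"
proof -
  have "Bseq X" using X(1) convergent_imp_Bseq convergentI by blast
  then obtain T where T: "T > 0" "\<And>n. \<bar>X n\<bar> \<le> T" unfolding Bseq_def by auto
  define S where "S = T + t"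
  have S: "S > 0" "t \<le> S" "\<And>n. X n \<le> S" using T X(3) by (auto simp: S_def abs_le_iff add_increasing2)
  from holder[OF S(1)] obtain \<alpha> C where \<alpha>: "0 < \<alpha>" and
    H: "\<And>p q. p \<in> {0..S} \<times> UNIV \<Longrightarrow> q \<in> {0..S} \<times> UNIV \<Longrightarrow> \<bar>(\<lambda>(t,x). u t x) p - (\<lambda>(t,x). u t x) q\<bar> \<le> C * dist p q powr \<alpha>"
    unfolding holder_on_def by blast
  show thesis
  proof (rule that[of "\<lambda>n. C * \<bar>X n - t\<bar> powr \<alpha>"])
    show "\<bar>u (X n) x - u t x\<bar> \<le> C * \<bar>X n - t\<bar> powr \<alpha>" for n x
      using H[of "(X n, x)" "(t, x)"] S X by (simp add: dist_Pair_Pair dist_real_def)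
    have "(\<lambda>n. \<bar>X n - t\<bar>) \<longlonglongrightarrow> 0" using X(1) by (simp add: LIM_zero_iff tendsto_rabs_zero)
    then have "(\<lambda>n. \<bar>X n - t\<bar> powr \<alpha>) \<longlonglongrightarrow> 0"
      by (rule tendsto_zero_powrI[OF _ tendsto_const]) (use \<alpha> in auto)
    then show "(\<lambda>n. C * \<bar>X n - t\<bar> powr \<alpha>) \<longlonglongrightarrow> 0" by (rule tendsto_mult_right_zero)
  qed
qed

lemma u_cont: assumes t: "t \<ge> 0" shows "continuous_on UNIV (u t)"
  unfolding continuous_on_sequentially comp_def
proof (intro allI ballI impI)
  fix x and X :: "nat \<Rightarrow> real" assume X: "(\<forall>n. X n \<in> UNIV) \<and> X \<longlonglongrightarrow> x"
  have "t + 1 > 0" using t by simp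
  from holder[OF this] obtain \<alpha> C where \<alpha>: "0 < \<alpha>" and
    H: "\<And>p q. p \<in> {0..t+1} \<times> UNIV \<Longrightarrow> q \<in> {0..t+1} \<times> UNIV \<Longrightarrow> \<bar>(\<lambda>(t,x). u t x) p - (\<lambda>(t,x). u t x) q\<bar> \<le> C * dist p q powr \<alpha>"
    unfolding holder_on_def by blast
  have "(\<lambda>n. u t (X n) - u t x) \<longlonglongrightarrow> 0"
  proof (rule Lim_null_comparison)
    show "\<forall>\<^sub>F n in sequentially. norm (u t (X n) - u t x) \<le> C * \<bar>X n - x\<bar> powr \<alpha>"
      using H[of "(t, X _)" "(t, x)"] t by (auto simp: dist_Pair_Pair dist_real_def)
    have "(\<lambda>n. \<bar>X n - x\<bar>) \<longlonglongrightarrow> 0" using X by (simp add: LIM_zero_iff tendsto_rabs_zero)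
    then have "(\<lambda>n. \<bar>X n - x\<bar> powr \<alpha>) \<longlonglongrightarrow> 0"
      by (rule tendsto_zero_powrI[OF _ tendsto_const]) (use \<alpha> in auto)
    then show "(\<lambda>n. C * \<bar>X n - x\<bar> powr \<alpha>) \<longlonglongrightarrow> 0" by (rule tendsto_mult_right_zero)
  qed
  then show "(\<lambda>n. u t (X n)) \<longlonglongrightarrow> u t x" by (rule LIM_zero_cancel)
qed

lemma u_meas [measurable]: "t \<ge> 0 \<Longrightarrow> u t \<in> borel_measurable borel"
  by (rule borel_measurable_continuous_onI[OF u_cont])

lemma u_seq:
  assumes X: "X \<longlonglongrightarrow> t" "\<And>n. X n \<ge> 0" "t \<ge> 0" and Z: "Z \<longlonglongrightarrow> x"
  shows "(\<lambda>n. u (X n) (Z n)) \<longlonglongrightarrow> u t x"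
proof -
  obtain c where c: "c \<longlonglongrightarrow> 0" "\<And>n x. \<bar>u (X n) x - u t x\<bar> \<le> c n" by (rule u_unif[OF X]) blast
  have "(\<lambda>n. u (X n) (Z n) - u t (Z n)) \<longlonglongrightarrow> 0"
    by (rule Lim_null_comparison[OF _ c(1)]) (use c(2) in auto)
  moreover have "isCont (u t) x" using u_cont[OF X(3)] by (simp add: continuous_on_eq_continuous_at)
  then have "(\<lambda>n. u t (Z n)) \<longlonglongrightarrow> u t x" using Z by (rule isCont_tendsto_compose)
  ultimately have "(\<lambda>n. (u (X n) (Z n) - u t (Z n)) + u t (Z n)) \<longlonglongrightarrow> 0 + u t x" by (rule tendsto_add)
  then show ?thesis by simp
qed

text \<open>The slope is integrated over the open interval and Cauchy-Schwarz is applied; its square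
  is the density of the absolutely continuous part of the energy, which lies below \<mu>. Atoms at
  the two endpoints do not enter, and the limits at quantiles later rely on this.\<close>

lemma u_sq:
  assumes t: "t \<ge> 0" and xz: "x \<le> z"
  shows "(u t z - u t x)\<^sup>2 \<le> (z - x) * measure (\<mu> t) {x<..<z}"
proof -
  interpret finite_measure "\<mu> t" by (rule mfin[OF t])
  from D[OF t] obtain f where wd: "weak_deriv (u t) f" and ac: "ac_part_density (\<mu> t) (\<lambda>x. (f x)\<^sup>2)" unfolding in_D_def by blast
  have ad: "antideriv (u t) f" by (rule weak_deriv_continuous_imp_antideriv[OF wd u_cont[OF t]])
  have [measurable]: "f \<in> borel_measurable borel" by (rule antideriv_measurable[OF ad])
  from ac obtain N where N: "N \<in> null_sets lborel" "\<And>A. A \<in> sets borel \<Longrightarrow> emeasure (\<mu> t) (A - N) = (\<integral>\<^sup>+ x \<in> A. ennreal ((f x)\<^sup>2) \<partial>lborel)"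
    unfolding ac_part_density_def by blast
  let ?i = "indicator {x<..<z} :: real \<Rightarrow> real"
  have le: "(\<integral>\<^sup>+w. ennreal (?i w * (f w)\<^sup>2) \<partial>lborel) \<le> ennreal (measure (\<mu> t) {x<..<z})"
  proof -
    have "(\<integral>\<^sup>+w. ennreal (?i w * (f w)\<^sup>2) \<partial>lborel) = (\<integral>\<^sup>+ w \<in> {x<..<z}. ennreal ((f w)\<^sup>2) \<partial>lborel)"
      by (rule nn_integral_cong) (simp add: indicator_def)
    also have "\<dots> = emeasure (\<mu> t) ({x<..<z} - N)" by (rule N(2)[symmetric]) simp
    also have "\<dots> \<le> emeasure (\<mu> t) {x<..<z}" by (rule emeasure_mono) (use msets[OF t] in auto)
    finally show ?thesis by (simp add: emeasure_eq_measure)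
  qed
  then have "(\<integral>\<^sup>+w. ennreal (?i w * (f w)\<^sup>2) \<partial>lborel) < \<infinity>" by (rule le_less_trans) simp
  then have ig: "integrable lborel (\<lambda>w. ?i w * (f w)\<^sup>2)" by (simp add: integrable_iff_bounded)
  have le2: "(\<integral>w. ?i w * (f w)\<^sup>2 \<partial>lborel) \<le> measure (\<mu> t) {x<..<z}"
    using le nn_integral_eq_integral[OF ig] by simp
  have ia: "integrable lborel ?i" by (rule integrable_real_indicator) (use xz in auto)
  have e: "AE w in lborel. indicator {x..z} w *\<^sub>R f w = ?i w * f w"
    using lborel_AE_neq[of x] lborel_AE_neq[of z] by eventually_elim (auto simp: indicator_def)
  have ib: "integrable lborel (\<lambda>w. ?i w * f w)"
    using antideriv_integrable[OF ad, of x z] integrable_cong_AE[OF _ _ e] unfolding set_integrable_def by simp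
  have I: "(\<integral>w. ?i w * f w \<partial>lborel) = u t z - u t x"
    using antideriv_eq[OF ad xz] integral_cong_AE[OF _ _ e] unfolding set_lebesgue_integral_def by simp
  have "(\<integral>w. ?i w * f w \<partial>lborel)\<^sup>2 \<le> (\<integral>w. ?i w \<partial>lborel) * (\<integral>w. ?i w * (f w)\<^sup>2 \<partial>lborel)"
    by (rule Cauchy_Schwarz_weighted[OF ia ib ig]) (auto simp: indicator_def)
  also have "\<dots> \<le> (z - x) * measure (\<mu> t) {x<..<z}"
    using le2 xz by (simp add: mult_left_mono)
  finally show ?thesis unfolding I .
qed

lemma u_bdd: assumes t: "t \<ge> 0" obtains C where "C \<ge> 0" "\<And>x. \<bar>u t x\<bar> \<le> C"
proof -
  interpret finite_measure "\<mu> t" by (rule mfin[OF t])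
  from D[OF t] obtain e a b where e: "L2 e" "AE x in lborel. u t x = e x + a * psp x + b * psm x"
    unfolding in_D_def in_E2_def H1_def by blast
  have md: "(u t x - u t z)\<^sup>2 \<le> measure (\<mu> t) UNIV" if d: "\<bar>x - z\<bar> \<le> 1" for x z
  proof -
    have *: "(u t z - u t x)\<^sup>2 \<le> measure (\<mu> t) UNIV" if "x \<le> z" "z - x \<le> 1" for x z
    proof -
      have "measure (\<mu> t) {x<..<z} \<le> measure (\<mu> t) UNIV" by (rule finite_measure_mono) (use msets[OF t] in auto)
      then have "(z - x) * measure (\<mu> t) {x<..<z} \<le> 1 * measure (\<mu> t) UNIV" using that by (intro mult_mono) auto
      then show ?thesis using u_sq[OF t that(1)] by simp
    qed
    show ?thesis using *[of x z] *[of z x] d by (cases "x \<le> z") (auto simp: power2_commute abs_le_iff)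
  qed
  have "AE x in lborel. \<bar>u t x - e x\<bar> \<le> \<bar>a\<bar> + \<bar>b\<bar>"
    using e(2)
  proof eventually_elim
    case (elim x)
    have "\<bar>a * psp x\<bar> \<le> \<bar>a\<bar>" "\<bar>b * psm x\<bar> \<le> \<bar>b\<bar>"
      using psp_bounds[of x] by (auto simp: abs_mult psm_eq mult_left_le)
    then show ?case using elim by linarith
  qed
  from bounded_of_modulus[OF md e(1) this] obtain C where C: "\<And>x. \<bar>u t x\<bar> \<le> C" by blast
  then show thesis using that[of C] abs_ge_zero order_trans by blast
qed

lemma u_bdd_T: assumes T: "T \<ge> 0" obtains C where "C \<ge> 0" "\<And>t x. 0 \<le> t \<Longrightarrow> t \<le> T \<Longrightarrow> \<bar>u t x\<bar> \<le> C"
proof -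
  obtain C0 where C0: "C0 \<ge> 0" "\<And>x. \<bar>u 0 x\<bar> \<le> C0" by (rule u_bdd[of 0]) auto
  have "T + 1 > 0" using T by simp
  from holder[OF this] obtain \<alpha> C where \<alpha>: "0 < \<alpha>" and
    H: "\<And>p q. p \<in> {0..T+1} \<times> UNIV \<Longrightarrow> q \<in> {0..T+1} \<times> UNIV \<Longrightarrow> \<bar>(\<lambda>(t,x). u t x) p - (\<lambda>(t,x). u t x) q\<bar> \<le> C * dist p q powr \<alpha>"
    unfolding holder_on_def by blast
  show thesis
  proof (rule that[of "C0 + \<bar>C\<bar> * T powr \<alpha>"])
    show "0 \<le> C0 + \<bar>C\<bar> * T powr \<alpha>" using C0 by simp
    fix t x assume t: "0 \<le> t" "t \<le> T"
    have "\<bar>u t x - u 0 x\<bar> \<le> C * t powr \<alpha>" using H[of "(t,x)" "(0,x)"] t by (simp add: dist_Pair_Pair dist_real_def)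
    also have "\<dots> \<le> \<bar>C\<bar> * T powr \<alpha>" using t \<alpha> by (intro mult_mono powr_mono2) auto
    finally show "\<bar>u t x\<bar> \<le> C0 + \<bar>C\<bar> * T powr \<alpha>" using C0(2)[of x] by linarith
  qed
qed

lemma mass_cont: "continuous_on {0..} (\<lambda>t. measure (\<mu> t) UNIV)"
proof -
  have "continuous_on {0..} (\<lambda>t. \<integral>x. (1::real) \<partial>(\<mu> t))" by (rule mu_weak) (auto intro!: continuous_intros)
  moreover have "(\<integral>x. (1::real) \<partial>(\<mu> t)) = measure (\<mu> t) UNIV" if "t \<ge> 0" for t
    using mspace[OF that] by simp
  ultimately show ?thesis by (subst (asm) continuous_on_cong[OF refl]) auto
qed

text \<open>The error of replacing g n by h is at most c n times the total mass, and the mass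
  converges along the sequence of times. For the fixed function h the weak continuity of the
  measures applies.\<close>

lemma mu_converge:
  fixes g :: "nat \<Rightarrow> real \<Rightarrow> real" and h :: "real \<Rightarrow> real" and c :: "nat \<Rightarrow> real"
  assumes X: "X \<longlonglongrightarrow> t" "\<And>n. X n \<ge> 0" "t \<ge> 0"
    and g: "\<And>n. continuous_on UNIV (g n)" "continuous_on UNIV h" "\<And>x. \<bar>h x\<bar> \<le> K"
    and c: "c \<longlonglongrightarrow> 0" "\<And>n x. \<bar>g n x - h x\<bar> \<le> c n"
  shows "(\<lambda>n. \<integral>x. g n x \<partial>\<mu> (X n)) \<longlonglongrightarrow> (\<integral>x. h x \<partial>\<mu> t)"
proof -
  have [measurable]: "g n \<in> borel_measurable borel" "h \<in> borel_measurable borel" for n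
    using g by (auto intro: borel_measurable_continuous_onI)
  have seq: "(\<lambda>n. f (X n)) \<longlonglongrightarrow> f t" if "continuous_on {0..} f" for f :: "real \<Rightarrow> real"
    using that X unfolding continuous_on_sequentially comp_def by auto
  have gb: "\<bar>g n x\<bar> \<le> K + c n" for n x using g(3)[of x] c(2)[of n x] by linarith
  have "(\<lambda>n. (\<integral>x. g n x \<partial>\<mu> (X n)) - (\<integral>x. h x \<partial>\<mu> (X n))) \<longlonglongrightarrow> 0"
  proof (rule Lim_null_comparison)
    have "(\<integral>x. g n x \<partial>\<mu> (X n)) - (\<integral>x. h x \<partial>\<mu> (X n)) = (\<integral>x. g n x - h x \<partial>\<mu> (X n))" for n
      by (rule Bochner_Integration.integral_diff[symmetric]) (auto intro: m_integrable[OF X(2)] gb g(3))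
    note e = this
    show "\<forall>\<^sub>F n in sequentially. norm ((\<integral>x. g n x \<partial>\<mu> (X n)) - (\<integral>x. h x \<partial>\<mu> (X n))) \<le> c n * measure (\<mu> (X n)) UNIV"
      unfolding e real_norm_def by (intro always_eventually allI m_integral_bound[OF X(2)] c(2)) measurable
    show "(\<lambda>n. c n * measure (\<mu> (X n)) UNIV) \<longlonglongrightarrow> 0"
      using tendsto_mult[OF c(1) seq[OF mass_cont]] by simp
  qed
  moreover have "bounded (range h)" using g(3) by (auto simp: bounded_iff)
  then have "(\<lambda>n. \<integral>x. h x \<partial>\<mu> (X n)) \<longlonglongrightarrow> (\<integral>x. h x \<partial>\<mu> t)" by (intro seq mu_weak g)
  ultimately have "(\<lambda>n. ((\<integral>x. g n x \<partial>\<mu> (X n)) - (\<integral>x. h x \<partial>\<mu> (X n))) + (\<integral>x. h x \<partial>\<mu> (X n))) \<longlonglongrightarrow> 0 + (\<integral>x. h x \<partial>\<mu> t)"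
    by (rule tendsto_add)
  then show ?thesis by simp
qed

lemma flux_cont:
  assumes b: "continuous_on UNIV b" "\<And>x. \<bar>b x\<bar> \<le> K"
  shows "continuous_on {0..} (\<lambda>t. \<integral>x. u t x * b x \<partial>\<mu> t)"
  unfolding continuous_on_sequentially comp_def
proof (intro allI ballI impI)
  fix t :: real and X :: "nat \<Rightarrow> real" assume t: "t \<in> {0..}" and X: "(\<forall>n. X n \<in> {0..}) \<and> X \<longlonglongrightarrow> t"
  then have X: "X \<longlonglongrightarrow> t" "\<And>n. X n \<ge> 0" "t \<ge> 0" by auto
  have K0: "0 \<le> K" using b(2)[of 0] by linarith
  obtain c where c: "c \<longlonglongrightarrow> 0" "\<And>n x. \<bar>u (X n) x - u t x\<bar> \<le> c n" by (rule u_unif[OF X]) blast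
  obtain C where C: "C \<ge> 0" "\<And>x. \<bar>u t x\<bar> \<le> C" by (rule u_bdd[OF X(3)]) blast
  show "(\<lambda>n. \<integral>x. u (X n) x * b x \<partial>\<mu> (X n)) \<longlonglongrightarrow> (\<integral>x. u t x * b x \<partial>\<mu> t)"
  proof (rule mu_converge[OF X])
    show "continuous_on UNIV (\<lambda>x. u (X n) x * b x)" for n by (intro continuous_intros u_cont X b)
    show "continuous_on UNIV (\<lambda>x. u t x * b x)" by (intro continuous_intros u_cont X b)
    show "\<bar>u t x * b x\<bar> \<le> C * K" for x unfolding abs_mult using C b by (intro mult_mono) auto
    show "(\<lambda>n. c n * K) \<longlonglongrightarrow> 0" using c(1) by (rule tendsto_mult_left_zero)
    show "\<bar>u (X n) x * b x - u t x * b x\<bar> \<le> c n * K" for n x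
      unfolding left_diff_distrib[symmetric] abs_mult using c(2)[of n x] b(2)[of x] K0
      by (intro mult_mono) (auto intro: order_trans[OF abs_ge_zero])
  qed
qed

text \<open>Products of a function of time and a function of space reduce the transport equation to
  a scalar weak equation in time. Its right-hand side is continuous, so the derivative exists in the
  classical sense at every time.\<close>

lemma mu_DERIV_test:
  assumes b: "test1 b" and t: "t \<ge> 0"
  shows "((\<lambda>t. \<integral>x. b x \<partial>\<mu> t) has_real_derivative (\<integral>x. u t x * deriv b x \<partial>\<mu> t)) (at t within {0..})"
proof (rule time_derivative[OF _ _ _ t])
  obtain K where K: "K > 0" "\<And>x. \<bar>b x\<bar> \<le> K" by (rule test1_bounded[OF b]) blast
  obtain K1 where K1: "K1 > 0" "\<And>x. \<bar>deriv b x\<bar> \<le> K1" by (rule test1_bounded[OF test1_deriv_test1[OF b]]) blast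
  have cb: "continuous_on UNIV b" "continuous_on UNIV (deriv b)" by (intro smooth1_continuous smooth1_deriv test1_smooth[OF b])+
  have [measurable]: "b \<in> borel_measurable borel" "deriv b \<in> borel_measurable borel"
    using cb by (auto intro: borel_measurable_continuous_onI)
  show "continuous_on {0..} (\<lambda>t. \<integral>x. b x \<partial>\<mu> t)" by (rule mu_weak[OF cb(1)]) (use K in \<open>auto simp: bounded_iff\<close>)
  show "continuous_on {0..} (\<lambda>t. \<integral>x. u t x * deriv b x \<partial>\<mu> t)" by (rule flux_cont[OF cb(2) K1(2)])
  fix a assume a: "test1 a"
  have "(\<integral>t. indicator {0..} t * (deriv a t * (\<integral>x. b x \<partial>\<mu> t) + a t * (\<integral>x. u t x * deriv b x \<partial>\<mu> t)) \<partial>lborel)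
      = (\<integral>t. indicator {0..} t * (\<integral>x. pd True (\<lambda>(t,x). a t * b x) (t,x) + u t x * pd False (\<lambda>(t,x). a t * b x) (t,x) \<partial>(\<mu> t)) \<partial>lborel)"
  proof (rule Bochner_Integration.integral_cong[OF refl])
    fix t :: real
    show "indicator {0..} t * (deriv a t * (\<integral>x. b x \<partial>\<mu> t) + a t * (\<integral>x. u t x * deriv b x \<partial>\<mu> t)) = indicator {0..} t * (\<integral>x. pd True (\<lambda>(t,x). a t * b x) (t,x) + u t x * pd False (\<lambda>(t,x). a t * b x) (t,x) \<partial>(\<mu> t))"
    proof (cases "t \<ge> 0")
      case True
      obtain C where C: "C \<ge> 0" "\<And>x. \<bar>u t x\<bar> \<le> C" by (rule u_bdd[OF True]) blast
      note [measurable] = u_meas[OF True]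
      have i1: "integrable (\<mu> t) b" by (rule m_integrable[OF True _ K(2)]) measurable
      have i2: "integrable (\<mu> t) (\<lambda>x. u t x * deriv b x)"
        by (rule m_integrable[OF True, of _ "C * K1"]) (use C K1 in \<open>auto simp: abs_mult intro!: mult_mono\<close>)
      have "(\<integral>x. pd True (\<lambda>(t,x). a t * b x) (t,x) + u t x * pd False (\<lambda>(t,x). a t * b x) (t,x) \<partial>(\<mu> t)) = (\<integral>x. deriv a t * b x + a t * (u t x * deriv b x) \<partial>\<mu> t)"
        unfolding test2_prod(2,3)[OF a b] by (rule Bochner_Integration.integral_cong) auto
      also have "\<dots> = deriv a t * (\<integral>x. b x \<partial>\<mu> t) + a t * (\<integral>x. u t x * deriv b x \<partial>\<mu> t)" using i1 i2 by simp
      finally show ?thesis by simp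
    qed simp
  qed
  also have "\<dots> = - (\<integral>x. (\<lambda>(t,x). a t * b x) (0,x) \<partial>(\<mu> 0))" by (rule weak_mu[OF test2_prod(1)[OF a b]])
  finally show "(\<integral>t. indicator {0..} t * (deriv a t * (\<integral>x. b x \<partial>\<mu> t) + a t * (\<integral>x. u t x * deriv b x \<partial>\<mu> t)) \<partial>lborel) = - (a 0 * (\<integral>x. b x \<partial>\<mu> 0))" by simp
qed

end

section \<open>Energy balance for test functions constant near infinity\<close>

lemma bump_integral_pos: assumes "a < b" shows "0 < (\<integral>x. bump n a b x \<partial>lborel)"
proof -
  have "(\<integral>x. bump n a b x \<partial>lborel) \<noteq> 0"
  proof
    assume "(\<integral>x. bump n a b x \<partial>lborel) = 0"
    then have "AE x in lborel. bump n a b x = 0"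
      using integral_nonneg_eq_0_iff_AE[OF test1_integrable[OF test1_bump]] bump_nonneg by auto
    then have "AE x in lborel. x \<notin> {a<..<b}"
      by eventually_elim (use bump_pos[of _ a b n] in force)
    then have "emeasure lborel {a<..<b} = 0" by (subst (asm) AE_iff_measurable[of "{a<..<b}"]) auto
    then show False using assms by simp
  qed
  moreover have "0 \<le> (\<integral>x. bump n a b x \<partial>lborel)" by (rule integral_nonneg_AE) (simp add: bump_nonneg)
  ultimately show ?thesis by simp
qed

lemma smooth_antiderivative: assumes "smooth1 f" obtains F where "smooth1 F" "deriv F = f" "antideriv F f"
proof -
  have c: "continuous_on UNIV f" by (rule smooth1_continuous[OF assms])
  have "\<exists>F. \<forall>x::real. -\<infinity> < ereal x \<longrightarrow> ereal x < \<infinity> \<longrightarrow> (F has_vector_derivative f x) (at x)"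
    by (rule einterval_antiderivative) (use c continuous_on_eq_continuous_at open_UNIV in auto)
  then obtain F where F: "\<And>x. (F has_real_derivative f x) (at x)"
    by (auto simp: has_real_derivative_iff_has_vector_derivative)
  show thesis by (rule that[of F]) (use smooth1_antideriv[OF assms F] F antideriv_DERIV[OF F c] in \<open>auto intro: DERIV_imp_deriv\<close>)
qed

lemma smooth_step:
  assumes pq: "p < q"
  obtains B where "smooth1 B" "test1 (deriv B)" "\<And>x. deriv B x \<le> 0" "\<And>x. x \<notin> {p<..<q} \<Longrightarrow> deriv B x = 0"
    "\<And>x. x \<le> p \<Longrightarrow> B x = 1" "\<And>x. q \<le> x \<Longrightarrow> B x = 0" "\<And>x. 0 \<le> B x \<and> B x \<le> 1"
proof -
  define c where "c = (\<integral>x. bump 0 p q x \<partial>lborel)"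
  have c: "c > 0" unfolding c_def by (rule bump_integral_pos[OF pq])
  \<comment> \<open>The vanishing second summand only brings f into the shape of a linear
    combination of test functions. The integral of f is -1, the total drop of the step.\<close>
  define f where "f x = (- 1 / c) * bump 0 p q x + 0 * bump 0 p q x" for x
  have tf: "test1 f" unfolding f_def[abs_def] by (intro test1_lin test1_bump)
  obtain F where F: "smooth1 F" "deriv F = f" "antideriv F f" by (rule smooth_antiderivative[OF test1_smooth[OF tf]])
  have f0: "f x = 0" if "x \<notin> {p<..<q}" for x using bump_eq_0[OF that] by (simp add: f_def)
  have fneg: "f x \<le> 0" for x using bump_nonneg[of 0 p q x] c by (simp add: f_def)
  have "(LBINT x:{p..q}. f x) = (\<integral>x. f x \<partial>lborel)" by (rule integral_eq_LBINT_support[symmetric]) (use f0 in auto)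
  also have "\<dots> = -1" using c by (simp add: f_def c_def)
  finally have Fpq: "F q = F p - 1" using antideriv_eq[OF F(3), of p q] pq by simp
  have const: "F b = F a" if "a \<le> b" "b \<le> p \<or> q \<le> a" for a b
  proof -
    have "(LBINT x:{a..b}. f x) = 0" unfolding set_lebesgue_integral_def
      by (rule integral_eq_zero_AE) (use f0 that in \<open>auto simp: indicator_def\<close>)
    then show ?thesis using antideriv_eq[OF F(3) that(1)] by simp
  qed
  have anti: "F b \<le> F a" if "a \<le> b" for a b
  proof -
    have "(LBINT x:{a..b}. f x) \<le> (LBINT x:{a..b}. 0)"
      by (rule set_integral_mono[OF antideriv_integrable[OF F(3)]]) (use fneg in \<open>auto simp: set_integrable_def\<close>)
    then show ?thesis using antideriv_eq[OF F(3) that] by simp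
  qed
  define B where "B x = F x + (1 - F p)" for x
  have dB: "deriv B x = f x" for x
    unfolding B_def[abs_def] using smooth1_DERIV[OF F(1), of x] F(2) by (auto intro!: DERIV_imp_deriv derivative_eq_intros)
  then have dB': "deriv B = f" by auto
  have one: "B x = 1" if "x \<le> p" for x using const[OF that] by (simp add: B_def)
  have zero: "B x = 0" if "q \<le> x" for x using const[OF that] Fpq by (simp add: B_def)
  have le1: "B x \<le> 1" for x
  proof (cases "x \<le> p")
    case False
    then have "F x \<le> F p" by (intro anti) simp
    then show ?thesis by (simp add: B_def)
  qed (simp add: one)
  have ge0: "0 \<le> B x" for x
  proof (cases "q \<le> x")
    case False
    then have "F q \<le> F x" by (intro anti) simp
    then show ?thesis using Fpq by (simp add: B_def)
  qed (simp add: zero)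
  show thesis
  proof (rule that[of B])
    show "smooth1 B" unfolding B_def[abs_def] by (intro smooth1_add F smooth1_const)
    show "test1 (deriv B)" unfolding dB' by (rule tf)
    show "deriv B x \<le> 0" for x unfolding dB by (rule fneg)
    show "deriv B x = 0" if "x \<notin> {p<..<q}" for x unfolding dB by (rule f0[OF that])
    show "0 \<le> B x \<and> B x \<le> 1" for x using le1 ge0 by blast
  qed (rule one zero, assumption)+
qed

text \<open>Smooth functions that are constant near each end of the line, such as constants and
  smooth cutoffs of half-lines. They are the tests for amounts of energy to the left of a point, and
  they are integrable because the energy is finite.\<close>

definition adm :: "(real \<Rightarrow> real) \<Rightarrow> bool" where
  "adm B \<longleftrightarrow> smooth1 B \<and> (\<exists>K. \<forall>x. \<bar>B x\<bar> \<le> K) \<and> test1 (deriv B)"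

lemma adm_props:
  assumes "adm B"
  obtains K0 K1 K2 where "K0 \<ge> 0" "K1 > 0" "K2 > 0" "\<And>x. \<bar>B x\<bar> \<le> K0" "\<And>x. \<bar>deriv B x\<bar> \<le> K1" "\<And>x. \<bar>deriv (deriv B) x\<bar> \<le> K2"
proof -
  from assms obtain K where K: "\<And>x. \<bar>B x\<bar> \<le> K" unfolding adm_def by blast
  have t: "test1 (deriv B)" using assms by (simp add: adm_def)
  obtain K1 where K1: "K1 > 0" "\<And>x. \<bar>deriv B x\<bar> \<le> K1" by (rule test1_bounded[OF t]) blast
  obtain K2 where K2: "K2 > 0" "\<And>x. \<bar>deriv (deriv B) x\<bar> \<le> K2" by (rule test1_bounded[OF test1_deriv_test1[OF t]]) blast
  have "0 \<le> K" using K[of 0] by linarith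
  then show thesis using that[of K K1 K2] K K1 K2 by blast
qed

lemma deriv_affine: "smooth1 f \<Longrightarrow> deriv (\<lambda>x. f (m * x + c)) = (\<lambda>x. m * deriv f (m * x + c))"
proof
  fix x assume s: "smooth1 f"
  have "((\<lambda>x. f (m * x + c)) has_real_derivative deriv f (m * x + c) * m) (at x)"
    by (rule DERIV_chain2[OF smooth1_DERIV[OF s]]) (auto intro!: derivative_eq_intros)
  then show "deriv (\<lambda>x. f (m * x + c)) x = m * deriv f (m * x + c)" by (metis DERIV_imp_deriv mult.commute)
qed

lemma deriv_shift: "smooth1 f \<Longrightarrow> deriv (\<lambda>x. f (x - s)) = (\<lambda>x. deriv f (x - s))"
  using deriv_affine[of f 1 "- s"] by simp

lemma test1_affine: assumes t: "test1 f" and m: "m \<noteq> 0" shows "test1 (\<lambda>x. f (m * x + c))"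
proof -
  obtain R where R: "R > 0" "\<And>x. \<bar>x\<bar> \<ge> R \<Longrightarrow> f x = 0" using test1_support[OF t] by metis
  define R' where "R' = (R + \<bar>c\<bar>) / \<bar>m\<bar>"
  have "{x. f (m * x + c) \<noteq> 0} \<subseteq> {- R'..R'}"
  proof
    fix x assume "x \<in> {x. f (m * x + c) \<noteq> 0}"
    then have "f (m * x + c) \<noteq> 0" by simp
    then have "\<bar>m * x + c\<bar> < R" using R(2)[of "m * x + c"] by linarith
    then have "\<bar>m * x\<bar> \<le> R + \<bar>c\<bar>" by linarith
    then have "\<bar>x\<bar> \<le> R'" using m by (simp add: R'_def abs_mult field_simps)
    then show "x \<in> {- R'..R'}" by auto
  qed
  then show ?thesis unfolding test1_def using smooth1_affine[OF test1_smooth[OF t]] bounded_subset[OF bounded_closed_interval] by blast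
qed

lemma test1_shift: "test1 f \<Longrightarrow> test1 (\<lambda>x. f (x - s))"
  using test1_affine[of f 1 "- s"] by simp

lemma adm_shift: "adm B \<Longrightarrow> adm (\<lambda>x. B (x - s))"
proof -
  assume B: "adm B"
  then have s: "smooth1 B" and t: "test1 (deriv B)" by (simp_all add: adm_def)
  from B obtain K where "\<forall>x. \<bar>B x\<bar> \<le> K" unfolding adm_def by blast
  then have "\<forall>x. \<bar>B (x - s)\<bar> \<le> K" by blast
  moreover have "smooth1 (\<lambda>x. B (x - s))" using smooth1_affine[OF s, of 1 "- s"] by simp
  ultimately show ?thesis unfolding adm_def deriv_shift[OF s] using test1_shift[OF t] by blast
qed

lemma adm_test1: "test1 b \<Longrightarrow> adm b"
proof -
  assume t: "test1 b"
  obtain K where "\<And>x. \<bar>b x\<bar> \<le> K" by (rule test1_bounded[OF t]) blast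
  then show ?thesis unfolding adm_def using test1_smooth[OF t] test1_deriv_test1[OF t] by blast
qed

lemma adm_const: "adm (\<lambda>x. c)"
  unfolding adm_def by (auto simp: smooth1_const test1_def)

context weak_solution begin

text \<open>B is truncated by a slowly varying cutoff w(x / (n + 1)). Its derivative contributes a
  term of order 1 / (n + 1), and dominated convergence applies in x by finiteness of the energy and
  in time by bounds uniform on {0..t}.\<close>

lemma mu_DERIV_adm:
  assumes B: "adm B" and t: "t \<ge> 0"
  shows "((\<lambda>t. \<integral>x. B x \<partial>\<mu> t) has_real_derivative (\<integral>x. u t x * deriv B x \<partial>\<mu> t)) (at t within {0..})"
proof (rule integral_DERIV[OF _ _ t])
  obtain K0 K1 K2 where K: "K0 \<ge> 0" "K1 > 0" "K2 > 0" "\<And>x. \<bar>B x\<bar> \<le> K0" "\<And>x. \<bar>deriv B x\<bar> \<le> K1" "\<And>x. \<bar>deriv (deriv B) x\<bar> \<le> K2"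
    by (rule adm_props[OF B]) blast
  have sB: "smooth1 B" using B by (simp add: adm_def)
  note cB = smooth1_continuous[OF sB, of UNIV] smooth1_continuous[OF smooth1_deriv[OF sB], of UNIV]
  have [measurable]: "B \<in> borel_measurable borel" "deriv B \<in> borel_measurable borel"
    using cB by (auto intro: borel_measurable_continuous_onI)
  show cQ: "continuous_on {0..} (\<lambda>t. \<integral>x. u t x * deriv B x \<partial>\<mu> t)" by (rule flux_cont[OF cB(2) K(5)])
  \<comment> \<open>A bump rescaled to the value 1 at 0, so that the stretched cutoffs converge
    pointwise to 1.\<close>
  define w where "w x = (1 / bump 0 (-1) 1 0) * bump 0 (-1) 1 x + 0 * bump 0 (-1) 1 x" for x
  have tw: "test1 w" unfolding w_def[abs_def] by (intro test1_lin test1_bump)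
  have w0: "w 0 = 1" using bump_pos[of 0 "-1" 1 0] by (simp add: w_def)
  obtain L0 where L0: "L0 > 0" "\<And>x. \<bar>w x\<bar> \<le> L0" by (rule test1_bounded[OF tw]) blast
  obtain L1 where L1: "L1 > 0" "\<And>x. \<bar>deriv w x\<bar> \<le> L1" by (rule test1_bounded[OF test1_deriv_test1[OF tw]]) blast
  note sw = test1_smooth[OF tw]
  define m where "m n = inverse (real (Suc n))" for n
  have m: "m n > 0" "m n \<le> 1" for n by (auto simp: m_def field_simps)
  have mlim: "m \<longlonglongrightarrow> 0" unfolding m_def[abs_def] by (rule LIMSEQ_inverse_real_of_nat)
  define b where "b n x = B x * w (m n * x + 0)" for n x
  have tb: "test1 (b n)" for n
  proof -
    have t: "test1 (\<lambda>x. w (m n * x + 0))" by (rule test1_affine[OF tw]) (use m[of n] in simp)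
    have "{x. b n x \<noteq> 0} \<subseteq> {x. w (m n * x + 0) \<noteq> 0}" by (auto simp: b_def)
    then show ?thesis using t sB unfolding test1_def b_def[abs_def] by (auto intro!: smooth1_mult intro: bounded_subset)
  qed
  have db: "deriv (b n) x = deriv B x * w (m n * x + 0) + B x * (m n * deriv w (m n * x + 0))" for n x
  proof (rule DERIV_imp_deriv)
    have "((\<lambda>x. w (m n * x + 0)) has_real_derivative m n * deriv w (m n * x + 0)) (at x)"
      using smooth1_DERIV[OF smooth1_affine[OF sw, of "m n" 0], of x] unfolding deriv_affine[OF sw] .
    from DERIV_mult[OF smooth1_DERIV[OF sB, of x] this]
    show "(b n has_real_derivative deriv B x * w (m n * x + 0) + B x * (m n * deriv w (m n * x + 0))) (at x)"
      unfolding b_def[abs_def] by (simp add: algebra_simps)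
  qed
  have wlim: "(\<lambda>n. w (m n * x + 0)) \<longlonglongrightarrow> 1" for x
  proof -
    have "isCont w 0" using smooth1_DERIV[OF sw] DERIV_isCont by blast
    moreover have "(\<lambda>n. m n * x + 0) \<longlonglongrightarrow> 0 * x + 0" by (intro tendsto_intros mlim)
    ultimately show ?thesis using isCont_tendsto_compose[of 0 w "\<lambda>n. m n * x + 0"] w0 by simp
  qed
  define K where "K = K1 * L0 + K0 * L1"
  have dbb: "\<bar>deriv (b n) x\<bar> \<le> K" for n x
  proof -
    have "\<bar>deriv B x * w (m n * x + 0)\<bar> \<le> K1 * L0" unfolding abs_mult using K L0 by (intro mult_mono) auto
    moreover have "\<bar>m n * deriv w (m n * x + 0)\<bar> \<le> 1 * L1" unfolding abs_mult using m[of n] L1 by (intro mult_mono) auto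
    then have "\<bar>B x * (m n * deriv w (m n * x + 0))\<bar> \<le> K0 * L1" unfolding abs_mult[of "B x"] using K by (intro mult_mono) auto
    ultimately show ?thesis unfolding db K_def by linarith
  qed
  have K0': "0 \<le> K" using dbb[of 0 0] by linarith
  have dblim: "(\<lambda>n. deriv (b n) x) \<longlonglongrightarrow> deriv B x" for x
  proof -
    have "(\<lambda>n. B x * (m n * deriv w (m n * x + 0))) \<longlonglongrightarrow> 0"
    proof (rule tendsto_mult_right_zero, rule Lim_null_comparison)
      show "\<forall>\<^sub>F n in sequentially. norm (m n * deriv w (m n * x + 0)) \<le> m n * L1"
      proof (intro always_eventually allI)
        fix n show "norm (m n * deriv w (m n * x + 0)) \<le> m n * L1"
          using m[of n] L1(2)[of "m n * x + 0"] by (simp add: abs_mult)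
      qed
      show "(\<lambda>n. m n * L1) \<longlonglongrightarrow> 0" by (rule tendsto_mult_left_zero[OF mlim])
    qed
    from tendsto_add[OF tendsto_mult[OF tendsto_const[of "deriv B x"] wlim[of x]] this]
    show ?thesis unfolding db by simp
  qed
  have bb: "\<bar>b n x\<bar> \<le> K0 * L0" for n x unfolding b_def abs_mult using K L0 by (intro mult_mono) auto
  have blim: "(\<lambda>n. b n x) \<longlonglongrightarrow> B x" for x
    using tendsto_mult[OF tendsto_const[of "B x"] wlim[of x]] unfolding b_def by simp
  have [measurable]: "b n \<in> borel_measurable borel" "deriv (b n) \<in> borel_measurable borel" for n
    by (intro borel_measurable_continuous_onI smooth1_continuous smooth1_deriv test1_smooth[OF tb])+
  have Plim: "(\<lambda>n. \<integral>x. b n x \<partial>\<mu> t) \<longlonglongrightarrow> (\<integral>x. B x \<partial>\<mu> t)" if t: "t \<ge> 0" for t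
  proof (rule integral_dominated_convergence[where w = "\<lambda>x. K0 * L0"])
    interpret finite_measure "\<mu> t" by (rule mfin[OF t])
    show "integrable (\<mu> t) (\<lambda>x. K0 * L0)" by simp
  qed (use msets[OF t] blim bb in \<open>auto simp: measurable_cong_sets[OF msets[OF t] refl]\<close>)
  have Qlim: "(\<lambda>n. \<integral>x. u t x * deriv (b n) x \<partial>\<mu> t) \<longlonglongrightarrow> (\<integral>x. u t x * deriv B x \<partial>\<mu> t)" if t: "t \<ge> 0" for t
  proof -
    obtain C where C: "C \<ge> 0" "\<And>x. \<bar>u t x\<bar> \<le> C" by (rule u_bdd[OF t]) blast
    note [measurable] = u_meas[OF t]
    show ?thesis
    proof (rule integral_dominated_convergence[where w = "\<lambda>x. C * K"])
      interpret finite_measure "\<mu> t" by (rule mfin[OF t])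
      show "integrable (\<mu> t) (\<lambda>x. C * K)" by simp
      show "AE x in \<mu> t. norm (u t x * deriv (b n) x) \<le> C * K" for n
        using C dbb K0' by (intro AE_I2) (simp add: abs_mult mult_mono)
      show "AE x in \<mu> t. (\<lambda>n. u t x * deriv (b n) x) \<longlonglongrightarrow> u t x * deriv B x"
        by (intro AE_I2 tendsto_mult tendsto_const dblim)
    qed (simp_all add: measurable_cong_sets[OF msets[OF t] refl])
  qed
  fix t :: real assume t: "t \<ge> 0"
  have cQn: "continuous_on {0..} (\<lambda>t. \<integral>x. u t x * deriv (b n) x \<partial>\<mu> t)" for n
    by (rule flux_cont[OF _ dbb]) (intro smooth1_continuous smooth1_deriv test1_smooth[OF tb])
  have eq: "(LBINT s:{0..t}. \<integral>x. u s x * deriv (b n) x \<partial>\<mu> s) = (\<integral>x. b n x \<partial>\<mu> t) - (\<integral>x. b n x \<partial>\<mu> 0)" for n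
    by (rule DERIV_integral(1)[OF cQn mu_DERIV_test[OF tb] t])
  obtain C where C: "C \<ge> 0" "\<And>s x. 0 \<le> s \<Longrightarrow> s \<le> t \<Longrightarrow> \<bar>u s x\<bar> \<le> C" by (rule u_bdd_T[OF t]) blast
  have "bounded ((\<lambda>s. measure (\<mu> s) UNIV) ` {0..t})"
    by (intro compact_imp_bounded compact_continuous_image continuous_on_subset[OF mass_cont]) auto
  then obtain Mb where Mb: "\<And>s. s \<in> {0..t} \<Longrightarrow> \<bar>measure (\<mu> s) UNIV\<bar> \<le> Mb" by (force simp: bounded_iff)
  have "(\<lambda>n. LBINT s:{0..t}. \<integral>x. u s x * deriv (b n) x \<partial>\<mu> s) \<longlonglongrightarrow> (LBINT s:{0..t}. \<integral>x. u s x * deriv B x \<partial>\<mu> s)"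
    unfolding set_lebesgue_integral_def
  proof (rule integral_dominated_convergence[where w = "\<lambda>s. indicator {0..t} s * (C * K * Mb)"])
    have i: "set_integrable lborel {0..t} Q" if "continuous_on {0..} Q" for Q :: "real \<Rightarrow> real"
      unfolding set_integrable_def by (rule borel_integrable_compact) (auto intro: continuous_on_subset[OF that])
    show "(\<lambda>s. indicator {0..t} s *\<^sub>R (\<integral>x. u s x * deriv B x \<partial>\<mu> s)) \<in> borel_measurable lborel"
      using i[OF cQ] unfolding set_integrable_def by (rule borel_measurable_integrable)
    show "(\<lambda>s. indicator {0..t} s *\<^sub>R (\<integral>x. u s x * deriv (b n) x \<partial>\<mu> s)) \<in> borel_measurable lborel" for n
      using i[OF cQn] unfolding set_integrable_def by (rule borel_measurable_integrable)
    show "integrable lborel (\<lambda>s. indicator {0..t} s * (C * K * Mb))"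
      by (intro integrable_mult_left integrable_real_indicator) (auto simp: emeasure_lborel_Icc_eq)
    show "AE s in lborel. (\<lambda>n. indicator {0..t} s *\<^sub>R (\<integral>x. u s x * deriv (b n) x \<partial>\<mu> s)) \<longlonglongrightarrow> indicator {0..t} s *\<^sub>R (\<integral>x. u s x * deriv B x \<partial>\<mu> s)"
    proof (rule AE_I2)
      fix s show "(\<lambda>n. indicator {0..t} s *\<^sub>R (\<integral>x. u s x * deriv (b n) x \<partial>\<mu> s)) \<longlonglongrightarrow> indicator {0..t} s *\<^sub>R (\<integral>x. u s x * deriv B x \<partial>\<mu> s)"
        using Qlim[of s] by (cases "s \<in> {0..t}") auto
    qed
    show "AE s in lborel. norm (indicator {0..t} s *\<^sub>R (\<integral>x. u s x * deriv (b n) x \<partial>\<mu> s)) \<le> indicator {0..t} s * (C * K * Mb)" for n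
    proof (rule AE_I2)
      fix s show "norm (indicator {0..t} s *\<^sub>R (\<integral>x. u s x * deriv (b n) x \<partial>\<mu> s)) \<le> indicator {0..t} s * (C * K * Mb)"
      proof (cases "s \<in> {0..t}")
        case True
        then have s: "0 \<le> s" "s \<le> t" by auto
        note [measurable] = u_meas[OF s(1)]
        have "\<bar>\<integral>x. u s x * deriv (b n) x \<partial>\<mu> s\<bar> \<le> (C * K) * measure (\<mu> s) UNIV"
          by (rule m_integral_bound[OF s(1)]) (use C(2)[OF s] C(1) dbb K0' in \<open>auto simp: abs_mult intro!: mult_mono\<close>)
        also have "\<dots> \<le> (C * K) * Mb" using Mb[OF True] C(1) K0' by (intro mult_left_mono) auto
        finally show ?thesis using True by simp
      qed simp
    qed
  qed
  moreover have "(\<lambda>n. LBINT s:{0..t}. \<integral>x. u s x * deriv (b n) x \<partial>\<mu> s) \<longlonglongrightarrow> (\<integral>x. B x \<partial>\<mu> t) - (\<integral>x. B x \<partial>\<mu> 0)"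
    unfolding eq by (intro tendsto_diff Plim) (use t in auto)
  ultimately have "(LBINT s:{0..t}. \<integral>x. u s x * deriv B x \<partial>\<mu> s) = (\<integral>x. B x \<partial>\<mu> t) - (\<integral>x. B x \<partial>\<mu> 0)"
    by (rule LIMSEQ_unique)
  then show "(\<integral>x. B x \<partial>\<mu> t) = (\<integral>x. B x \<partial>\<mu> 0) + (LBINT s:{0..t}. \<integral>x. u s x * deriv B x \<partial>\<mu> s)" by simp
qed

text \<open>The constant 1 is an admissible test with derivative 0, so no energy escapes to
  infinity.\<close>

lemma mass: "t \<ge> 0 \<Longrightarrow> measure (\<mu> t) UNIV = measure (\<mu> 0) UNIV"
proof -
  assume t: "t \<ge> 0"
  have d: "((\<lambda>t. \<integral>x. (1::real) \<partial>\<mu> t) has_real_derivative 0) (at s within {0..})" if "s \<ge> 0" for s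
    using mu_DERIV_adm[OF adm_const[of 1] that] by simp
  have "(LBINT s:{0..t}. (0::real)) = (\<integral>x. (1::real) \<partial>\<mu> t) - (\<integral>x. (1::real) \<partial>\<mu> 0)"
    by (rule DERIV_integral(1)[OF _ d t]) auto
  then show ?thesis using mspace[OF t] mspace[of 0] by simp
qed

text \<open>In a frame moving with speed c the energy is transported with velocity u - c. For a
  decreasing cutoff the sign of this relative velocity decides whether the energy to the left grows
  or shrinks.\<close>

lemma mu_move:
  assumes B: "adm B" and t: "t \<ge> 0"
  shows "((\<lambda>t. \<integral>x. B (x - c * (t - t0)) \<partial>\<mu> t) has_real_derivative (\<integral>x. (u t x - c) * deriv B (x - c * (t - t0)) \<partial>\<mu> t)) (at t within {0..})"
proof -
  obtain K0 K1 K2 where K: "K0 \<ge> 0" "K1 > 0" "K2 > 0" "\<And>x. \<bar>B x\<bar> \<le> K0" "\<And>x. \<bar>deriv B x\<bar> \<le> K1" "\<And>x. \<bar>deriv (deriv B) x\<bar> \<le> K2"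
    by (rule adm_props[OF B]) blast
  have sB: "smooth1 B" using B by (simp add: adm_def)
  note cB = smooth1_continuous[OF sB, of UNIV] smooth1_continuous[OF smooth1_deriv[OF sB], of UNIV]
  have [measurable]: "B \<in> borel_measurable borel" "deriv B \<in> borel_measurable borel"
    using cB by (auto intro: borel_measurable_continuous_onI)
  let ?y = "\<lambda>t. c * (t - t0)"
  \<comment> \<open>The factor 1 is the weight \<open>k\<close> of
    \<open>deriv_convolution\<close>.\<close>
  let ?f = "\<lambda>t s. \<integral>x. 1 * B (x - s) \<partial>\<mu> t"
  let ?fy = "\<lambda>t s. - (\<integral>x. 1 * deriv B (x - s) \<partial>\<mu> t)"
  have "((\<lambda>t. ?f t (?y t)) has_real_derivative (\<integral>x. u t x * deriv B (x - ?y t) \<partial>\<mu> t) + ?fy t (?y t) * c) (at t within {0..})"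
  proof (rule moving_frame_DERIV[where f = ?f and y = ?y and fy = ?fy])
    show "((\<lambda>t'. ?f t' (?y t)) has_real_derivative (\<integral>x. u t x * deriv B (x - ?y t) \<partial>\<mu> t)) (at t within {0..})"
      using mu_DERIV_adm[OF adm_shift[OF B] t, of "?y t"] unfolding deriv_shift[OF sB] by simp
    show "((\<lambda>s. ?f t s) has_real_derivative ?fy t s) (at s)" if "t \<ge> 0" for t s
    proof (rule deriv_convolution[OF _ msets[OF that] smooth1_DERIV[OF sB] smooth1_DERIV[OF smooth1_deriv[OF sB]] K(4-6)])
      interpret finite_measure "\<mu> t" by (rule mfin[OF that])
      show "integrable (\<mu> t) (\<lambda>x. 1::real)" by simp
    qed
    show "continuous (at (t, ?y t) within {0..} \<times> UNIV) (\<lambda>(t,s). ?fy t s)"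
      unfolding continuous_within_sequentially comp_def
    proof (intro allI impI)
      fix Z :: "nat \<Rightarrow> real \<times> real" assume Z: "(\<forall>n. Z n \<in> {0..} \<times> UNIV) \<and> Z \<longlonglongrightarrow> (t, ?y t)"
      define X S where "X n = fst (Z n)" and "S n = snd (Z n)" for n
      have X: "X \<longlonglongrightarrow> t" "\<And>n. X n \<ge> 0" "t \<ge> 0" and S: "S \<longlonglongrightarrow> ?y t"
      proof -
        have "Z \<longlonglongrightarrow> (t, ?y t)" using Z by blast
        from tendsto_fst[OF this] tendsto_snd[OF this] show "X \<longlonglongrightarrow> t" "S \<longlonglongrightarrow> ?y t"
          by (simp_all add: X_def[abs_def] S_def[abs_def])
        show "\<And>n. X n \<ge> 0" "t \<ge> 0" using Z t by (auto simp: X_def mem_Times_iff)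
      qed
      have "(\<lambda>n. \<integral>x. deriv B (x - S n) \<partial>\<mu> (X n)) \<longlonglongrightarrow> (\<integral>x. deriv B (x - ?y t) \<partial>\<mu> t)"
      proof (rule mu_converge[OF X, where c = "\<lambda>n. K2 * \<bar>S n - ?y t\<bar>"])
        show "continuous_on UNIV (\<lambda>x. deriv B (x - S n))" "continuous_on UNIV (\<lambda>x. deriv B (x - ?y t))" for n
          by (rule continuous_on_compose2[OF cB(2)]; auto intro!: continuous_intros)+
        show "\<bar>deriv B (x - ?y t)\<bar> \<le> K1" for x by (rule K)
        have "(\<lambda>n. \<bar>S n - ?y t\<bar>) \<longlonglongrightarrow> 0" using S by (simp add: LIM_zero_iff tendsto_rabs_zero)
        then show "(\<lambda>n. K2 * \<bar>S n - ?y t\<bar>) \<longlonglongrightarrow> 0" by (rule tendsto_mult_right_zero)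
        show "\<bar>deriv B (x - S n) - deriv B (x - ?y t)\<bar> \<le> K2 * \<bar>S n - ?y t\<bar>" for n x
          using lipschitz_of_deriv[OF smooth1_DERIV[OF smooth1_deriv[OF sB]] K(6), of "x - S n" "x - ?y t"] by (simp add: abs_minus_commute)
      qed
      then have "(\<lambda>n. - (\<integral>x. 1 * deriv B (x - S n) \<partial>\<mu> (X n))) \<longlonglongrightarrow> - (\<integral>x. 1 * deriv B (x - ?y t) \<partial>\<mu> t)" by (simp add: tendsto_minus)
      then show "(\<lambda>n. case Z n of (t, s) \<Rightarrow> ?fy t s) \<longlonglongrightarrow> (case (t, ?y t) of (t, s) \<Rightarrow> ?fy t s)"
        by (simp add: X_def S_def case_prod_beta)
    qed
    show "(?y has_real_derivative c) (at t within {0..})" by (auto intro!: derivative_eq_intros)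
  qed
  moreover have "(\<integral>x. u t x * deriv B (x - ?y t) \<partial>\<mu> t) + ?fy t (?y t) * c = (\<integral>x. (u t x - c) * deriv B (x - ?y t) \<partial>\<mu> t)"
  proof -
    obtain C where C: "C \<ge> 0" "\<And>x. \<bar>u t x\<bar> \<le> C" by (rule u_bdd[OF t]) blast
    note [measurable] = u_meas[OF t]
    have i1: "integrable (\<mu> t) (\<lambda>x. u t x * deriv B (x - ?y t))"
      by (rule m_integrable[OF t, of _ "C * K1"]) (use C K in \<open>auto simp: abs_mult intro!: mult_mono\<close>)
    have i2: "integrable (\<mu> t) (\<lambda>x. deriv B (x - ?y t))" by (rule m_integrable[OF t _ K(5)]) measurable
    show ?thesis using i1 i2 by (simp add: left_diff_distrib)
  qed
  ultimately show ?thesis by simp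
qed

end

section \<open>Transport of the quantiles of the energy\<close>

context weak_solution begin

definition mass0 :: real where "mass0 = measure (\<mu> 0) UNIV"
text \<open>Closed half-lines make \<open>F t\<close> right continuous, so that the infimum defining
  the quantile \<open>yq\<close> is attained.\<close>

definition F :: "real \<Rightarrow> real \<Rightarrow> real" where "F t x = measure (\<mu> t) {..x}"
definition yq :: "real \<Rightarrow> real \<Rightarrow> real" where "yq t \<eta> = Inf {x. \<eta> \<le> F t x}"

lemma F_mono: "t \<ge> 0 \<Longrightarrow> x \<le> z \<Longrightarrow> F t x \<le> F t z"
  unfolding F_def by (rule finite_measure.finite_measure_mono[OF mfin]) (auto simp: msets)

lemma F_bounds: "t \<ge> 0 \<Longrightarrow> 0 \<le> F t x" "t \<ge> 0 \<Longrightarrow> F t x \<le> mass0"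
proof -
  show "0 \<le> F t x" by (simp add: F_def)
  assume t: "t \<ge> 0"
  have "F t x \<le> measure (\<mu> t) UNIV" unfolding F_def
    by (rule finite_measure.finite_measure_mono[OF mfin[OF t]]) (auto simp: msets[OF t])
  then show "F t x \<le> mass0" using mass[OF t] by (simp add: mass0_def)
qed

lemma F_top: assumes t: "t \<ge> 0" shows "(\<lambda>n. F t (real n)) \<longlonglongrightarrow> mass0"
proof -
  interpret finite_measure "\<mu> t" by (rule mfin[OF t])
  have "(\<lambda>n. measure (\<mu> t) {..real n}) \<longlonglongrightarrow> measure (\<mu> t) (\<Union>n. {..real n})"
    by (rule finite_Lim_measure_incseq) (auto simp: incseq_def msets[OF t])
  also have "(\<Union>n. {..real n}) = UNIV" using real_arch_simple by auto
  finally show ?thesis using mass[OF t] by (simp add: F_def mass0_def)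
qed

lemma F_bot: assumes t: "t \<ge> 0" shows "(\<lambda>n. F t (- real n)) \<longlonglongrightarrow> 0"
proof -
  interpret finite_measure "\<mu> t" by (rule mfin[OF t])
  have "(\<lambda>n. measure (\<mu> t) {..- real n}) \<longlonglongrightarrow> measure (\<mu> t) (\<Inter>n. {..- real n})"
    by (rule finite_Lim_measure_decseq) (auto simp: decseq_def msets[OF t])
  also have "(\<Inter>n. {..- real n}) = {}"
  proof -
    have "\<exists>n. \<not> x \<le> - real n" for x
    proof -
      obtain n where "- x < real n" using reals_Archimedean2 by blast
      then have "\<not> x \<le> - real n" by simp
      then show ?thesis by blast
    qed
    then show ?thesis by blast
  qed
  finally show ?thesis by (simp add: F_def)
qed

lemma F_right: assumes t: "t \<ge> 0" shows "(\<lambda>n. F t (x + inverse (real (Suc n)))) \<longlonglongrightarrow> F t x"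
proof -
  interpret finite_measure "\<mu> t" by (rule mfin[OF t])
  have "(\<lambda>n. measure (\<mu> t) {..x + inverse (real (Suc n))}) \<longlonglongrightarrow> measure (\<mu> t) (\<Inter>n. {..x + inverse (real (Suc n))})"
  proof (rule finite_Lim_measure_decseq)
    show "decseq (\<lambda>n. {..x + inverse (real (Suc n))})"
    proof (rule decseq_SucI)
      fix n have "inverse (real (Suc (Suc n))) \<le> inverse (real (Suc n))" by (rule le_imp_inverse_le) auto
      then show "{..x + inverse (real (Suc (Suc n)))} \<subseteq> {..x + inverse (real (Suc n))}" by auto
    qed
  qed (auto simp: msets[OF t])
  also have "(\<Inter>n. {..x + inverse (real (Suc n))}) = {..x}"
  proof (intro equalityI subsetI)
    fix z assume z: "z \<in> (\<Inter>n. {..x + inverse (real (Suc n))})"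
    show "z \<in> {..x}"
    proof (rule ccontr)
      assume "z \<notin> {..x}"
      then have "0 < z - x" by simp
      from reals_Archimedean[OF this] obtain n where "inverse (real (Suc n)) < z - x" by blast
      moreover have "z \<le> x + inverse (real (Suc n))" using z by blast
      ultimately show False by linarith
    qed
  next
    fix z assume "z \<in> {..x}"
    then have z: "z \<le> x" by simp
    have "z \<le> x + inverse (real (Suc n))" for n
    proof -
      have "0 < inverse (real (Suc n))" by simp
      then show ?thesis using z by linarith
    qed
    then show "z \<in> (\<Inter>n. {..x + inverse (real (Suc n))})" by blast
  qed
  finally show ?thesis by (simp add: F_def)
qed

text \<open>A level strictly between 0 and the total mass is exceeded somewhere to the right and
  missed somewhere to the left, so the set is nonempty and bounded below. Right continuity puts its
  infimum into it.\<close>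

lemma yq_galois:
  assumes t: "t \<ge> 0" and \<eta>: "0 < \<eta>" "\<eta> < mass0"
  shows "yq t \<eta> \<le> x \<longleftrightarrow> \<eta> \<le> F t x"
proof -
  let ?S = "{x. \<eta> \<le> F t x}"
  obtain n where "\<bar>F t (real n) - mass0\<bar> < mass0 - \<eta>"
    using LIMSEQ_D[OF F_top[OF t], of "mass0 - \<eta>"] \<eta> by auto
  then have ne: "real n \<in> ?S" by auto
  obtain k where "\<bar>F t (- real k)\<bar> < \<eta>"
    using LIMSEQ_D[OF F_bot[OF t], of \<eta>] \<eta> by auto
  then have k: "F t (- real k) < \<eta>" by auto
  have bb: "bdd_below ?S"
  proof (rule bdd_belowI)
    fix x assume "x \<in> ?S"
    then show "- real k \<le> x" using k F_mono[OF t, of x "- real k"] by (cases "x \<le> - real k") auto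
  qed
  define s where "s = Inf ?S"
  have "\<eta> \<le> F t (s + inverse (real (Suc n)))" for n
  proof -
    have "Inf ?S < s + inverse (real (Suc n))" by (simp add: s_def)
    then obtain z where "z \<in> ?S" "z < s + inverse (real (Suc n))" using cInf_lessD[of ?S] ne by blast
    then show ?thesis using F_mono[OF t, of z "s + inverse (real (Suc n))"] by simp
  qed
  then have S: "\<eta> \<le> F t s" using LIMSEQ_le_const[OF F_right[OF t, of s]] by blast
  show ?thesis unfolding yq_def s_def[symmetric]
  proof
    assume "s \<le> x" then show "\<eta> \<le> F t x" using F_mono[OF t, of s x] S by simp
  next
    assume "\<eta> \<le> F t x" then show "s \<le> x" unfolding s_def by (intro cInf_lower[OF _ bb]) simp
  qed
qed

lemma u_near:
  assumes t0: "t0 \<ge> 0" and e: "e > 0"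
  obtains r where "r > 0" "\<And>t x. t \<ge> 0 \<Longrightarrow> \<bar>t - t0\<bar> \<le> r \<Longrightarrow> \<bar>x - x0\<bar> \<le> r \<Longrightarrow> \<bar>u t x - u t0 x0\<bar> < e"
proof -
  have "continuous (at (t0, x0) within {0..} \<times> UNIV) (\<lambda>p. u (fst p) (snd p))"
    unfolding continuous_within_sequentially comp_def
  proof (intro allI impI)
    fix Z :: "nat \<Rightarrow> real \<times> real" assume Z: "(\<forall>n. Z n \<in> {0..} \<times> UNIV) \<and> Z \<longlonglongrightarrow> (t0, x0)"
    then have "Z \<longlonglongrightarrow> (t0, x0)" by blast
    from tendsto_fst[OF this] tendsto_snd[OF this] have "(\<lambda>n. fst (Z n)) \<longlonglongrightarrow> t0" "(\<lambda>n. snd (Z n)) \<longlonglongrightarrow> x0" by simp_all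
    moreover have "\<And>n. fst (Z n) \<ge> 0" using Z by (auto simp: mem_Times_iff)
    ultimately show "(\<lambda>n. u (fst (Z n)) (snd (Z n))) \<longlonglongrightarrow> u (fst (t0, x0)) (snd (t0, x0))"
      using u_seq t0 by simp
  qed
  then obtain d where d: "d > 0" "\<And>p. p \<in> {0..} \<times> UNIV \<Longrightarrow> dist p (t0, x0) < d \<Longrightarrow> dist (u (fst p) (snd p)) (u t0 x0) < e"
    unfolding continuous_within_eps_delta using e by (metis fst_conv snd_conv)
  show thesis
  proof (rule that[of "d / 3"])
    show "d / 3 > 0" using d by simp
    fix t x assume *: "t \<ge> 0" "\<bar>t - t0\<bar> \<le> d / 3" "\<bar>x - x0\<bar> \<le> d / 3"
    have "dist (t, x) (t0, x0) \<le> \<bar>t - t0\<bar> + \<bar>x - x0\<bar>"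
      using sqrt_sum_squares_le_sum_abs[of "t - t0" "x - x0"] by (simp add: dist_Pair_Pair dist_real_def)
    then have "dist (t, x) (t0, x0) < d" using * d(1) by linarith
    then show "\<bar>u t x - u t0 x0\<bar> < e" using d(2)[of "(t, x)"] *(1) by (simp add: dist_real_def)
  qed
qed

text \<open>The mass to the left of a line moving faster (slower) than all nearby values of \<open>u\<close> increases (decreases).
  The gap between \<open>p\<close> and \<open>q\<close> leaves room for a smooth cutoff.\<close>
lemma barrier:
  assumes near: "\<And>t x. t \<ge> 0 \<Longrightarrow> \<bar>t - t0\<bar> \<le> r \<Longrightarrow> \<bar>x - x0\<bar> \<le> r \<Longrightarrow> \<bar>u t x - c\<bar> < e"
    and e: "e > 0" and d: "d \<le> r" "(\<bar>c\<bar> + e) * d \<le> r / 2"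
    and pq: "p < q" "x0 - r / 2 \<le> p" "q \<le> x0 + r / 2"
    and t: "0 \<le> t1" "t1 \<le> t2" "\<bar>t1 - t0\<bar> \<le> d" "\<bar>t2 - t0\<bar> \<le> d"
  shows "F t1 (p + (c + e) * (t1 - t0)) \<le> F t2 (q + (c + e) * (t2 - t0))"
    and "F t2 (p + (c - e) * (t2 - t0)) \<le> F t1 (q + (c - e) * (t1 - t0))"
proof -
  obtain B where B: "smooth1 B" "test1 (deriv B)" "\<And>x. deriv B x \<le> 0" "\<And>x. x \<notin> {p<..<q} \<Longrightarrow> deriv B x = 0"
    "\<And>x. x \<le> p \<Longrightarrow> B x = 1" "\<And>x. q \<le> x \<Longrightarrow> B x = 0" "\<And>x. 0 \<le> B x \<and> B x \<le> 1"
    by (rule smooth_step[OF pq(1)]) blast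
  have "\<forall>x. \<bar>B x\<bar> \<le> 1" using B(7) by (simp add: abs_le_iff order_trans[OF _ zero_le_one])
  then have ad: "adm B" unfolding adm_def using B(1,2) by blast
  have [measurable]: "B \<in> borel_measurable borel"
    by (rule borel_measurable_continuous_onI[OF smooth1_continuous[OF B(1)]])
  define \<Psi> where "\<Psi> s t = (\<integral>x. B (x - s * (t - t0)) \<partial>\<mu> t)" for s t
  have low: "F t (p + s * (t - t0)) \<le> \<Psi> s t" and up: "\<Psi> s t \<le> F t (q + s * (t - t0))" if t: "t \<ge> 0" for s t
  proof -
    interpret finite_measure "\<mu> t" by (rule mfin[OF t])
    have i: "integrable (\<mu> t) (\<lambda>x. B (x - s * (t - t0)))"
      by (rule m_integrable[OF t, of _ 1]) (use B(7) in \<open>auto simp: abs_le_iff order_trans[OF _ zero_le_one]\<close>)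
    have ind: "integrable (\<mu> t) (indicator {..z} :: real \<Rightarrow> real)" "(\<integral>x. indicator {..z} x \<partial>\<mu> t) = F t z" for z :: real
    proof -
      show "integrable (\<mu> t) (indicator {..z} :: real \<Rightarrow> real)"
        by (rule m_integrable[OF t, of _ 1]) (auto simp: indicator_def)
      show "(\<integral>x. indicator {..z} x \<partial>\<mu> t) = F t z" using msets[OF t] mspace[OF t] by (simp add: F_def)
    qed
    have "F t (p + s * (t - t0)) = (\<integral>x. indicator {..p + s * (t - t0)} x \<partial>\<mu> t)" using ind by simp
    also have "\<dots> \<le> \<Psi> s t" unfolding \<Psi>_def
      by (rule integral_mono[OF ind(1) i]) (use B(5,7) in \<open>auto simp: indicator_def\<close>)
    finally show "F t (p + s * (t - t0)) \<le> \<Psi> s t" .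
    have "\<Psi> s t \<le> (\<integral>x. indicator {..q + s * (t - t0)} x \<partial>\<mu> t)" unfolding \<Psi>_def
      by (rule integral_mono[OF i ind(1)]) (use B(6,7) in \<open>auto simp: indicator_def not_le\<close>)
    then show "\<Psi> s t \<le> F t (q + s * (t - t0))" using ind by simp
  qed
  have mvt: "\<exists>t\<in>{t1..t2}. \<Psi> s t2 - \<Psi> s t1 = (\<integral>x. (u t x - s) * deriv B (x - s * (t - t0)) \<partial>\<mu> t) * (t2 - t1)" for s
  proof (cases "t1 < t2")
    case True
    have "\<exists>t\<in>{t1<..<t2}. \<Psi> s t2 - \<Psi> s t1 = (\<lambda>h. (\<integral>x. (u t x - s) * deriv B (x - s * (t - t0)) \<partial>\<mu> t) * h) (t2 - t1)"
    proof (rule mvt_simple[OF True])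
      fix t assume "t1 \<le> t" "t \<le> t2"
      then have "t \<ge> 0" "{t1..t2} \<subseteq> {0..}" using assms by auto
      from DERIV_subset[OF mu_move[OF ad this(1), of s t0] this(2)]
      show "(\<Psi> s has_derivative (\<lambda>h. (\<integral>x. (u t x - s) * deriv B (x - s * (t - t0)) \<partial>\<mu> t) * h)) (at t within {t1..t2})"
        unfolding has_field_derivative_def \<Psi>_def[abs_def] .
    qed
    then show ?thesis by (meson greaterThanLessThan_subseteq_atLeastAtMost_iff order_refl subsetD)
  next
    case False
    then show ?thesis using t by (intro bexI[of _ t1]) auto
  qed
  have loc: "\<bar>u t x - c\<bar> < e \<or> deriv B (x - s * (t - t0)) = 0" if tt: "t \<in> {t1..t2}" and s: "\<bar>s\<bar> \<le> \<bar>c\<bar> + e" for s t x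
  proof (cases "x - s * (t - t0) \<in> {p<..<q}")
    case True
    have td: "\<bar>t - t0\<bar> \<le> d" using tt t by (auto simp: abs_le_iff)
    have "\<bar>s * (t - t0)\<bar> \<le> (\<bar>c\<bar> + e) * d" unfolding abs_mult using s td e by (intro mult_mono) auto
    then have "\<bar>x - x0\<bar> \<le> r" using True pq d(2) by (auto simp: abs_le_iff)
    then show ?thesis using near[of t x] tt t td d(1) by auto
  qed (use B(4) in blast)
  have "0 \<le> \<Psi> (c + e) t2 - \<Psi> (c + e) t1"
  proof -
    obtain t where tt: "t \<in> {t1..t2}" and eq: "\<Psi> (c + e) t2 - \<Psi> (c + e) t1 = (\<integral>x. (u t x - (c + e)) * deriv B (x - (c + e) * (t - t0)) \<partial>\<mu> t) * (t2 - t1)"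
      using mvt by blast
    have "0 \<le> (\<integral>x. (u t x - (c + e)) * deriv B (x - (c + e) * (t - t0)) \<partial>\<mu> t)"
    proof (rule integral_nonneg_AE, rule AE_I2)
      fix x
      have "\<bar>c + e\<bar> \<le> \<bar>c\<bar> + e" using e by linarith
      then show "0 \<le> (u t x - (c + e)) * deriv B (x - (c + e) * (t - t0))"
        using loc[OF tt, of "c + e" x] B(3)[of "x - (c + e) * (t - t0)"] mult_nonpos_nonpos[of "u t x - (c + e)"] by fastforce
    qed
    then show ?thesis unfolding eq using assms by simp
  qed
  then show "F t1 (p + (c + e) * (t1 - t0)) \<le> F t2 (q + (c + e) * (t2 - t0))"
    using low[of t1 "c + e"] up[of t2 "c + e"] assms by simp
  have "\<Psi> (c - e) t2 - \<Psi> (c - e) t1 \<le> 0"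
  proof -
    obtain t where tt: "t \<in> {t1..t2}" and eq: "\<Psi> (c - e) t2 - \<Psi> (c - e) t1 = (\<integral>x. (u t x - (c - e)) * deriv B (x - (c - e) * (t - t0)) \<partial>\<mu> t) * (t2 - t1)"
      using mvt by blast
    have "0 \<le> (\<integral>x. - ((u t x - (c - e)) * deriv B (x - (c - e) * (t - t0))) \<partial>\<mu> t)"
    proof (rule integral_nonneg_AE, rule AE_I2)
      fix x
      have "\<bar>c - e\<bar> \<le> \<bar>c\<bar> + e" using e by linarith
      then show "0 \<le> - ((u t x - (c - e)) * deriv B (x - (c - e) * (t - t0)))"
        using loc[OF tt, of "c - e" x] B(3)[of "x - (c - e) * (t - t0)"] mult_nonneg_nonpos[of "u t x - (c - e)"] by fastforce
    qed
    then have "(\<integral>x. (u t x - (c - e)) * deriv B (x - (c - e) * (t - t0)) \<partial>\<mu> t) \<le> 0" by simp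
    then show ?thesis unfolding eq using assms by (simp add: mult_nonpos_nonneg)
  qed
  then show "F t2 (p + (c - e) * (t2 - t0)) \<le> F t1 (q + (c - e) * (t1 - t0))"
    using low[of t2 "c - e"] up[of t1 "c - e"] assms by simp
qed

text \<open>For short times the two lines through the quantile with slopes c + e and c - e enclose
  it: no net energy crosses the faster line from left to right nor the slower one from right to
  left. So the difference quotient is within e of c; for times before t0 the two lines exchange
  their roles.\<close>

lemma yq_DERIV:
  assumes t0: "t0 \<ge> 0" and \<eta>: "0 < \<eta>" "\<eta> < mass0"
  shows "((\<lambda>t. yq t \<eta>) has_real_derivative u t0 (yq t0 \<eta>)) (at t0 within {0..})"
  unfolding has_field_derivative_def has_derivative_within_alt
proof (intro conjI allI impI)
  show "bounded_linear ((*) (u t0 (yq t0 \<eta>)))" by (rule bounded_linear_mult_right)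
  fix e :: real assume e: "e > 0"
  define x0 c where "x0 = yq t0 \<eta>" and "c = u t0 (yq t0 \<eta>)"
  obtain r where r: "r > 0" and near: "\<And>t x. t \<ge> 0 \<Longrightarrow> \<bar>t - t0\<bar> \<le> r \<Longrightarrow> \<bar>x - x0\<bar> \<le> r \<Longrightarrow> \<bar>u t x - c\<bar> < e"
    using u_near[OF t0 e, of x0] unfolding x0_def c_def by metis
  \<comment> \<open>Small enough for \<open>near\<close> to apply in time and for a line of slope at
    most |c| + e to stay within r / 2 of x0.\<close>
  define d where "d = min r (r / (2 * (\<bar>c\<bar> + e)))"
  have d: "d > 0" "d \<le> r" using r e by (auto simp: d_def)
  have "d \<le> r / (2 * (\<bar>c\<bar> + e))" by (simp add: d_def)
  then have d2: "(\<bar>c\<bar> + e) * d \<le> r / 2" using e by (simp add: field_simps)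
  have bar: "F t1 (p + (c + e) * (t1 - t0)) \<le> F t2 (q + (c + e) * (t2 - t0))"
    "F t2 (p + (c - e) * (t2 - t0)) \<le> F t1 (q + (c - e) * (t1 - t0))"
    if "p < q" "x0 - r / 2 \<le> p" "q \<le> x0 + r / 2" "0 \<le> t1" "t1 \<le> t2" "\<bar>t1 - t0\<bar> \<le> d" "\<bar>t2 - t0\<bar> \<le> d" for p q t1 t2
    by (rule barrier[of t0 r x0 c e d]; use near e d d2 that in blast)+
  have Fx0: "\<eta> \<le> F t0 x0" using yq_galois[OF t0 \<eta>, of x0] by (simp add: x0_def)
  have Fq: "F t0 q < \<eta>" if "q < x0" for q using yq_galois[OF t0 \<eta>, of q] that by (simp add: x0_def)
  have up: "yq t \<eta> \<le> x0 + s * (t - t0)" if t: "t \<ge> 0" and "\<And>q. x0 < q \<Longrightarrow> q < x0 + r / 2 \<Longrightarrow> F t0 x0 \<le> F t (q + s * (t - t0))" for s t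
  proof -
    have "yq t \<eta> - s * (t - t0) \<le> x0"
    proof (rule dense_ge_bounded[of x0 "x0 + r / 2"])
      fix q assume "x0 < q" "q < x0 + r / 2"
      then have "\<eta> \<le> F t (q + s * (t - t0))" using that(2)[of q] Fx0 by simp
      then have "yq t \<eta> \<le> q + s * (t - t0)" unfolding yq_galois[OF t \<eta>] .
      then show "yq t \<eta> - s * (t - t0) \<le> q" by linarith
    qed (use r in simp)
    then show ?thesis by simp
  qed
  \<comment> \<open>At x0 itself F may exceed the level because of an atom, so the comparison point
    q is taken strictly left of x0, where F is below the level, and p is left of q to leave room for
    the cutoff.\<close>
  have low: "x0 + s * (t - t0) \<le> yq t \<eta>" if t: "t \<ge> 0" and "\<And>p q. p < q \<Longrightarrow> q < x0 \<Longrightarrow> x0 - r / 2 < p \<Longrightarrow> F t (p + s * (t - t0)) \<le> F t0 q" for s t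
  proof -
    have "x0 \<le> yq t \<eta> - s * (t - t0)"
    proof (rule dense_le_bounded[of "x0 - r / 2" x0])
      fix p assume p: "x0 - r / 2 < p" "p < x0"
      obtain q where q: "p < q" "q < x0" using dense[OF p(2)] by blast
      have "F t (p + s * (t - t0)) < \<eta>" using that(2)[OF q p(1)] Fq[OF q(2)] by simp
      then have "p + s * (t - t0) < yq t \<eta>" using yq_galois[OF t \<eta>, of "p + s * (t - t0)"] by simp
      then show "p \<le> yq t \<eta> - s * (t - t0)" by simp
    qed (use r in simp)
    then show ?thesis by simp
  qed
  show "\<exists>d>0. \<forall>t\<in>{0..}. norm (t - t0) < d \<longrightarrow> norm (yq t \<eta> - yq t0 \<eta> - u t0 (yq t0 \<eta>) * (t - t0)) \<le> e * norm (t - t0)"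
  proof (intro exI[of _ d] conjI ballI impI d(1))
    fix t assume "t \<in> {0..}" and td: "norm (t - t0) < d"
    then have t: "t \<ge> 0" "\<bar>t - t0\<bar> \<le> d" by auto
    have d0: "\<bar>t0 - t0\<bar> \<le> d" using d(1) by simp
    have "\<bar>yq t \<eta> - x0 - c * (t - t0)\<bar> \<le> e * \<bar>t - t0\<bar>"
    proof (cases "t0 \<le> t")
      case True
      have "yq t \<eta> \<le> x0 + (c + e) * (t - t0)"
      proof (rule up[OF t(1)])
        fix q assume "x0 < q" "q < x0 + r / 2"
        then show "F t0 x0 \<le> F t (q + (c + e) * (t - t0))" using bar(1)[OF _ _ _ t0 True d0 t(2), of x0 q] r by simp
      qed
      moreover have "x0 + (c - e) * (t - t0) \<le> yq t \<eta>"
      proof (rule low[OF t(1)])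
        fix p q assume "p < q" "q < x0" "x0 - r / 2 < p"
        then show "F t (p + (c - e) * (t - t0)) \<le> F t0 q" using bar(2)[OF _ _ _ t0 True d0 t(2), of p q] r by simp
      qed
      ultimately show ?thesis unfolding abs_of_nonneg[OF iffD2[OF diff_ge_0_iff_ge True]] abs_le_iff distrib_right left_diff_distrib by linarith
    next
      case False
      then have F1: "t \<le> t0" by simp
      have "yq t \<eta> \<le> x0 + (c - e) * (t - t0)"
      proof (rule up[OF t(1)])
        fix q assume "x0 < q" "q < x0 + r / 2"
        then show "F t0 x0 \<le> F t (q + (c - e) * (t - t0))" using bar(2)[OF _ _ _ t(1) F1 t(2) d0, of x0 q] r by simp
      qed
      moreover have "x0 + (c + e) * (t - t0) \<le> yq t \<eta>"
      proof (rule low[OF t(1)])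
        fix p q assume "p < q" "q < x0" "x0 - r / 2 < p"
        then show "F t (p + (c + e) * (t - t0)) \<le> F t0 q" using bar(1)[OF _ _ _ t(1) F1 t(2) d0, of p q] r by simp
      qed
      ultimately show ?thesis unfolding abs_of_nonpos[OF iffD2[OF diff_le_0_iff_le F1]] abs_le_iff distrib_right left_diff_distrib minus_diff_eq right_diff_distrib by linarith
    qed
    then show "norm (yq t \<eta> - yq t0 \<eta> - u t0 (yq t0 \<eta>) * (t - t0)) \<le> e * norm (t - t0)"
      by (simp add: x0_def c_def)
  qed
qed

end

section \<open>The velocity equation in a moving frame\<close>

lemma integral_shift:
  fixes g :: "real \<Rightarrow> real"
  shows "(\<integral>x. g (x - s) \<partial>lborel) = (\<integral>x. g x \<partial>lborel)"
  using lborel_integral_real_affine[of 1 g "- s"] by simp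

text \<open>The primitive of b that vanishes at minus infinity, written with an open half-line so
  that it arises directly when the order of integration in the source term is exchanged.\<close>

definition cum :: "(real \<Rightarrow> real) \<Rightarrow> real \<Rightarrow> real" where
  "cum b z = (\<integral>x. indicator {..<z} x * b x \<partial>lborel)"

lemma cum_props:
  assumes b: "test1 b"
  shows "smooth1 (cum b)" "deriv (cum b) = b" "adm (cum b)"
proof -
  obtain B where B: "smooth1 B" "deriv B = b" "antideriv B b" by (rule smooth_antiderivative[OF test1_smooth[OF b]])
  have ad: "antideriv (cum b) b" unfolding cum_def[abs_def] by (rule antideriv_of_integrable[OF test1_integrable[OF b]])
  have e: "cum b z = B z + (cum b 0 - B 0)" for z
    using antideriv_eq[OF ad, of 0 z] antideriv_eq[OF B(3), of 0 z] antideriv_eq[OF ad, of z 0] antideriv_eq[OF B(3), of z 0]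
    by (cases "0 \<le> z") auto
  have cumB: "cum b = (\<lambda>z. B z + (cum b 0 - B 0))" by (rule ext) (rule e)
  have D: "((\<lambda>z. B z + (cum b 0 - B 0)) has_real_derivative b z) (at z)" for z
    using smooth1_DERIV[OF B(1), of z] unfolding B(2) by (auto intro!: derivative_eq_intros)
  have D': "(cum b has_real_derivative b z) (at z)" for z by (subst cumB) (rule D)
  show s: "smooth1 (cum b)" by (rule smooth1_antideriv[OF test1_smooth[OF b] D'])
  show d: "deriv (cum b) = b" by (rule ext) (rule DERIV_imp_deriv[OF D'])
  have "\<bar>cum b z\<bar> \<le> (\<integral>x. \<bar>b x\<bar> \<partial>lborel)" for z unfolding cum_def
  proof (rule order_trans[OF integral_abs_bound integral_mono])
    have i: "integrable lborel b" by (rule test1_integrable[OF b])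
    show "integrable lborel (\<lambda>x. \<bar>indicator {..<z} x * b x\<bar>)"
      using integrable_mult_indicator[OF _ i, of "{..<z}"] by (intro integrable_abs) simp
    show "integrable lborel (\<lambda>x. \<bar>b x\<bar>)" using i by simp
  qed (simp add: indicator_def)
  then show "adm (cum b)" unfolding adm_def d using s b by blast
qed

lemma cum_shift: "cum (\<lambda>x. b (x - s)) z = cum b (z - s)"
proof -
  have "cum (\<lambda>x. b (x - s)) z = (\<integral>x. (\<lambda>x. indicator {..<z - s} x * b x) (x - s) \<partial>lborel)"
    unfolding cum_def by (rule Bochner_Integration.integral_cong) (auto simp: indicator_def)
  then show ?thesis unfolding cum_def integral_shift[of "\<lambda>x. indicator {..<z - s} x * b x" s] .
qed

lemma integrable_cont_test1:
  assumes h: "continuous_on UNIV h" and b: "test1 b" shows "integrable lborel (\<lambda>x. h x * b x)"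
proof -
  obtain R where R: "R > 0" "\<And>x. \<bar>x\<bar> \<ge> R \<Longrightarrow> b x = 0" using test1_support[OF b] by metis
  have z: "h x * b x = 0" if "x \<notin> {-R..R}" for x
  proof -
    have "\<bar>x\<bar> \<ge> R" using that by auto
    then show ?thesis using R(2) by simp
  qed
  have "set_integrable lborel {-R..R} (\<lambda>x. h x * b x)"
    by (intro set_integrable_cont continuous_intros h smooth1_continuous test1_smooth b)
  then show ?thesis using integrable_iff_support[OF z] by simp
qed

lemma conv_DERIV:
  assumes h: "continuous_on UNIV h" and b: "test1 b"
  shows "((\<lambda>s. \<integral>x. h x * b (x - s) \<partial>lborel) has_real_derivative - (\<integral>x. h x * deriv b (x - s) \<partial>lborel)) (at s)"
proof -
  obtain K0 K1 K2 where K: "K0 \<ge> 0" "K1 > 0" "K2 > 0" "\<And>x. \<bar>b x\<bar> \<le> K0" "\<And>x. \<bar>deriv b x\<bar> \<le> K1" "\<And>x. \<bar>deriv (deriv b) x\<bar> \<le> K2"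
    by (rule adm_props[OF adm_test1[OF b]]) blast
  obtain R where R: "R > 0" "\<And>x. \<bar>x\<bar> \<ge> R \<Longrightarrow> b x = 0 \<and> deriv b x = 0" using test1_support[OF b] by metis
  \<comment> \<open>The weight h need not be integrable. For shifts within 1 of s the translated
    test function vanishes outside {-L..L}, so h may be truncated there without changing either
    integral.\<close>
  define L where "L = \<bar>s\<bar> + 1 + R"
  define k where "k x = indicator {-L..L} x *\<^sub>R h x" for x
  have ki: "integrable lborel k" using set_integrable_cont[OF h, of "-L" L] unfolding set_integrable_def k_def[abs_def] .
  have kh: "k x * b (x - s') = h x * b (x - s')" "k x * deriv b (x - s') = h x * deriv b (x - s')" if "\<bar>s' - s\<bar> < 1" for x s'
  proof -
    have "b (x - s') = 0 \<and> deriv b (x - s') = 0" if "x \<notin> {-L..L}"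
    proof -
      have "\<bar>x\<bar> \<ge> L" using that by auto
      then have "\<bar>x - s'\<bar> \<ge> R" using \<open>\<bar>s' - s\<bar> < 1\<close> unfolding L_def by linarith
      then show ?thesis by (rule R(2))
    qed
    then show "k x * b (x - s') = h x * b (x - s')" "k x * deriv b (x - s') = h x * deriv b (x - s')"
      unfolding k_def by (cases "x \<in> {-L..L}"; simp)+
  qed
  note sb = test1_smooth[OF b]
  have "((\<lambda>s. \<integral>x. k x * b (x - s) \<partial>lborel) has_real_derivative - (\<integral>x. k x * deriv b (x - s) \<partial>lborel)) (at s)"
    by (rule deriv_convolution[OF ki _ smooth1_DERIV[OF sb] smooth1_DERIV[OF smooth1_deriv[OF sb]] K(4-6)]) simp
  moreover have "(\<integral>x. k x * deriv b (x - s) \<partial>lborel) = (\<integral>x. h x * deriv b (x - s) \<partial>lborel)" using kh(2)[of s] by (intro Bochner_Integration.integral_cong) simp_all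
  ultimately have "((\<lambda>s. \<integral>x. k x * b (x - s) \<partial>lborel) has_real_derivative - (\<integral>x. h x * deriv b (x - s) \<partial>lborel)) (at s)" by simp
  then show ?thesis
  proof (rule has_field_derivative_transform_within_open[of _ _ _ "ball s 1"])
    fix s' assume "s' \<in> ball s 1"
    then have "\<bar>s' - s\<bar> < 1" by (simp add: dist_real_def abs_minus_commute)
    then show "(\<integral>x. k x * b (x - s') \<partial>lborel) = (\<integral>x. h x * b (x - s') \<partial>lborel)" using kh(1) by (intro Bochner_Integration.integral_cong) simp_all
  qed auto
qed

lemma conv_tendsto:
  fixes h :: "real \<Rightarrow> real" and g :: "nat \<Rightarrow> real \<Rightarrow> real"
  assumes h: "continuous_on UNIV h" and g: "\<And>n. continuous_on UNIV (g n)" and b: "test1 b"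
    and c: "c \<longlonglongrightarrow> 0" "\<And>n x. \<bar>g n x - h x\<bar> \<le> c n" and S: "S \<longlonglongrightarrow> s"
  shows "(\<lambda>n. \<integral>x. g n x * b (x - S n) \<partial>lborel) \<longlonglongrightarrow> (\<integral>x. h x * b (x - s) \<partial>lborel)"
proof -
  have i: "integrable lborel (\<lambda>x. f x * b (x - s))" if "continuous_on UNIV f" for f s
    by (rule integrable_cont_test1[OF that test1_shift[OF b]])
  have "(\<lambda>n. (\<integral>x. g n x * b (x - S n) \<partial>lborel) - (\<integral>x. h x * b (x - S n) \<partial>lborel)) \<longlonglongrightarrow> 0"
  proof (rule Lim_null_comparison)
    show "(\<lambda>n. c n * (\<integral>x. \<bar>b x\<bar> \<partial>lborel)) \<longlonglongrightarrow> 0" by (rule tendsto_mult_left_zero[OF c(1)])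
    show "\<forall>\<^sub>F n in sequentially. norm ((\<integral>x. g n x * b (x - S n) \<partial>lborel) - (\<integral>x. h x * b (x - S n) \<partial>lborel)) \<le> c n * (\<integral>x. \<bar>b x\<bar> \<partial>lborel)"
    proof (intro always_eventually allI)
      fix n
      have ib: "integrable lborel (\<lambda>x. \<bar>b (x - S n)\<bar>)" using test1_integrable[OF test1_shift[OF b]] by simp
      have "(\<integral>x. g n x * b (x - S n) \<partial>lborel) - (\<integral>x. h x * b (x - S n) \<partial>lborel) = (\<integral>x. (g n x - h x) * b (x - S n) \<partial>lborel)"
        using i[OF g] i[OF h] by (simp add: left_diff_distrib)
      also have "norm \<dots> \<le> (\<integral>x. c n * \<bar>b (x - S n)\<bar> \<partial>lborel)"
        unfolding real_norm_def
      proof (rule order_trans[OF integral_abs_bound integral_mono])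
        show "integrable lborel (\<lambda>x. \<bar>(g n x - h x) * b (x - S n)\<bar>)" by (intro integrable_abs i continuous_intros g h)
        show "integrable lborel (\<lambda>x. c n * \<bar>b (x - S n)\<bar>)" using ib by simp
        show "\<bar>(g n x - h x) * b (x - S n)\<bar> \<le> c n * \<bar>b (x - S n)\<bar>" for x
          unfolding abs_mult by (rule mult_right_mono[OF c(2)]) simp
      qed
      also have "\<dots> = c n * (\<integral>x. \<bar>b x\<bar> \<partial>lborel)" using integral_shift[of "\<lambda>x. \<bar>b x\<bar>"] by simp
      finally show "norm ((\<integral>x. g n x * b (x - S n) \<partial>lborel) - (\<integral>x. h x * b (x - S n) \<partial>lborel)) \<le> c n * (\<integral>x. \<bar>b x\<bar> \<partial>lborel)" .
    qed
  qed
  moreover have "(\<lambda>n. \<integral>x. h x * b (x - S n) \<partial>lborel) \<longlonglongrightarrow> (\<integral>x. h x * b (x - s) \<partial>lborel)"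
    by (rule isCont_tendsto_compose[OF DERIV_isCont[OF conv_DERIV[OF h b]] S])
  ultimately have "(\<lambda>n. ((\<integral>x. g n x * b (x - S n) \<partial>lborel) - (\<integral>x. h x * b (x - S n) \<partial>lborel)) + (\<integral>x. h x * b (x - S n) \<partial>lborel)) \<longlonglongrightarrow> 0 + (\<integral>x. h x * b (x - s) \<partial>lborel)"
    by (rule tendsto_add)
  then show ?thesis by simp
qed

context weak_solution begin

text \<open>The source term tested with b(x - s), after Fubini: integrating the sign of x - z
  against b leaves the total integral of b minus twice its primitive at z. In this form a continuous
  function is integrated against \<mu>, so weak continuity gives continuity in time, which the
  energies of half-lines need not have.\<close>

definition src :: "(real \<Rightarrow> real) \<Rightarrow> real \<Rightarrow> real \<Rightarrow> real" where
  "src b s t = 1/4 * (\<integral>z. (\<integral>x. b x \<partial>lborel) - 2 * cum b (z - s) \<partial>\<mu> t)"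

lemma source_integral:
  assumes b: "test1 b" and t: "t \<ge> 0"
  shows "(\<integral>x. 1/4 * (measure (\<mu> t) {..<x} - measure (\<mu> t) {x<..}) * b x \<partial>lborel) = src b 0 t"
    "integrable lborel (\<lambda>x. 1/4 * (measure (\<mu> t) {..<x} - measure (\<mu> t) {x<..}) * b x)"
proof -
  interpret finite_measure "\<mu> t" by (rule mfin[OF t])
  interpret P: pair_sigma_finite lborel "\<mu> t"
    by (simp add: pair_sigma_finite_def sigma_finite_measure_axioms lborel.sigma_finite_measure_axioms)
  note [measurable_cong] = msets[OF t]
  note bi = test1_integrable[OF b]
  have [measurable]: "b \<in> borel_measurable borel" using bi by (auto dest: borel_measurable_integrable)
  define k where "k x z = (indicator {..<x} z - indicator {x<..} z) * b x" for x z :: real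
  have k_eq: "k x z = (of_bool (z < x) - of_bool (x < z)) * b x" for x z by (simp add: k_def indicator_def)
  have km[measurable]: "(\<lambda>(x,z). k x z) \<in> borel_measurable (lborel \<Otimes>\<^sub>M \<mu> t)" unfolding k_eq by measurable
  have ind: "integrable (\<mu> t) (indicator A :: real \<Rightarrow> real)" if "A \<in> sets borel" for A
    by (rule m_integrable[OF t, of _ 1]) (use that in \<open>auto simp: indicator_def\<close>)
  have kz: "(\<integral>z. k x z \<partial>\<mu> t) = (measure (\<mu> t) {..<x} - measure (\<mu> t) {x<..}) * b x" for x
    unfolding k_def using ind by (simp add: msets[OF t] mspace[OF t])
  have kx: "(\<integral>x. k x z \<partial>lborel) = (\<integral>x. b x \<partial>lborel) - 2 * cum b z" for z
  proof -
    have ii: "integrable lborel (\<lambda>x. indicator {..<z} x * b x)"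
      using integrable_mult_indicator[OF _ bi, of "{..<z}"] by simp
    have "(\<integral>x. k x z \<partial>lborel) = (\<integral>x. b x - 2 * (indicator {..<z} x * b x) \<partial>lborel)"
    proof (rule integral_cong_AE)
      show "AE x in lborel. k x z = b x - 2 * (indicator {..<z} x * b x)"
        using lborel_AE_neq[of z] by eventually_elim (auto simp: k_def indicator_def)
      show "(\<lambda>x. k x z) \<in> borel_measurable lborel" unfolding k_eq by measurable
    qed measurable
    then show ?thesis using bi ii by (simp add: cum_def)
  qed
  have int: "integrable (lborel \<Otimes>\<^sub>M \<mu> t) (\<lambda>(x,z). k x z)"
  proof (rule P.Fubini_integrable[OF km])
    have kb: "\<bar>k x z\<bar> \<le> \<bar>b x\<bar>" for x z by (auto simp: k_def indicator_def abs_mult)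
    show "AE x in lborel. integrable (\<mu> t) (\<lambda>z. (\<lambda>(x,z). k x z) (x, z))"
      unfolding k_def prod.case using ind by (intro AE_I2 integrable_mult_left Bochner_Integration.integrable_diff) auto
    have "integrable lborel (\<lambda>x. \<bar>b x\<bar> * measure (\<mu> t) UNIV)" using bi by simp
    then show "integrable lborel (\<lambda>x. \<integral>z. norm ((\<lambda>(x,z). k x z) (x, z)) \<partial>\<mu> t)"
    proof (rule Bochner_Integration.integrable_bound)
      show "AE x in lborel. norm (\<integral>z. norm ((\<lambda>(x,z). k x z) (x, z)) \<partial>\<mu> t) \<le> norm (\<bar>b x\<bar> * measure (\<mu> t) UNIV)"
      proof (rule AE_I2)
        fix x
        have "(\<lambda>z. \<bar>k x z\<bar>) \<in> borel_measurable borel" unfolding k_eq by measurable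
        then have "\<bar>\<integral>z. \<bar>k x z\<bar> \<partial>\<mu> t\<bar> \<le> \<bar>b x\<bar> * measure (\<mu> t) UNIV"
          by (rule m_integral_bound[OF t]) (use kb in simp)
        then show "norm (\<integral>z. norm ((\<lambda>(x,z). k x z) (x, z)) \<partial>\<mu> t) \<le> norm (\<bar>b x\<bar> * measure (\<mu> t) UNIV)" by simp
      qed
    qed measurable
  qed
  have "integrable lborel (\<lambda>x. \<integral>z. k x z \<partial>\<mu> t)" using P.integrable_fst'[OF int] by simp
  then have i4: "integrable lborel (\<lambda>x. (measure (\<mu> t) {..<x} - measure (\<mu> t) {x<..}) * b x)" unfolding kz .
  then show "integrable lborel (\<lambda>x. 1/4 * (measure (\<mu> t) {..<x} - measure (\<mu> t) {x<..}) * b x)"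
    unfolding mult.assoc by (rule integrable_mult_right)
  have "(\<integral>x. 1/4 * (measure (\<mu> t) {..<x} - measure (\<mu> t) {x<..}) * b x \<partial>lborel) = 1/4 * (\<integral>x. \<integral>z. k x z \<partial>\<mu> t \<partial>lborel)"
    unfolding kz mult.assoc by (rule integral_mult_right_zero)
  also have "(\<integral>x. \<integral>z. k x z \<partial>\<mu> t \<partial>lborel) = (\<integral>z. \<integral>x. k x z \<partial>lborel \<partial>\<mu> t)"
    by (rule P.Fubini_integral[OF int, symmetric])
  finally show "(\<integral>x. 1/4 * (measure (\<mu> t) {..<x} - measure (\<mu> t) {x<..}) * b x \<partial>lborel) = src b 0 t"
    unfolding kx src_def by simp
qed

lemma src_shift: "src (\<lambda>x. b (x - s)) 0 t = src b s t"
  unfolding src_def cum_shift integral_shift by simp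

lemma src_tendsto:
  assumes X: "X \<longlonglongrightarrow> t" "\<And>n. X n \<ge> 0" "t \<ge> 0" and b: "test1 b" and S: "S \<longlonglongrightarrow> s"
  shows "(\<lambda>n. src b (S n) (X n)) \<longlonglongrightarrow> src b s t"
  unfolding src_def
proof (intro tendsto_mult tendsto_const)
  let ?I = "\<integral>x. b x \<partial>lborel"
  obtain K0 K1 K2 where K: "K0 \<ge> 0" "K1 > 0" "K2 > 0" "\<And>x. \<bar>cum b x\<bar> \<le> K0" "\<And>x. \<bar>deriv (cum b) x\<bar> \<le> K1" "\<And>x. \<bar>deriv (deriv (cum b)) x\<bar> \<le> K2"
    by (rule adm_props[OF cum_props(3)[OF b]]) blast
  note sc = cum_props(1)[OF b]
  show "(\<lambda>n. \<integral>z. ?I - 2 * cum b (z - S n) \<partial>\<mu> (X n)) \<longlonglongrightarrow> (\<integral>z. ?I - 2 * cum b (z - s) \<partial>\<mu> t)"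
  proof (rule mu_converge[OF X, where c = "\<lambda>n. 2 * K1 * \<bar>S n - s\<bar>"])
    show "continuous_on UNIV (\<lambda>z. ?I - 2 * cum b (z - S n))" "continuous_on UNIV (\<lambda>z. ?I - 2 * cum b (z - s))" for n
      by (intro continuous_intros continuous_on_compose2[OF smooth1_continuous[OF sc, of UNIV]]; auto)+
    show "\<bar>?I - 2 * cum b (x - s)\<bar> \<le> \<bar>?I\<bar> + 2 * K0" for x using K(4)[of "x - s"] by linarith
    have "(\<lambda>n. \<bar>S n - s\<bar>) \<longlonglongrightarrow> 0" using S by (simp add: LIM_zero_iff tendsto_rabs_zero)
    then show "(\<lambda>n. 2 * K1 * \<bar>S n - s\<bar>) \<longlonglongrightarrow> 0" by (rule tendsto_mult_right_zero)
    show "\<bar>(?I - 2 * cum b (x - S n)) - (?I - 2 * cum b (x - s))\<bar> \<le> 2 * K1 * \<bar>S n - s\<bar>" for n x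
      using lipschitz_of_deriv[OF smooth1_DERIV[OF sc] K(5), of "x - S n" "x - s"] by (simp add: abs_minus_commute)
  qed
qed

lemma u_conv_tendsto:
  assumes X: "X \<longlonglongrightarrow> t" "\<And>n. X n \<ge> 0" "t \<ge> 0" and b: "test1 b" and S: "S \<longlonglongrightarrow> s"
  shows "(\<lambda>n. \<integral>x. u (X n) x * b (x - S n) \<partial>lborel) \<longlonglongrightarrow> (\<integral>x. u t x * b (x - s) \<partial>lborel)"
    "(\<lambda>n. \<integral>x. 1/2 * (u (X n) x)\<^sup>2 * b (x - S n) \<partial>lborel) \<longlonglongrightarrow> (\<integral>x. 1/2 * (u t x)\<^sup>2 * b (x - s) \<partial>lborel)"
proof -
  obtain c where c: "c \<longlonglongrightarrow> 0" "\<And>n x. \<bar>u (X n) x - u t x\<bar> \<le> c n" by (rule u_unif[OF X]) blast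
  obtain C where C: "C \<ge> 0" "\<And>x. \<bar>u t x\<bar> \<le> C" by (rule u_bdd[OF X(3)]) blast
  show "(\<lambda>n. \<integral>x. u (X n) x * b (x - S n) \<partial>lborel) \<longlonglongrightarrow> (\<integral>x. u t x * b (x - s) \<partial>lborel)"
    by (rule conv_tendsto[OF u_cont[OF X(3)] u_cont[OF X(2)] b c S])
  show "(\<lambda>n. \<integral>x. 1/2 * (u (X n) x)\<^sup>2 * b (x - S n) \<partial>lborel) \<longlonglongrightarrow> (\<integral>x. 1/2 * (u t x)\<^sup>2 * b (x - s) \<partial>lborel)"
  proof (rule conv_tendsto[OF _ _ b _ _ S, where c = "\<lambda>n. c n * (2 * C + c n)"])
    show "continuous_on UNIV (\<lambda>x. 1/2 * (u t x)\<^sup>2)" "continuous_on UNIV (\<lambda>x. 1/2 * (u (X n) x)\<^sup>2)" for n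
      by (intro continuous_intros u_cont X)+
    have "(\<lambda>n. c n * (2 * C + c n)) \<longlonglongrightarrow> 0 * (2 * C + 0)" by (intro tendsto_intros c)
    then show "(\<lambda>n. c n * (2 * C + c n)) \<longlonglongrightarrow> 0" by simp
    show "\<bar>1/2 * (u (X n) x)\<^sup>2 - 1/2 * (u t x)\<^sup>2\<bar> \<le> c n * (2 * C + c n)" for n x
    proof -
      have c0: "0 \<le> c n" using c(2)[of n x] by linarith
      have "\<bar>u (X n) x + u t x\<bar> \<le> 2 * C + c n" using c(2)[of n x] C(2)[of x] by linarith
      then have "\<bar>u (X n) x - u t x\<bar> * \<bar>u (X n) x + u t x\<bar> \<le> c n * (2 * C + c n)"
        using c(2)[of n x] c0 by (intro mult_mono) auto
      then have *: "\<bar>(u (X n) x - u t x) * (u (X n) x + u t x)\<bar> \<le> c n * (2 * C + c n)" unfolding abs_mult .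
      have eq: "1/2 * (u (X n) x)\<^sup>2 - 1/2 * (u t x)\<^sup>2 = 1/2 * ((u (X n) x - u t x) * (u (X n) x + u t x))"
        by (simp add: power2_eq_square algebra_simps)
      show ?thesis unfolding eq using * by linarith
    qed
  qed
qed

text \<open>As for the energy, product tests reduce the equation to one in time. Continuity of the
  right-hand side rests on the uniform convergence of \<open>u\<close> for the flux and on the
  Fubini form of the source.\<close>

lemma u_DERIV_test:
  assumes b: "test1 b" and t: "t \<ge> 0"
  shows "((\<lambda>t. \<integral>x. u t x * b x \<partial>lborel) has_real_derivative (\<integral>x. 1/2 * (u t x)\<^sup>2 * deriv b x \<partial>lborel) + src b 0 t) (at t within {0..})"
proof (rule time_derivative[OF _ _ _ t])
  note db = test1_deriv_test1[OF b]
  show "continuous_on {0..} (\<lambda>t. \<integral>x. u t x * b x \<partial>lborel)"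
    unfolding continuous_on_sequentially comp_def
    using u_conv_tendsto(1)[OF _ _ _ b tendsto_const[of 0]] by simp
  show "continuous_on {0..} (\<lambda>t. (\<integral>x. 1/2 * (u t x)\<^sup>2 * deriv b x \<partial>lborel) + src b 0 t)"
    unfolding continuous_on_sequentially comp_def
  proof (intro allI ballI impI)
    fix t :: real and X :: "nat \<Rightarrow> real" assume "t \<in> {0..}" "(\<forall>n. X n \<in> {0..}) \<and> X \<longlonglongrightarrow> t"
    then have X: "X \<longlonglongrightarrow> t" "\<And>n. X n \<ge> 0" "t \<ge> 0" by auto
    from tendsto_add[OF u_conv_tendsto(2)[OF X db tendsto_const[of 0]] src_tendsto[OF X b tendsto_const[of 0]]]
    show "(\<lambda>n. (\<integral>x. 1/2 * (u (X n) x)\<^sup>2 * deriv b x \<partial>lborel) + src b 0 (X n)) \<longlonglongrightarrow> (\<integral>x. 1/2 * (u t x)\<^sup>2 * deriv b x \<partial>lborel) + src b 0 t" by simp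
  qed
  fix a assume a: "test1 a"
  have "(\<integral>t. indicator {0..} t * (deriv a t * (\<integral>x. u t x * b x \<partial>lborel) + a t * ((\<integral>x. 1/2 * (u t x)\<^sup>2 * deriv b x \<partial>lborel) + src b 0 t)) \<partial>lborel)
    = (\<integral>t. indicator {0..} t * (\<integral>x. u t x * pd True (\<lambda>(t,x). a t * b x) (t,x) + 1/2 * (u t x)\<^sup>2 * pd False (\<lambda>(t,x). a t * b x) (t,x)
               + 1/4 * (measure (\<mu> t) {..<x} - measure (\<mu> t) {x<..}) * (\<lambda>(t,x). a t * b x) (t,x) \<partial>lborel) \<partial>lborel)"
  proof (rule Bochner_Integration.integral_cong[OF refl])
    fix t :: real
    show "indicator {0..} t * (deriv a t * (\<integral>x. u t x * b x \<partial>lborel) + a t * ((\<integral>x. 1/2 * (u t x)\<^sup>2 * deriv b x \<partial>lborel) + src b 0 t))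
      = indicator {0..} t * (\<integral>x. u t x * pd True (\<lambda>(t,x). a t * b x) (t,x) + 1/2 * (u t x)\<^sup>2 * pd False (\<lambda>(t,x). a t * b x) (t,x)
               + 1/4 * (measure (\<mu> t) {..<x} - measure (\<mu> t) {x<..}) * (\<lambda>(t,x). a t * b x) (t,x) \<partial>lborel)"
    proof (cases "t \<ge> 0")
      case True
      have i1: "integrable lborel (\<lambda>x. u t x * b x)" by (rule integrable_cont_test1[OF u_cont[OF True] b])
      have i2: "integrable lborel (\<lambda>x. 1/2 * (u t x)\<^sup>2 * deriv b x)"
        by (rule integrable_cont_test1[OF _ db]) (intro continuous_intros u_cont[OF True])
      note i3 = source_integral(2)[OF b True]
      have "(\<integral>x. u t x * pd True (\<lambda>(t,x). a t * b x) (t,x) + 1/2 * (u t x)\<^sup>2 * pd False (\<lambda>(t,x). a t * b x) (t,x)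
               + 1/4 * (measure (\<mu> t) {..<x} - measure (\<mu> t) {x<..}) * (\<lambda>(t,x). a t * b x) (t,x) \<partial>lborel)
        = (\<integral>x. deriv a t * (u t x * b x) + a t * (1/2 * (u t x)\<^sup>2 * deriv b x + 1/4 * (measure (\<mu> t) {..<x} - measure (\<mu> t) {x<..}) * b x) \<partial>lborel)"
        unfolding test2_prod(2,3)[OF a b] prod.case by (rule Bochner_Integration.integral_cong) (auto simp: algebra_simps)
      also have "\<dots> = (\<integral>x. deriv a t * (u t x * b x) \<partial>lborel) + (\<integral>x. a t * (1/2 * (u t x)\<^sup>2 * deriv b x + 1/4 * (measure (\<mu> t) {..<x} - measure (\<mu> t) {x<..}) * b x) \<partial>lborel)"
        by (rule Bochner_Integration.integral_add) (intro integrable_mult_right i1 i2 i3 Bochner_Integration.integrable_add)+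
      also have "\<dots> = deriv a t * (\<integral>x. u t x * b x \<partial>lborel) + a t * ((\<integral>x. 1/2 * (u t x)\<^sup>2 * deriv b x \<partial>lborel) + src b 0 t)"
        unfolding integral_mult_right_zero Bochner_Integration.integral_add[OF i2 i3] source_integral(1)[OF b True] ..
      finally show ?thesis by simp
    qed simp
  qed
  also have "\<dots> = - (\<integral>x. u 0 x * (\<lambda>(t,x). a t * b x) (0,x) \<partial>lborel)" by (rule weak_u[OF test2_prod(1)[OF a b]])
  finally show "(\<integral>t. indicator {0..} t * (deriv a t * (\<integral>x. u t x * b x \<partial>lborel) + a t * ((\<integral>x. 1/2 * (u t x)\<^sup>2 * deriv b x \<partial>lborel) + src b 0 t)) \<partial>lborel) = - (a 0 * (\<integral>x. u 0 x * b x \<partial>lborel))"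
    by (simp add: mult.left_commute)
qed

lemma u_move:
  assumes b: "test1 b" and t: "t \<ge> 0" and y: "(y has_real_derivative y') (at t within {0..})"
  shows "((\<lambda>t. \<integral>x. u t x * b (x - y t) \<partial>lborel) has_real_derivative
    (\<integral>x. 1/2 * (u t x)\<^sup>2 * deriv b (x - y t) \<partial>lborel) + src b (y t) t + - (\<integral>x. u t x * deriv b (x - y t) \<partial>lborel) * y') (at t within {0..})"
proof (rule moving_frame_DERIV[where f = "\<lambda>t s. \<integral>x. u t x * b (x - s) \<partial>lborel" and y = y and fy = "\<lambda>t s. - (\<integral>x. u t x * deriv b (x - s) \<partial>lborel)", OF _ _ _ y])
  show "((\<lambda>t'. \<integral>x. u t' x * b (x - y t) \<partial>lborel) has_real_derivative (\<integral>x. 1/2 * (u t x)\<^sup>2 * deriv b (x - y t) \<partial>lborel) + src b (y t) t) (at t within {0..})"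
    using u_DERIV_test[OF test1_shift[OF b] t, of "y t"] unfolding deriv_shift[OF test1_smooth[OF b]] src_shift .
  show "((\<lambda>s. \<integral>x. u t x * b (x - s) \<partial>lborel) has_real_derivative - (\<integral>x. u t x * deriv b (x - s) \<partial>lborel)) (at s)" if "t \<ge> 0" for t s
    by (rule conv_DERIV[OF u_cont[OF that] b])
  show "continuous (at (t, y t) within {0..} \<times> UNIV) (\<lambda>(t,s). - (\<integral>x. u t x * deriv b (x - s) \<partial>lborel))"
    unfolding continuous_within_sequentially comp_def
  proof (intro allI impI)
    fix Z :: "nat \<Rightarrow> real \<times> real" assume Z: "(\<forall>n. Z n \<in> {0..} \<times> UNIV) \<and> Z \<longlonglongrightarrow> (t, y t)"
    then have "Z \<longlonglongrightarrow> (t, y t)" by blast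
    from tendsto_fst[OF this] tendsto_snd[OF this] have l: "(\<lambda>n. fst (Z n)) \<longlonglongrightarrow> t" "(\<lambda>n. snd (Z n)) \<longlonglongrightarrow> y t" by simp_all
    have p: "\<And>n. fst (Z n) \<ge> 0" using Z by (auto simp: mem_Times_iff)
    from tendsto_minus[OF u_conv_tendsto(1)[OF l(1) p t test1_deriv_test1[OF b] l(2)]]
    show "(\<lambda>n. case Z n of (t, s) \<Rightarrow> - (\<integral>x. u t x * deriv b (x - s) \<partial>lborel)) \<longlonglongrightarrow> (case (t, y t) of (t, s) \<Rightarrow> - (\<integral>x. u t x * deriv b (x - s) \<partial>lborel))"
      by (simp add: case_prod_beta)
  qed
qed

end

section \<open>The velocity along the quantiles\<close>

lemma integral_affine:
  fixes g :: "real \<Rightarrow> real"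
  assumes N: "N > 0"
  shows "(\<integral>x. N * g (N * (x - y)) \<partial>lborel) = (\<integral>x. g x \<partial>lborel)"
proof -
  have "(\<integral>x. g x \<partial>lborel) = N * (\<integral>x. g (- (N * y) + N * x) \<partial>lborel)"
    using lborel_integral_real_affine[of N g "- (N * y)"] N by simp
  also have "\<dots> = (\<integral>x. N * g (- (N * y) + N * x) \<partial>lborel)" by simp
  also have "(\<lambda>x. N * g (- (N * y) + N * x)) = (\<lambda>x. N * g (N * (x - y)))"
    by (simp add: right_diff_distrib algebra_simps)
  finally show ?thesis by simp
qed

lemma test1_integral_deriv: assumes "test1 b" shows "(\<integral>x. deriv b x \<partial>lborel) = 0"
  using antideriv_imp_weak_deriv[OF antideriv_const, of 1] assms unfolding weak_deriv_def by simp

lemma deriv_eq_0_of_open: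
  fixes f :: "real \<Rightarrow> real"
  assumes "open S" "x \<in> S" "\<And>y. y \<in> S \<Longrightarrow> f y = 0" shows "deriv f x = 0"
proof (rule DERIV_imp_deriv)
  have "((\<lambda>x. 0) has_real_derivative 0) (at x)" by simp
  then show "(f has_real_derivative 0) (at x)"
    by (rule has_field_derivative_transform_within_open[OF _ assms(1,2)]) (simp add: assms(3))
qed

text \<open>The support lies to the right of 0. Rescaled kernels at y then see only energy in the
  open interval from y to y + 1/N, and their primitives converge to the indicator of {y<..} with the
  value 0 at y itself.\<close>

lemma unit_kernel:
  obtains w where "test1 w" "\<And>x. 0 \<le> w x" "\<And>x. x \<notin> {0<..<1} \<Longrightarrow> w x = 0" "\<And>x. x \<notin> {0..1} \<Longrightarrow> deriv w x = 0"
    "(\<integral>x. w x \<partial>lborel) = 1"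
proof -
  define c where "c = (\<integral>x. bump 0 0 1 x \<partial>lborel)"
  have c: "c > 0" unfolding c_def by (rule bump_integral_pos) simp
  define w where "w x = (1 / c) * bump 0 0 1 x + 0 * bump 0 0 1 x" for x
  have z: "w x = 0" if "x \<notin> {0<..<1}" for x using bump_eq_0[OF that] by (simp add: w_def)
  show thesis
  proof (rule that[of w])
    show "test1 w" unfolding w_def[abs_def] by (intro test1_lin test1_bump)
    show "0 \<le> w x" for x using c bump_nonneg by (simp add: w_def)
    show "deriv w x = 0" if "x \<notin> {0..1}" for x
      by (rule deriv_eq_0_of_open[of "- {0..1}"]) (use that z in \<open>auto simp: open_Compl\<close>)
    show "(\<integral>x. w x \<partial>lborel) = 1" using c by (simp add: w_def c_def)
  qed (rule z)
qed

lemma cum_scale: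
  assumes N: "N > 0" shows "cum (\<lambda>x. N * w (N * x)) z = cum w (N * z)"
proof -
  have "cum (\<lambda>x. N * w (N * x)) z = (\<integral>x. N * (\<lambda>x. indicator {..<N * z} x * w x) (N * (x - 0)) \<partial>lborel)"
    unfolding cum_def by (rule Bochner_Integration.integral_cong) (use N in \<open>auto simp: indicator_def\<close>)
  then show ?thesis unfolding integral_affine[OF N, of "\<lambda>x. indicator {..<N * z} x * w x" 0] cum_def .
qed

context weak_solution begin

lemma yq_continuous: assumes \<eta>: "0 < \<eta>" "\<eta> < mass0" shows "continuous_on {0..} (\<lambda>t. yq t \<eta>)"
  unfolding continuous_on_eq_continuous_within by (auto intro!: DERIV_continuous[OF yq_DERIV[OF _ \<eta>]])

text \<open>The nonlinear contribution in a frame moving with speed \<open>u t y\<close>. It is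
  quadratic in the increment of \<open>u\<close> from y, hence small when b is concentrated at y,
  although the derivative of b is then large.\<close>

definition rate :: "(real \<Rightarrow> real) \<Rightarrow> real \<Rightarrow> real \<Rightarrow> real" where
  "rate b t y = (\<integral>x. 1/2 * (u t x - u t y)\<^sup>2 * deriv b (x - y) \<partial>lborel)"

text \<open>The derivative of b has integral 0, so the constant half the square of
  \<open>u t y\<close> may be added to the flux, which completes the square.\<close>

lemma rate_eq:
  assumes b: "test1 b" and t: "t \<ge> 0"
  shows "rate b t y = (\<integral>x. 1/2 * (u t x)\<^sup>2 * deriv b (x - y) \<partial>lborel) - (\<integral>x. u t x * deriv b (x - y) \<partial>lborel) * u t y"
proof -
  define c where "c = u t y"
  note db = test1_shift[OF test1_deriv_test1[OF b], of y]
  have i2: "integrable lborel (\<lambda>x. 1/2 * (u t x)\<^sup>2 * deriv b (x - y))"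
    by (rule integrable_cont_test1[OF _ db]) (intro continuous_intros u_cont[OF t])
  have i1: "integrable lborel (\<lambda>x. u t x * deriv b (x - y))" by (rule integrable_cont_test1[OF u_cont[OF t] db])
  note i0 = test1_integrable[OF db]
  have z: "(\<integral>x. deriv b (x - y) \<partial>lborel) = 0" using integral_shift[of "deriv b" y] test1_integral_deriv[OF b] by simp
  have "rate b t y = (\<integral>x. (1/2 * (u t x)\<^sup>2 * deriv b (x - y) + (- c) * (u t x * deriv b (x - y))) + (c\<^sup>2 / 2) * deriv b (x - y) \<partial>lborel)"
    unfolding rate_def c_def by (rule Bochner_Integration.integral_cong) (auto simp: power2_eq_square field_simps)
  also have "\<dots> = (\<integral>x. 1/2 * (u t x)\<^sup>2 * deriv b (x - y) \<partial>lborel) + (- c) * (\<integral>x. u t x * deriv b (x - y) \<partial>lborel) + (c\<^sup>2 / 2) * 0"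
    unfolding z[symmetric] integral_mult_right_zero[symmetric]
    using i2 integrable_mult_right[OF i1, of "- c"] integrable_mult_right[OF i0, of "c\<^sup>2 / 2"] by (simp only: Bochner_Integration.integral_add Bochner_Integration.integrable_add)
  finally show ?thesis by (simp add: c_def)
qed

lemma quantile_DERIV:
  assumes b: "test1 b" and \<eta>: "0 < \<eta>" "\<eta> < mass0" and t: "t \<ge> 0"
  shows "((\<lambda>t. \<integral>x. u t x * b (x - yq t \<eta>) \<partial>lborel) has_real_derivative rate b t (yq t \<eta>) + src b (yq t \<eta>) t) (at t within {0..})"
  by (rule DERIV_cong[OF u_move[OF b t yq_DERIV[OF t \<eta>]]]) (simp add: rate_eq[OF b t])

lemma quantile_rate_continuous:
  assumes b: "test1 b" and \<eta>: "0 < \<eta>" "\<eta> < mass0"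
  shows "continuous_on {0..} (\<lambda>t. rate b t (yq t \<eta>) + src b (yq t \<eta>) t)"
  unfolding continuous_on_sequentially comp_def
proof (intro allI ballI impI)
  fix t and X :: "nat \<Rightarrow> real" assume "t \<in> {0..}" "(\<forall>n. X n \<in> {0..}) \<and> X \<longlonglongrightarrow> t"
  then have X: "X \<longlonglongrightarrow> t" "\<And>n. X n \<ge> 0" "t \<ge> 0" by auto
  have Y: "(\<lambda>n. yq (X n) \<eta>) \<longlonglongrightarrow> yq t \<eta>"
    using continuous_on_tendsto_compose[OF yq_continuous[OF \<eta>] X(1)] X by simp
  note db = test1_deriv_test1[OF b]
  show "(\<lambda>n. rate b (X n) (yq (X n) \<eta>) + src b (yq (X n) \<eta>) (X n)) \<longlonglongrightarrow> rate b t (yq t \<eta>) + src b (yq t \<eta>) t"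
    unfolding rate_eq[OF b X(2)] rate_eq[OF b X(3)]
    by (intro tendsto_intros u_conv_tendsto[OF X db Y] src_tendsto[OF X b Y] u_seq[OF X Y])
qed

text \<open>The derivative of the rescaled kernel has size N^2. One factor N is absorbed by x - y
  \<le> 1/N from the squared increment of \<open>u\<close>, the other by the length of the support,
  so the bound is the energy of a shrinking interval times a constant of the kernel.\<close>

lemma rate_bound:
  assumes w: "test1 w" "\<And>x. x \<notin> {0..1} \<Longrightarrow> deriv w x = 0" and N: "N > 0" and t: "t \<ge> 0"
  shows "\<bar>rate (\<lambda>x. N * w (N * x)) t y\<bar> \<le> 1/2 * measure (\<mu> t) {y<..<y + 1/N} * (\<integral>x. \<bar>x * deriv w x\<bar> \<partial>lborel)"
proof -
  interpret finite_measure "\<mu> t" by (rule mfin[OF t])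
  define M where "M = measure (\<mu> t) {y<..<y + 1/N}"
  define g where "g x = 1/2 * M * \<bar>x * deriv w x\<bar>" for x
  note sw = test1_smooth[OF w(1)]
  have db: "deriv (\<lambda>x. N * w (N * x)) x = N * (N * deriv w (N * x))" for x
  proof (rule DERIV_imp_deriv)
    have "((\<lambda>x. w (N * x + 0)) has_real_derivative N * deriv w (N * x + 0)) (at x)"
      using smooth1_DERIV[OF smooth1_affine[OF sw, of N 0], of x] unfolding deriv_affine[OF sw] .
    then show "((\<lambda>x. N * w (N * x)) has_real_derivative N * (N * deriv w (N * x))) (at x)"
      using DERIV_cmult[where c = N and f = "\<lambda>x. w (N * x + 0)"] by fastforce
  qed
  have tb: "test1 (\<lambda>x. N * w (N * x))"
    using test1_lin[OF test1_affine[OF w(1), of N 0] test1_affine[OF w(1), of N 0], of N 0] N by simp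
  have ig: "integrable lborel g" unfolding g_def
    by (intro integrable_mult_right integrable_abs integrable_cont_test1 continuous_intros test1_deriv_test1 w)
  have "rate (\<lambda>x. N * w (N * x)) t y = (\<integral>x. 1/2 * (u t x - u t y)\<^sup>2 * deriv (\<lambda>x. N * w (N * x)) (x - y) \<partial>lborel)" by (simp add: rate_def)
  also have "\<bar>\<dots>\<bar> \<le> (\<integral>x. N * g (N * (x - y)) \<partial>lborel)"
  proof (rule order_trans[OF integral_abs_bound integral_mono])
    show "integrable lborel (\<lambda>x. \<bar>1/2 * (u t x - u t y)\<^sup>2 * deriv (\<lambda>x. N * w (N * x)) (x - y)\<bar>)"
      by (intro integrable_abs integrable_cont_test1 continuous_intros u_cont[OF t] test1_shift test1_deriv_test1 tb)
    have "integrable lborel (\<lambda>x. g (- (N * y) + N * x))" by (rule lborel_integrable_real_affine[OF ig]) (use N in simp)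
    moreover have "- (N * y) + N * x = N * (x - y)" for x by (simp add: right_diff_distrib)
    ultimately show "integrable lborel (\<lambda>x. N * g (N * (x - y)))" by simp
    show "\<bar>1/2 * (u t x - u t y)\<^sup>2 * deriv (\<lambda>x. N * w (N * x)) (x - y)\<bar> \<le> N * g (N * (x - y))" for x
    proof (cases "N * (x - y) \<in> {0..1}")
      case True
      then have xy: "y \<le> x" "x \<le> y + 1/N" using N by (auto simp: zero_le_mult_iff field_simps)
      have "(u t x - u t y)\<^sup>2 \<le> (x - y) * measure (\<mu> t) {y<..<x}" by (rule u_sq[OF t xy(1)])
      also have "\<dots> \<le> (x - y) * M" unfolding M_def
        by (intro mult_left_mono finite_measure_mono) (use xy msets[OF t] in auto)
      finally have "(u t x - u t y)\<^sup>2 * \<bar>deriv w (N * (x - y))\<bar> \<le> (x - y) * M * \<bar>deriv w (N * (x - y))\<bar>" by (rule mult_right_mono) simp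
      then have "1/2 * N * N * ((u t x - u t y)\<^sup>2 * \<bar>deriv w (N * (x - y))\<bar>) \<le> 1/2 * N * N * ((x - y) * M * \<bar>deriv w (N * (x - y))\<bar>)"
        by (rule mult_left_mono) (use N in simp)
      then show ?thesis unfolding db g_def using N xy by (simp add: abs_mult mult_ac)
    next
      case False
      then show ?thesis unfolding db g_def using w(2) by simp
    qed
  qed
  also have "\<dots> = (\<integral>x. g x \<partial>lborel)" by (rule integral_affine[OF N])
  also have "\<dots> = 1/2 * M * (\<integral>x. \<bar>x * deriv w x\<bar> \<partial>lborel)" unfolding g_def by (rule integral_mult_right_zero)
  finally show ?thesis unfolding M_def .
qed

text \<open>Strictly left of the quantile the cumulative energy is below the level, and the open
  half-line is exhausted by such closed ones.\<close>

lemma lessThan_quantile: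
  assumes t: "t \<ge> 0" and \<eta>: "0 < \<eta>" "\<eta> < mass0"
  shows "measure (\<mu> t) {..<yq t \<eta>} \<le> \<eta>"
proof -
  interpret finite_measure "\<mu> t" by (rule mfin[OF t])
  let ?y = "yq t \<eta>"
  have "(\<lambda>n. measure (\<mu> t) {..?y - inverse (real (Suc n))}) \<longlonglongrightarrow> measure (\<mu> t) (\<Union>n. {..?y - inverse (real (Suc n))})"
  proof (rule finite_Lim_measure_incseq)
    show "incseq (\<lambda>n. {..?y - inverse (real (Suc n))})"
    proof (rule incseq_SucI)
      fix n have "inverse (real (Suc (Suc n))) \<le> inverse (real (Suc n))" by (rule le_imp_inverse_le) auto
      then show "{..?y - inverse (real (Suc n))} \<subseteq> {..?y - inverse (real (Suc (Suc n)))}" by auto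
    qed
  qed (auto simp: msets[OF t])
  moreover have "measure (\<mu> t) {..?y - inverse (real (Suc n))} \<le> \<eta>" for n
  proof -
    have "0 < inverse (real (Suc n))" by simp
    then have "\<not> ?y \<le> ?y - inverse (real (Suc n))" by linarith
    then have "\<not> \<eta> \<le> F t (?y - inverse (real (Suc n)))" using yq_galois[OF t \<eta>] by blast
    then show ?thesis unfolding F_def by linarith
  qed
  ultimately have le: "measure (\<mu> t) (\<Union>n. {..?y - inverse (real (Suc n))}) \<le> \<eta>" by (intro LIMSEQ_le_const2) auto
  have "(\<Union>n. {..?y - inverse (real (Suc n))}) = {..<?y}"
  proof (intro equalityI subsetI)
    fix z assume "z \<in> (\<Union>n. {..?y - inverse (real (Suc n))})"
    then obtain n where "z \<le> ?y - inverse (real (Suc n))" by blast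
    moreover have "0 < inverse (real (Suc n))" by simp
    ultimately have "z < ?y" by linarith
    then show "z \<in> {..<?y}" by simp
  next
    fix z assume "z \<in> {..<?y}"
    then have "0 < ?y - z" by simp
    from reals_Archimedean[OF this] obtain n where "inverse (real (Suc n)) < ?y - z" by blast
    then have "z \<le> ?y - inverse (real (Suc n))" by linarith
    then show "z \<in> (\<Union>n. {..?y - inverse (real (Suc n))})" by blast
  qed
  then show ?thesis using le by simp
qed

lemma no_atom_quantile:
  assumes t: "t \<ge> 0" and \<eta>: "0 < \<eta>" "\<eta> < mass0" and na: "emeasure (\<mu> t) {yq t \<eta>} = 0"
  shows "F t (yq t \<eta>) = \<eta>"
proof (rule antisym)
  interpret finite_measure "\<mu> t" by (rule mfin[OF t])
  let ?y = "yq t \<eta>"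
  show "\<eta> \<le> F t ?y" using yq_galois[OF t \<eta>, of ?y] by simp
  note l = lessThan_quantile[OF t \<eta>]
  have "F t ?y = measure (\<mu> t) ({..<?y} \<union> {?y})" unfolding F_def by (rule arg_cong[of _ _ "measure (\<mu> t)"]) auto
  also have "\<dots> \<le> measure (\<mu> t) {..<?y} + measure (\<mu> t) {?y}" by (rule measure_Un_le) (auto simp: msets[OF t])
  also have "\<dots> \<le> \<eta>" using l na by (simp add: measure_def)
  finally show "F t ?y \<le> \<eta>" .
qed

lemma ae_no_atoms: "AE t in lborel. t \<ge> 0 \<longrightarrow> (\<forall>y. emeasure (\<mu> t) {y} = 0)"
proof -
  obtain N where N: "N \<in> null_sets lborel" "\<And>t. t \<ge> 0 \<Longrightarrow> t \<notin> N \<Longrightarrow> \<exists>ux. weak_deriv (u t) ux \<and> \<mu> t = density lborel (\<lambda>x. ennreal ((ux x)\<^sup>2))"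
    using ac_ae by metis
  have "emeasure (\<mu> t) {y} = 0" if t: "t \<ge> 0" "t \<notin> N" for t y
  proof -
    obtain f where f: "weak_deriv (u t) f" "\<mu> t = density lborel (\<lambda>x. ennreal ((f x)\<^sup>2))" using N(2)[OF t] by blast
    have [measurable]: "f \<in> borel_measurable borel"
      by (rule antideriv_measurable[OF weak_deriv_continuous_imp_antideriv[OF f(1) u_cont[OF t(1)]]])
    have "emeasure (density lborel (\<lambda>x. ennreal ((f x)\<^sup>2))) {y} = (\<integral>\<^sup>+x. ennreal ((f x)\<^sup>2) * indicator {y} x \<partial>lborel)"
      by (rule emeasure_density) simp_all
    also have "\<dots> = (\<integral>\<^sup>+(x::real). 0 \<partial>lborel)"
    proof (rule nn_integral_cong_AE)
      show "AE x in lborel. ennreal ((f x)\<^sup>2) * indicator {y} x = 0" using lborel_AE_neq[of y] by eventually_elim simp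
    qed
    finally show ?thesis using f(2) by simp
  qed
  note * = this
  show ?thesis using AE_not_in[OF N(1)] by eventually_elim (use * in blast)
qed

end

lemma cum_kernel:
  assumes w: "test1 w" "\<And>x. 0 \<le> w x" "\<And>x. x \<notin> {0<..<1} \<Longrightarrow> w x = 0" "(\<integral>x. w x \<partial>lborel) = 1"
  shows "z \<le> 0 \<Longrightarrow> cum w z = 0" "1 \<le> z \<Longrightarrow> cum w z = 1" "0 \<le> cum w z" "cum w z \<le> 1"
proof -
  have i: "integrable lborel (\<lambda>x. indicator {..<z} x * w x)"
    using integrable_mult_indicator[OF _ test1_integrable[OF w(1)], of "{..<z}"] by simp
  have "(\<lambda>x. indicator {..<z} x * w x) = (\<lambda>x. 0)" if "z \<le> 0"
    by (rule ext) (use w(3) that in \<open>auto simp: indicator_def\<close>)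
  then show "z \<le> 0 \<Longrightarrow> cum w z = 0" by (simp add: cum_def)
  have "(\<lambda>x. indicator {..<z} x * w x) = w" if "1 \<le> z"
    by (rule ext) (use w(3) that in \<open>auto simp: indicator_def\<close>)
  then show "1 \<le> z \<Longrightarrow> cum w z = 1" using w(4) by (simp add: cum_def)
  show "0 \<le> cum w z" unfolding cum_def by (rule Bochner_Integration.integral_nonneg) (simp add: w(2))
  have "cum w z \<le> (\<integral>x. w x \<partial>lborel)" unfolding cum_def
    by (rule integral_mono[OF i test1_integrable[OF w(1)]]) (simp add: indicator_def w(2))
  then show "cum w z \<le> 1" using w(4) by simp
qed

lemma mollify:
  assumes w: "test1 w" "(\<integral>x. w x \<partial>lborel) = 1" and h: "continuous_on UNIV h" "\<And>x. \<bar>h x\<bar> \<le> C"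
  shows "(\<lambda>n. \<integral>x. h x * (real (Suc n) * w (real (Suc n) * (x - y))) \<partial>lborel) \<longlonglongrightarrow> h y"
proof -
  have hm[measurable]: "h \<in> borel_measurable borel" by (rule borel_measurable_continuous_onI[OF h(1)])
  note wi = test1_integrable[OF w(1)]
  have wm[measurable]: "w \<in> borel_measurable borel" using wi by (auto dest: borel_measurable_integrable)
  have e: "(\<integral>x. h x * (real (Suc n) * w (real (Suc n) * (x - y))) \<partial>lborel) = (\<integral>v. h (y + inverse (real (Suc n)) * v) * w v \<partial>lborel)" for n
  proof -
    have "(\<lambda>x. h x * (real (Suc n) * w (real (Suc n) * (x - y)))) =
        (\<lambda>x. real (Suc n) * (\<lambda>v. h (y + inverse (real (Suc n)) * v) * w v) (real (Suc n) * (x - y)))"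
    proof (rule ext)
      fix x
      have "y + inverse (real (Suc n)) * (real (Suc n) * (x - y)) = x"
        unfolding mult.assoc[symmetric] by (simp del: of_nat_Suc)
      then show "h x * (real (Suc n) * w (real (Suc n) * (x - y))) = real (Suc n) * (\<lambda>v. h (y + inverse (real (Suc n)) * v) * w v) (real (Suc n) * (x - y))"
        by simp
    qed
    then show ?thesis using integral_affine[of "real (Suc n)" "\<lambda>v. h (y + inverse (real (Suc n)) * v) * w v" y] by simp
  qed
  have "(\<lambda>n. \<integral>v. h (y + inverse (real (Suc n)) * v) * w v \<partial>lborel) \<longlonglongrightarrow> (\<integral>v. h y * w v \<partial>lborel)"
  proof (rule integral_dominated_convergence[where w = "\<lambda>v. C * \<bar>w v\<bar>"])
    show "integrable lborel (\<lambda>v. C * \<bar>w v\<bar>)" using wi by simp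
    show "AE v in lborel. (\<lambda>n. h (y + inverse (real (Suc n)) * v) * w v) \<longlonglongrightarrow> h y * w v"
    proof (rule AE_I2)
      fix v
      have "(\<lambda>n. y + inverse (real (Suc n)) * v) \<longlonglongrightarrow> y + 0 * v" by (intro tendsto_intros LIMSEQ_inverse_real_of_nat)
      then have "(\<lambda>n. y + inverse (real (Suc n)) * v) \<longlonglongrightarrow> y" by simp
      then have "(\<lambda>n. h (y + inverse (real (Suc n)) * v)) \<longlonglongrightarrow> h y"
        by (rule isCont_tendsto_compose[rotated]) (use h(1) in \<open>simp add: continuous_on_eq_continuous_at\<close>)
      then show "(\<lambda>n. h (y + inverse (real (Suc n)) * v) * w v) \<longlonglongrightarrow> h y * w v" by (intro tendsto_intros)
    qed
    show "AE v in lborel. norm (h (y + inverse (real (Suc n)) * v) * w v) \<le> C * \<bar>w v\<bar>" for n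
      by (rule AE_I2) (simp only: real_norm_def abs_mult, rule mult_right_mono, rule h(2), simp)
  qed measurable
  then show ?thesis unfolding e using w(2) by simp
qed

context weak_solution begin

text \<open>The rescaled primitives tend to the indicator of the open half-line {y<..}. The limit is
  a quarter of mass0 - 2 (mass0 - F t y), in which an atom at y is counted with the energy on the
  left.\<close>

lemma src_limit:
  assumes t: "t \<ge> 0" and w: "test1 w" "\<And>x. 0 \<le> w x" "\<And>x. x \<notin> {0<..<1} \<Longrightarrow> w x = 0" "(\<integral>x. w x \<partial>lborel) = 1"
  shows "(\<lambda>n. src (\<lambda>x. real (Suc n) * w (real (Suc n) * x)) y t) \<longlonglongrightarrow> (2 * F t y - mass0) / 4"
    and "\<bar>src (\<lambda>x. real (Suc n) * w (real (Suc n) * x)) y t\<bar> \<le> mass0"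
proof -
  interpret finite_measure "\<mu> t" by (rule mfin[OF t])
  note W = cum_kernel[OF w]
  have cm[measurable]: "cum w \<in> borel_measurable borel"
    by (rule borel_measurable_continuous_onI[OF smooth1_continuous[OF cum_props(1)[OF w(1)]]])
  have s: "src (\<lambda>x. real (Suc n) * w (real (Suc n) * x)) y t = 1/4 * (\<integral>z. 1 - 2 * cum w (real (Suc n) * (z - y)) \<partial>\<mu> t)" for n
    using integral_affine[of "real (Suc n)" w 0] w(4) cum_scale[of "real (Suc n)" w] unfolding src_def by simp
  have b: "\<bar>1 - 2 * cum w (real (Suc n) * (z - y))\<bar> \<le> 1" for n z
    using W(3,4)[of "real (Suc n) * (z - y)"] by linarith
  have lim: "(\<lambda>n. 1 - 2 * cum w (real (Suc n) * (z - y))) \<longlonglongrightarrow> 1 - 2 * indicator {y<..} z" for z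
  proof (cases "y < z")
    case True
    then have "0 < z - y" by simp
    from reals_Archimedean[OF this] obtain m where m: "inverse (real (Suc m)) < z - y" by blast
    have "cum w (real (Suc n) * (z - y)) = 1" if "n \<ge> m" for n
    proof (rule W(2))
      have "1 \<le> real (Suc m) * (z - y)" using m by (simp add: field_simps)
      also have "\<dots> \<le> real (Suc n) * (z - y)" using that True by (intro mult_right_mono) auto
      finally show "1 \<le> real (Suc n) * (z - y)" .
    qed
    then have "\<forall>\<^sub>F n in sequentially. 1 - 2 * cum w (real (Suc n) * (z - y)) = 1 - 2 * indicator {y<..} z"
      unfolding eventually_sequentially using True by (intro exI[of _ m]) auto
    then show ?thesis by (rule tendsto_eventually)
  next
    case False
    then have "cum w (real (Suc n) * (z - y)) = 0" for n by (intro W(1) mult_nonneg_nonpos) auto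
    then show ?thesis using False by simp
  qed
  have "(\<lambda>n. \<integral>z. 1 - 2 * cum w (real (Suc n) * (z - y)) \<partial>\<mu> t) \<longlonglongrightarrow> (\<integral>z. 1 - 2 * indicator {y<..} z \<partial>\<mu> t)"
    by (rule integral_dominated_convergence[where w = "\<lambda>_. 1"])
      (use lim b in \<open>auto simp: measurable_cong_sets[OF msets[OF t] refl]\<close>)
  also have "(\<integral>z. 1 - 2 * indicator {y<..} z \<partial>\<mu> t) = mass0 - 2 * measure (\<mu> t) {y<..}"
  proof -
    have "integrable (\<mu> t) (indicator {y<..} :: real \<Rightarrow> real)"
      by (rule m_integrable[OF t, of _ 1]) (auto simp: indicator_def)
    then show ?thesis using mass[OF t] by (simp add: mspace[OF t] msets[OF t] mass0_def)
  qed
  also have "measure (\<mu> t) {y<..} = mass0 - F t y"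
  proof -
    have "measure (\<mu> t) (UNIV - {..y}) = measure (\<mu> t) UNIV - measure (\<mu> t) {..y}"
      using finite_measure_compl[of "{..y}"] by (simp add: mspace[OF t] msets[OF t])
    moreover have "UNIV - {..y} = {y<..}" by auto
    ultimately show ?thesis using mass[OF t] by (simp add: F_def mass0_def)
  qed
  finally have "(\<lambda>n. \<integral>z. 1 - 2 * cum w (real (Suc n) * (z - y)) \<partial>\<mu> t) \<longlonglongrightarrow> mass0 - 2 * (mass0 - F t y)" .
  from tendsto_mult[OF tendsto_const[of "1/4"] this]
  show "(\<lambda>n. src (\<lambda>x. real (Suc n) * w (real (Suc n) * x)) y t) \<longlonglongrightarrow> (2 * F t y - mass0) / 4"
    unfolding s by (simp add: field_simps)
  have "\<bar>\<integral>z. 1 - 2 * cum w (real (Suc n) * (z - y)) \<partial>\<mu> t\<bar> \<le> 1 * measure (\<mu> t) UNIV"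
    by (rule m_integral_bound[OF t]) (use b in auto)
  then show "\<bar>src (\<lambda>x. real (Suc n) * w (real (Suc n) * x)) y t\<bar> \<le> mass0"
    unfolding s using mass[OF t] by (simp add: mass0_def)
qed

text \<open>The open intervals from y to y + 1/(n+1) decrease to the empty set, so their energy
  tends to 0 for every y and t. The uniform bound serves as majorant for the time integral.\<close>

lemma rate_limit:
  assumes t: "t \<ge> 0" and w: "test1 w" "\<And>x. x \<notin> {0..1} \<Longrightarrow> deriv w x = 0"
  shows "(\<lambda>n. rate (\<lambda>x. real (Suc n) * w (real (Suc n) * x)) t y) \<longlonglongrightarrow> 0"
    and "\<bar>rate (\<lambda>x. real (Suc n) * w (real (Suc n) * x)) t y\<bar> \<le> mass0 * (\<integral>x. \<bar>x * deriv w x\<bar> \<partial>lborel)"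
proof -
  interpret finite_measure "\<mu> t" by (rule mfin[OF t])
  let ?L = "\<integral>x. \<bar>x * deriv w x\<bar> \<partial>lborel"
  let ?M = "\<lambda>n. measure (\<mu> t) {y<..<y + 1 / real (Suc n)}"
  have b: "\<bar>rate (\<lambda>x. real (Suc n) * w (real (Suc n) * x)) t y\<bar> \<le> 1/2 * ?M n * ?L" for n
    by (rule rate_bound[OF w(1) _ _ t]) (use w(2) in auto)
  have L: "0 \<le> ?L" by simp
  have "?M n \<le> mass0" using mass[OF t] finite_measure_mono[of "{y<..<y + 1 / real (Suc n)}" UNIV] by (simp add: msets[OF t] mass0_def)
  then have "1/2 * ?M n \<le> mass0" using measure_nonneg[of "\<mu> t" "{y<..<y + 1 / real (Suc n)}"] by linarith
  then have "1/2 * ?M n * ?L \<le> mass0 * ?L" using L by (rule mult_right_mono)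
  then show "\<bar>rate (\<lambda>x. real (Suc n) * w (real (Suc n) * x)) t y\<bar> \<le> mass0 * ?L" using b[of n] by linarith
  have "?M \<longlonglongrightarrow> measure (\<mu> t) (\<Inter>n. {y<..<y + 1 / real (Suc n)})"
  proof (rule finite_Lim_measure_decseq)
    show "decseq (\<lambda>n. {y<..<y + 1 / real (Suc n)})"
    proof (rule decseq_SucI)
      fix n have "1 / real (Suc (Suc n)) \<le> 1 / real (Suc n)" by (simp add: frac_le)
      then show "{y<..<y + 1 / real (Suc (Suc n))} \<subseteq> {y<..<y + 1 / real (Suc n)}" by auto
    qed
  qed (auto simp: msets[OF t])
  also have "(\<Inter>n. {y<..<y + 1 / real (Suc n)}) = {}"
  proof (rule equals0I)
    fix z assume z: "z \<in> (\<Inter>n. {y<..<y + 1 / real (Suc n)})"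
    then have "z \<in> {y<..<y + 1 / real (Suc 0)}" by blast
    then have "0 < z - y" by simp
    from reals_Archimedean[OF this] obtain n where "inverse (real (Suc n)) < z - y" by blast
    moreover have "z \<in> {y<..<y + 1 / real (Suc n)}" using z by blast
    ultimately show False by (simp add: inverse_eq_divide)
  qed
  finally have "?M \<longlonglongrightarrow> 0" by simp
  then have "(\<lambda>n. 1/2 * ?M n * ?L) \<longlonglongrightarrow> 1/2 * 0 * ?L" by (intro tendsto_intros)
  then have "(\<lambda>n. 1/2 * ?M n * ?L) \<longlonglongrightarrow> 0" by simp
  then show "(\<lambda>n. rate (\<lambda>x. real (Suc n) * w (real (Suc n) * x)) t y) \<longlonglongrightarrow> 0"
    by (rule Lim_null_comparison[rotated]) (use b in simp)
qed

lemma quantile_velocity: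
  assumes t: "t \<ge> 0" and \<eta>: "0 < \<eta>" "\<eta> < mass0"
  shows "u t (yq t \<eta>) = u 0 (yq 0 \<eta>) + t * ((2 * \<eta> - mass0) / 4)"
proof -
  obtain w where w: "test1 w" "\<And>x. 0 \<le> w x" "\<And>x. x \<notin> {0<..<1} \<Longrightarrow> w x = 0" "\<And>x. x \<notin> {0..1} \<Longrightarrow> deriv w x = 0"
    "(\<integral>x. w x \<partial>lborel) = 1" by (rule unit_kernel) blast
  define b where "b n = (\<lambda>x. real (Suc n) * w (real (Suc n) * x))" for n
  have tb: "test1 (b n)" for n
    using test1_lin[OF test1_affine[OF w(1), of "real (Suc n)" 0] test1_affine[OF w(1), of "real (Suc n)" 0], of "real (Suc n)" 0]
    unfolding b_def by simp
  define A where "A n s = (\<integral>x. u s x * b n (x - yq s \<eta>) \<partial>lborel)" for n s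
  define E where "E n s = rate (b n) s (yq s \<eta>) + src (b n) (yq s \<eta>) s" for n s
  have Al: "(\<lambda>n. A n s) \<longlonglongrightarrow> u s (yq s \<eta>)" if s: "s \<ge> 0" for s
  proof -
    obtain C where "\<And>x. \<bar>u s x\<bar> \<le> C" by (rule u_bdd[OF s]) blast
    from mollify[OF w(1,5) u_cont[OF s] this] show ?thesis unfolding A_def b_def .
  qed
  have I: "(LBINT s:{0..t}. E n s) = A n t - A n 0" "set_integrable lborel {0..t} (E n)" for n
    using DERIV_integral[OF quantile_rate_continuous[OF tb \<eta>] _ t, of "A n" n] quantile_DERIV[OF tb \<eta>, of _ n] unfolding A_def E_def by blast+
  define K where "K = mass0 * (\<integral>x. \<bar>x * deriv w x\<bar> \<partial>lborel) + mass0"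
  have "(\<lambda>n. \<integral>s. indicator {0..t} s *\<^sub>R E n s \<partial>lborel) \<longlonglongrightarrow> (\<integral>s. indicator {0..t} s *\<^sub>R ((2 * \<eta> - mass0) / 4) \<partial>lborel)"
  proof (rule integral_dominated_convergence[where w = "\<lambda>s. indicator {0..t} s *\<^sub>R K"])
    show "integrable lborel (\<lambda>s. indicator {0..t} s *\<^sub>R K)"
      by (intro integrable_scaleR_left integrable_real_indicator) (use t in auto)
    show "(\<lambda>s. indicator {0..t} s *\<^sub>R E n s) \<in> borel_measurable lborel" for n
      using I(2)[of n] unfolding set_integrable_def by (rule borel_measurable_integrable)
    show "AE s in lborel. norm (indicator {0..t} s *\<^sub>R E n s) \<le> indicator {0..t} s *\<^sub>R K" for n
    proof (rule AE_I2)
      fix s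
      show "norm (indicator {0..t} s *\<^sub>R E n s) \<le> indicator {0..t} s *\<^sub>R K"
      proof (cases "s \<in> {0..t}")
        case True
        then have s: "s \<ge> 0" by simp
        have "\<bar>E n s\<bar> \<le> K" unfolding E_def K_def b_def
          using rate_limit(2)[OF s w(1,4), of n "yq s \<eta>"] src_limit(2)[OF s w(1,2,3,5), of n "yq s \<eta>"] by linarith
        then show ?thesis using True by simp
      qed simp
    qed
    \<comment> \<open>At an exceptional time an atom at the quantile could make
      \<open>F s (yq s \<eta>)\<close> larger than the level, and the source limit would be wrong.
      Such times form a null set, and the majorant K covers them.\<close>
    show "AE s in lborel. (\<lambda>n. indicator {0..t} s *\<^sub>R E n s) \<longlonglongrightarrow> indicator {0..t} s *\<^sub>R ((2 * \<eta> - mass0) / 4)"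
      using ae_no_atoms
    proof eventually_elim
      case (elim s)
      show ?case
      proof (cases "s \<in> {0..t}")
        case True
        then have s: "s \<ge> 0" by simp
        have "F s (yq s \<eta>) = \<eta>" using no_atom_quantile[OF s \<eta>] elim s by blast
        then have "(\<lambda>n. E n s) \<longlonglongrightarrow> 0 + (2 * \<eta> - mass0) / 4" unfolding E_def b_def
          using tendsto_add[OF rate_limit(1)[OF s w(1,4), of "yq s \<eta>"] src_limit(1)[OF s w(1,2,3,5), of "yq s \<eta>"]] by simp
        then show ?thesis using True by simp
      qed simp
    qed
  qed simp
  then have "(\<lambda>n. A n t - A n 0) \<longlonglongrightarrow> t * ((2 * \<eta> - mass0) / 4)"
    using I(1) t unfolding set_lebesgue_integral_def by simp
  moreover have "(\<lambda>n. A n t - A n 0) \<longlonglongrightarrow> u t (yq t \<eta>) - u 0 (yq 0 \<eta>)" by (intro tendsto_diff Al t order_refl)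
  ultimately have "t * ((2 * \<eta> - mass0) / 4) = u t (yq t \<eta>) - u 0 (yq 0 \<eta>)" by (rule LIMSEQ_unique)
  then show ?thesis by linarith
qed

lemma quantile_position:
  assumes t: "t \<ge> 0" and \<eta>: "0 < \<eta>" "\<eta> < mass0"
  shows "yq t \<eta> = yq 0 \<eta> + (t * u 0 (yq 0 \<eta>) + t\<^sup>2 / 8 * (2 * \<eta> - mass0))"
proof -
  let ?v = "\<lambda>s. u 0 (yq 0 \<eta>) + s * ((2 * \<eta> - mass0) / 4)"
  let ?P = "\<lambda>s. yq s \<eta> - (s * u 0 (yq 0 \<eta>) + s\<^sup>2 / 8 * (2 * \<eta> - mass0))"
  have "(?P has_real_derivative 0) (at s within {0..t})" if "s \<in> {0..t}" for s
  proof -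
    have s: "s \<ge> 0" using that by simp
    have q: "((\<lambda>s. s * c + s\<^sup>2 / 8 * k) has_real_derivative c + s * (k / 4)) (at s within {0..t})" for c k :: real
      by (auto intro!: derivative_eq_intros)
    have "((\<lambda>t. yq t \<eta>) has_real_derivative ?v s) (at s within {0..})"
      using yq_DERIV[OF s \<eta>] unfolding quantile_velocity[OF s \<eta>] .
    then have "((\<lambda>t. yq t \<eta>) has_real_derivative ?v s) (at s within {0..t})" by (rule DERIV_subset) auto
    from DERIV_diff[OF this q[of "u 0 (yq 0 \<eta>)" "2 * \<eta> - mass0"]] show ?thesis by simp
  qed
  then have "\<exists>c. \<forall>s\<in>{0..t}. ?P s = c" by (intro has_field_derivative_zero_constant) auto
  then obtain c where "\<And>s. s \<in> {0..t} \<Longrightarrow> ?P s = c" by blast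
  from this[of t] this[of 0] show ?thesis using t by simp
qed

end

section \<open>Uniqueness\<close>

context weak_solution begin

text \<open>Between the quantile of a level \<eta> below F t x and the point x there is energy at
  most F t x - \<eta>, so the increment of \<open>u\<close> vanishes as \<eta> increases to F t x.
  This also covers an x in a gap of the energy, where the quantiles need not converge to x.\<close>

lemma u_left_limit:
  assumes t: "t \<ge> 0" and x: "0 < F t x"
  shows "((\<lambda>\<eta>. u t (yq t \<eta>)) \<longlongrightarrow> u t x) (at_left (F t x))"
proof -
  interpret finite_measure "\<mu> t" by (rule mfin[OF t])
  define a where "a = F t x"
  \<comment> \<open>The quantile of a fixed lower level bounds the quantiles from below, so the
    distance to x in the estimate stays bounded while the energy tends to 0.\<close>
  define y0 where "y0 = yq t (a / 2)"
  have a: "0 < a" "a \<le> mass0" using x F_bounds(2)[OF t, of x] by (simp_all add: a_def)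
  have b: "\<bar>u t (yq t \<eta>) - u t x\<bar> \<le> sqrt ((x - y0) * (a - \<eta>))" if \<eta>: "a / 2 < \<eta>" "\<eta> < a" for \<eta>
  proof -
    have g: "0 < \<eta>" "\<eta> < mass0" "0 < a / 2" "a / 2 < mass0" using \<eta> a by auto
    have yx: "yq t \<eta> \<le> x" using yq_galois[OF t g(1,2), of x] \<eta> by (simp add: a_def)
    have Fy: "\<eta> \<le> F t (yq t \<eta>)" using yq_galois[OF t g(1,2), of "yq t \<eta>"] by simp
    have y0: "y0 \<le> yq t \<eta>" using yq_galois[OF t g(3,4), of "yq t \<eta>"] Fy \<eta> by (simp add: y0_def)
    have "measure (\<mu> t) {yq t \<eta><..<x} \<le> measure (\<mu> t) ({..x} - {..yq t \<eta>})"
      by (rule finite_measure_mono) (auto simp: msets[OF t])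
    also have "\<dots> = a - F t (yq t \<eta>)" unfolding a_def F_def
      by (rule finite_measure_Diff) (use yx in \<open>auto simp: msets[OF t]\<close>)
    finally have le: "measure (\<mu> t) {yq t \<eta><..<x} \<le> a - \<eta>" using Fy by simp
    have "(u t x - u t (yq t \<eta>))\<^sup>2 \<le> (x - yq t \<eta>) * measure (\<mu> t) {yq t \<eta><..<x}" by (rule u_sq[OF t yx])
    also have "\<dots> \<le> (x - y0) * (a - \<eta>)" by (intro mult_mono le) (use y0 yx in auto)
    finally have "(u t (yq t \<eta>) - u t x)\<^sup>2 \<le> (x - y0) * (a - \<eta>)" by (simp add: power2_commute)
    then show ?thesis by (rule real_le_rsqrt[of "\<bar>_\<bar>", simplified])
  qed
  have "((\<lambda>\<eta>. sqrt ((x - y0) * (a - \<eta>))) \<longlongrightarrow> sqrt ((x - y0) * (a - a))) (at_left a)" by (intro tendsto_intros)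
  then have "((\<lambda>\<eta>. sqrt ((x - y0) * (a - \<eta>))) \<longlongrightarrow> 0) (at_left a)" by simp
  then have "((\<lambda>\<eta>. u t (yq t \<eta>) - u t x) \<longlongrightarrow> 0) (at_left a)"
  proof (rule Lim_null_comparison[rotated])
    have "a / 2 < a" using a by simp
    show "\<forall>\<^sub>F \<eta> in at_left a. norm (u t (yq t \<eta>) - u t x) \<le> sqrt ((x - y0) * (a - \<eta>))"
      using eventually_at_left_real[OF \<open>a / 2 < a\<close>] by eventually_elim (use b in simp)
  qed
  then show ?thesis unfolding a_def by (rule LIM_zero_cancel)
qed

text \<open>A point with no energy to its left lies below all quantiles, and the energy strictly
  between it and the quantile of level \<eta> is at most \<eta>. The median bounds the distance from
  above.\<close>

lemma u_right_limit:
  assumes t: "t \<ge> 0" and x: "F t x = 0" and m: "0 < mass0"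
  shows "((\<lambda>\<eta>. u t (yq t \<eta>)) \<longlongrightarrow> u t x) (at_right 0)"
proof -
  interpret finite_measure "\<mu> t" by (rule mfin[OF t])
  define y1 where "y1 = yq t (mass0 / 2)"
  have b: "\<bar>u t (yq t \<eta>) - u t x\<bar> \<le> sqrt ((y1 - x) * \<eta>)" if \<eta>: "0 < \<eta>" "\<eta> < mass0 / 2" for \<eta>
  proof -
    have g: "0 < \<eta>" "\<eta> < mass0" "0 < mass0 / 2" "mass0 / 2 < mass0" using \<eta> m by auto
    have yx: "x \<le> yq t \<eta>" using yq_galois[OF t g(1,2), of x] \<eta> x by simp
    have "mass0 / 2 \<le> F t y1" using yq_galois[OF t g(3,4), of y1] by (simp add: y1_def)
    then have y1: "yq t \<eta> \<le> y1" using yq_galois[OF t g(1,2), of y1] \<eta> by simp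
    have "measure (\<mu> t) {x<..<yq t \<eta>} \<le> \<eta>"
    proof -
      have "measure (\<mu> t) {..<yq t \<eta>} \<le> \<eta>" by (rule lessThan_quantile[OF t g(1,2)])
      moreover have "measure (\<mu> t) {x<..<yq t \<eta>} \<le> measure (\<mu> t) {..<yq t \<eta>}"
        by (rule finite_measure_mono) (auto simp: msets[OF t])
      ultimately show ?thesis by simp
    qed
    then have le: "(yq t \<eta> - x) * measure (\<mu> t) {x<..<yq t \<eta>} \<le> (y1 - x) * \<eta>"
      by (intro mult_mono) (use y1 yx in auto)
    then have "(u t (yq t \<eta>) - u t x)\<^sup>2 \<le> (y1 - x) * \<eta>" using u_sq[OF t yx] by simp
    then show ?thesis by (rule real_le_rsqrt[of "\<bar>_\<bar>", simplified])
  qed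
  have "((\<lambda>\<eta>. sqrt ((y1 - x) * \<eta>)) \<longlongrightarrow> sqrt ((y1 - x) * 0)) (at_right 0)" by (intro tendsto_intros)
  then have "((\<lambda>\<eta>. sqrt ((y1 - x) * \<eta>)) \<longlongrightarrow> 0) (at_right 0)" by simp
  then have "((\<lambda>\<eta>. u t (yq t \<eta>) - u t x) \<longlongrightarrow> 0) (at_right 0)"
  proof (rule Lim_null_comparison[rotated])
    have "0 < mass0 / 2" using m by simp
    show "\<forall>\<^sub>F \<eta> in at_right 0. norm (u t (yq t \<eta>) - u t x) \<le> sqrt ((y1 - x) * \<eta>)"
      using eventually_at_right_real[OF \<open>0 < mass0 / 2\<close>] by eventually_elim (use b in simp)
  qed
  then show ?thesis by (rule LIM_zero_cancel)
qed

text \<open>Without energy \<open>u_sq\<close> makes \<open>u\<close> constant in x at each time.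
  Testing with a kernel of integral 1 then returns this constant, and neither the flux nor the
  source contributes to its time derivative.\<close>

lemma u_const_of_mass_0:
  assumes t: "t \<ge> 0" and m: "mass0 = 0" shows "u t x = u 0 0"
proof -
  have const: "u s x = u s 0" if s: "s \<ge> 0" for s x
  proof -
    interpret finite_measure "\<mu> s" by (rule mfin[OF s])
    have z: "measure (\<mu> s) A = 0" if "A \<in> sets borel" for A
    proof -
      have "measure (\<mu> s) A \<le> measure (\<mu> s) UNIV" by (rule finite_measure_mono) (use that in \<open>auto simp: msets[OF s]\<close>)
      then have "measure (\<mu> s) A \<le> 0" using mass[OF s] m by (simp add: mass0_def)
      then show ?thesis using measure_nonneg[of "\<mu> s" A] by linarith
    qed
    have "(u s b - u s a)\<^sup>2 \<le> 0" if "a \<le> b" for a b using u_sq[OF s that] z[of "{a<..<b}"] by simp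
    from this[of 0 x] this[of x 0] show ?thesis by (cases "0 \<le> x") auto
  qed
  have z: "src b s t = 0" if t: "t \<ge> 0" and b: "test1 b" for b s t
  proof -
    obtain K0 K1 K2 where K: "\<And>x. \<bar>cum b x\<bar> \<le> K0" using adm_props[OF cum_props(3)[OF b]] by metis
    have [measurable]: "cum b \<in> borel_measurable borel"
      by (rule borel_measurable_continuous_onI[OF smooth1_continuous[OF cum_props(1)[OF b]]])
    have "\<bar>\<integral>z. (\<integral>x. b x \<partial>lborel) - 2 * cum b (z - s) \<partial>\<mu> t\<bar> \<le> (\<bar>\<integral>x. b x \<partial>lborel\<bar> + 2 * K0) * measure (\<mu> t) UNIV"
    proof (rule m_integral_bound[OF t])
      show "\<bar>(\<integral>x. b x \<partial>lborel) - 2 * cum b (z - s)\<bar> \<le> \<bar>\<integral>x. b x \<partial>lborel\<bar> + 2 * K0" for z using K[of "z - s"] by linarith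
    qed measurable
    then show ?thesis using mass[OF t] m by (simp add: src_def mass0_def)
  qed
  obtain w where w: "test1 w" "(\<integral>x. w x \<partial>lborel) = 1" using unit_kernel by metis
  have D: "((\<lambda>t. u t 0) has_real_derivative 0) (at s within {0..t})" if "s \<in> {0..t}" for s
  proof -
    have s: "s \<ge> 0" using that by simp
    obtain k where k: "\<And>x. u s x = k" using const[OF s] by blast
    have "(\<integral>x. 1/2 * (u s x)\<^sup>2 * deriv w x \<partial>lborel) + src w 0 s = 0"
      unfolding k using test1_integral_deriv[OF w(1)] z[OF s w(1)] by simp
    then have "((\<lambda>t. \<integral>x. u t x * w x \<partial>lborel) has_real_derivative 0) (at s within {0..})"
      using u_DERIV_test[OF w(1) s] by simp
    then have "((\<lambda>t. \<integral>x. u t x * w x \<partial>lborel) has_real_derivative 0) (at s within {0..t})" by (rule DERIV_subset) auto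
    moreover have "(\<integral>x. u r x * w x \<partial>lborel) = u r 0" if r: "r \<ge> 0" for r
    proof -
      obtain k where k: "\<And>x. u r x = k" using const[OF r] by blast
      show ?thesis unfolding k using w(2) by simp
    qed
    ultimately show ?thesis
      by (elim has_field_derivative_transform_within[of _ _ _ _ 1]) (use that in auto)
  qed
  then have "\<exists>c. \<forall>s\<in>{0..t}. u s 0 = c" by (intro has_field_derivative_zero_constant) auto
  then obtain c where "\<And>s. s \<in> {0..t} \<Longrightarrow> u s 0 = c" by blast
  from this[of t] this[of 0] have "u t 0 = u 0 0" using t by simp
  then show ?thesis using const[OF t, of x] by (rule trans[rotated])
qed

end

lemma HS_unique:
  assumes psi: "psi_pair psp psm"
    and HS: "HS_weak_conservative psp psm u \<mu>" "HS_weak_conservative psp psm u' \<mu>'"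
    and u0: "AE x in lborel. u 0 x = u' 0 x" and m0: "\<mu> 0 = \<mu>' 0" and t: "t \<ge> 0"
  shows "u t = u' t" "\<mu> t = \<mu>' t"
proof -
  interpret A: weak_solution psp psm u \<mu> by unfold_locales (fact psi, fact HS(1))
  interpret B: weak_solution psp psm u' \<mu>' by unfold_locales (fact psi, fact HS(2))
  \<comment> \<open>Both velocities are continuous, so the agreement almost everywhere at time 0
    holds at every point, in particular at the initial quantiles.\<close>
  have u0: "u 0 x = u' 0 x" for x
    using AE_eq_continuous_imp_eq[OF A.u_cont B.u_cont u0] by simp
  have mm: "A.mass0 = B.mass0" by (simp add: A.mass0_def B.mass0_def m0)
  have y0: "A.yq 0 \<eta> = B.yq 0 \<eta>" for \<eta> by (simp add: A.yq_def B.yq_def A.F_def B.F_def m0)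
  have y: "A.yq t \<eta> = B.yq t \<eta>" and v: "u t (A.yq t \<eta>) = u' t (B.yq t \<eta>)" if "0 < \<eta>" "\<eta> < A.mass0" for \<eta>
    using that A.quantile_position[OF t that] B.quantile_position[OF t, of \<eta>] A.quantile_velocity[OF t that] B.quantile_velocity[OF t, of \<eta>]
    by (simp_all add: mm u0 y0)
  have iff: "\<eta> \<le> A.F t x \<longleftrightarrow> \<eta> \<le> B.F t x" if "0 < \<eta>" "\<eta> < A.mass0" for \<eta> x
    using A.yq_galois[OF t that, of x] B.yq_galois[OF t, of \<eta> x] that y[OF that] by (simp add: mm)
  \<comment> \<open>Levels range only over the open interval from 0 to the total mass. The bounds on
    f and g place a level strictly between them inside this interval if f were larger than
    g.\<close>
  have le: "f \<le> g" if h: "\<And>\<eta>. 0 < \<eta> \<Longrightarrow> \<eta> < A.mass0 \<Longrightarrow> \<eta> \<le> f \<Longrightarrow> \<eta> \<le> g" and "0 \<le> g" "f \<le> A.mass0" for f g :: real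
  proof (rule ccontr)
    assume "\<not> f \<le> g"
    then obtain \<eta> where "g < \<eta>" "\<eta> < f" using dense by (meson not_le)
    then show False using h[of \<eta>] that(2,3) by linarith
  qed
  have FF: "A.F t x = B.F t x" for x
  proof (rule antisym)
    show "A.F t x \<le> B.F t x" by (rule le) (use iff B.F_bounds(1)[OF t] A.F_bounds(2)[OF t] in auto)
    show "B.F t x \<le> A.F t x" by (rule le) (use iff A.F_bounds(1)[OF t] B.F_bounds(2)[OF t] in \<open>auto simp: mm\<close>)
  qed
  interpret FA: finite_measure "\<mu> t" by (rule A.mfin[OF t])
  interpret FB: finite_measure "\<mu>' t" by (rule B.mfin[OF t])
  show "\<mu> t = \<mu>' t"
  proof (rule measure_eqI_lessThan[OF A.msets[OF t] B.msets[OF t]])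
    fix x :: real
    show "emeasure (\<mu> t) {x<..} < \<infinity>" by (simp add: FA.emeasure_eq_measure)
    have c: "UNIV - {..x} = {x<..}" by auto
    have "measure (\<mu> t) {x<..} = A.mass0 - A.F t x"
      using FA.finite_measure_compl[of "{..x}"] A.mass[OF t]
      by (simp add: A.mspace[OF t] A.msets[OF t] c A.F_def A.mass0_def)
    moreover have "measure (\<mu>' t) {x<..} = B.mass0 - B.F t x"
      using FB.finite_measure_compl[of "{..x}"] B.mass[OF t]
      by (simp add: B.mspace[OF t] B.msets[OF t] c B.F_def B.mass0_def)
    ultimately show "emeasure (\<mu> t) {x<..} = emeasure (\<mu>' t) {x<..}"
      by (simp add: FA.emeasure_eq_measure FB.emeasure_eq_measure mm FF)
  qed
  show "u t = u' t"
  proof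
    fix x
    \<comment> \<open>A point with energy at or left of it is reached from levels below F t x, a
      point with none from levels above 0. Without any energy there are no levels and
      \<open>u\<close> is constant.\<close>
    consider "A.mass0 = 0" | "0 < A.mass0" "0 < A.F t x" | "0 < A.mass0" "A.F t x = 0"
      using A.F_bounds[OF t, of x] by linarith
    then show "u t x = u' t x"
    proof cases
      case 1 then show ?thesis using A.u_const_of_mass_0[OF t, of x] B.u_const_of_mass_0[OF t, of x] mm u0 by simp
    next
      case 2
      have "\<forall>\<^sub>F \<eta> in at_left (A.F t x). u t (A.yq t \<eta>) = u' t (B.yq t \<eta>)"
        using eventually_at_left_real[OF 2(2)] by eventually_elim (use v A.F_bounds(2)[OF t, of x] in auto)
      then have "((\<lambda>\<eta>. u' t (B.yq t \<eta>)) \<longlongrightarrow> u t x) (at_left (A.F t x))"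
        using A.u_left_limit[OF t 2(2)] by (simp cong: tendsto_cong)
      moreover have "((\<lambda>\<eta>. u' t (B.yq t \<eta>)) \<longlongrightarrow> u' t x) (at_left (A.F t x))" using B.u_left_limit[OF t, of x] 2 FF by simp
      ultimately show ?thesis by (rule tendsto_unique[rotated]) simp
    next
      case 3
      have "\<forall>\<^sub>F \<eta> in at_right 0. u t (A.yq t \<eta>) = u' t (B.yq t \<eta>)"
        using eventually_at_right_real[OF 3(1)] by eventually_elim (use v in auto)
      then have "((\<lambda>\<eta>. u' t (B.yq t \<eta>)) \<longlongrightarrow> u t x) (at_right 0)"
        using A.u_right_limit[OF t 3(2,1)] by (simp cong: tendsto_cong)
      moreover have "((\<lambda>\<eta>. u' t (B.yq t \<eta>)) \<longlongrightarrow> u' t x) (at_right 0)" using B.u_right_limit[OF t, of x] 3 FF mm by simp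
      ultimately show ?thesis by (rule tendsto_unique[rotated]) simp
    qed
  qed
qed

theorem theorem3p6:
  fixes psp psm u0 :: "real \<Rightarrow> real" and \<mu>0 :: "real measure"
  assumes "psi_pair psp psm"
    and "in_D psp psm u0 \<mu>0"
  shows "\<exists>u \<mu>. HS_weak_conservative psp psm u \<mu> \<and>
            (AE x in lborel. u 0 x = u0 x) \<and> \<mu> 0 = \<mu>0 \<and>
            (\<forall>u' \<mu>'. HS_weak_conservative psp psm u' \<mu>' \<and>
                 (AE x in lborel. u' 0 x = u0 x) \<and> \<mu>' 0 = \<mu>0 \<longrightarrow>
                 (\<forall>t\<ge>0. u' t = u t \<and> \<mu>' t = \<mu> t))"
proof -
  obtain u \<mu> where s: "HS_weak_conservative psp psm u \<mu>" "AE x in lborel. u 0 x = u0 x" "\<mu> 0 = \<mu>0"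
    using HS_existence[OF assms] by blast
  show ?thesis
  proof (intro exI[of _ u] exI[of _ \<mu>] conjI allI impI s)
    fix u' \<mu>' and t :: real
    assume A: "HS_weak_conservative psp psm u' \<mu>' \<and> (AE x in lborel. u' 0 x = u0 x) \<and> \<mu>' 0 = \<mu>0" and t: "0 \<le> t"
    then have B: "HS_weak_conservative psp psm u' \<mu>'" "AE x in lborel. u' 0 x = u0 x" "\<mu>' 0 = \<mu> 0"
      by (simp_all add: s(3))
    have "AE x in lborel. u' 0 x = u 0 x" using B(2) s(2) by eventually_elim simp
    from HS_unique[OF assms(1) B(1) s(1) this B(3) t]
    show "u' t = u t" "\<mu>' t = \<mu> t" .
  qed
qed

end
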